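(* There is an equivalence of categories $\mathbf{DFC}^{\mathrm{core}}\simeq\mathbf{KJBM}$, formed by the functors $Z:\mathbf{DFC}^{\mathrm{core}}\to\mathbf{KJBM}$ and $P:\mathbf{KJBM}\to\mathbf{DFC}^{\mathrm{core}}$, between the groupoid $\mathbf{DFC}^{\mathrm{core}}$ of dendritic face complexes and their isomorphisms and the groupoid $\mathbf{KJBM}$ of opetopes and their isomorphisms.
   Context: **Many-to-one posets.** A many-to-one poset (MOP) is a finite set $P$ (of cells) with $\dim:P\to\mathbb N\cup\{-1\}$ (write $P_k=\dim^{-1}(k)$) and maps $\delta,\gamma:P_{k+1}\to\mathcal P(P_k)$ for each $k\ge-1$, such that: if $\dim x\ge 0$ then $\gamma(x)$ is a singleton; if $\delta(x)\cap\gamma(x)\ne\emptyset$ then $\delta(x)=\gamma(x)$; there is a unique cell $\ast$ of dimension $-1$, and $\gamma(x)\setminus\delta(x)=\{\ast\}$ whenever $\dim x=0$. Write $y\prec^- x$ iff $y\in\delta(x)\setminus\gamma(x)$; $y\prec^+x$ iff $y\in\gamma(x)\setminus\delta(x)$; $y\prec^\circ x$ iff $y\in\delta(x)\cap\gamma(x)$ ($x$ is then a loop on $y$); $y\prec x$ iff $y\in\partial(x):=\delta(x)\cup\gamma(x)$. The reflexive transitive closure of $\prec$ is a partial order on $P$. We identify $\gamma(x)$ with its unique element. $\delta$, $\gamma$, $\partial$ extend to sets of cells by unions. Put $\gamma^+(x)=\gamma(x)\setminus\delta(x)$, $\Lambda=P\setminus\gamma^+(P)$, $\Lambda_k=\Lambda\cap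 P_k$; $N=\{x:\delta(x)=\emptyset\}$. Finally, a MOP carries, for each $x\in\Lambda$ and $z\in\partial^2(x)$, a total order $\triangleleft$ on $\{y\mid z\prec^\circ y\prec^- x\}$ (the local order). A morphism of MOPs $f:C\to D$ is a dimension-preserving map such that for every $x$ with $\dim x\ge0$, $f$ restricts to a bijection $\delta(x)\to\delta(f(x))$ and $f(\gamma(x))=\gamma(f(x))$, and $f$ preserves local orders. Signs $+,-,\circ$ are multiplied as $+1,-1,0$. **DFC.** A dendritic face complex (DFC) is a MOP $C$ such that: (greatest element) $C$ has a greatest element, of dimension $\ge0$; (loops) if $z\prec^\circ y$ there is $x$ with $y\prec^+x$; (oriented thinness) if $z\prec^\beta y\prec^\alpha x$ with $\alpha,\beta\neq\circ$, there is a unique $y'\ne y$ with $z\prec y'\prec x$, and moreover, writing $z\prec^{\beta'}y'\prec^{\alpha'}x$, one has $\alpha\beta=-\alpha'\beta'$; and if $z\prec^\circ y\prec^-x$ there is $y'$ ($\neq y$) with $z\prec^\beta y'\prec^\alpha x$ and $(\alpha,\beta)\ne(-,\circ)$; (acyclicity) for $\dim x\ge1$ there are no $p\ge1$ and $y_1,\dots,y_p\prec^-x$ with $\gamma(y_{i+1})\prec^+y_{i+1}$ and $\gamma(y_{i+1})\prec^- y_i$ for all $i$ (indices mod $p$). $\mathbf{DFC}$ is the full subcategory of MOPs on DFCs, $\mathbf{DFC}^{\mathrm{core}}$ its groupoid of isomorphisms. The dimension $n$ of $C$ is the dimension of its greatest element $\omega$. **Trees.** A rooted tree $T$ consists of finite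 sets $T^\bullet$ of nodes and $E(T)$ of edges; each node has exactly one target edge (it is then the source node of that edge; an edge has at most one source node); each edge $b$ has at most one target node $a$ (then $b$ is called a source of $a$); a distinguished root edge $\rho(T)$ has no target node; and from every edge there is a descending path to $\rho(T)$. Here a descending path from $x$ to $y$ is an alternating sequence of nodes and edges (possibly of length one) from $x$ to $y$, each term being the target of the previous one; write $x\sqsubseteq y$ if one exists. Leaves ($T^{|}$) are edges without source node; null dots are nodes without sources. A unit tree has no node and a single edge; a corolla has exactly one node; a tree is linear if each node has exactly one source. A subdivision $W$ of $T$ is a finite totally ordered set $W(b)$ for each edge $b$; the subdivided tree $T'=(T,W)$ is seen as a rooted tree by inserting the elements of $W(b)$ as nodes on $b$, in increasing order starting nearest the root. Put $\mathrm{blackdots}(T')=T^\bullet$, $\mathrm{whitedots}(T')=\bigsqcup_bW(b)$, $\mathrm{dots}(T')$ their union (for a tree $U$ without subdivision, $\mathrm{dots}(U)=U^\bullet$). **Opetopes.** A constellation $T\to U$ of rooted trees is a subdivision $T'$ of $T$ with bijections $\sigma_\bullet:\mathrm{blackdots}(T')\to U^{|}$ and $\sigma_\circ:\mathrm{whitedots}(T')\to\{\text{null dots of }U\}$ such that, with $\sigma=\sigma_\bullet+\sigma_\circ$, for each $x\in\mathrm{dots}(U)$ the set $\{t\in\mathrm{dots}(T')\mid\sigma(t)\sqsubseteq x\}$ induces a connected full subgraph of $T'$ (kernel rule). It is exact if $\sigma_\bullet,\sigma_\circ$ are identities. An $n$-opetope is a sequence of exact constellations $T_0\to\cdots\to T_n$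 where $T_0$ has one root, one leaf and one node; if $n\ge1$, $T_1$ has the same form; if $n\ge2$, $T_2$ is linear. An isomorphism of $n$-opetopes is a sequence of isomorphisms of (subdivided) trees compatible with the structural maps of the constellations. $\mathbf{KJBM}$ is the category of opetopes and their isomorphisms. **The functor $Z$.** Let $C$ be a DFC of dimension $n$ with greatest element $\omega$; $\gamma^{(k)}\omega\in C_k$ is the iterated target of $\omega$. For $2\le k\le n+2$, $T_k$ is the rooted tree with nodes $\Lambda_{k-1}$ (empty if $k=n+2$), edges $C_{k-2}$, root $\gamma^{(k-2)}\omega$; $y$ is a source of $x$ iff $y\prec^-x$ and $y$ is the target of $x$ iff $y\prec^+x$. $T_0,T_1$ are trees with one node, one leaf and one root, chosen (uniquely up to renaming) so that the node of $T_0$ is the leaf of $T_1$ and the node of $T_1$ is the unique leaf of the linear tree $T_2$; they have empty subdivisions. For $2\le k<n+2$, $T_k$ is subdivided by $W_k(y)=\{w\in\Lambda_k\cap N\mid\gamma^2(w)=y\}$, ordered by $w<w'$ iff $\gamma(w)\blacktriangleleft\gamma(w')$, where $\blacktriangleleft$ is as follows. Fix a cell $c$. For loops $b,b'$ on $c$ write $b'\subset b$ if $b\prec^+a$, $b'\prec^-a$ for some $a\in\Lambda$; $\subseteq$ is the reflexive transitive closure. If $c\in C_k$ with $0\le k\le n-2$, all chains $c\prec^\beta b\prec^\alpha a$ with $a\in\Lambda$, $\alpha,\beta\ne\circ$ are listed by a zig-zag $b_1,a_1,b_2,\dots,a_{q-1},b_q$ in $T_{k+2}$ with $c\prec^-b_i$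 for $i\le p$, $c\prec^+b_i$ for $i>p$; $b_i\prec^-a_i$, $b_{i+1}\prec^+a_i$ for $i<p$; $b_p\prec^-a_p$, $b_{p+1}\prec^-a_p$; $b_i\prec^+a_i$, $b_{i+1}\prec^-a_i$ for $i>p$ (the left part $i\le p$, the right part $i>p$, or everything may be empty). If $c\prec^\circ b\prec^-a_i$, $c\prec^\circ b'\prec^-a_j$, $i<j$, $\bar b\subseteq b$, $\bar b'\subseteq b'$, put $\bar b\blacktriangleleft^1\bar b'$. If $c\prec^\circ b\prec^+a$, $c\prec^\circ b'\prec^+a'$ with $b\ne b'$ and $a,a'\in\Lambda\cap N$ are not $\blacktriangleleft^1$-comparable, there are uniquely determined sequences in $\Lambda$, $a=a_0,a_1,\dots,a_p=a''$ and $a'=a'_0,\dots,a'_q=a''$, and loops $b=b_0,\dots,b_{p-1}$, $b'=b'_0,\dots,b'_{q-1}$ on $c$, with $a_i\succ^+b_i\prec^-a_{i+1}$, $a'_i\succ^+b'_i\prec^-a'_{i+1}$ and $b_{p-1}\ne b'_{q-1}$; put $b\blacktriangleleft^2b'$ iff $b_{p-1}\triangleleft b'_{q-1}$. Then $\blacktriangleleft$ is $\blacktriangleleft^1\cup\blacktriangleleft^2$ restricted to the loops $b$ on $c$ with $b\prec^+a$ for some $a\in\Lambda\cap N$. $Z(C)$ is the $n$-opetope $T_0\to T_1\to\cdots\to T_n$ with these subdivisions and exact constellations. For an isomorphism $f:C\to D$, $Z(f)$ is given by $f$ on nodes, edges and white dots in degrees $\ge2$ (and in the only possible way in degrees $0,1$).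 **The functor $P$.** Let $Y=(S_0\to\cdots\to S_n)$ be an $n$-opetope. Extend it by the corolla $S_{n+1}$ with node $\top$ and set of leaves $S_n^\bullet$, and the unit tree $S_{n+2}$ with root edge $\top$; $S_n$ and $S_{n+1}$ are given the empty subdivision, which gives two exact constellations $S_n\to S_{n+1}\to S_{n+2}$; $S_k'$ is the subdivided tree associated to $S_k$ for $k<n+2$. Write $\bot=\rho(S_1)$. For $0\le k\le n+1$ and $x$ a node or edge of $S_{k+1}$ let $\mathcal O_{k,x}=\{y\in\mathrm{dots}(S_k')\mid y\sqsubseteq x\text{ in }S_{k+1}\}$; by the kernel rule it induces a connected full subgraph of $S'_k$, that is a subdivided subtree of $S'_k$, whose underlying rooted tree is denoted $S_{k,x}$ (nodes: the nodes of $S_k$ in $\mathcal O_{k,x}$; edges: the edges of $S_k$ adjacent to them; if $\mathcal O_{k,x}$ consists only of white dots, they lie on one edge of $S_k$ and $S_{k,x}$ is the unit tree on that edge). $P(Y)$ is the MOP with $P(Y)_{-1}=\{\bot\}$, $P(Y)_k=E(S_{k+2})$ for $0\le k\le n$; $\gamma(x)=\rho(S_{k+1,x})$ for $x\in P(Y)_k$, $k\ge0$; $\delta(x)=S_{k+1,x}^{|}$ for $k>0$ and $\delta(x)=\emptyset$ for $k=0$; local order: if $y\ne y'$, $z\prec^\circ y\prec^-x$, $z\prec^\circ y'\prec^-x$ with $x\in P(Y)_k$, then $\mathcal O_{k,y}$, $\mathcal O_{k,y'}$ are disjoint sets of successive white dots on the edge $z$ of $S_k$, and $y\triangleleft y'$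 iff $\mathcal O_{k,y}<\mathcal O_{k,y'}$ in the subdivision order. For an isomorphism $f$ of opetopes (extended to degrees $n+1,n+2$), $P(f)$ is $f$ on every element.
   Formalization: In oriented thinness, y' is unique among cells with both signs nonzero (loops on z may also occur); in defining P, if S_n is a unit tree it gets one white dot ⊤ instead of the empty subdivision; all finite structures live in one fixed infinite universe over arbitrary atoms. *)

theory Defs
  imports "HOL-Library.FuncSet"
begin

section \<open>Categories, functors and equivalences\<close>

text \<open>Hom-sets of different pairs of objects may overlap, so composition
  \<open>Comp X Y Z g f\<close> takes the three objects involved and the morphism part of a functor takes
  the domain and the codomain of its argument.\<close>

record ('o, 'm) category =
  Ob :: "'o set"
  Hom :: "'o \<Rightarrow> 'o \<Rightarrow> 'm set"
  Id :: "'o \<Rightarrow> 'm"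
  Comp :: "'o \<Rightarrow> 'o \<Rightarrow> 'o \<Rightarrow> 'm \<Rightarrow> 'm \<Rightarrow> 'm"

definition is_category :: "('o, 'm) category \<Rightarrow> bool" where
  "is_category C \<longleftrightarrow>
     (\<forall>X\<in>Ob C. Id C X \<in> Hom C X X) \<and>
     (\<forall>X\<in>Ob C. \<forall>Y\<in>Ob C. \<forall>Z\<in>Ob C. \<forall>f\<in>Hom C X Y. \<forall>g\<in>Hom C Y Z. Comp C X Y Z g f \<in> Hom C X Z) \<and>
     (\<forall>X\<in>Ob C. \<forall>Y\<in>Ob C. \<forall>f\<in>Hom C X Y.
        Comp C X X Y f (Id C X) = f \<and> Comp C X Y Y (Id C Y) f = f) \<and>
     (\<forall>W\<in>Ob C. \<forall>X\<in>Ob C. \<forall>Y\<in>Ob C. \<forall>Z\<in>Ob C.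
        \<forall>f\<in>Hom C W X. \<forall>g\<in>Hom C X Y. \<forall>h\<in>Hom C Y Z.
          Comp C W X Z (Comp C X Y Z h g) f = Comp C W Y Z h (Comp C W X Y g f))"

definition is_iso :: "('o, 'm) category \<Rightarrow> 'o \<Rightarrow> 'o \<Rightarrow> 'm \<Rightarrow> bool" where
  "is_iso C X Y f \<longleftrightarrow> f \<in> Hom C X Y \<and>
     (\<exists>g\<in>Hom C Y X. Comp C X Y X g f = Id C X \<and> Comp C Y X Y f g = Id C Y)"

definition is_groupoid :: "('o, 'm) category \<Rightarrow> bool" where
  "is_groupoid C \<longleftrightarrow> is_category C \<and> (\<forall>X\<in>Ob C. \<forall>Y\<in>Ob C. \<forall>f\<in>Hom C X Y. is_iso C X Y f)"

definition full_subcategory :: "('o, 'm) category \<Rightarrow> 'o set \<Rightarrow> ('o, 'm) category" where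
  "full_subcategory C A = C\<lparr>Ob := Ob C \<inter> A\<rparr>"

definition core :: "('o, 'm) category \<Rightarrow> ('o, 'm) category" where
  "core C = C\<lparr>Hom := \<lambda>X Y. {f. is_iso C X Y f}\<rparr>"

record ('o, 'm, 'p, 'q) cfunctor =
  fob :: "'o \<Rightarrow> 'p"
  fmor :: "'o \<Rightarrow> 'o \<Rightarrow> 'm \<Rightarrow> 'q"

definition is_functor ::
  "('o, 'm) category \<Rightarrow> ('p, 'q) category \<Rightarrow> ('o, 'm, 'p, 'q) cfunctor \<Rightarrow> bool" where
  "is_functor C D F \<longleftrightarrow>
     (\<forall>X\<in>Ob C. fob F X \<in> Ob D) \<and>
     (\<forall>X\<in>Ob C. \<forall>Y\<in>Ob C. \<forall>f\<in>Hom C X Y. fmor F X Y f \<in> Hom D (fob F X) (fob F Y)) \<and>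
     (\<forall>X\<in>Ob C. fmor F X X (Id C X) = Id D (fob F X)) \<and>
     (\<forall>X\<in>Ob C. \<forall>Y\<in>Ob C. \<forall>Z\<in>Ob C. \<forall>f\<in>Hom C X Y. \<forall>g\<in>Hom C Y Z.
        fmor F X Z (Comp C X Y Z g f) =
          Comp D (fob F X) (fob F Y) (fob F Z) (fmor F Y Z g) (fmor F X Y f))"

definition id_functor :: "('o, 'm, 'o, 'm) cfunctor" where
  "id_functor = \<lparr>fob = \<lambda>X. X, fmor = \<lambda>X Y f. f\<rparr>"

definition comp_functor ::
  "('p, 'q, 'r, 's) cfunctor \<Rightarrow> ('o, 'm, 'p, 'q) cfunctor \<Rightarrow> ('o, 'm, 'r, 's) cfunctor" where
  "comp_functor G F =
     \<lparr>fob = \<lambda>X. fob G (fob F X),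
      fmor = \<lambda>X Y f. fmor G (fob F X) (fob F Y) (fmor F X Y f)\<rparr>"

definition natural_iso ::
  "('o, 'm) category \<Rightarrow> ('p, 'q) category \<Rightarrow> ('o, 'm, 'p, 'q) cfunctor \<Rightarrow>
   ('o, 'm, 'p, 'q) cfunctor \<Rightarrow> ('o \<Rightarrow> 'q) \<Rightarrow> bool" where
  "natural_iso C D F G \<eta> \<longleftrightarrow>
     (\<forall>X\<in>Ob C. is_iso D (fob F X) (fob G X) (\<eta> X)) \<and>
     (\<forall>X\<in>Ob C. \<forall>Y\<in>Ob C. \<forall>f\<in>Hom C X Y.
        Comp D (fob F X) (fob F Y) (fob G Y) (\<eta> Y) (fmor F X Y f) =
        Comp D (fob F X) (fob G X) (fob G Y) (fmor G X Y f) (\<eta> X))"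

definition forms_equivalence ::
  "('o, 'm) category \<Rightarrow> ('p, 'q) category \<Rightarrow> ('o, 'm, 'p, 'q) cfunctor \<Rightarrow>
   ('p, 'q, 'o, 'm) cfunctor \<Rightarrow> bool" where
  "forms_equivalence C D F G \<longleftrightarrow>
     is_category C \<and> is_category D \<and> is_functor C D F \<and> is_functor D C G \<and>
     (\<exists>\<eta>. natural_iso C C id_functor (comp_functor G F) \<eta>) \<and>
     (\<exists>\<epsilon>. natural_iso D D (comp_functor F G) id_functor \<epsilon>)"


section \<open>Many-to-one posets\<close>

text \<open>\<open>lord C x z\<close> is the strict local order on the loops \<open>y\<close> on \<open>z\<close> with \<open>y \<prec>\<^sup>- x\<close>.\<close>

record 'a mop =
  cells :: "'a set"
  dim :: "'a \<Rightarrow> int"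
  delta :: "'a \<Rightarrow> 'a set"
  gamma :: "'a \<Rightarrow> 'a set"
  lord :: "'a \<Rightarrow> 'a \<Rightarrow> ('a \<times> 'a) set"

definition cells_dim :: "('a, 'b) mop_scheme \<Rightarrow> int \<Rightarrow> 'a set" where
  "cells_dim C k = {x \<in> cells C. dim C x = k}"

definition bdry :: "('a, 'b) mop_scheme \<Rightarrow> 'a \<Rightarrow> 'a set" where
  "bdry C x = delta C x \<union> gamma C x"

text \<open>\<open>face C s y x\<close> is \<open>y \<prec>\<^sup>s x\<close>, where the signs \<open>+\<close>, \<open>-\<close>, \<open>\<circ>\<close> are the integers 1, -1, 0.\<close>

definition face :: "('a, 'b) mop_scheme \<Rightarrow> int \<Rightarrow> 'a \<Rightarrow> 'a \<Rightarrow> bool" where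
  "face C s y x \<longleftrightarrow> x \<in> cells C \<and>
     (s = -1 \<and> y \<in> delta C x - gamma C x \<or>
      s = 1 \<and> y \<in> gamma C x - delta C x \<or>
      s = 0 \<and> y \<in> delta C x \<inter> gamma C x)"

definition prec :: "('a, 'b) mop_scheme \<Rightarrow> 'a \<Rightarrow> 'a \<Rightarrow> bool" where
  "prec C y x \<longleftrightarrow> x \<in> cells C \<and> y \<in> bdry C x"

definition le_rel :: "('a, 'b) mop_scheme \<Rightarrow> ('a \<times> 'a) set" where
  "le_rel C = {(y, x). prec C y x}\<^sup>*"

definition gam :: "('a, 'b) mop_scheme \<Rightarrow> 'a \<Rightarrow> 'a" where
  "gam C x = the_elem (gamma C x)"

definition Lam :: "('a, 'b) mop_scheme \<Rightarrow> 'a set" where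
  "Lam C = cells C - (\<Union>x\<in>cells C. gamma C x - delta C x)"

definition null_cells :: "('a, 'b) mop_scheme \<Rightarrow> 'a set" where
  "null_cells C = {x \<in> cells C. delta C x = {}}"

definition local_loops :: "('a, 'b) mop_scheme \<Rightarrow> 'a \<Rightarrow> 'a \<Rightarrow> 'a set" where
  "local_loops C x z = {y. face C 0 z y \<and> face C (-1) y x}"

text \<open>\<open>delta\<close> and \<open>gamma\<close> are only meaningful in dimension at least 0, and local orders only for
  \<open>x \<in> Lam C\<close> and \<open>z \<in> \<partial>\<^sup>2(x)\<close>; elsewhere (on cells) they are empty by convention.\<close>

definition is_mop :: "'a mop \<Rightarrow> bool" where
  "is_mop C \<longleftrightarrow>
     finite (cells C) \<and>
     (\<forall>x\<in>cells C. dim C x \<ge> -1) \<and>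
     (\<forall>x\<in>cells C. dim C x = -1 \<longrightarrow> delta C x = {} \<and> gamma C x = {}) \<and>
     (\<forall>x\<in>cells C. dim C x \<ge> 0 \<longrightarrow>
        delta C x \<subseteq> cells_dim C (dim C x - 1) \<and>
        gamma C x \<subseteq> cells_dim C (dim C x - 1) \<and>
        is_singleton (gamma C x)) \<and>
     (\<forall>x\<in>cells C. delta C x \<inter> gamma C x \<noteq> {} \<longrightarrow> delta C x = gamma C x) \<and>
     (\<exists>!s. s \<in> cells_dim C (-1)) \<and>
     (\<forall>x\<in>cells_dim C 0. gamma C x - delta C x = cells_dim C (-1)) \<and>
     (\<forall>x z. if x \<in> Lam C \<and> z \<in> (\<Union>y\<in>bdry C x. bdry C y)
        then lord C x z \<subseteq> local_loops C x z \<times> local_loops C x z \<and>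
             strict_linear_order_on (local_loops C x z) (lord C x z)
        else lord C x z = {})"

definition mop_hom :: "'a mop \<Rightarrow> 'a mop \<Rightarrow> ('a \<Rightarrow> 'a) set" where
  "mop_hom C D = {f \<in> cells C \<rightarrow>\<^sub>E cells D.
     (\<forall>x\<in>cells C. dim D (f x) = dim C x) \<and>
     (\<forall>x\<in>cells C. dim C x \<ge> 0 \<longrightarrow>
        bij_betw f (delta C x) (delta D (f x)) \<and> f ` gamma C x = gamma D (f x)) \<and>
     (\<forall>x z y y'. (y, y') \<in> lord C x z \<longrightarrow> (f y, f y') \<in> lord D (f x) (f z))}"

definition MOP :: "('a mop, 'a \<Rightarrow> 'a) category" where
  "MOP = \<lparr>Ob = {C. is_mop C}, Hom = mop_hom,
          Id = \<lambda>C. restrict (\<lambda>x. x) (cells C),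
          Comp = \<lambda>C D E g f. compose (cells C) g f\<rparr>"


section \<open>Dendritic face complexes\<close>

definition greatest_cell :: "('a, 'b) mop_scheme \<Rightarrow> 'a \<Rightarrow> bool" where
  "greatest_cell C w \<longleftrightarrow> w \<in> cells C \<and> (\<forall>x\<in>cells C. (x, w) \<in> le_rel C)"

text \<open>In oriented thinness, the second chain \<open>z \<prec> y' \<prec> x\<close> also has nonzero signs, as the sign rule
  demands. Besides it there may be any number of chains \<open>z \<prec>\<^sup>\<circ> y'' \<prec>\<^sup>- x\<close>: a composite may have a loop
  and a non-loop among its sources.\<close>

definition is_dfc :: "'a mop \<Rightarrow> bool" where
  "is_dfc C \<longleftrightarrow> is_mop C \<and>
     (\<exists>w. greatest_cell C w \<and> dim C w \<ge> 0) \<and>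
     (\<forall>z y. face C 0 z y \<longrightarrow> (\<exists>x. face C 1 y x)) \<and>
     (\<forall>x y z \<alpha> \<beta>. face C \<beta> z y \<and> face C \<alpha> y x \<and> \<alpha> \<noteq> 0 \<and> \<beta> \<noteq> 0 \<longrightarrow>
        (\<exists>!y'. y' \<noteq> y \<and> (\<exists>\<alpha>' \<beta>'. \<alpha>' \<noteq> 0 \<and> \<beta>' \<noteq> 0 \<and> face C \<beta>' z y' \<and> face C \<alpha>' y' x)) \<and>
        (\<forall>y' \<alpha>' \<beta>'. y' \<noteq> y \<and> \<alpha>' \<noteq> 0 \<and> \<beta>' \<noteq> 0 \<and> face C \<beta>' z y' \<and> face C \<alpha>' y' x \<longrightarrow>
           \<alpha> * \<beta> = - (\<alpha>' * \<beta>'))) \<and>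
     (\<forall>x y z. face C 0 z y \<and> face C (-1) y x \<longrightarrow>
        (\<exists>y' \<alpha> \<beta>. y' \<noteq> y \<and> face C \<beta> z y' \<and> face C \<alpha> y' x \<and> (\<alpha>, \<beta>) \<noteq> (-1, 0))) \<and>
     (\<forall>x\<in>cells C. dim C x \<ge> 1 \<longrightarrow>
        \<not> (\<exists>p y. p \<ge> 1 \<and> (\<forall>i<p. face C (-1) (y i) x \<and>
              (let y' = y (Suc i mod p) in
                 face C 1 (gam C y') y' \<and> face C (-1) (gam C y') (y i)))))"

definition DFC :: "('a mop, 'a \<Rightarrow> 'a) category" where
  "DFC = full_subcategory MOP {C. is_dfc C}"

definition DFC_core :: "('a mop, 'a \<Rightarrow> 'a) category" where
  "DFC_core = core DFC"


section \<open>Rooted trees and subdivisions\<close>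

text \<open>\<open>(b, a) \<in> tsource T\<close> means that the edge \<open>b\<close> is a source of the node \<open>a\<close>, and
  \<open>(b, a) \<in> ttarget T\<close> that \<open>b\<close> is the target of \<open>a\<close>. Nodes and edges have separate types, so a node
  and an edge of the same tree may share their name when both types coincide; as vertices of
  descending paths they are distinguished as \<open>Inl\<close> (nodes) and \<open>Inr\<close> (edges).\<close>

record ('n, 'e) rtree =
  nodes :: "'n set"
  edges :: "'e set"
  root :: 'e
  tsource :: "('e \<times> 'n) set"
  ttarget :: "('e \<times> 'n) set"

definition vertices :: "('n, 'e) rtree \<Rightarrow> ('n + 'e) set" where
  "vertices T = Inl ` nodes T \<union> Inr ` edges T"

definition desc_step :: "('n, 'e) rtree \<Rightarrow> (('n + 'e) \<times> ('n + 'e)) set" where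
  "desc_step T = {(Inl a, Inr b) | a b. (b, a) \<in> ttarget T} \<union>
                 {(Inr b, Inl a) | a b. (b, a) \<in> tsource T}"

definition desc :: "('n, 'e) rtree \<Rightarrow> ('n + 'e) \<Rightarrow> ('n + 'e) \<Rightarrow> bool" where
  "desc T x y \<longleftrightarrow> x \<in> vertices T \<and> y \<in> vertices T \<and> (x, y) \<in> (desc_step T)\<^sup>*"

definition rooted_tree :: "('n, 'e) rtree \<Rightarrow> bool" where
  "rooted_tree T \<longleftrightarrow>
     finite (nodes T) \<and> finite (edges T) \<and>
     tsource T \<subseteq> edges T \<times> nodes T \<and> ttarget T \<subseteq> edges T \<times> nodes T \<and>
     (\<forall>a\<in>nodes T. \<exists>!b. (b, a) \<in> ttarget T) \<and>
     (\<forall>b a a'. (b, a) \<in> ttarget T \<and> (b, a') \<in> ttarget T \<longrightarrow> a = a') \<and>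
     (\<forall>b a a'. (b, a) \<in> tsource T \<and> (b, a') \<in> tsource T \<longrightarrow> a = a') \<and>
     root T \<in> edges T \<and> (\<nexists>a. (root T, a) \<in> tsource T) \<and>
     (\<forall>b\<in>edges T. desc T (Inr b) (Inr (root T)))"

definition leaves :: "('n, 'e) rtree \<Rightarrow> 'e set" where
  "leaves T = {b \<in> edges T. \<nexists>a. (b, a) \<in> ttarget T}"

definition null_dots :: "('n, 'e) rtree \<Rightarrow> 'n set" where
  "null_dots T = {a \<in> nodes T. \<nexists>b. (b, a) \<in> tsource T}"

definition linear_tree :: "('n, 'e) rtree \<Rightarrow> bool" where
  "linear_tree T \<longleftrightarrow> (\<forall>a\<in>nodes T. \<exists>!b. (b, a) \<in> tsource T)"

definition unary_corolla :: "('n, 'e) rtree \<Rightarrow> bool" where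
  "unary_corolla T \<longleftrightarrow> is_singleton (nodes T) \<and> is_singleton (leaves T)"

definition unit_tree :: "'e \<Rightarrow> ('n, 'e) rtree" where
  "unit_tree b = \<lparr>nodes = {}, edges = {b}, root = b, tsource = {}, ttarget = {}\<rparr>"

definition corolla :: "'n \<Rightarrow> 'e set \<Rightarrow> 'e \<Rightarrow> ('n, 'e) rtree" where
  "corolla a L r = \<lparr>nodes = {a}, edges = insert r L, root = r,
                    tsource = L \<times> {a}, ttarget = {(r, a)}\<rparr>"

record ('e, 'w) subdiv =
  wset :: "'e \<Rightarrow> 'w set"
  wless :: "'e \<Rightarrow> ('w \<times> 'w) set"

definition empty_subdiv :: "('e, 'w) subdiv" where
  "empty_subdiv = \<lparr>wset = \<lambda>b. {}, wless = \<lambda>b. {}\<rparr>"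

definition is_subdivision :: "('n, 'e) rtree \<Rightarrow> ('e, 'w) subdiv \<Rightarrow> bool" where
  "is_subdivision T W \<longleftrightarrow>
     (\<forall>b\<in>edges T. finite (wset W b) \<and> wless W b \<subseteq> wset W b \<times> wset W b \<and>
        strict_linear_order_on (wset W b) (wless W b)) \<and>
     (\<forall>b\<in>edges T. \<forall>b'\<in>edges T. b \<noteq> b' \<longrightarrow> wset W b \<inter> wset W b' = {})"

definition white_dots :: "('n, 'e) rtree \<Rightarrow> ('e, 'w) subdiv \<Rightarrow> 'w set" where
  "white_dots T W = (\<Union>b\<in>edges T. wset W b)"

definition dots :: "('n, 'e) rtree \<Rightarrow> ('e, 'w) subdiv \<Rightarrow> ('n + 'w) set" where
  "dots T W = Inl ` nodes T \<union> Inr ` white_dots T W"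

definition greatest_opt :: "('w \<times> 'w) set \<Rightarrow> 'w set \<Rightarrow> 'w option" where
  "greatest_opt r S =
     (if S = {} then None else Some (THE m. m \<in> S \<and> (\<forall>s\<in>S. s \<noteq> m \<longrightarrow> (s, m) \<in> r)))"

text \<open>In the subdivided tree, the edge \<open>b\<close> is cut by its white dots into the segment \<open>(b, None)\<close>
  at the root end and, for each white dot \<open>w\<close> on \<open>b\<close>, the segment \<open>(b, Some w)\<close> whose target node
  is \<open>w\<close>.\<close>

definition subdivide :: "('n, 'e) rtree \<Rightarrow> ('e, 'w) subdiv \<Rightarrow> ('n + 'w, 'e \<times> 'w option) rtree" where
  "subdivide T W =
     \<lparr>nodes = dots T W,
      edges = {(b, None) | b. b \<in> edges T} \<union> {(b, Some w) | b w. b \<in> edges T \<and> w \<in> wset W b},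
      root = (root T, None),
      tsource = {((b, None), Inl a) | a b. (b, a) \<in> tsource T} \<union>
                {((b, Some w), Inr w) | b w. b \<in> edges T \<and> w \<in> wset W b},
      ttarget = {((b, greatest_opt (wless W b) (wset W b)), Inl a) | a b. (b, a) \<in> ttarget T} \<union>
                {((b, greatest_opt (wless W b) {w'. (w', w) \<in> wless W b}), Inr w) | b w.
                   b \<in> edges T \<and> w \<in> wset W b}\<rparr>"

definition adjacent_nodes :: "('n, 'e) rtree \<Rightarrow> 'n \<Rightarrow> 'n \<Rightarrow> bool" where
  "adjacent_nodes T a a' \<longleftrightarrow>
     (\<exists>e. (e, a) \<in> tsource T \<and> (e, a') \<in> ttarget T \<or> (e, a) \<in> ttarget T \<and> (e, a') \<in> tsource T)"

definition induces_connected :: "('n, 'e) rtree \<Rightarrow> 'n set \<Rightarrow> bool" where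
  "induces_connected T D \<longleftrightarrow>
     (\<forall>a\<in>D. \<forall>a'\<in>D. (a, a') \<in> {(u, v). u \<in> D \<and> v \<in> D \<and> adjacent_nodes T u v}\<^sup>*)"


section \<open>Constellations and opetopes\<close>

text \<open>Black dots are sent to leaves, which are edges, and white dots to null dots, which are nodes.\<close>

definition dot_map :: "('n \<Rightarrow> 'f) \<Rightarrow> ('w \<Rightarrow> 'm) \<Rightarrow> 'n + 'w \<Rightarrow> 'm + 'f" where
  "dot_map sb sw = case_sum (\<lambda>a. Inr (sb a)) (\<lambda>w. Inl (sw w))"

definition is_constellation ::
  "('n, 'e) rtree \<Rightarrow> ('e, 'w) subdiv \<Rightarrow> ('m, 'f) rtree \<Rightarrow> ('n \<Rightarrow> 'f) \<Rightarrow> ('w \<Rightarrow> 'm) \<Rightarrow> bool" where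
  "is_constellation T W U sb sw \<longleftrightarrow>
     rooted_tree T \<and> is_subdivision T W \<and> rooted_tree U \<and>
     bij_betw sb (nodes T) (leaves U) \<and>
     bij_betw sw (white_dots T W) (null_dots U) \<and>
     (\<forall>x\<in>nodes U. induces_connected (subdivide T W)
        {t \<in> dots T W. desc U (dot_map sb sw t) (Inl x)})"

definition exact_constellation ::
  "('a, 'e) rtree \<Rightarrow> ('e, 'w) subdiv \<Rightarrow> ('w, 'a) rtree \<Rightarrow> bool" where
  "exact_constellation T W U \<longleftrightarrow> is_constellation T W U (\<lambda>a. a) (\<lambda>w. w)"

text \<open>An opetope of dimension \<open>n = odim Y\<close> consists of the trees \<open>otree Y k\<close> for \<open>k \<le> n\<close> and
  the subdivisions \<open>osub Y k\<close> for \<open>k < n\<close>; the values for larger \<open>k\<close> are irrelevant.\<close>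

record 'a opetope =
  odim :: nat
  otree :: "nat \<Rightarrow> ('a, 'a) rtree"
  osub :: "nat \<Rightarrow> ('a, 'a) subdiv"

definition is_opetope :: "'a opetope \<Rightarrow> bool" where
  "is_opetope Y \<longleftrightarrow>
     (\<forall>k\<le>odim Y. rooted_tree (otree Y k)) \<and>
     (\<forall>k<odim Y. exact_constellation (otree Y k) (osub Y k) (otree Y (Suc k))) \<and>
     unary_corolla (otree Y 0) \<and>
     (odim Y \<ge> 1 \<longrightarrow> unary_corolla (otree Y 1)) \<and>
     (odim Y \<ge> 2 \<longrightarrow> linear_tree (otree Y 2))"

definition tree_iso ::
  "('n, 'e) rtree \<Rightarrow> ('m, 'f) rtree \<Rightarrow> ('n \<Rightarrow> 'm) \<Rightarrow> ('e \<Rightarrow> 'f) \<Rightarrow> bool" where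
  "tree_iso T U fn fe \<longleftrightarrow>
     bij_betw fn (nodes T) (nodes U) \<and> bij_betw fe (edges T) (edges U) \<and>
     fe (root T) = root U \<and>
     (\<forall>a\<in>nodes T. \<forall>b\<in>edges T.
        ((fe b, fn a) \<in> tsource U \<longleftrightarrow> (b, a) \<in> tsource T) \<and>
        ((fe b, fn a) \<in> ttarget U \<longleftrightarrow> (b, a) \<in> ttarget T))"

definition subdiv_iso ::
  "('n, 'e) rtree \<Rightarrow> ('e, 'w) subdiv \<Rightarrow> ('f, 'v) subdiv \<Rightarrow> ('e \<Rightarrow> 'f) \<Rightarrow> ('w \<Rightarrow> 'v) \<Rightarrow> bool" where
  "subdiv_iso T W V fe fw \<longleftrightarrow>
     (\<forall>b\<in>edges T. bij_betw fw (wset W b) (wset V (fe b)) \<and>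
        (\<forall>w\<in>wset W b. \<forall>w'\<in>wset W b. (fw w, fw w') \<in> wless V (fe b) \<longleftrightarrow> (w, w') \<in> wless W b))"

record 'a opetope_map =
  mnode :: "nat \<Rightarrow> 'a \<Rightarrow> 'a"
  medge :: "nat \<Rightarrow> 'a \<Rightarrow> 'a"
  mwhite :: "nat \<Rightarrow> 'a \<Rightarrow> 'a"

definition onodes :: "'a opetope \<Rightarrow> nat \<Rightarrow> 'a set" where
  "onodes Y k = (if k \<le> odim Y then nodes (otree Y k) else {})"

definition oedges :: "'a opetope \<Rightarrow> nat \<Rightarrow> 'a set" where
  "oedges Y k = (if k \<le> odim Y then edges (otree Y k) else {})"

definition owhites :: "'a opetope \<Rightarrow> nat \<Rightarrow> 'a set" where
  "owhites Y k = (if k < odim Y then white_dots (otree Y k) (osub Y k) else {})"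

definition opetope_isos :: "'a opetope \<Rightarrow> 'a opetope \<Rightarrow> 'a opetope_map set" where
  "opetope_isos Y Y' = {f. odim Y = odim Y' \<and>
     (\<forall>k. mnode f k \<in> extensional (onodes Y k) \<and>
          medge f k \<in> extensional (oedges Y k) \<and>
          mwhite f k \<in> extensional (owhites Y k)) \<and>
     (\<forall>k\<le>odim Y. tree_iso (otree Y k) (otree Y' k) (mnode f k) (medge f k)) \<and>
     (\<forall>k<odim Y. subdiv_iso (otree Y k) (osub Y k) (osub Y' k) (medge f k) (mwhite f k)) \<and>
     (\<forall>k<odim Y. (\<forall>a\<in>onodes Y k. medge f (Suc k) a = mnode f k a) \<and>
                  (\<forall>w\<in>owhites Y k. mnode f (Suc k) w = mwhite f k w))}"

definition KJBM :: "('a opetope, 'a opetope_map) category" where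
  "KJBM = \<lparr>Ob = {Y. is_opetope Y}, Hom = opetope_isos,
     Id = \<lambda>Y. \<lparr>mnode = \<lambda>k. restrict (\<lambda>x. x) (onodes Y k),
                medge = \<lambda>k. restrict (\<lambda>x. x) (oedges Y k),
                mwhite = \<lambda>k. restrict (\<lambda>x. x) (owhites Y k)\<rparr>,
     Comp = \<lambda>Y Y' Y'' g f.
              \<lparr>mnode = \<lambda>k. compose (onodes Y k) (mnode g k) (mnode f k),
               medge = \<lambda>k. compose (oedges Y k) (medge g k) (medge f k),
               mwhite = \<lambda>k. compose (owhites Y k) (mwhite g k) (mwhite f k)\<rparr>\<rparr>"


section \<open>The functor from dendritic face complexes to opetopes\<close>

definition top_cell :: "'a mop \<Rightarrow> 'a" where
  "top_cell C = (THE w. greatest_cell C w)"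

definition mop_dim :: "'a mop \<Rightarrow> nat" where
  "mop_dim C = nat (dim C (top_cell C))"

definition iter_target :: "'a mop \<Rightarrow> nat \<Rightarrow> 'a" where
  "iter_target C k = (gam C ^^ (mop_dim C - k)) (top_cell C)"

subsection \<open>The order on the white dots of an edge\<close>

definition loop_incl :: "'a mop \<Rightarrow> 'a \<Rightarrow> ('a \<times> 'a) set" where
  "loop_incl C c = {(b', b). face C 0 c b' \<and> face C 0 c b \<and>
                     (\<exists>a\<in>Lam C. face C 1 b a \<and> face C (-1) b' a)}\<^sup>*"

text \<open>The zig-zag \<open>b\<^sub>1, a\<^sub>1, b\<^sub>2, \<dots>, a\<^bsub>q-1\<^esub>, b\<^sub>q\<close> with left part \<open>b\<^sub>1, \<dots>, b\<^sub>p\<close>, indexed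
  from 1; it lists all chains \<open>c \<prec>\<^sup>\<beta> b \<prec>\<^sup>\<alpha> a\<close> with \<open>a \<in> Lam C\<close> and nonzero signs. The sign
  conditions make it unique (when there is a chain at all).\<close>

definition is_zigzag :: "'a mop \<Rightarrow> 'a \<Rightarrow> nat \<Rightarrow> nat \<Rightarrow> (nat \<Rightarrow> 'a) \<Rightarrow> (nat \<Rightarrow> 'a) \<Rightarrow> bool" where
  "is_zigzag C c p q b a \<longleftrightarrow>
     p \<le> q \<and>
     (\<forall>i\<in>{1..q}. (i \<le> p \<longrightarrow> face C (-1) c (b i)) \<and> (i > p \<longrightarrow> face C 1 c (b i))) \<and>
     (\<forall>i\<in>{1..<q}. a i \<in> Lam C \<and>
        (i < p \<longrightarrow> face C (-1) (b i) (a i) \<and> face C 1 (b (Suc i)) (a i)) \<and>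
        (i = p \<longrightarrow> face C (-1) (b i) (a i) \<and> face C (-1) (b (Suc i)) (a i)) \<and>
        (i > p \<longrightarrow> face C 1 (b i) (a i) \<and> face C (-1) (b (Suc i)) (a i))) \<and>
     {(b', a'). a' \<in> Lam C \<and> (\<exists>\<alpha> \<beta>. \<alpha> \<noteq> 0 \<and> \<beta> \<noteq> 0 \<and> face C \<beta> c b' \<and> face C \<alpha> b' a')} =
       (\<Union>i\<in>{1..<q}. {(b i, a i), (b (Suc i), a i)})"

definition order1 :: "'a mop \<Rightarrow> 'a \<Rightarrow> 'a \<Rightarrow> 'a \<Rightarrow> bool" where
  "order1 C c u u' \<longleftrightarrow>
     0 \<le> dim C c \<and> dim C c \<le> int (mop_dim C) - 2 \<and>
     (\<exists>p q b a. is_zigzag C c p q b a \<and>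
        (\<exists>i\<in>{1..<q}. \<exists>j\<in>{1..<q}. i < j \<and>
           (\<exists>v v'. face C 0 c v \<and> face C (-1) v (a i) \<and> face C 0 c v' \<and> face C (-1) v' (a j) \<and>
                   (u, v) \<in> loop_incl C c \<and> (u', v') \<in> loop_incl C c)))"

definition loop_path ::
  "'a mop \<Rightarrow> 'a \<Rightarrow> nat \<Rightarrow> (nat \<Rightarrow> 'a) \<Rightarrow> (nat \<Rightarrow> 'a) \<Rightarrow> bool" where
  "loop_path C c p a b \<longleftrightarrow>
     p \<ge> 1 \<and> (\<forall>i\<le>p. a i \<in> Lam C) \<and>
     (\<forall>i<p. face C 0 c (b i) \<and> face C 1 (b i) (a i) \<and> face C (-1) (b i) (a (Suc i)))"

definition order2 :: "'a mop \<Rightarrow> 'a \<Rightarrow> 'a \<Rightarrow> 'a \<Rightarrow> bool" where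
  "order2 C c u u' \<longleftrightarrow>
     u \<noteq> u' \<and> \<not> order1 C c u u' \<and> \<not> order1 C c u' u \<and>
     (\<exists>p q a a' b b'. loop_path C c p a b \<and> loop_path C c q a' b' \<and>
        b 0 = u \<and> b' 0 = u' \<and> a 0 \<in> null_cells C \<and> a' 0 \<in> null_cells C \<and>
        a p = a' q \<and> b (p - 1) \<noteq> b' (q - 1) \<and>
        (b (p - 1), b' (q - 1)) \<in> lord C (a p) c)"

definition null_loops :: "'a mop \<Rightarrow> 'a \<Rightarrow> 'a set" where
  "null_loops C c = {b. face C 0 c b \<and> (\<exists>a\<in>Lam C \<inter> null_cells C. face C 1 b a)}"

definition loop_order :: "'a mop \<Rightarrow> 'a \<Rightarrow> ('a \<times> 'a) set" where
  "loop_order C c = {(u, u'). u \<in> null_loops C c \<and> u' \<in> null_loops C c \<and>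
                       (order1 C c u u' \<or> order2 C c u u')}"

subsection \<open>Objects and morphisms\<close>

definition first_leaf :: "'a mop \<Rightarrow> 'a" where
  "first_leaf C = (THE l. l \<in> Lam C \<inter> cells_dim C 0)"

text \<open>In degrees 0 and 1 the tree has node and leaf named \<open>first_leaf C\<close> (the leaf of the tree in
  degree 2) and root edge named by the cell of dimension -1. So the node in degree 0 is the leaf in
  degree 1, and with these names an isomorphism of complexes acts in all degrees by restriction.\<close>

definition Z_tree :: "'a mop \<Rightarrow> nat \<Rightarrow> ('a, 'a) rtree" where
  "Z_tree C k =
     (if k < 2 then corolla (first_leaf C) {first_leaf C} (the_elem (cells_dim C (-1)))
      else
        (let N = Lam C \<inter> cells_dim C (int k - 1); E = cells_dim C (int k - 2) in
         \<lparr>nodes = N, edges = E, root = iter_target C (k - 2),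
          tsource = {(y, x). y \<in> E \<and> x \<in> N \<and> face C (-1) y x},
          ttarget = {(y, x). y \<in> E \<and> x \<in> N \<and> face C 1 y x}\<rparr>))"

definition Z_white :: "'a mop \<Rightarrow> nat \<Rightarrow> 'a \<Rightarrow> 'a set" where
  "Z_white C k y =
     {w \<in> Lam C \<inter> cells_dim C (int k) \<inter> null_cells C. gam C (gam C w) = y}"

definition Z_sub :: "'a mop \<Rightarrow> nat \<Rightarrow> ('a, 'a) subdiv" where
  "Z_sub C k =
     (if k < 2 then empty_subdiv
      else \<lparr>wset = Z_white C k,
            wless = \<lambda>y. {(w, w'). w \<in> Z_white C k y \<and> w' \<in> Z_white C k y \<and>
                           (gam C w, gam C w') \<in> loop_order C y}\<rparr>)"

definition Z_ob :: "'a mop \<Rightarrow> 'a opetope" where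
  "Z_ob C = \<lparr>odim = mop_dim C, otree = Z_tree C, osub = Z_sub C\<rparr>"

definition Z_mor :: "'a mop \<Rightarrow> 'a mop \<Rightarrow> ('a \<Rightarrow> 'a) \<Rightarrow> 'a opetope_map" where
  "Z_mor C D f = \<lparr>mnode = \<lambda>k. restrict f (onodes (Z_ob C) k),
                  medge = \<lambda>k. restrict f (oedges (Z_ob C) k),
                  mwhite = \<lambda>k. restrict f (owhites (Z_ob C) k)\<rparr>"

definition Z_functor :: "('a mop, 'a \<Rightarrow> 'a, 'a opetope, 'a opetope_map) cfunctor" where
  "Z_functor = \<lparr>fob = Z_ob, fmor = Z_mor\<rparr>"


section \<open>The functor from opetopes to dendritic face complexes\<close>

text \<open>All finite structures are taken inside the infinite universe \<open>'a elem\<close>, for an arbitrary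
  type \<open>'a\<close> of atoms. It is closed under tagging: the edge \<open>x\<close> of the tree in degree \<open>k + 2\<close>, seen
  as a cell of dimension \<open>k\<close>, is \<open>Cell k x\<close>, so that the sets of cells of different dimensions are
  disjoint even when trees of different degrees share edge names.\<close>

datatype 'a elem = Atom 'a | Cell int "'a elem"

text \<open>\<open>fresh Y\<close> names the node of the corolla in degree \<open>n + 1\<close> (also the edge of the unit tree in
  degree \<open>n + 2\<close>) and, as an edge, the root of that corolla: it differs from the leaves.\<close>

definition fresh :: "'a opetope \<Rightarrow> 'a" where
  "fresh Y = (SOME x. x \<notin> nodes (otree Y (odim Y)))"

definition ext_tree :: "'a opetope \<Rightarrow> nat \<Rightarrow> ('a, 'a) rtree" where
  "ext_tree Y k =
     (if k \<le> odim Y then otree Y k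
      else if k = odim Y + 1 then corolla (fresh Y) (nodes (otree Y (odim Y))) (fresh Y)
      else unit_tree (fresh Y))"

text \<open>The tree in degree \<open>n\<close> gets the empty subdivision, except when it is a unit tree: then the
  node of the corolla in degree \<open>n + 1\<close> is a null dot, and exactness of the constellation into the
  corolla forces one white dot, namely this node, on the only edge.\<close>

definition ext_sub :: "'a opetope \<Rightarrow> nat \<Rightarrow> ('a, 'a) subdiv" where
  "ext_sub Y k =
     (if k < odim Y then osub Y k
      else if k = odim Y \<and> nodes (otree Y k) = {}
        then \<lparr>wset = \<lambda>b. if b = root (otree Y k) then {fresh Y} else {}, wless = \<lambda>b. {}\<rparr>
      else empty_subdiv)"

definition dots_above :: "'a opetope \<Rightarrow> nat \<Rightarrow> 'a + 'a \<Rightarrow> ('a + 'a) set" where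
  "dots_above Y k x =
     {t \<in> dots (ext_tree Y k) (ext_sub Y k).
        desc (ext_tree Y (Suc k)) (dot_map (\<lambda>a. a) (\<lambda>w. w) t) x}"

text \<open>The underlying tree of the full subdivided subtree on a set \<open>D\<close> of dots of \<open>(T, W)\<close>.\<close>

definition subtree :: "('n, 'e) rtree \<Rightarrow> ('e, 'w) subdiv \<Rightarrow> ('n + 'w) set \<Rightarrow> ('n, 'e) rtree" where
  "subtree T W D =
     (let N = {a \<in> nodes T. Inl a \<in> D} in
      if N = {} then unit_tree (THE b. b \<in> edges T \<and> (\<exists>w. Inr w \<in> D \<and> w \<in> wset W b))
      else
        (let E = {b \<in> edges T. \<exists>a\<in>N. (b, a) \<in> tsource T \<or> (b, a) \<in> ttarget T} in
         \<lparr>nodes = N, edges = E,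
          root = (THE b. b \<in> E \<and> (\<nexists>a. a \<in> N \<and> (b, a) \<in> tsource T)),
          tsource = tsource T \<inter> (E \<times> N), ttarget = ttarget T \<inter> (E \<times> N)\<rparr>))"

text \<open>For an edge \<open>x\<close> of the tree in degree \<open>k + 1\<close>.\<close>

definition sub_tree :: "'a opetope \<Rightarrow> nat \<Rightarrow> 'a \<Rightarrow> ('a, 'a) rtree" where
  "sub_tree Y k x = subtree (ext_tree Y k) (ext_sub Y k) (dots_above Y k (Inr x))"

definition P_cells :: "'a elem opetope \<Rightarrow> 'a elem set" where
  "P_cells Y = insert (Cell (-1) (root (ext_tree Y 1)))
     {Cell (int k) x | k x. k \<le> odim Y \<and> x \<in> edges (ext_tree Y (k + 2))}"

fun P_dim :: "'a elem \<Rightarrow> int" where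
  "P_dim (Cell k x) = k"
| "P_dim (Atom x) = -1"

fun P_gamma :: "'a elem opetope \<Rightarrow> 'a elem \<Rightarrow> 'a elem set" where
  "P_gamma Y (Cell k x) =
     (if k \<ge> 0 then {Cell (k - 1) (root (sub_tree Y (nat k + 1) x))} else {})"
| "P_gamma Y (Atom x) = {}"

fun P_delta :: "'a elem opetope \<Rightarrow> 'a elem \<Rightarrow> 'a elem set" where
  "P_delta Y (Cell k x) =
     (if k > 0 then Cell (k - 1) ` leaves (sub_tree Y (nat k + 1) x) else {})"
| "P_delta Y (Atom x) = {}"

definition P_faces :: "'a elem opetope \<Rightarrow> 'a elem mop" where
  "P_faces Y = \<lparr>cells = P_cells Y, dim = P_dim, delta = P_delta Y, gamma = P_gamma Y,
                lord = \<lambda>x z. {}\<rparr>"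

definition P_lord :: "'a elem opetope \<Rightarrow> 'a elem \<Rightarrow> 'a elem \<Rightarrow> ('a elem \<times> 'a elem) set" where
  "P_lord Y X U =
     {(Cell (int k - 1) y, Cell (int k - 1) y') | k y y' x z.
        X = Cell (int k) x \<and> U = Cell (int k - 2) z \<and> X \<in> Lam (P_faces Y) \<and> y \<noteq> y' \<and>
        Cell (int k - 1) y \<in> local_loops (P_faces Y) X U \<and>
        Cell (int k - 1) y' \<in> local_loops (P_faces Y) X U \<and>
        (\<forall>w w'. Inr w \<in> dots_above Y k (Inr y) \<and> Inr w' \<in> dots_above Y k (Inr y') \<longrightarrow>
           (w, w') \<in> wless (ext_sub Y k) z)}"

definition P_ob :: "'a elem opetope \<Rightarrow> 'a elem mop" where
  "P_ob Y = (P_faces Y)\<lparr>lord := P_lord Y\<rparr>"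

definition ext_edge_map :: "'a opetope \<Rightarrow> 'a opetope \<Rightarrow> 'a opetope_map \<Rightarrow> nat \<Rightarrow> 'a \<Rightarrow> 'a" where
  "ext_edge_map Y Y' f k x =
     (if k \<le> odim Y then medge f k x
      else if k = odim Y + 1 \<and> x \<in> nodes (otree Y (odim Y)) then mnode f (odim Y) x
      else fresh Y')"

fun P_act :: "'a elem opetope \<Rightarrow> 'a elem opetope \<Rightarrow> 'a elem opetope_map \<Rightarrow> 'a elem \<Rightarrow> 'a elem" where
  "P_act Y Y' f (Cell k x) = Cell k (ext_edge_map Y Y' f (nat (k + 2)) x)"
| "P_act Y Y' f (Atom x) = Atom x"

definition P_mor ::
  "'a elem opetope \<Rightarrow> 'a elem opetope \<Rightarrow> 'a elem opetope_map \<Rightarrow> 'a elem \<Rightarrow> 'a elem" where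
  "P_mor Y Y' f = restrict (P_act Y Y' f) (P_cells Y)"

definition P_functor ::
  "('a elem opetope, 'a elem opetope_map, 'a elem mop, 'a elem \<Rightarrow> 'a elem) cfunctor" where
  "P_functor = \<lparr>fob = P_ob, fmor = P_mor\<rparr>"

end

theory Submission
  imports Defs
begin

text \<open>In an exact constellation from \<open>T\<close> to \<open>U\<close> the dots around an edge \<open>c\<close> of \<open>T\<close> form a string: the
  node below \<open>c\<close>, the white dots on \<open>c\<close>, the node above \<open>c\<close>. The kernel rule makes the set of dots above
  an edge \<open>x\<close> of \<open>U\<close> convex on each string, and what it contains of the string of \<open>c\<close> is the sign of \<open>c\<close>
  in \<open>x\<close>: the upper node but not the lower one (\<open>+\<close>), the lower node but not the upper one (\<open>-\<close>), or only
  white dots on \<open>c\<close> (\<open>\<circ>\<close>). These signs define \<open>P\<close>, and since the dots above the target of a node of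
  \<open>U\<close> are the disjoint union of the dots above its sources, oriented thinness is a count of end points.

  Conversely, let \<open>C\<close> be a dendritic face complex. Going down from the top dimension, thinness and
  acyclicity show that each graph \<open>T\<^sub>k\<close> is a rooted tree with leaves in \<open>\<Lambda>\<close>, and that the signs of
  \<open>c\<close> in a cell \<open>x\<close> can be read off from the cells of \<open>\<Lambda>\<close> above \<open>x\<close>. The order on the white dots of
  \<open>c\<close> turns out to be lexicographic: two of them are compared at the node where their descending paths
  meet, by the zig-zag of \<open>c\<close> or by a local order. Hence the kernel rule holds, the signs of the opetope
  \<open>Z(C)\<close> are those of \<open>C\<close>, and unit and counit only rename cells, nodes and edges.\<close>

section \<open>Rooted trees\<close>

text \<open>On the side of Z the obstacle is the order on white dots: it is given by a zig-zag and
  by loop paths, where neither totality nor transitivity nor convexity is visible. These properties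
  are proved for the lexicographic order, where they reduce to the sources of one node; the zig-zag
  is constructed only to identify the two orders. On both sides a nonzero sign of \<open>c\<close>
  in \<open>x\<close> means that exactly one of the two end nodes of the string of \<open>c\<close>
  lies above \<open>x\<close>, and each end above the target of a node is above exactly one of its
  sources. Rootedness of the tree with edges of dimension \<open>e\<close> is obtained inside a
  single cell, the iterated target two dimensions up, of which all nodes are sources; degenerate
  cases arise when there is no such cell or when it is a loop. The two trees that P adds on top are
  treated as ordinary levels: P reads a sequence of trees ending with a unit tree, and Z(C)
  continued to degree n + 2 is such a sequence too. So the unit is a comparison of two complexes on
  the same trees, followed by a renaming in the two top degrees.\<close>

definition tops :: "('n, 'e) rtree \<Rightarrow> ('n + 'e) set" where
  "tops T = Inr ` leaves T \<union> Inl ` null_dots T"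

lemma desc_step_iff [simp]:
  "(Inl a, Inr b) \<in> desc_step T \<longleftrightarrow> (b, a) \<in> ttarget T"
  "(Inr b, Inl a) \<in> desc_step T \<longleftrightarrow> (b, a) \<in> tsource T"
  "(Inl a, Inl a') \<notin> desc_step T"
  "(Inr b, Inr b') \<notin> desc_step T"
  by (auto simp: desc_step_def)

lemma desc_step_InrE:
  assumes "(x, Inr b) \<in> desc_step T"
  obtains a where "x = Inl a" "(b, a) \<in> ttarget T"
  using assms by (cases x) auto

lemma desc_step_InlE:
  assumes "(x, Inl a) \<in> desc_step T"
  obtains b where "x = Inr b" "(b, a) \<in> tsource T"
  using assms by (cases x) auto

lemma vertices_iff [simp]:
  "Inl a \<in> vertices T \<longleftrightarrow> a \<in> nodes T" "Inr b \<in> vertices T \<longleftrightarrow> b \<in> edges T"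
  by (auto simp: vertices_def)

lemma desc_trans: "desc T x y \<Longrightarrow> desc T y z \<Longrightarrow> desc T x z"
  by (auto simp: desc_def)

lemma desc_refl: "x \<in> vertices T \<Longrightarrow> desc T x x"
  by (auto simp: desc_def)

locale tree =
  fixes T :: "('n, 'e) rtree"
  assumes rooted: "rooted_tree T"
begin

lemma finite_nodes: "finite (nodes T)" and finite_edges: "finite (edges T)"
  using rooted by (auto simp: rooted_tree_def)

lemma source_mem: "(b, a) \<in> tsource T \<Longrightarrow> b \<in> edges T \<and> a \<in> nodes T"
  using rooted by (auto simp: rooted_tree_def)

lemma target_mem: "(b, a) \<in> ttarget T \<Longrightarrow> b \<in> edges T \<and> a \<in> nodes T"
  using rooted by (auto simp: rooted_tree_def)

lemma target_ex: "a \<in> nodes T \<Longrightarrow> \<exists>b. (b, a) \<in> ttarget T"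
  using rooted unfolding rooted_tree_def by blast

lemma target_unique: "(b, a) \<in> ttarget T \<Longrightarrow> (b', a) \<in> ttarget T \<Longrightarrow> b = b'"
  using rooted target_mem unfolding rooted_tree_def by metis

lemma upper_unique: "(b, a) \<in> ttarget T \<Longrightarrow> (b, a') \<in> ttarget T \<Longrightarrow> a = a'"
  using rooted unfolding rooted_tree_def by blast

lemma lower_unique: "(b, a) \<in> tsource T \<Longrightarrow> (b, a') \<in> tsource T \<Longrightarrow> a = a'"
  using rooted unfolding rooted_tree_def by blast

lemma root_mem: "root T \<in> edges T"
  using rooted by (auto simp: rooted_tree_def)

lemma root_not_source: "(root T, a) \<notin> tsource T"
  using rooted by (auto simp: rooted_tree_def)

lemma step_mem: "(x, y) \<in> desc_step T \<Longrightarrow> x \<in> vertices T \<and> y \<in> vertices T"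
  using source_mem target_mem by (cases x; cases y) auto

lemma step_unique: "(x, y) \<in> desc_step T \<Longrightarrow> (x, z) \<in> desc_step T \<Longrightarrow> y = z"
  using target_unique lower_unique by (cases x; cases y; cases z) auto

lemma root_no_step: "(Inr (root T), y) \<notin> desc_step T"
  using root_not_source by (cases y) auto

lemma desc_step: "(x, y) \<in> desc_step T \<Longrightarrow> desc T x y"
  using step_mem by (auto simp: desc_def)

lemma desc_target: "(b, a) \<in> ttarget T \<Longrightarrow> desc T (Inl a) (Inr b)"
  by (intro desc_step) simp

lemma desc_source: "(b, a) \<in> tsource T \<Longrightarrow> desc T (Inr b) (Inl a)"
  by (intro desc_step) simp

lemma desc_root: "x \<in> vertices T \<Longrightarrow> desc T x (Inr (root T))"
proof (cases x)
  case (Inl a)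
  assume "x \<in> vertices T"
  then obtain b where b: "(b, a) \<in> ttarget T" using Inl target_ex by auto
  have "desc T (Inr b) (Inr (root T))"
    using rooted target_mem[OF b] by (auto simp: rooted_tree_def)
  thus ?thesis using desc_target[OF b] Inl desc_trans by metis
next
  case (Inr b)
  assume "x \<in> vertices T"
  thus ?thesis using rooted Inr by (auto simp: rooted_tree_def)
qed

lemma rtrancl_cases_step:
  assumes "(x, y) \<in> (desc_step T)\<^sup>*" "(x, z) \<in> desc_step T"
  shows "x = y \<or> (z, y) \<in> (desc_step T)\<^sup>*"
  using assms step_unique by (metis converse_rtranclE)

text \<open>A vertex has at most one step down, so a cycle can never be left; but every vertex
  reaches the root, from which there is no step.\<close>

lemma acyclic_step: "acyclic (desc_step T)"
proof (rule acyclicI, rule allI, rule notI)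
  fix x assume cyc: "(x, x) \<in> (desc_step T)\<^sup>+"
  have key: "(z, z) \<in> (desc_step T)\<^sup>+" if "(x, z) \<in> (desc_step T)\<^sup>*" for z
    using that
  proof induction
    case base thus ?case by (rule cyc)
  next
    case (step y z)
    from step.IH obtain u where u: "(y, u) \<in> desc_step T" "(u, y) \<in> (desc_step T)\<^sup>*"
      by (meson tranclD)
    with step.hyps have "u = z" using step_unique by blast
    thus ?case using u by (metis rtrancl_into_trancl1)
  qed
  have "x \<in> vertices T" using cyc by (meson step_mem tranclD)
  hence "(x, Inr (root T)) \<in> (desc_step T)\<^sup>*" using desc_root by (auto simp: desc_def)
  from key[OF this] show False using root_no_step by (meson tranclD)
qed

lemma finite_step: "finite (desc_step T)"
proof (rule finite_subset)
  show "desc_step T \<subseteq> vertices T \<times> vertices T" using step_mem by auto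
  show "finite (vertices T \<times> vertices T)"
    using finite_nodes finite_edges by (auto simp: vertices_def)
qed

lemma wf_step: "wf (desc_step T)"
  using finite_acyclic_wf finite_step acyclic_step by blast

lemma wf_step_converse: "wf ((desc_step T)\<inverse>)"
  using finite_acyclic_wf_converse finite_step acyclic_step by blast

lemma desc_antisym: "desc T x y \<Longrightarrow> desc T y x \<Longrightarrow> x = y"
  using acyclic_step by (auto simp: desc_def acyclic_def) (metis rtrancl_eq_or_trancl trancl_trans)

text \<open>Steps are unique, so of two descending paths from \<open>x\<close> one is an initial
  part of the other.\<close>

lemma desc_total: "desc T x y \<Longrightarrow> desc T x z \<Longrightarrow> desc T y z \<or> desc T z y"
proof -
  assume "desc T x y" "desc T x z"
  hence v: "y \<in> vertices T" "z \<in> vertices T" by (auto simp: desc_def)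
  have "(y, z) \<in> (desc_step T)\<^sup>* \<or> (z, y) \<in> (desc_step T)\<^sup>*"
    if "(x, y) \<in> (desc_step T)\<^sup>*" "(x, z) \<in> (desc_step T)\<^sup>*"
    using that
  proof (induction rule: converse_rtrancl_induct)
    case base thus ?case by simp
  next
    case (step x x')
    thus ?case using rtrancl_cases_step[OF step.prems step.hyps(1)]
      by (metis converse_rtrancl_into_rtrancl)
  qed
  thus ?thesis using \<open>desc T x y\<close> \<open>desc T x z\<close> by (auto simp: desc_def)
qed

lemma desc_vertices: "desc T x y \<Longrightarrow> x \<in> vertices T \<and> y \<in> vertices T"
  by (auto simp: desc_def)

lemma desc_through_step:
  assumes "desc T x y" "(x, z) \<in> desc_step T" "x \<noteq> y" shows "desc T z y"
  using assms rtrancl_cases_step step_mem unfolding desc_def by metis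

lemma desc_lastE:
  assumes "desc T x y" "x \<noteq> y"
  obtains z where "desc T x z" "(z, y) \<in> desc_step T"
  using assms step_mem unfolding desc_def by (metis rtranclE)

lemma desc_firstE:
  assumes "desc T x y" "x \<noteq> y"
  obtains z where "(x, z) \<in> desc_step T" "desc T z y"
  using assms step_mem unfolding desc_def by (metis converse_rtranclE)

lemma no_back_step: "(x, y) \<in> desc_step T \<Longrightarrow> \<not> desc T y x"
  using acyclic_step unfolding desc_def acyclic_def by (metis rtrancl_into_trancl2)

text \<open>By \<open>desc_total\<close> one of the two edges descends to the other. If they differ,
  this path continues through \<open>a\<close>, so that \<open>a\<close> would descend to one of its
  own sources.\<close>

lemma sources_disjoint:
  assumes "(y, a) \<in> tsource T" "(y', a) \<in> tsource T" "desc T x (Inr y)" "desc T x (Inr y')"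
  shows "y = y'"
proof (rule ccontr)
  assume ne: "y \<noteq> y'"
  have *: False if "(y, a) \<in> tsource T" "(y', a) \<in> tsource T" "desc T (Inr y) (Inr y')" "y \<noteq> y'" for y y'
  proof -
    have "desc T (Inl a) (Inr y')" using desc_through_step[of "Inr y" "Inr y'" "Inl a"] that by auto
    thus False using no_back_step[of "Inr y'" "Inl a"] that by auto
  qed
  show False using desc_total[OF assms(3,4)] *[of y y'] *[of y' y] assms ne by blast
qed

text \<open>Well-founded induction from the tops towards the root, in steps of one node: the
  hypothesis concerns the sources of the node whose target is \<open>b\<close>.\<close>

lemma edge_up_induct [consumes 1]:
  assumes "b \<in> edges T"
    and step: "\<And>b. b \<in> edges T \<Longrightarrow> (\<And>a y. (b, a) \<in> ttarget T \<Longrightarrow> (y, a) \<in> tsource T \<Longrightarrow> P y) \<Longrightarrow> P b"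
  shows "P b"
proof -
  have "b \<in> edges T \<longrightarrow> P b" if "x = Inr b" for x :: "'n + 'e" and b
    using that
  proof (induction x arbitrary: b rule: wf_induct[OF wf_trancl[OF wf_step]])
    case (1 x b)
    show ?case
    proof
      assume b: "b \<in> edges T"
      show "P b"
      proof (rule step[OF b])
        fix a y assume ay: "(b, a) \<in> ttarget T" "(y, a) \<in> tsource T"
        hence "(Inr y, x) \<in> (desc_step T)\<^sup>+" using 1(2)
          by (metis desc_step_iff(1,2) r_into_trancl trancl_into_trancl)
        thus "P y" using 1(1) ay source_mem by blast
      qed
    qed
  qed
  thus ?thesis using assms(1) by blast
qed

text \<open>Tops are the vertices with nothing above them. An exact constellation makes them
  correspond to the dots of the tree one degree below.\<close>

lemma tops_no_step: "t \<in> tops T \<Longrightarrow> (x, t) \<notin> desc_step T"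
  by (cases t; cases x) (auto simp: tops_def leaves_def null_dots_def)

lemma tops_maximal: "t \<in> tops T \<Longrightarrow> desc T x t \<Longrightarrow> x = t"
  using desc_lastE tops_no_step by metis

lemma tops_vertices: "t \<in> tops T \<Longrightarrow> t \<in> vertices T"
  by (auto simp: tops_def leaves_def null_dots_def)

lemma top_above:
  assumes "b \<in> edges T" shows "\<exists>t\<in>tops T. desc T t (Inr b)"
  using assms
proof (induction rule: edge_up_induct)
  case (1 b)
  show ?case
  proof (cases "b \<in> leaves T")
    case True
    thus ?thesis using 1(1) desc_refl[of "Inr b" T] by (auto simp: tops_def intro!: bexI[of _ "Inr b"])
  next
    case False
    then obtain a where a: "(b, a) \<in> ttarget T" using 1(1) by (auto simp: leaves_def)
    show ?thesis
    proof (cases "a \<in> null_dots T")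
      case True
      thus ?thesis using desc_target[OF a] by (auto simp: tops_def)
    next
      case False
      then obtain y where y: "(y, a) \<in> tsource T" using target_mem[OF a] by (auto simp: null_dots_def)
      thus ?thesis using 1(2)[OF a y] desc_target[OF a] desc_source[OF y] desc_trans by metis
    qed
  qed
qed

lemma desc_edge_cases:
  assumes "desc T x (Inr b)" "x \<in> tops T"
  shows "x = Inr b \<or> (\<exists>a. (b, a) \<in> ttarget T \<and> (x = Inl a \<or> (\<exists>y. (y, a) \<in> tsource T \<and> desc T x (Inr y))))"
    by (metis assms desc_lastE desc_step_InrE desc_step_InlE)

text \<open>The path from \<open>x\<close> to the root has a last vertex \<open>p\<close> to which
  \<open>x'\<close> does not descend; the next vertex \<open>v\<close> is reached by the path from
  \<open>x'\<close> through a different vertex. Only a node can be entered in two ways.\<close>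

lemma meet_ex:
  assumes "x \<in> vertices T" "x' \<in> vertices T" "\<not> desc T x x'" "\<not> desc T x' x"
  shows "\<exists>a y y'. (y, a) \<in> tsource T \<and> (y', a) \<in> tsource T \<and> y \<noteq> y' \<and> desc T x (Inr y) \<and> desc T x' (Inr y')"
proof -
  have "\<not> desc T x' r \<longrightarrow> (\<exists>p v. desc T x p \<and> (p, v) \<in> desc_step T \<and> \<not> desc T x' p \<and> desc T x' v)"
    if "desc T x r" "desc T r (Inr (root T))" for r
  proof -
    have "(r, Inr (root T)) \<in> (desc_step T)\<^sup>*" using that by (auto simp: desc_def)
    thus ?thesis using that(1)
    proof (induction rule: converse_rtrancl_induct)
      case base thus ?case using desc_root assms by auto
    next
      case (step y z)
      thus ?case using desc_step desc_trans by metis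
    qed
  qed
  from this[of x] obtain p v where pv: "desc T x p" "(p, v) \<in> desc_step T" "\<not> desc T x' p" "desc T x' v"
    using assms desc_refl desc_root by metis
  have "x' \<noteq> v" using pv assms desc_step desc_trans by metis
  then obtain p' where p': "desc T x' p'" "(p', v) \<in> desc_step T" using pv desc_lastE by metis
  have "p \<noteq> p'" using p' pv by auto
  show ?thesis
  proof (cases v)
    case (Inr b)
    thus ?thesis using pv p' upper_unique by (metis desc_step_InrE)
  next
    case (Inl a)
    thus ?thesis using pv p' by (metis desc_step_InlE)
  qed
qed

text \<open>The left-to-right order of two incomparable vertices, where \<open>R a\<close> compares the sources of
  the node \<open>a\<close> at which the two descending paths meet.\<close>

definition lex :: "('n \<Rightarrow> 'e \<Rightarrow> 'e \<Rightarrow> bool) \<Rightarrow> 'n + 'e \<Rightarrow> 'n + 'e \<Rightarrow> bool" where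
  "lex R t t' \<longleftrightarrow> (\<exists>a y y'. (y, a) \<in> tsource T \<and> (y', a) \<in> tsource T \<and> y \<noteq> y' \<and>
      desc T t (Inr y) \<and> desc T t' (Inr y') \<and> R a y y')"

text \<open>The nodes \<open>a\<close> and \<open>b\<close> both lie below \<open>t\<close>, hence
  on one path. If they differ, the paths from \<open>t\<close> and \<open>t'\<close> already run
  together when they reach the lower one, so they enter it through the same source.\<close>

lemma meet_unique:
  assumes "(y, a) \<in> tsource T" "(y', a) \<in> tsource T" "y \<noteq> y'" "desc T t (Inr y)" "desc T t' (Inr y')"
    and "(z, b) \<in> tsource T" "(z', b) \<in> tsource T" "z \<noteq> z'" "desc T t (Inr z)" "desc T t' (Inr z')"
  shows "a = b \<and> y = z \<and> y' = z'"
proof -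
  have *: False if "(y, a) \<in> tsource T" "(y', a) \<in> tsource T" "desc T t (Inr y)" "desc T t' (Inr y')"
    "(z, b) \<in> tsource T" "(z', b) \<in> tsource T" "z \<noteq> z'" "desc T t (Inr z)" "desc T t' (Inr z')"
    and m: "desc T (Inl a) (Inl b)" "a \<noteq> b" for y y' z z' a b
  proof -
    obtain z'' where z'': "(z'', b) \<in> tsource T" "desc T (Inl a) (Inr z'')"
      using m desc_lastE desc_step_InlE by (metis sum.inject(1))
    have "desc T t (Inr z'')" "desc T t' (Inr z'')"
      using z'' that(1-4) desc_source desc_trans by meson+
    thus False using sources_disjoint z'' that by metis
  qed
  have "desc T t (Inl a)" "desc T t (Inl b)" using assms desc_source desc_trans by meson+
  hence "desc T (Inl a) (Inl b) \<or> desc T (Inl b) (Inl a)" using desc_total by blast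
  hence "a = b" using * assms by metis
  thus ?thesis using assms sources_disjoint by metis
qed

lemma lex_irrefl: "\<not> lex R t t"
  unfolding lex_def using sources_disjoint by metis

lemma lexI:
  "(y, a) \<in> tsource T \<Longrightarrow> (y', a) \<in> tsource T \<Longrightarrow> y \<noteq> y' \<Longrightarrow> desc T t (Inr y) \<Longrightarrow>
   desc T t' (Inr y') \<Longrightarrow> R a y y' \<Longrightarrow> lex R t t'"
  unfolding lex_def by blast

lemma lex_meet:
  assumes "lex R t t'" "(y, a) \<in> tsource T" "(y', a) \<in> tsource T" "y \<noteq> y'" "desc T t (Inr y)" "desc T t' (Inr y')"
  shows "R a y y'"
  using assms meet_unique unfolding lex_def by metis

lemma lex_total:
  assumes X: "X \<subseteq> tops T" and t: "t \<in> X" "t' \<in> X" "t \<noteq> t'"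
    and tot: "\<And>a y y' t t'. (y, a) \<in> tsource T \<Longrightarrow> (y', a) \<in> tsource T \<Longrightarrow> y \<noteq> y' \<Longrightarrow>
       t \<in> X \<Longrightarrow> t' \<in> X \<Longrightarrow> desc T t (Inr y) \<Longrightarrow> desc T t' (Inr y') \<Longrightarrow> R a y y' \<or> R a y' y"
  shows "lex R t t' \<or> lex R t' t"
proof -
  have "t \<in> tops T" "t' \<in> tops T" using X t by auto
  hence "\<not> desc T t t'" "\<not> desc T t' t" "t \<in> vertices T" "t' \<in> vertices T"
    using t tops_maximal tops_vertices by blast+
  from meet_ex[OF this(3,4,1,2)] obtain a y y' where m: "(y, a) \<in> tsource T" "(y', a) \<in> tsource T" "y \<noteq> y'"
     "desc T t (Inr y)" "desc T t' (Inr y')" by blast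
  thus ?thesis using tot t unfolding lex_def by metis
qed

lemma lex_asym:
  assumes "\<And>a y y'. (y, a) \<in> tsource T \<Longrightarrow> (y', a) \<in> tsource T \<Longrightarrow> y \<noteq> y' \<Longrightarrow> R a y y' \<Longrightarrow> \<not> R a y' y"
  shows "lex R t t' \<Longrightarrow> \<not> lex R t' t" using lex_def assms lex_meet by blast

text \<open>Both meets lie below \<open>t2\<close>, so they are comparable. The lower one is also
  the meet of \<open>t1\<close> and \<open>t3\<close>; when they coincide, the transitivity of
  \<open>R\<close> at this node is used.\<close>

lemma lex_trans:
  assumes tr: "\<And>a y y' y''. (y, a) \<in> tsource T \<Longrightarrow> (y', a) \<in> tsource T \<Longrightarrow> (y'', a) \<in> tsource T \<Longrightarrow>
        y \<noteq> y' \<Longrightarrow> y' \<noteq> y'' \<Longrightarrow> R a y y' \<Longrightarrow> R a y' y'' \<Longrightarrow> y \<noteq> y'' \<and> R a y y''"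
    and l: "lex R t1 t2" "lex R t2 t3"
  shows "lex R t1 t3"
proof -
  obtain a y1 y2 where a: "(y1, a) \<in> tsource T" "(y2, a) \<in> tsource T" "y1 \<noteq> y2"
     "desc T t1 (Inr y1)" "desc T t2 (Inr y2)" "R a y1 y2" using l unfolding lex_def by blast
  obtain b z2 z3 where b: "(z2, b) \<in> tsource T" "(z3, b) \<in> tsource T" "z2 \<noteq> z3"
     "desc T t2 (Inr z2)" "desc T t3 (Inr z3)" "R b z2 z3" using l unfolding lex_def by blast
  have "desc T t2 (Inl a)" "desc T t2 (Inl b)" using a b desc_source desc_trans by meson+
  then consider "a = b" | "a \<noteq> b" "desc T (Inl a) (Inl b)" | "a \<noteq> b" "desc T (Inl b) (Inl a)"
    using desc_total by blast
  thus ?thesis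
  proof cases
    case 1
    hence "y2 = z2" using a b sources_disjoint by metis
    thus ?thesis using tr[of y1 a y2 z3] a b 1 unfolding lex_def by metis
  next
    case 2
    obtain z where z: "(z, b) \<in> tsource T" "desc T (Inl a) (Inr z)"
      using 2 desc_lastE desc_step_InlE by (metis sum.inject(1))
    hence "desc T t2 (Inr z)" "desc T t1 (Inr z)" using a desc_source desc_trans by meson+
    hence "z = z2" using z b sources_disjoint by metis
    thus ?thesis using b \<open>desc T t1 (Inr z)\<close> unfolding lex_def by metis
  next
    case 3
    obtain z where z: "(z, a) \<in> tsource T" "desc T (Inl b) (Inr z)"
      using 3 desc_lastE desc_step_InlE by (metis sum.inject(1))
    hence "desc T t2 (Inr z)" "desc T t3 (Inr z)" using b desc_source desc_trans by meson+
    hence "z = y2" using z a sources_disjoint by metis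
    thus ?thesis using a \<open>desc T t3 (Inr z)\<close> unfolding lex_def by metis
  qed
qed

text \<open>If \<open>t2\<close> avoids \<open>x\<close>, then \<open>x\<close> descends to the
  branch \<open>y1\<close> through which \<open>t1\<close> meets \<open>t2\<close>. So
  \<open>t3\<close> comes through \<open>y1\<close> as well and meets \<open>t2\<close> at the same
  node from the same side, against asymmetry.\<close>

lemma lex_convex:
  assumes tops: "t1 \<in> tops T" "t2 \<in> tops T"
    and asym: "\<And>a y y'. (y, a) \<in> tsource T \<Longrightarrow> (y', a) \<in> tsource T \<Longrightarrow> y \<noteq> y' \<Longrightarrow> R a y y' \<Longrightarrow> \<not> R a y' y"
    and l: "lex R t1 t2" "lex R t2 t3" and d: "desc T t1 (Inr x)" "desc T t3 (Inr x)"
  shows "desc T t2 (Inr x)"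
proof (rule ccontr)
  assume n: "\<not> desc T t2 (Inr x)"
  obtain a y1 y2 where a: "(y1, a) \<in> tsource T" "(y2, a) \<in> tsource T" "y1 \<noteq> y2"
     "desc T t1 (Inr y1)" "desc T t2 (Inr y2)" "R a y1 y2" using l unfolding lex_def by blast
  have "desc T (Inr x) (Inr y1)"
  proof (rule ccontr)
    assume "\<not> ?thesis"
    hence "desc T (Inr y1) (Inr x)" "y1 \<noteq> x" using desc_total a d by metis+
    hence "desc T (Inl a) (Inr x)" using desc_through_step a by (metis desc_step_iff(2) sum.inject(2))
    thus False using n a desc_source desc_trans by meson
  qed
  hence "desc T t3 (Inr y1)" using d desc_trans by meson
  thus False using lex_meet[OF l(2) a(2) a(1)] a asym by metis
qed

end

section \<open>Connected sets of dots\<close>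

text \<open>The order along the string of \<open>c\<close>, starting at the root end. It takes the
  place of the segments \<open>(c, Some w)\<close> of \<open>subdivide\<close> in what
  follows.\<close>

definition string_less :: "('n, 'e) rtree \<Rightarrow> ('e, 'w) subdiv \<Rightarrow> 'e \<Rightarrow> 'n + 'w \<Rightarrow> 'n + 'w \<Rightarrow> bool" where
  "string_less T W c d d' \<longleftrightarrow>
     (case d of
        Inl l \<Rightarrow> (c, l) \<in> tsource T \<and>
          (case d' of Inl u \<Rightarrow> (c, u) \<in> ttarget T | Inr w \<Rightarrow> w \<in> wset W c)
      | Inr w \<Rightarrow> w \<in> wset W c \<and>
          (case d' of Inl u \<Rightarrow> (c, u) \<in> ttarget T | Inr w' \<Rightarrow> (w, w') \<in> wless W c))"

lemma string_less_simps [simp]: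
  "string_less T W c (Inl l) (Inl u) \<longleftrightarrow> (c, l) \<in> tsource T \<and> (c, u) \<in> ttarget T"
  "string_less T W c (Inl l) (Inr w) \<longleftrightarrow> (c, l) \<in> tsource T \<and> w \<in> wset W c"
  "string_less T W c (Inr w) (Inl u) \<longleftrightarrow> w \<in> wset W c \<and> (c, u) \<in> ttarget T"
  "string_less T W c (Inr w) (Inr w') \<longleftrightarrow> w \<in> wset W c \<and> (w, w') \<in> wless W c"
  by (auto simp: string_less_def)

text \<open>\<open>c\<close> is the edge that a descending path meets directly below the dot
  \<open>d\<close>: the string of \<open>c\<close> contains \<open>d\<close>, but not as its lower
  node.\<close>

definition carried :: "('n, 'e) rtree \<Rightarrow> ('e, 'w) subdiv \<Rightarrow> 'n + 'w \<Rightarrow> 'e \<Rightarrow> bool" where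
  "carried T W d c \<longleftrightarrow>
     (case d of Inl a \<Rightarrow> (c, a) \<in> ttarget T | Inr w \<Rightarrow> c \<in> edges T \<and> w \<in> wset W c)"

lemma carried_simps [simp]:
  "carried T W (Inl a) c \<longleftrightarrow> (c, a) \<in> ttarget T"
  "carried T W (Inr w) c \<longleftrightarrow> c \<in> edges T \<and> w \<in> wset W c"
  by (auto simp: carried_def)

text \<open>The next dot towards the root. Adjacency in the subdivided tree is the symmetric version
  of this relation, and a connected set turns out to be one with at most one
  \<open>bottom\<close>.\<close>

definition parent :: "('n, 'e) rtree \<Rightarrow> ('e, 'w) subdiv \<Rightarrow> 'n + 'w \<Rightarrow> 'n + 'w \<Rightarrow> bool" where
  "parent T W d d' \<longleftrightarrow> (\<exists>e. (e, d) \<in> ttarget (subdivide T W) \<and> (e, d') \<in> tsource (subdivide T W))"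

lemma adjacent_subdivide:
  "adjacent_nodes (subdivide T W) u v \<longleftrightarrow> parent T W u v \<or> parent T W v u"
  by (auto simp: adjacent_nodes_def parent_def)

definition bottom :: "('n, 'e) rtree \<Rightarrow> ('e, 'w) subdiv \<Rightarrow> ('n + 'w) set \<Rightarrow> 'n + 'w \<Rightarrow> bool" where
  "bottom T W D d \<longleftrightarrow> d \<in> D \<and> (\<forall>d'. parent T W d d' \<longrightarrow> d' \<notin> D)"

lemma finite_linear_max:
  assumes "finite S" "S \<noteq> {}" "trans r" "\<And>x y. x \<in> S \<Longrightarrow> y \<in> S \<Longrightarrow> x \<noteq> y \<Longrightarrow> (x, y) \<in> r \<or> (y, x) \<in> r"
  shows "\<exists>m\<in>S. \<forall>s\<in>S. s \<noteq> m \<longrightarrow> (s, m) \<in> r"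
  using assms(1,2,4)
proof (induction S rule: finite_ne_induct)
  case (singleton x) thus ?case by simp
next
  case (insert x F)
  then obtain m where m: "m \<in> F" "\<forall>s\<in>F. s \<noteq> m \<longrightarrow> (s, m) \<in> r" by auto
  show ?case
  proof (cases "(x, m) \<in> r")
    case True thus ?thesis using m by auto
  next
    case False
    hence mx: "(m, x) \<in> r" using insert m by auto
    have "\<forall>s\<in>F. (s, x) \<in> r" using m mx \<open>trans r\<close> by (metis transD)
    thus ?thesis by auto
  qed
qed

locale stree = tree T for T :: "('n, 'e) rtree" +
  fixes W :: "('e, 'w) subdiv"
  assumes subdivision: "is_subdivision T W"
begin

lemma finite_wset: "c \<in> edges T \<Longrightarrow> finite (wset W c)"
  and wless_mem: "c \<in> edges T \<Longrightarrow> (w, w') \<in> wless W c \<Longrightarrow> w \<in> wset W c \<and> w' \<in> wset W c"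
  and wless_linear: "c \<in> edges T \<Longrightarrow> strict_linear_order_on (wset W c) (wless W c)"
  and wset_disjoint: "c \<in> edges T \<Longrightarrow> c' \<in> edges T \<Longrightarrow> w \<in> wset W c \<Longrightarrow> w \<in> wset W c' \<Longrightarrow> c = c'"
  using subdivision unfolding is_subdivision_def by blast+

lemma wless_irrefl: "c \<in> edges T \<Longrightarrow> (w, w) \<notin> wless W c"
  and wless_trans: "c \<in> edges T \<Longrightarrow> trans (wless W c)"
  and wless_total: "c \<in> edges T \<Longrightarrow> w \<in> wset W c \<Longrightarrow> w' \<in> wset W c \<Longrightarrow> w \<noteq> w' \<Longrightarrow>
      (w, w') \<in> wless W c \<or> (w', w) \<in> wless W c"
  using wless_linear unfolding strict_linear_order_on_def irrefl_def total_on_def by blast+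

text \<open>A nonempty finite subset of a strict linear order has exactly one greatest element, so
  the definite description in \<open>greatest_opt\<close> is meaningful.\<close>

lemma greatest_opt_eq:
  assumes c: "c \<in> edges T" and S: "S \<subseteq> wset W c"
  shows "greatest_opt (wless W c) S = None \<longleftrightarrow> S = {}"
    and "greatest_opt (wless W c) S = Some m \<longleftrightarrow> m \<in> S \<and> (\<forall>s\<in>S. s \<noteq> m \<longrightarrow> (s, m) \<in> wless W c)"
proof -
  show "greatest_opt (wless W c) S = None \<longleftrightarrow> S = {}" by (auto simp: greatest_opt_def)
  let ?P = "\<lambda>m. m \<in> S \<and> (\<forall>s\<in>S. s \<noteq> m \<longrightarrow> (s, m) \<in> wless W c)"
  have uniq: "m = m'" if "?P m" "?P m'" for m m'
    using that wless_irrefl[OF c] wless_trans[OF c] by (metis transD)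
  show "greatest_opt (wless W c) S = Some m \<longleftrightarrow> ?P m"
  proof (cases "S = {}")
    case False
    have "\<exists>m\<in>S. \<forall>s\<in>S. s \<noteq> m \<longrightarrow> (s, m) \<in> wless W c"
    proof (rule finite_linear_max)
      show "finite S" using finite_wset[OF c] S finite_subset by blast
      show "(x, y) \<in> wless W c \<or> (y, x) \<in> wless W c" if "x \<in> S" "y \<in> S" "x \<noteq> y" for x y
        using that wless_total[OF c] S by blast
    qed (use False wless_trans[OF c] in auto)
    then obtain m' where m': "?P m'" by blast
    have "(THE m. ?P m) = m'" by (rule the_equality, rule m', rule uniq[OF _ m'])
    hence "greatest_opt (wless W c) S = Some m'" using False by (simp add: greatest_opt_def)
    thus ?thesis using m' uniq by auto
  qed (auto simp: greatest_opt_def)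
qed

text \<open>The segment under a dot lies directly above the highest white dot that precedes the dot
  on its string, or at the root end if none precedes it. Stated with \<open>string_less\<close>,
  this holds for black and white dots alike.\<close>

lemma lower_whites:
  assumes "carried T W d c"
  shows "(e, d) \<in> ttarget (subdivide T W) \<longleftrightarrow>
    e = (c, greatest_opt (wless W c) {w. w \<in> wset W c \<and> string_less T W c (Inr w) d})"
proof (cases d)
  case (Inl a)
  have *: "{w. w \<in> wset W c \<and> string_less T W c (Inr w) d} = wset W c"
    using assms Inl by auto
  show ?thesis unfolding * using assms Inl target_unique by (auto simp: subdivide_def)
next
  case (Inr v)
  have *: "{w. w \<in> wset W c \<and> string_less T W c (Inr w) d} = {w. (w, v) \<in> wless W c}"
    using assms Inr wless_mem by auto
  show ?thesis unfolding * using assms Inr wset_disjoint by (auto simp: subdivide_def)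
qed

lemma carried_mem: "carried T W d c \<Longrightarrow> c \<in> edges T"
  using target_mem by (cases d) auto

lemma carried_unique: "carried T W d c \<Longrightarrow> carried T W d c' \<Longrightarrow> c = c'"
  using target_unique wset_disjoint by (cases d) auto

lemma string_less_carried: "c \<in> edges T \<Longrightarrow> string_less T W c d d' \<Longrightarrow> carried T W d' c"
  by (cases d; cases d') (auto dest: wless_mem)

lemma string_less_irrefl: "c \<in> edges T \<Longrightarrow> \<not> string_less T W c d d"
proof (cases d)
  case (Inl a)
  thus ?thesis using no_back_step[of "Inl a" "Inr c"] desc_source[of c a] by auto
qed (use wless_irrefl in auto)

lemma string_less_trans:
  "c \<in> edges T \<Longrightarrow> string_less T W c d d' \<Longrightarrow> string_less T W c d' d'' \<Longrightarrow> string_less T W c d d''"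
proof -
  have F: False if "(c, a) \<in> tsource T" "(c, a) \<in> ttarget T" for a
    using that no_back_step[of "Inl a" "Inr c"] desc_source by auto
  assume c: "c \<in> edges T" and s: "string_less T W c d d'" "string_less T W c d' d''"
  have tr: "(x, y) \<in> wless W c \<Longrightarrow> (y, z) \<in> wless W c \<Longrightarrow> (x, z) \<in> wless W c" for x y z
    using transD[OF wless_trans[OF c]] .
  show ?thesis
  proof (cases d')
    case (Inl a)
    have "\<not> ((c, a) \<in> tsource T \<and> (c, a) \<in> ttarget T)" using F by blast
    thus ?thesis using s Inl by (cases d; cases d'') simp_all
  next
    case (Inr w)
    thus ?thesis using s by (cases d; cases d'') (auto intro: tr dest: wless_mem[OF c])
  qed
qed

lemma string_less_asym: "c \<in> edges T \<Longrightarrow> string_less T W c d d' \<Longrightarrow> \<not> string_less T W c d' d"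
  using string_less_trans[of c d d' d] string_less_irrefl by blast

text \<open>The parent is the immediate predecessor on the string. This removes the segments of
  \<open>subdivide\<close> from the later proofs.\<close>

lemma parent_iff:
  "parent T W d d' \<longleftrightarrow> (\<exists>c\<in>edges T. string_less T W c d' d \<and>
      (\<forall>d''. string_less T W c d'' d \<longrightarrow> d'' = d' \<or> string_less T W c d'' d'))"
  (is "?L \<longleftrightarrow> (\<exists>c\<in>edges T. ?R c)")
proof
  assume ?L
  then obtain e where e: "(e, d) \<in> ttarget (subdivide T W)" "(e, d') \<in> tsource (subdivide T W)"
    by (auto simp: parent_def)
  obtain c where c: "carried T W d c"
    using e(1) by (cases d) (auto simp: subdivide_def)
  let ?S = "{w. w \<in> wset W c \<and> string_less T W c (Inr w) d}"
  have ec: "e = (c, greatest_opt (wless W c) ?S)" using lower_whites[OF c] e by blast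
  have cE: "c \<in> edges T" using c by (rule carried_mem)
  show "\<exists>c\<in>edges T. ?R c"
  proof (rule bexI[OF _ cE])
    show "?R c"
    proof (cases d')
      case (Inl l)
      hence l: "(c, l) \<in> tsource T" and n: "greatest_opt (wless W c) ?S = None"
        using e(2) ec by (auto simp: subdivide_def)
      have "?S \<subseteq> wset W c" by auto
      from greatest_opt_eq(1)[OF cE this] n have S: "?S = {}" by blast
      have "string_less T W c (Inl l) d" using l c by (cases d) auto
      moreover have "d'' = Inl l" if "string_less T W c d'' d" for d''
      proof (cases d'')
        case (Inl l')
        hence "(c, l') \<in> tsource T" using that by (auto simp: string_less_def)
        thus ?thesis using Inl l lower_unique by blast
      next
        case (Inr w)
        hence "w \<in> ?S" using that by (auto simp: string_less_def)
        thus ?thesis using S by blast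
      qed
      ultimately show ?thesis using Inl by blast
    next
      case (Inr w)
      then obtain b where b: "e = (b, Some w)" "w \<in> wset W b"
        using e(2) by (auto simp: subdivide_def)
      have "(b, Some w) = (c, greatest_opt (wless W c) ?S)" using b(1) ec by (rule trans[OF sym])
      hence bc: "b = c" and n: "greatest_opt (wless W c) ?S = Some w"
        by (blast elim: Pair_inject intro: sym)+
      have "?S \<subseteq> wset W c" by auto
      note mm = greatest_opt_eq(2)[OF cE this, THEN iffD1, OF n]
      note m = mm[THEN conjunct1] mm[THEN conjunct2]
      have "d'' = Inr w \<or> string_less T W c d'' (Inr w)" if "string_less T W c d'' d" for d''
        using m that by (cases d'') (auto simp: string_less_def)
      thus ?thesis using Inr m by blast
    qed
  qed
next
  assume "\<exists>c\<in>edges T. ?R c"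
  then obtain c where cE: "c \<in> edges T" and R: "?R c" by blast
  hence c: "carried T W d c" using string_less_carried by blast
  let ?S = "{w. w \<in> wset W c \<and> string_less T W c (Inr w) d}"
  have "((c, greatest_opt (wless W c) ?S), d') \<in> tsource (subdivide T W)"
  proof (cases d')
    case (Inl l)
    have "?S = {}"
    proof (rule ccontr)
      assume "?S \<noteq> {}"
      then obtain w where "w \<in> wset W c" "string_less T W c (Inr w) d" by auto
      hence "string_less T W c (Inr w) (Inl l)" using R Inl by blast
      moreover have "(c, l) \<in> tsource T" using R Inl by (auto simp: string_less_def)
      ultimately show False using no_back_step[of "Inl l" "Inr c"] desc_source by auto
    qed
    hence "greatest_opt (wless W c) ?S = None" by (simp add: greatest_opt_def)
    moreover have "(c, l) \<in> tsource T" using R Inl by (auto simp: string_less_def)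
    ultimately show ?thesis using Inl by (auto simp: subdivide_def)
  next
    case (Inr w)
    have w: "w \<in> wset W c" using R Inr by (auto simp: string_less_def)
    have "?S \<subseteq> wset W c" by auto
    moreover have "w \<in> ?S" using R Inr w by blast
    moreover have "\<forall>s\<in>?S. s \<noteq> w \<longrightarrow> (s, w) \<in> wless W c" using R Inr by auto
    ultimately have "greatest_opt (wless W c) ?S = Some w"
      using greatest_opt_eq(2)[OF cE] by blast
    thus ?thesis using Inr w cE by (auto simp: subdivide_def)
  qed
  thus ?L unfolding parent_def using lower_whites[OF c] by blast
qed

lemma parent_unique:
  assumes "parent T W d d1" "parent T W d d2" shows "d1 = d2"
    by (metis assms parent_iff carried_unique string_less_carried string_less_asym)

definition lower :: "'e \<Rightarrow> 'n + 'w \<Rightarrow> ('n + 'w) set" where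
  "lower c d = {d'. string_less T W c d' d}"

lemma finite_lower: "c \<in> edges T \<Longrightarrow> finite (lower c d)"
proof -
  assume c: "c \<in> edges T"
  have "d' \<in> Inl ` nodes T \<union> Inr ` wset W c" if "string_less T W c d' d" for d'
  proof (cases d')
    case (Inl l)
    hence "(c, l) \<in> tsource T" using that by (auto simp: string_less_def)
    thus ?thesis using source_mem Inl by blast
  next
    case (Inr w)
    thus ?thesis using that by (auto simp: string_less_def)
  qed
  hence "lower c d \<subseteq> Inl ` nodes T \<union> Inr ` wset W c" by (auto simp: lower_def)
  thus ?thesis using finite_nodes finite_wset[OF c] by (meson finite_Un finite_imageI finite_subset)
qed

lemma string_total:
  assumes "c \<in> edges T" "string_less T W c d1 d" "string_less T W c d2 d"
  shows "d1 = d2 \<or> string_less T W c d1 d2 \<or> string_less T W c d2 d1"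
  using assms by (cases d1; cases d2)
    (auto simp: string_less_def dest: lower_unique wless_total[OF assms(1)])

lemma parent_ex:
  assumes c: "c \<in> edges T" and d: "string_less T W c d' d"
  shows "\<exists>d1. parent T W d d1 \<and> (d1 = d' \<or> string_less T W c d' d1)"
proof -
  let ?r = "{(x, y). string_less T W c x y}"
  have "\<exists>m\<in>lower c d. \<forall>s\<in>lower c d. s \<noteq> m \<longrightarrow> (s, m) \<in> ?r"
  proof (rule finite_linear_max)
    show "finite (lower c d)" by (rule finite_lower[OF c])
    show "lower c d \<noteq> {}" using d by (auto simp: lower_def)
    show "trans ?r" by (rule transI) (auto intro: string_less_trans[OF c])
    show "(x, y) \<in> ?r \<or> (y, x) \<in> ?r" if "x \<in> lower c d" "y \<in> lower c d" "x \<noteq> y" for x y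
      using that string_total[OF c] by (auto simp: lower_def)
  qed
  then obtain m where m: "m \<in> lower c d" "\<forall>s\<in>lower c d. s \<noteq> m \<longrightarrow> string_less T W c s m" by auto
  hence "parent T W d m" unfolding parent_iff using c by (auto simp: lower_def)
  thus ?thesis using m d by (auto simp: lower_def)
qed

definition carrier :: "'n + 'w \<Rightarrow> 'e" where
  "carrier d = (THE c. carried T W d c)"

lemma carrier_eq: "carried T W d c \<Longrightarrow> carrier d = c"
  unfolding carrier_def using carried_unique by blast

text \<open>Passing to the parent either moves to a carrying edge further down the tree (black
  parent), or keeps the edge and leaves fewer dots below on its string (white parent).\<close>

lemma parent_wf: "wf {(d', d). parent T W d d'}"
proof (rule wf_subset)
  let ?m = "\<lambda>d. (Inr (carrier d), card (lower (carrier d) d))"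
  show "wf (inv_image (((desc_step T)\<inverse>)\<^sup>+ <*lex*> less_than) ?m)"
    using wf_step_converse by (intro wf_inv_image wf_lex_prod wf_trancl) auto
  show "{(d', d). parent T W d d'} \<subseteq> inv_image (((desc_step T)\<inverse>)\<^sup>+ <*lex*> less_than) ?m"
  proof clarify
    fix d d' assume "parent T W d d'"
    then obtain c where c: "c \<in> edges T" "string_less T W c d' d" unfolding parent_iff by blast
    hence cd: "carrier d = c" using string_less_carried carrier_eq by blast
    show "(d', d) \<in> inv_image (((desc_step T)\<inverse>)\<^sup>+ <*lex*> less_than) ?m"
    proof (cases d')
      case (Inl l)
      hence l: "(c, l) \<in> tsource T" using c by (auto simp: string_less_def)
      then obtain e where e: "(e, l) \<in> ttarget T" using source_mem target_ex by blast
      hence "carrier d' = e" using Inl carrier_eq by auto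
      moreover have "(Inr c, Inr e) \<in> (desc_step T)\<^sup>+"
        using l e by (metis desc_step_iff(1,2) r_into_trancl trancl_into_trancl)
      ultimately show ?thesis using cd by (simp add: trancl_converse)
    next
      case (Inr w)
      hence "carried T W d' c" using c by (auto simp: string_less_def)
      hence cd': "carrier d' = c" by (rule carrier_eq)
      have "lower c d' \<subseteq> lower c d" "d' \<in> lower c d" "d' \<notin> lower c d'"
        using c(2) string_less_trans[OF c(1) _ c(2)] string_less_irrefl[OF c(1)] by (auto simp: lower_def)
      hence "lower c d' \<subset> lower c d" by blast
      hence "card (lower c d') < card (lower c d)" using finite_lower[OF c(1)] psubset_card_mono by blast
      thus ?thesis using cd cd' by simp
    qed
  qed
qed

definition below :: "('n + 'w) rel" where
  "below = {(d, d'). parent T W d d'}\<^sup>*"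

lemma below_antisym: "(d, d') \<in> below \<Longrightarrow> (d', d) \<in> below \<Longrightarrow> d = d'"
  using wf_acyclic parent_wf below_def acyclic_impl_antisym_rtrancl antisymD by fastforce

lemma string_below:
  assumes c: "c \<in> edges T" and s: "string_less T W c d' d" shows "(d, d') \<in> below"
  using s
proof (induction d rule: wf_induct_rule[OF parent_wf])
  case (1 d)
  obtain d1 where d1: "parent T W d d1" "d1 = d' \<or> string_less T W c d' d1" using parent_ex[OF c 1(2)] by blast
  hence "(d1, d') \<in> below" using 1(1) by (auto simp: below_def)
  thus ?case using d1(1) unfolding below_def by (simp add: converse_rtrancl_into_rtrancl)
qed

text \<open>Parents are unique. So along any path of \<open>D\<close> that starts at the bottom
  \<open>d\<close>, every dot reached can still descend to \<open>d\<close> inside \<open>D\<close>;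
  a second bottom can do so only if it is \<open>d\<close>.\<close>

lemma connected_bottom_unique:
  assumes con: "induces_connected (subdivide T W) D" and b: "bottom T W D d" "bottom T W D d'"
  shows "d = d'"
proof -
  have path: "(d, d') \<in> {(u, v). u \<in> D \<and> v \<in> D \<and> adjacent_nodes (subdivide T W) u v}\<^sup>*"
    using con b unfolding induces_connected_def bottom_def by blast
  let ?r = "{(u, v). u \<in> D \<and> v \<in> D \<and> parent T W u v}"
  have "(e, d) \<in> ?r\<^sup>*" if "(d, e) \<in> {(u, v). u \<in> D \<and> v \<in> D \<and> adjacent_nodes (subdivide T W) u v}\<^sup>*" for e
    using that
  proof induction
    case base thus ?case by simp
  next
    case (step u v)
    from step.hyps(2) have uv: "u \<in> D" "v \<in> D" "parent T W u v \<or> parent T W v u"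
      by (auto simp: adjacent_subdivide)
    show ?case
    proof (cases "parent T W v u")
      case True
      thus ?thesis using step.IH uv by (auto intro: converse_rtrancl_into_rtrancl)
    next
      case False
      hence p: "parent T W u v" using uv by blast
      hence "u \<noteq> d" using b uv by (auto simp: bottom_def)
      then obtain x where x: "(u, x) \<in> ?r" "(x, d) \<in> ?r\<^sup>*"
        using step.IH by (blast elim: converse_rtranclE)
      hence "x = v" using parent_unique[OF _ p] by blast
      thus ?thesis using x by blast
    qed
  qed
  from this[OF path] show ?thesis using b by (auto simp: bottom_def elim: converse_rtranclE)
qed

text \<open>A path that starts above \<open>d2\<close> and avoids \<open>d2\<close> stays above it,
  because the only way down from a dot is to its parent. Hence it cannot reach \<open>d1\<close>,
  which is below \<open>d2\<close>.\<close>

lemma connected_convex: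
  assumes con: "induces_connected (subdivide T W) D" and d: "d1 \<in> D" "d3 \<in> D"
    and c: "c \<in> edges T" and s: "string_less T W c d1 d2" "string_less T W c d2 d3"
  shows "d2 \<in> D"
proof (rule ccontr)
  assume n: "d2 \<notin> D"
  have path: "(d3, d1) \<in> {(u, v). u \<in> D \<and> v \<in> D \<and> adjacent_nodes (subdivide T W) u v}\<^sup>*"
    using con d unfolding induces_connected_def by blast
  have "(e, d2) \<in> below" if "(d3, e) \<in> {(u, v). u \<in> D \<and> v \<in> D \<and> adjacent_nodes (subdivide T W) u v}\<^sup>*" for e
    using that
  proof induction
    case base thus ?case using string_below[OF c s(2)] .
  next
    case (step u v)
    from step.hyps(2) have uv: "u \<in> D" "v \<in> D" "parent T W u v \<or> parent T W v u"
      by (auto simp: adjacent_subdivide)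
    show ?case
    proof (cases "parent T W v u")
      case True
      thus ?thesis using step.IH by (auto simp: below_def intro: converse_rtrancl_into_rtrancl)
    next
      case False
      hence p: "parent T W u v" using uv by blast
      have "u \<noteq> d2" using n uv by auto
      then obtain x where x: "parent T W u x" "(x, d2) \<in> below"
        using step.IH unfolding below_def by (blast elim: converse_rtranclE)
      hence "x = v" using parent_unique[OF _ p] by blast
      thus ?thesis using x by blast
    qed
  qed
  from this[OF path] have "(d1, d2) \<in> below" .
  hence "d1 = d2" using string_below[OF c s(1)] below_antisym by blast
  thus False using s string_less_irrefl c by blast
qed

lemma bottom_below:
  assumes "d \<in> D"
  shows "\<exists>b. bottom T W D b \<and> (d, b) \<in> {(u, v). u \<in> D \<and> v \<in> D \<and> parent T W u v}\<^sup>*"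
  using assms
proof (induction d rule: wf_induct_rule[OF parent_wf])
  case (1 d)
  show ?case
  proof (cases "bottom T W D d")
    case False
    then obtain d' where "parent T W d d'" "d' \<in> D" using 1(2) by (auto simp: bottom_def)
    thus ?thesis using 1 by (force intro: converse_rtrancl_into_rtrancl)
  qed auto
qed

text \<open>Every dot of \<open>D\<close> descends inside \<open>D\<close> to some bottom, and two
  such descents to the same bottom form a connecting path.\<close>

lemma connectedI:
  assumes uniq: "\<And>d d'. bottom T W D d \<Longrightarrow> bottom T W D d' \<Longrightarrow> d = d'"
  shows "induces_connected (subdivide T W) D"
  unfolding induces_connected_def
proof (intro ballI)
  fix a a' assume a: "a \<in> D" "a' \<in> D"
  let ?p = "{(u, v). u \<in> D \<and> v \<in> D \<and> parent T W u v}"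
  let ?r = "{(u, v). u \<in> D \<and> v \<in> D \<and> adjacent_nodes (subdivide T W) u v}"
  have sub: "?p \<subseteq> ?r" "?p\<inverse> \<subseteq> ?r" by (auto simp: adjacent_subdivide)
  obtain b where b: "bottom T W D b" "(a, b) \<in> ?p\<^sup>*" using bottom_below[OF a(1)] by blast
  obtain b' where b': "bottom T W D b'" "(a', b') \<in> ?p\<^sup>*" using bottom_below[OF a(2)] by blast
  have "(a', b) \<in> ?p\<^sup>*" using b'(2) uniq[OF b'(1) b(1)] by simp
  note b = b(2) this
  have "(a, b) \<in> ?r\<^sup>*" using b(1) rtrancl_mono[OF sub(1)] by blast
  moreover have "(b, a') \<in> (?p\<inverse>)\<^sup>*" using b(2) by (rule rtrancl_converseI)
  hence "(b, a') \<in> ?r\<^sup>*" using rtrancl_mono[OF sub(2)] by blast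
  ultimately show "(a, a') \<in> ?r\<^sup>*" by (rule rtrancl_trans)
qed

text \<open>A descent inside \<open>D\<close> that starts on the string of \<open>c\<close> can
  leave it only through the lower node, which is not in \<open>D\<close>; so it stops at a dot
  carried by \<open>c\<close>.\<close>

lemma bottom_on_edge:
  assumes d: "d \<in> D" "carried T W d c" and l: "\<And>l. (c, l) \<in> tsource T \<Longrightarrow> Inl l \<notin> D"
  shows "\<exists>b. bottom T W D b \<and> carried T W b c"
  using d
proof (induction d rule: wf_induct_rule[OF parent_wf])
  case (1 d)
  show ?case
  proof (cases "bottom T W D d")
    case True thus ?thesis using 1 by blast
  next
    case False
    then obtain d' where d': "parent T W d d'" "d' \<in> D" using 1 by (auto simp: bottom_def)
    then obtain c' where c': "c' \<in> edges T" "string_less T W c' d' d" unfolding parent_iff by blast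
    hence "c' = c" using string_less_carried 1(3) carried_unique by blast
    hence "carried T W d' c" using c' l d' by (cases d') (auto simp: string_less_def)
    thus ?thesis using 1(1) d' by auto
  qed
qed

end

section \<open>Subtrees on connected sets of dots\<close>

definition upper_in :: "('n, 'e) rtree \<Rightarrow> ('n + 'w) set \<Rightarrow> 'e \<Rightarrow> bool" where
  "upper_in T D c \<longleftrightarrow> (\<exists>u. (c, u) \<in> ttarget T \<and> Inl u \<in> D)"

definition lower_in :: "('n, 'e) rtree \<Rightarrow> ('n + 'w) set \<Rightarrow> 'e \<Rightarrow> bool" where
  "lower_in T D c \<longleftrightarrow> (\<exists>l. (c, l) \<in> tsource T \<and> Inl l \<in> D)"

text \<open>Read in descending direction: a path enters the part \<open>D\<close> of the tree
  through its leaf edges and leaves it through its root edge, so the name \<open>leaves_at\<close>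
  contains a verb and is unrelated to \<open>leaves\<close>. The two cases give the signs - and
  +.\<close>

definition enters :: "('n, 'e) rtree \<Rightarrow> ('n + 'w) set \<Rightarrow> 'e \<Rightarrow> bool" where
  "enters T D c \<longleftrightarrow> lower_in T D c \<and> \<not> upper_in T D c"

definition leaves_at :: "('n, 'e) rtree \<Rightarrow> ('n + 'w) set \<Rightarrow> 'e \<Rightarrow> bool" where
  "leaves_at T D c \<longleftrightarrow> upper_in T D c \<and> \<not> lower_in T D c"

context stree
begin

lemma upper_in_mem: "upper_in T D c \<Longrightarrow> c \<in> edges T"
  and lower_in_mem: "lower_in T D c \<Longrightarrow> c \<in> edges T"
  using source_mem target_mem by (auto simp: upper_in_def lower_in_def)

text \<open>Otherwise the parent of \<open>b\<close> is the lower node of \<open>c\<close> or lies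
  on the string between that node and \<open>b\<close>, hence in \<open>D\<close> by
  convexity.\<close>

lemma bottom_no_lower:
  assumes con: "induces_connected (subdivide T W) D" and b: "bottom T W D b" "carried T W b c"
  shows "\<not> lower_in T D c"
proof
  assume "lower_in T D c"
  then obtain l where l: "(c, l) \<in> tsource T" "Inl l \<in> D" by (auto simp: lower_in_def)
  have c: "c \<in> edges T" using carried_mem b by blast
  have s: "string_less T W c (Inl l) b" using b(2) l by (cases b) auto
  obtain d where d: "parent T W b d" "d = Inl l \<or> string_less T W c (Inl l) d"
    using parent_ex[OF c s] by blast
  obtain c' where c': "c' \<in> edges T" "string_less T W c' d b" using d(1) unfolding parent_iff by blast
  hence "c' = c" using string_less_carried b carried_unique by blast
  hence "d \<in> D" using d(2) l connected_convex[OF con l(2) _ c _ ] b c' by (auto simp: bottom_def)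
  thus False using d b by (auto simp: bottom_def)
qed

lemma leaves_at_ex:
  assumes con: "induces_connected (subdivide T W) D" and a: "Inl a \<in> D" "D \<subseteq> dots T W"
  shows "\<exists>c. leaves_at T D c"
proof -
  obtain b where b: "bottom T W D b" "(Inl a, b) \<in> {(u, v). u \<in> D \<and> v \<in> D \<and> parent T W u v}\<^sup>*"
    using bottom_below[OF a(1)] by blast
  have "\<exists>c. carried T W b c"
    using b(1) a(2) target_ex by (cases b) (auto simp: bottom_def dots_def white_dots_def)
  then obtain c where c: "carried T W b c" by blast
  \<comment> \<open>Upwards from the bottom \<open>b\<close>, dots stay on the string of
    \<open>c\<close> until its upper node has been passed. Since \<open>a\<close> is black, that
    node is in \<open>D\<close> in either case.\<close>
  have "carried T W d c \<or> upper_in T D c" if "(d, b) \<in> {(u, v). u \<in> D \<and> v \<in> D \<and> parent T W u v}\<^sup>*" for d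
    using that
  proof (induction rule: converse_rtrancl_induct)
    case base thus ?case using c by blast
  next
    case (step d d')
    show ?case
    proof (cases "upper_in T D c")
      case False
      with step.IH have cd': "carried T W d' c" by blast
      show ?thesis
      proof (cases d')
        case (Inl u)
        thus ?thesis using cd' step.hyps(1) by (auto simp: upper_in_def)
      next
        case (Inr w)
        obtain c' where c': "c' \<in> edges T" "string_less T W c' d' d"
          using step.hyps(1) unfolding parent_iff by blast
        hence "w \<in> wset W c'" using Inr by (auto simp: string_less_def)
        hence "c' = c" using cd' Inr wset_disjoint c' by auto
        thus ?thesis using c' string_less_carried by blast
      qed
    qed simp
  qed
  from this[OF b(2)] have "upper_in T D c" using a by (auto simp: upper_in_def)
  thus ?thesis using bottom_no_lower[OF con b(1) c] by (auto simp: leaves_at_def)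
qed

text \<open>An edge through which \<open>D\<close> is left carries a bottom of \<open>D\<close>, and
  a connected set has only one bottom.\<close>

lemma leaves_at_unique:
  assumes con: "induces_connected (subdivide T W) D" and c: "leaves_at T D c" "leaves_at T D c'"
  shows "c = c'"
proof -
  have *: "\<exists>b. bottom T W D b \<and> carried T W b c" if lc: "leaves_at T D c" for c
  proof -
    obtain u where "(c, u) \<in> ttarget T" "Inl u \<in> D" using lc by (auto simp: leaves_at_def upper_in_def)
    thus ?thesis using bottom_on_edge[of "Inl u" D c] lc by (auto simp: leaves_at_def lower_in_def)
  qed
  show ?thesis using *[OF c(1)] *[OF c(2)] connected_bottom_unique[OF con] carried_unique by blast
qed

lemma subtree_black:
  assumes con: "induces_connected (subdivide T W) D" and a: "Inl a \<in> D" "D \<subseteq> dots T W"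
  shows "root (subtree T W D) = c \<longleftrightarrow> leaves_at T D c"
    and "leaves (subtree T W D) = {c. enters T D c}"
proof -
  have n: "Inl b \<in> D \<Longrightarrow> b \<in> nodes T" for b using a by (auto simp: dots_def)
  let ?N = "{a \<in> nodes T. Inl a \<in> D}"
  let ?E = "{b \<in> edges T. \<exists>a\<in>?N. (b, a) \<in> tsource T \<or> (b, a) \<in> ttarget T}"
  have N: "?N \<noteq> {}" using a n by blast
  have lv: "b \<in> ?E \<and> (\<nexists>a. a \<in> ?N \<and> (b, a) \<in> tsource T) \<longleftrightarrow> leaves_at T D b" for b
    using source_mem target_mem unfolding leaves_at_def upper_in_def lower_in_def by blast
  have sub: "subtree T W D = \<lparr>nodes = ?N, edges = ?E, root = (THE b. b \<in> ?E \<and> (\<nexists>a. a \<in> ?N \<and> (b, a) \<in> tsource T)),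
      tsource = tsource T \<inter> (?E \<times> ?N), ttarget = ttarget T \<inter> (?E \<times> ?N)\<rparr>"
    unfolding subtree_def Let_def by (rule if_not_P[OF N])
  have "root (subtree T W D) = (THE b. leaves_at T D b)"
    unfolding sub rtree.select_convs lv ..
  moreover obtain r where r: "leaves_at T D r" using leaves_at_ex[OF con a] by blast
  hence "(THE b. leaves_at T D b) = r" by (rule the_equality) (rule leaves_at_unique[OF con _ r])
  ultimately have rr: "root (subtree T W D) = r" by (rule trans)
  show "root (subtree T W D) = c \<longleftrightarrow> leaves_at T D c"
    unfolding rr using r leaves_at_unique[OF con _ r] by blast
  have "leaves (subtree T W D) = {b \<in> ?E. \<nexists>a. (b, a) \<in> ttarget T \<inter> (?E \<times> ?N)}"
    unfolding sub leaves_def rtree.select_convs ..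
  also have "\<dots> = {c. enters T D c}"
    using source_mem target_mem unfolding enters_def upper_in_def lower_in_def by blast
  finally show "leaves (subtree T W D) = {c. enters T D c}" .
qed

lemma white_single_edge:
  assumes con: "induces_connected (subdivide T W) D" and D: "D \<noteq> {}" "D \<subseteq> dots T W" "\<And>a. Inl a \<notin> D"
  shows "\<exists>c\<in>edges T. D \<subseteq> Inr ` wset W c"
proof -
  have *: "\<exists>b. bottom T W D b \<and> carried T W b c" if "d \<in> D" "carried T W d c" for d c
    using bottom_on_edge[OF that] D by blast
  have ex: "\<exists>c\<in>edges T. carried T W d c" if "d \<in> D" for d
    using that D by (cases d) (auto simp: dots_def white_dots_def)
  obtain d0 c where c: "d0 \<in> D" "carried T W d0 c" "c \<in> edges T" using ex D by blast
  have "d \<in> Inr ` wset W c" if d: "d \<in> D" for d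
  proof -
    obtain c' where c': "carried T W d c'" using ex d by blast
    have "c' = c" using *[OF d c'] *[OF c(1,2)] connected_bottom_unique[OF con] carried_unique by blast
    thus ?thesis using c' D d by (cases d) auto
  qed
  thus ?thesis using c by blast
qed

lemma subtree_white:
  assumes D: "D \<noteq> {}" "D \<subseteq> Inr ` wset W c" "c \<in> edges T"
  shows "root (subtree T W D) = c" "leaves (subtree T W D) = {c}"
proof -
  have N: "{a \<in> nodes T. Inl a \<in> D} = {}" using D by auto
  have "(THE b. b \<in> edges T \<and> (\<exists>w. Inr w \<in> D \<and> w \<in> wset W b)) = c"
    by (rule the_equality) (use D wset_disjoint in blast)+
  hence "subtree T W D = unit_tree c" using N by (simp add: subtree_def)
  thus "root (subtree T W D) = c" "leaves (subtree T W D) = {c}"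
    by (auto simp: unit_tree_def leaves_def)
qed

lemma desc_leaves_at:
  assumes con: "induces_connected (subdivide T W) D" and r: "leaves_at T D r" and a: "Inl a \<in> D" "a \<in> nodes T"
  shows "desc T (Inl a) (Inr r)"
proof -
  have "\<forall>a. x = Inl a \<longrightarrow> Inl a \<in> D \<longrightarrow> a \<in> nodes T \<longrightarrow> desc T (Inl a) (Inr r)" for x :: "'n + 'e"
  proof (induction x rule: wf_induct_rule[OF wf_trancl[OF wf_step_converse]])
    case (1 x)
    show ?case
    proof (intro allI impI)
      fix a assume a: "x = Inl a" "Inl a \<in> D" "a \<in> nodes T"
      obtain e where e: "(e, a) \<in> ttarget T" using target_ex a by blast
      show "desc T (Inl a) (Inr r)"
      proof (cases "lower_in T D e")
        case False
        hence "leaves_at T D e" using e a by (auto simp: leaves_at_def upper_in_def)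
        thus ?thesis using leaves_at_unique[OF con r] desc_target[OF e] by blast
      next
        case True
        then obtain l where l: "(e, l) \<in> tsource T" "Inl l \<in> D" by (auto simp: lower_in_def)
        have "(Inl l, x) \<in> ((desc_step T)\<inverse>)\<^sup>+"
          using e l a trancl_into_trancl[OF r_into_trancl, of "Inl a" "Inr e" "desc_step T" "Inl l"]
          by (simp add: trancl_converse)
        hence "desc T (Inl l) (Inr r)" using 1 l source_mem by blast
        thus ?thesis using desc_target[OF e] desc_source[OF l(1)] desc_trans by blast
      qed
    qed
  qed
  thus ?thesis using a by blast
qed

lemma enters_desc:
  assumes con: "induces_connected (subdivide T W) D" and r: "leaves_at T D r" and y: "enters T D y"
  shows "desc T (Inr y) (Inr r)"
proof -
  obtain l where l: "(y, l) \<in> tsource T" "Inl l \<in> D" using y by (auto simp: enters_def lower_in_def)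
  thus ?thesis using desc_leaves_at[OF con r l(2)] source_mem desc_source desc_trans by blast
qed

text \<open>Going down from a node of \<open>D\<close> one stays in \<open>D\<close> as far as the
  root edge \<open>r\<close>. Before \<open>r\<close> the edge \<open>y\<close> cannot occur, since
  its upper node is not in \<open>D\<close>; beyond \<open>r\<close> it cannot occur either, since
  \<open>y\<close> itself descends to \<open>r\<close>.\<close>

lemma enters_not_below:
  assumes con: "induces_connected (subdivide T W) D" and r: "leaves_at T D r" and y: "enters T D y"
    and a: "Inl a \<in> D"
  shows "\<not> desc T (Inl a) (Inr y)"
proof -
  have "\<forall>a. x = Inl a \<longrightarrow> Inl a \<in> D \<longrightarrow> \<not> desc T (Inl a) (Inr y)" for x :: "'n + 'e"
  proof (induction x rule: wf_induct_rule[OF wf_trancl[OF wf_step_converse]])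
    case (1 x)
    show ?case
    proof (intro allI impI notI)
      fix a assume a: "x = Inl a" "Inl a \<in> D" "desc T (Inl a) (Inr y)"
      hence "a \<in> nodes T" using desc_vertices by fastforce
      then obtain e where e: "(e, a) \<in> ttarget T" using target_ex by blast
      have ey: "e \<noteq> y" using e a y by (auto simp: enters_def upper_in_def)
      have de: "desc T (Inr e) (Inr y)" using desc_through_step[OF a(3)] e by auto
      show False
      proof (cases "lower_in T D e")
        case False
        hence "leaves_at T D e" using e a by (auto simp: leaves_at_def upper_in_def)
        hence "e = r" using leaves_at_unique[OF con r] by blast
        thus False using de enters_desc[OF con r y] ey desc_antisym by blast
      next
        case True
        then obtain l where l: "(e, l) \<in> tsource T" "Inl l \<in> D" by (auto simp: lower_in_def)
        have "(Inl l, x) \<in> ((desc_step T)\<inverse>)\<^sup>+"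
          using e l a trancl_into_trancl[OF r_into_trancl, of "Inl a" "Inr e" "desc_step T" "Inl l"]
          by (simp add: trancl_converse)
        moreover have "desc T (Inl l) (Inr y)" using desc_through_step[OF de] l ey by auto
        ultimately show False using 1 l by blast
      qed
    qed
  qed
  thus ?thesis using a by blast
qed

lemma enters_disjoint:
  assumes con: "induces_connected (subdivide T W) D" and r: "leaves_at T D r"
    and y: "enters T D y" "enters T D y'" and v: "desc T v (Inr y)" "desc T v (Inr y')"
  shows "y = y'"
proof -
  have *: "y = y'" if y: "enters T D y" "enters T D y'" "desc T (Inr y) (Inr y')" for y y'
  proof (rule ccontr)
    assume ne: "y \<noteq> y'"
    obtain l where l: "(y, l) \<in> tsource T" "Inl l \<in> D" using y by (auto simp: enters_def lower_in_def)
    have "desc T (Inl l) (Inr y')" using desc_through_step[OF y(3)] l ne by auto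
    thus False using enters_not_below[OF con r y(2) l(2)] by blast
  qed
  show ?thesis using desc_total[OF v] *[OF y] *[OF y(2,1)] by blast
qed

text \<open>Climb from \<open>v\<close> towards the leaf \<open>t\<close> as long as the upper node
  is in \<open>D\<close>. The climb ends at the latest at \<open>t\<close>, which has no upper
  node.\<close>

lemma enters_above:
  assumes t: "t \<in> leaves T" and v: "desc T (Inr t) (Inr v)" "upper_in T D v"
  shows "\<exists>y. enters T D y \<and> desc T (Inr t) (Inr y)"
proof -
  have "v \<in> edges T" using upper_in_mem v by blast
  hence "desc T (Inr t) (Inr v) \<Longrightarrow> upper_in T D v \<Longrightarrow> ?thesis"
  proof (induction rule: edge_up_induct)
    case (1 v)
    obtain u where u: "(v, u) \<in> ttarget T" "Inl u \<in> D" using 1(4) by (auto simp: upper_in_def)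
    have "t \<noteq> v" using t u by (auto simp: leaves_def)
    moreover have "Inr t \<in> tops T" using t by (auto simp: tops_def)
    ultimately obtain y where y: "(y, u) \<in> tsource T" "desc T (Inr t) (Inr y)"
      using desc_edge_cases[OF 1(3)] u(1) upper_unique by blast
    have "lower_in T D y" using y u by (auto simp: lower_in_def)
    thus ?case using 1(2)[OF u(1) y(1) y(2)] y by (cases "upper_in T D y") (auto simp: enters_def)
  qed
  thus ?thesis using v by blast
qed

end

section \<open>Exact constellations\<close>

abbreviation dot_vertex :: "'n + 'w \<Rightarrow> 'w + 'n" where
  "dot_vertex \<equiv> dot_map (\<lambda>a. a) (\<lambda>w. w)"

lemma dot_map_simps [simp]: "dot_map f g (Inl a) = Inr (f a)" "dot_map f g (Inr w) = Inl (g w)"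
  by (auto simp: dot_map_def)

lemma dots_iff [simp]:
  "Inl a \<in> dots T W \<longleftrightarrow> a \<in> nodes T" "Inr w \<in> dots T W \<longleftrightarrow> w \<in> white_dots T W"
  by (auto simp: dots_def)

locale constellation = stree T W + U: tree U
  for T :: "('a, 'e) rtree" and W :: "('e, 'w) subdiv" and U :: "('w, 'a) rtree" +
  assumes exact: "exact_constellation T W U"
begin

definition above :: "'a \<Rightarrow> ('a + 'w) set" where
  "above x = {t \<in> dots T W. desc U (dot_vertex t) (Inr x)}"

definition inc :: "int \<Rightarrow> 'e \<Rightarrow> 'a \<Rightarrow> bool" where
  "inc s c x \<longleftrightarrow> c \<in> edges T \<and> x \<in> edges U \<and>
     (s = 1 \<and> leaves_at T (above x) c \<or> s = -1 \<and> enters T (above x) c \<or>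
      s = 0 \<and> above x \<subseteq> Inr ` wset W c)"

lemma nodes_eq: "nodes T = leaves U" and whites_eq: "white_dots T W = null_dots U"
  using exact unfolding exact_constellation_def is_constellation_def bij_betw_def by auto

lemma dot_vertex_tops: "dot_vertex t \<in> tops U \<longleftrightarrow> t \<in> dots T W"
  using nodes_eq whites_eq by (cases t) (auto simp: tops_def)

lemma tops_dot: "v \<in> tops U \<Longrightarrow> \<exists>t\<in>dots T W. dot_vertex t = v"
  using nodes_eq whites_eq unfolding tops_def
  by (auto intro: bexI[of _ "Inl _"] bexI[of _ "Inr _"])

lemma above_dots: "above x \<subseteq> dots T W"
  by (auto simp: above_def)

lemma above_iff: "t \<in> above x \<longleftrightarrow> t \<in> dots T W \<and> desc U (dot_vertex t) (Inr x)"
  by (auto simp: above_def)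

lemma above_nonempty: "x \<in> edges U \<Longrightarrow> above x \<noteq> {}"
  using U.top_above tops_dot unfolding above_def by blast

lemma above_leaf:
  assumes "x \<in> leaves U" shows "above x = {Inl x}"
proof -
  have x: "Inr x \<in> tops U" using assms by (auto simp: tops_def)
  have "t = Inl x" if "t \<in> above x" for t
    using U.tops_maximal[OF x, of "dot_vertex t"] that by (cases t) (auto simp: above_iff)
  moreover have "Inl x \<in> above x" using assms nodes_eq
    by (auto simp: above_iff leaves_def intro: desc_refl)
  ultimately show ?thesis by blast
qed

text \<open>The kernel rule speaks of the nodes of \<open>U\<close>; this lets it be applied to the
  edges that are not leaves. No dot becomes the edge \<open>x\<close> itself, because
  \<open>x\<close> is not a leaf.\<close>

lemma above_target:
  assumes a: "(x, a) \<in> ttarget U" shows "above x = {t \<in> dots T W. desc U (dot_vertex t) (Inl a)}"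
proof -
  have "desc U (dot_vertex t) (Inr x) \<longleftrightarrow> desc U (dot_vertex t) (Inl a)" if t: "t \<in> dots T W" for t
  proof
    assume d: "desc U (dot_vertex t) (Inr x)"
    have "dot_vertex t \<noteq> Inr x" using t a nodes_eq by (cases t) (auto simp: leaves_def)
    thus "desc U (dot_vertex t) (Inl a)"
      using U.desc_lastE[OF d] a U.upper_unique by (metis desc_step_InrE)
  next
    assume "desc U (dot_vertex t) (Inl a)"
    thus "desc U (dot_vertex t) (Inr x)" using U.desc_target[OF a] desc_trans by blast
  qed
  thus ?thesis by (auto simp: above_def)
qed

lemma above_connected:
  assumes "x \<in> edges U" shows "induces_connected (subdivide T W) (above x)"
proof (cases "x \<in> leaves U")
  case True
  thus ?thesis using above_leaf by (auto simp: induces_connected_def)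
next
  case False
  then obtain a where a: "(x, a) \<in> ttarget U" using assms by (auto simp: leaves_def)
  thus ?thesis using exact U.target_mem unfolding exact_constellation_def is_constellation_def
    above_target[OF a] by blast
qed

text \<open>Connects the subtree in the definition of P with the signs. A set of white dots only
  gives a unit tree, whose edge is root and leaf at once: this is sign 0.\<close>

lemma root_iff:
  assumes x: "x \<in> edges U"
  shows "root (subtree T W (above x)) = c \<longleftrightarrow> inc 1 c x \<or> inc 0 c x"
    and "c \<in> leaves (subtree T W (above x)) \<longleftrightarrow> inc (-1) c x \<or> inc 0 c x"
proof -
  have "(root (subtree T W (above x)) = c \<longleftrightarrow> inc 1 c x \<or> inc 0 c x) \<and>
        (c \<in> leaves (subtree T W (above x)) \<longleftrightarrow> inc (-1) c x \<or> inc 0 c x)"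
  proof (cases "\<exists>a. Inl a \<in> above x")
    case True
    then obtain a where a: "Inl a \<in> above x" by blast
    note s = subtree_black[OF above_connected[OF x] a above_dots]
    have "\<not> inc 0 c x" using a by (auto simp: inc_def)
    thus ?thesis using s(1)[of c] s(2) x upper_in_mem[of "above x" c] lower_in_mem[of "above x" c]
      by (auto simp: inc_def leaves_at_def enters_def)
  next
    case False
    then obtain e where e: "e \<in> edges T" "above x \<subseteq> Inr ` wset W e"
      using white_single_edge[OF above_connected[OF x] above_nonempty[OF x] above_dots] by blast
    note s = subtree_white[OF above_nonempty[OF x] e(2,1)]
    have "inc 0 c x \<longleftrightarrow> c = e"
    proof
      assume "inc 0 c x"
      hence c: "c \<in> edges T" "above x \<subseteq> Inr ` wset W c" by (auto simp: inc_def)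
      obtain t where "t \<in> above x" using above_nonempty[OF x] by blast
      thus "c = e" using c e wset_disjoint by blast
    qed (use e x in \<open>simp add: inc_def\<close>)
    moreover have "\<not> inc 1 c x" "\<not> inc (-1) c x" using False
      by (auto simp: inc_def leaves_at_def enters_def upper_in_def lower_in_def)
    ultimately show ?thesis using s by auto
  qed
  thus "root (subtree T W (above x)) = c \<longleftrightarrow> inc 1 c x \<or> inc 0 c x"
    and "c \<in> leaves (subtree T W (above x)) \<longleftrightarrow> inc (-1) c x \<or> inc 0 c x" by auto
qed

lemma inc_exclusive: "inc s c x \<Longrightarrow> inc s' c x \<Longrightarrow> s = s'"
  unfolding inc_def leaves_at_def enters_def upper_in_def lower_in_def by auto

lemma inc_root_unique: "inc 1 c x \<or> inc 0 c x \<Longrightarrow> inc 1 c' x \<or> inc 0 c' x \<Longrightarrow> c = c'"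
  using root_iff(1)[of x c] root_iff(1)[of x c'] unfolding inc_def by blast

lemma inc_loop_unique: "inc 0 c x \<Longrightarrow> inc s c' x \<Longrightarrow> c = c' \<and> s = 0"
proof -
  assume a: "inc 0 c x" "inc s c' x"
  hence "s = 0" by (auto simp: inc_def leaves_at_def enters_def upper_in_def lower_in_def)
  thus ?thesis using a inc_root_unique by blast
qed

end

section \<open>Signs over leaves, and loops on a common edge\<close>

context constellation
begin

lemma inc_leaf:
  assumes x: "x \<in> leaves U"
  shows "inc 1 c x \<longleftrightarrow> (c, x) \<in> ttarget T" "inc (-1) c x \<longleftrightarrow> (c, x) \<in> tsource T" "\<not> inc 0 c x"
proof -
  have e: "x \<in> edges U" using x by (auto simp: leaves_def)
  have n: "\<not> ((c, x) \<in> tsource T \<and> (c, x) \<in> ttarget T)"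
    using no_back_step[of "Inl x" "Inr c"] desc_source by auto
  show "inc 1 c x \<longleftrightarrow> (c, x) \<in> ttarget T" "inc (-1) c x \<longleftrightarrow> (c, x) \<in> tsource T" "\<not> inc 0 c x"
    using n e source_mem[of c x] target_mem[of c x]
    by (auto simp: inc_def above_leaf[OF x] leaves_at_def enters_def upper_in_def lower_in_def)
qed

lemma inc_mem: "inc s c x \<Longrightarrow> c \<in> edges T \<and> x \<in> edges U"
  and inc_sign: "inc s c x \<Longrightarrow> s \<in> {-1, 0, 1}"
  by (auto simp: inc_def)

lemma inc_zero_not_leaf: "inc 0 c x \<Longrightarrow> x \<notin> leaves U"
  using inc_leaf by blast

text \<open>Both sets of dots are convex on the string of \<open>z\<close> and they are disjoint, so
  one comparison between them decides all others.\<close>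

lemma loops_separated:
  assumes y: "inc 0 z y" "inc 0 z y'" and disj: "above y \<inter> above y' = {}"
    and w0: "Inr w0 \<in> above y" "Inr w0' \<in> above y'" "(w0, w0') \<in> wless W z"
    and w: "Inr w \<in> above y" "Inr w' \<in> above y'"
  shows "(w, w') \<in> wless W z"
proof (rule ccontr)
  assume n: "(w, w') \<notin> wless W z"
  have z: "z \<in> edges T" and yU: "y \<in> edges U" "y' \<in> edges U" using y by (auto simp: inc_def)
  have ws: "w \<in> wset W z" "w' \<in> wset W z" "w0 \<in> wset W z" "w0' \<in> wset W z"
    using y w w0 by (auto simp: inc_def)
  have "w \<noteq> w'" "w0 \<noteq> w'" using disj w w0 by auto
  hence l: "(w', w) \<in> wless W z" "(w0, w') \<in> wless W z \<or> (w', w0) \<in> wless W z"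
    using wless_total[OF z] ws n by blast+
  have "Inr w' \<in> above y" if "(w0, w') \<in> wless W z"
    using connected_convex[OF above_connected[OF yU(1)] w0(1) w(1) z, of "Inr w'"] that l ws by simp
  moreover have "Inr w0 \<in> above y'" if "(w', w0) \<in> wless W z"
    using connected_convex[OF above_connected[OF yU(2)] w(2) w0(2) z, of "Inr w0"] that w0 ws by simp
  ultimately show False using l disj w w0 by blast
qed

lemma black_root:
  assumes "x \<in> edges U" "Inl a \<in> above x"
  shows "\<exists>r. inc 1 r x"
  using leaves_at_ex[OF above_connected[OF assms(1)] assms(2) above_dots] assms(1) upper_in_mem
  by (auto simp: inc_def leaves_at_def)

lemma enters_root: "inc (-1) c x \<Longrightarrow> \<exists>r. inc 1 r x"
  using black_root by (auto simp: inc_def enters_def lower_in_def)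

lemma above_mono: "desc U (Inr y) (Inr r) \<Longrightarrow> above y \<subseteq> above r"
  using desc_trans by (auto simp: above_def)

end

text \<open>Abstract form of the chains \<open>z \<prec> y \<prec> x\<close> with nonzero signs:
  \<open>r\<close> is the target and \<open>L\<close> the set of sources of \<open>x\<close>, and
  \<open>M s y\<close> says that the end of the string of \<open>z\<close> with sign
  \<open>s\<close> (upper node for 1, lower node for -1) lies above \<open>y\<close>.\<close>

definition sign_chain :: "(int \<Rightarrow> 'b \<Rightarrow> bool) \<Rightarrow> 'b \<Rightarrow> 'b set \<Rightarrow> int \<Rightarrow> int \<Rightarrow> 'b \<Rightarrow> bool" where
  "sign_chain M r L \<alpha> \<beta> y \<longleftrightarrow> (\<alpha> = 1 \<and> y = r \<or> \<alpha> = -1 \<and> y \<in> L) \<and> (\<beta> = 1 \<or> \<beta> = -1) \<and>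
     M \<beta> y \<and> \<not> M (- \<beta>) y"

text \<open>Each end of the string above the target is above exactly one source. If only one end is
  above the target, the target and the source owning that end are partners; if both ends are, but
  belong to different sources, these two sources are partners. In each case the product of the signs
  changes.\<close>

lemma sign_chain_thin:
  fixes M :: "int \<Rightarrow> 'b \<Rightarrow> bool"
  assumes r: "r \<notin> L" and M: "\<And>s. s = 1 \<or> s = -1 \<Longrightarrow> M s r \<longleftrightarrow> (\<exists>y\<in>L. M s y)"
    and uniq: "\<And>s y y'. s = 1 \<or> s = -1 \<Longrightarrow> y \<in> L \<Longrightarrow> y' \<in> L \<Longrightarrow> M s y \<Longrightarrow> M s y' \<Longrightarrow> y = y'"
  assumes y: "sign_chain M r L \<alpha> \<beta> y"
  shows "\<exists>\<alpha>' \<beta>' y'. y' \<noteq> y \<and> sign_chain M r L \<alpha>' \<beta>' y'"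
    and "sign_chain M r L \<alpha>' \<beta>' y' \<Longrightarrow> y' \<noteq> y \<Longrightarrow> \<alpha> * \<beta> = - (\<alpha>' * \<beta>')"
proof -
  have b: "\<beta> = 1 \<or> \<beta> = -1" "- \<beta> = 1 \<or> - \<beta> = -1" using y by (auto simp: sign_chain_def)
  show "\<exists>\<alpha>' \<beta>' y'. y' \<noteq> y \<and> sign_chain M r L \<alpha>' \<beta>' y'"
  proof (cases "\<alpha> = 1")
    case True
    hence yr: "y = r" "M \<beta> r" "\<not> M (- \<beta>) r" using y by (auto simp: sign_chain_def)
    then obtain y' where y': "y' \<in> L" "M \<beta> y'" using M[OF b(1)] by blast
    hence "\<not> M (- \<beta>) y'" using M[OF b(2)] yr by blast
    hence "sign_chain M r L (-1) \<beta> y'" using y' b by (auto simp: sign_chain_def)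
    moreover have "y' \<noteq> y" using y' r yr by auto
    ultimately show ?thesis by (intro exI conjI)
  next
    case False
    hence yL: "y \<in> L" "M \<beta> y" "\<not> M (- \<beta>) y" using y by (auto simp: sign_chain_def)
    hence mr: "M \<beta> r" using M[OF b(1)] by blast
    show ?thesis
    proof (cases "M (- \<beta>) r")
      case False
      hence "sign_chain M r L 1 \<beta> r" using mr b by (auto simp: sign_chain_def)
      moreover have "r \<noteq> y" using yL r by auto
      ultimately show ?thesis by (intro exI conjI)
    next
      case True
      then obtain y' where y': "y' \<in> L" "M (- \<beta>) y'" using M[OF b(2)] by blast
      hence "y' \<noteq> y" using yL by blast
      hence "\<not> M \<beta> y'" using uniq[OF b(1)] yL y' by blast
      hence "sign_chain M r L (-1) (- \<beta>) y'" using y' b by (auto simp: sign_chain_def)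
      thus ?thesis using \<open>y' \<noteq> y\<close> by (intro exI conjI)
    qed
  qed
  assume y': "sign_chain M r L \<alpha>' \<beta>' y'" "y' \<noteq> y"
  have b': "\<beta>' = 1 \<or> \<beta>' = -1" using y' by (auto simp: sign_chain_def)
  have signs: "\<beta> \<noteq> \<beta>' \<longrightarrow> \<beta>' = - \<beta>" using b b' by auto
  show "\<alpha> * \<beta> = - (\<alpha>' * \<beta>')"
  proof (cases "\<alpha> = \<alpha>'")
    case True
    hence "y \<in> L" "y' \<in> L" using y y' by (auto simp: sign_chain_def)
    hence "\<beta> \<noteq> \<beta>'" using uniq[OF b(1), of y y'] y y' by (auto simp: sign_chain_def)
    thus ?thesis using signs True by auto
  next
    case False
    have "\<beta> = \<beta>'"
    proof (rule ccontr)
      assume "\<beta> \<noteq> \<beta>'"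
      hence "\<beta>' = - \<beta>" using signs by blast
      thus False using y y' False M[OF b(1)] M[OF b(2)] by (auto simp: sign_chain_def)
    qed
    thus ?thesis using False y y' by (auto simp: sign_chain_def)
  qed
qed

section \<open>Two consecutive constellations: thinness, loops and acyclicity\<close>

locale constellation2 = C1: constellation T W U + C2: constellation U V Q
  for T :: "('a, 'e) rtree" and W :: "('e, 'w) subdiv" and U :: "('w, 'a) rtree"
    and V :: "('a, 'v) subdiv" and Q :: "('v, 'w) rtree"
begin

definition side :: "'e \<Rightarrow> int \<Rightarrow> 'a \<Rightarrow> bool" where
  "side z s y \<longleftrightarrow> (if s = 1 then upper_in T (C1.above y) z else lower_in T (C1.above y) z)"

lemma inc_side:
  assumes "s = 1 \<or> s = -1" "y \<in> edges U"
  shows "C1.inc s z y \<longleftrightarrow> side z s y \<and> \<not> side z (- s) y"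
  using assms C1.upper_in_mem[of "C1.above y" z] C1.lower_in_mem[of "C1.above y" z]
  by (auto simp: C1.inc_def side_def leaves_at_def enters_def)

lemma side_black:
  assumes s: "s = 1 \<or> s = -1" "side z s y"
  shows "\<exists>a. Inl a \<in> C1.above y \<and> (\<forall>y'. side z s y' \<longleftrightarrow> Inl a \<in> C1.above y')"
proof (cases "s = 1")
  case True
  then obtain u where u: "(z, u) \<in> ttarget T" "Inl u \<in> C1.above y"
    using s by (auto simp: side_def upper_in_def)
  have "side z s y' \<longleftrightarrow> Inl u \<in> C1.above y'" for y'
    using True u(1) by (auto simp: side_def upper_in_def dest: C1.upper_unique[OF u(1)])
  thus ?thesis using u by blast
next
  case False
  then obtain u where u: "(z, u) \<in> tsource T" "Inl u \<in> C1.above y"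
    using s by (auto simp: side_def lower_in_def)
  have "side z s y' \<longleftrightarrow> Inl u \<in> C1.above y'" for y'
    using False u(1) by (auto simp: side_def lower_in_def dest: C1.lower_unique[OF u(1)])
  thus ?thesis using u by blast
qed

lemma sources_desc_root: "C2.inc (-1) y x \<Longrightarrow> C2.inc 1 r x \<Longrightarrow> desc U (Inr y) (Inr r)"
  using C2.enters_desc C2.above_connected by (auto simp: C2.inc_def)

lemma sources_above_unique:
  "C2.inc (-1) y x \<Longrightarrow> C2.inc (-1) y' x \<Longrightarrow> t \<in> C1.above y \<Longrightarrow> t \<in> C1.above y' \<Longrightarrow> y = y'"
proof -
  assume a: "C2.inc (-1) y x" "C2.inc (-1) y' x" "t \<in> C1.above y" "t \<in> C1.above y'"
  then obtain r where r: "C2.inc 1 r x" using C2.enters_root by blast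
  have x: "x \<in> edges Q" using r C2.inc_mem by blast
  show ?thesis
    using C2.enters_disjoint[OF C2.above_connected[OF x], of r y y' "dot_vertex t"] a r
    by (auto simp: C2.inc_def C1.above_def)
qed

text \<open>Black dots are leaves of \<open>U\<close>, so the path from \<open>a\<close> down to
  \<open>r\<close> has to enter the subtree of \<open>x\<close> from outside, through a source of
  \<open>x\<close>. A white dot may instead be a node of that subtree and lie above no source, so
  only the ends of strings can be counted.\<close>

lemma black_root_source:
  assumes r: "C2.inc 1 r x" and a: "Inl a \<in> C1.above r"
  shows "\<exists>y. C2.inc (-1) y x \<and> Inl a \<in> C1.above y"
proof -
  have al: "a \<in> leaves U" using a C1.nodes_eq by (auto simp: C1.above_def)
  have "desc U (Inr a) (Inr r)" "upper_in U (C2.above x) r"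
    using a r by (auto simp: C1.above_def C2.inc_def leaves_at_def)
  then obtain y where "enters U (C2.above x) y" "desc U (Inr a) (Inr y)"
    using C2.enters_above[OF al] by blast
  thus ?thesis using r a C2.lower_in_mem by (auto simp: C2.inc_def C1.above_def enters_def)
qed

lemma side_root:
  assumes r: "C2.inc 1 r x" and s: "s = 1 \<or> s = -1"
  shows "side z s r \<longleftrightarrow> (\<exists>y\<in>{y. C2.inc (-1) y x}. side z s y)"
    using side_black s black_root_source r C1.above_mono sources_desc_root by fastforce

lemma side_unique:
  assumes "s = 1 \<or> s = -1" "y \<in> {y. C2.inc (-1) y x}" "y' \<in> {y. C2.inc (-1) y x}" "side z s y" "side z s y'"
  shows "y = y'"
  using side_black[OF assms(1,4)] assms sources_above_unique by blast

lemma chain_iff: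
  assumes r: "C2.inc 1 r x"
  shows "C1.inc \<beta> z y \<and> C2.inc \<alpha> y x \<and> \<alpha> \<noteq> 0 \<and> \<beta> \<noteq> 0 \<longleftrightarrow>
    sign_chain (side z) r {y. C2.inc (-1) y x} \<alpha> \<beta> y"
proof -
  have "C2.inc 1 y x \<longleftrightarrow> y = r" using r C2.inc_root_unique by blast
  moreover have "\<beta> = 1 \<or> \<beta> = -1" if "C1.inc \<beta> z y" "\<beta> \<noteq> 0" using C1.inc_sign[OF that(1)] that by auto
  moreover have "\<alpha> = 1 \<or> \<alpha> = -1" if "C2.inc \<alpha> y x" "\<alpha> \<noteq> 0" using C2.inc_sign[OF that(1)] that by auto
  moreover have "y \<in> edges U" if "C2.inc \<alpha> y x" for \<alpha> y using that C2.inc_mem by blast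
  ultimately show ?thesis unfolding sign_chain_def using inc_side by auto
qed

lemma thin:
  assumes c: "C1.inc \<beta> z y" "C2.inc \<alpha> y x" "\<alpha> \<noteq> 0" "\<beta> \<noteq> 0"
  shows "\<exists>y' \<alpha>' \<beta>'. y' \<noteq> y \<and> \<alpha>' \<noteq> 0 \<and> \<beta>' \<noteq> 0 \<and> C1.inc \<beta>' z y' \<and> C2.inc \<alpha>' y' x"
    and "C1.inc \<beta>' z y' \<Longrightarrow> C2.inc \<alpha>' y' x \<Longrightarrow> \<alpha>' \<noteq> 0 \<Longrightarrow> \<beta>' \<noteq> 0 \<Longrightarrow> y' \<noteq> y \<Longrightarrow> \<alpha> * \<beta> = - (\<alpha>' * \<beta>')"
proof -
  have "\<alpha> = 1 \<or> \<alpha> = -1" using C2.inc_sign c by auto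
  then obtain r where r: "C2.inc 1 r x" using c C2.enters_root by blast
  have rn: "r \<notin> {y. C2.inc (-1) y x}" using C2.inc_exclusive[OF r, of "-1"] by auto
  have y: "sign_chain (side z) r {y. C2.inc (-1) y x} \<alpha> \<beta> y" using chain_iff[OF r] c by blast
  let ?ch = "sign_chain (side z) r {y. C2.inc (-1) y x}"
  have "\<exists>\<alpha>' \<beta>' y'. y' \<noteq> y \<and> ?ch \<alpha>' \<beta>' y'"
    by (rule sign_chain_thin(1)[OF rn _ _ y]) (erule side_root[OF r], rule side_unique)
  thus "\<exists>y' \<alpha>' \<beta>'. y' \<noteq> y \<and> \<alpha>' \<noteq> 0 \<and> \<beta>' \<noteq> 0 \<and> C1.inc \<beta>' z y' \<and> C2.inc \<alpha>' y' x"
    unfolding chain_iff[OF r, symmetric] by blast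
  assume "C1.inc \<beta>' z y'" "C2.inc \<alpha>' y' x" "\<alpha>' \<noteq> 0" "\<beta>' \<noteq> 0" and ne: "y' \<noteq> y"
  hence y': "?ch \<alpha>' \<beta>' y'" using chain_iff[OF r] by blast
  show "\<alpha> * \<beta> = - (\<alpha>' * \<beta>')"
    by (rule sign_chain_thin(2)[OF rn _ _ y y' ne]) (erule side_root[OF r], rule side_unique)
qed

text \<open>If only white dots lie above the target \<open>r\<close>, then \<open>r\<close> is
  itself a loop on \<open>z\<close>. Otherwise at least one end of the string of \<open>z\<close>
  lies above \<open>r\<close>, and the source owning that end will do: it cannot own both ends,
  because by convexity it would then share the white dots of \<open>y\<close>.\<close>

lemma loop_source:
  assumes y: "C1.inc 0 z y" "C2.inc (-1) y x"
  shows "\<exists>y' \<alpha> \<beta>. y' \<noteq> y \<and> C1.inc \<beta> z y' \<and> C2.inc \<alpha> y' x \<and> (\<alpha>, \<beta>) \<noteq> (-1, 0)"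
proof -
  obtain r where r: "C2.inc 1 r x" using y C2.enters_root by blast
  have z: "z \<in> edges T" and ay: "C1.above y \<subseteq> Inr ` wset W z" using y by (auto simp: C1.inc_def)
  have rU: "r \<in> edges U" "y \<in> edges U" using r y C2.inc_mem by blast+
  have yr: "C1.above y \<subseteq> C1.above r" using C1.above_mono[OF sources_desc_root[OF y(2) r]] .
  obtain w where w: "Inr w \<in> C1.above y" "w \<in> wset W z" using C1.above_nonempty[OF rU(2)] ay by blast
  show ?thesis
  proof (cases "\<exists>a. Inl a \<in> C1.above r")
    case False
    then obtain c where c: "c \<in> edges T" "C1.above r \<subseteq> Inr ` wset W c"
      using C1.white_single_edge[OF C1.above_connected C1.above_nonempty C1.above_dots, OF rU(1) rU(1)] by blast
    hence "c = z" using w yr C1.wset_disjoint z by blast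
    hence "C1.inc 0 z r" using c rU by (auto simp: C1.inc_def)
    moreover have "r \<noteq> y" using r y C2.inc_exclusive[of "-1" y x 1] by auto
    ultimately show ?thesis using r by (intro exI[of _ r] exI[of _ 1] exI[of _ 0]) auto
  next
    case True
    then obtain a where a: "Inl a \<in> C1.above r" by blast
    note con = C1.above_connected[OF rU(1)]
    have "\<exists>s. (s = 1 \<or> s = -1) \<and> side z s r"
    proof (cases "lower_in T (C1.above r) z")
      case True thus ?thesis by (intro exI[of _ "-1"]) (auto simp: side_def)
    next
      case False
      \<comment> \<open>Without the lower node, the white dot \<open>w\<close> descends to a bottom
        carried by \<open>z\<close>. The bottom of a connected set is unique, so \<open>z\<close> is
        the edge through which the set is left, and its upper node belongs to the set.\<close>
      obtain c where c: "leaves_at T (C1.above r) c" using C1.leaves_at_ex[OF con a C1.above_dots] by blast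
      then obtain u where u: "(c, u) \<in> ttarget T" "Inl u \<in> C1.above r"
        by (auto simp: leaves_at_def upper_in_def)
      obtain b where b: "bottom T W (C1.above r) b" "carried T W b c"
        using C1.bottom_on_edge[of "Inl u" "C1.above r" c] u c by (auto simp: leaves_at_def lower_in_def)
      obtain b' where b': "bottom T W (C1.above r) b'" "carried T W b' z"
        using C1.bottom_on_edge[of "Inr w" "C1.above r" z] w yr z False by (auto simp: lower_in_def)
      have "c = z" using C1.connected_bottom_unique[OF con] b b' C1.carried_unique by blast
      thus ?thesis using c by (intro exI[of _ 1]) (auto simp: side_def leaves_at_def)
    qed
    then obtain s where s: "s = 1 \<or> s = -1" "side z s r" by blast
    then obtain y' where y': "C2.inc (-1) y' x" "side z s y'" using side_root[OF r] by blast
    have yb: "Inl u \<notin> C1.above y" for u using ay by blast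
    have ne: "y' \<noteq> y" using side_black[OF s(1) y'(2)] yb by blast
    have "\<not> side z (- s) y'"
    proof
      assume "side z (- s) y'"
      hence "upper_in T (C1.above y') z" "lower_in T (C1.above y') z"
        using y' s by (auto simp: side_def)
      then obtain u l where ul: "(z, u) \<in> ttarget T" "Inl u \<in> C1.above y'" "(z, l) \<in> tsource T" "Inl l \<in> C1.above y'"
        by (auto simp: upper_in_def lower_in_def)
      have "y' \<in> edges U" using y' C2.inc_mem by blast
      from C1.connected_convex[OF C1.above_connected[OF this] ul(4,2) z, of "Inr w"]
      have "Inr w \<in> C1.above y'" using ul w by auto
      thus False using sources_above_unique[OF y(2) y'(1) w(1)] ne by blast
    qed
    hence "C1.inc s z y'" using inc_side[OF s(1)] y' C2.inc_mem by blast
    thus ?thesis using y' ne s by (intro exI[of _ y'] exI[of _ "-1"] exI[of _ s]) auto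
  qed
qed

text \<open>The target of \<open>y\<close> lies strictly below its sources in \<open>T\<close>, so a
  cycle of the kind forbidden by the acyclicity axiom would be a cycle of descending paths.\<close>

lemma target_descends:
  assumes "C1.inc 1 g y" "C1.inc (-1) g' y"
  shows "(Inr g', Inr g) \<in> (desc_step T)\<^sup>+"
proof -
  have "desc T (Inr g') (Inr g)"
    using assms C1.enters_desc C1.above_connected by (auto simp: C1.inc_def)
  moreover have "g' \<noteq> g" using assms C1.inc_exclusive[of 1 g y "-1"] by auto
  ultimately show ?thesis unfolding desc_def by (metis rtrancl_eq_or_trancl sum.inject(2))
qed

end

section \<open>The complex of an extended opetope\<close>

definition op_dots :: "'a opetope \<Rightarrow> nat \<Rightarrow> 'a + 'a \<Rightarrow> ('a + 'a) set" where
  "op_dots X k x = {t \<in> dots (otree X k) (osub X k). desc (otree X (Suc k)) (dot_vertex t) x}"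

definition op_subtree :: "'a opetope \<Rightarrow> nat \<Rightarrow> 'a \<Rightarrow> ('a, 'a) rtree" where
  "op_subtree X k x = subtree (otree X k) (osub X k) (op_dots X k (Inr x))"

definition op_cells :: "'a elem opetope \<Rightarrow> 'a elem set" where
  "op_cells X = insert (Cell (-1) (root (otree X 1)))
     {Cell (int k) x | k x. k + 2 \<le> odim X \<and> x \<in> edges (otree X (k + 2))}"

fun op_gamma :: "'a elem opetope \<Rightarrow> 'a elem \<Rightarrow> 'a elem set" where
  "op_gamma X (Cell k x) =
     (if k \<ge> 0 then {Cell (k - 1) (root (op_subtree X (nat k + 1) x))} else {})"
| "op_gamma X (Atom x) = {}"

fun op_delta :: "'a elem opetope \<Rightarrow> 'a elem \<Rightarrow> 'a elem set" where
  "op_delta X (Cell k x) =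
     (if k > 0 then Cell (k - 1) ` leaves (op_subtree X (nat k + 1) x) else {})"
| "op_delta X (Atom x) = {}"

definition op_faces :: "'a elem opetope \<Rightarrow> 'a elem mop" where
  "op_faces X = \<lparr>cells = op_cells X, dim = P_dim, delta = op_delta X, gamma = op_gamma X,
                 lord = \<lambda>x z. {}\<rparr>"

definition op_lord :: "'a elem opetope \<Rightarrow> 'a elem \<Rightarrow> 'a elem \<Rightarrow> ('a elem \<times> 'a elem) set" where
  "op_lord X A B =
     {(Cell (int k - 1) y, Cell (int k - 1) y') | k y y' x z.
        A = Cell (int k) x \<and> B = Cell (int k - 2) z \<and> A \<in> Lam (op_faces X) \<and> y \<noteq> y' \<and>
        Cell (int k - 1) y \<in> local_loops (op_faces X) A B \<and>
        Cell (int k - 1) y' \<in> local_loops (op_faces X) A B \<and>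
        (\<forall>w w'. Inr w \<in> op_dots X k (Inr y) \<and> Inr w' \<in> op_dots X k (Inr y') \<longrightarrow>
           (w, w') \<in> wless (osub X k) z)}"

text \<open>The construction of P read off from the trees of \<open>X\<close> alone. It is applied
  to \<open>ext_op Y\<close>, which gives P(Y), and to \<open>Z_ext C\<close>.\<close>

definition op_mop :: "'a elem opetope \<Rightarrow> 'a elem mop" where
  "op_mop X = (op_faces X)\<lparr>lord := op_lord X\<rparr>"

lemma op_mop_simps [simp]:
  "cells (op_mop X) = op_cells X" "dim (op_mop X) = P_dim" "delta (op_mop X) = op_delta X"
  "gamma (op_mop X) = op_gamma X" "lord (op_mop X) = op_lord X"
  by (auto simp: op_mop_def op_faces_def)

lemma op_faces_face: "face (op_faces X) = face (op_mop X)"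
  by (intro ext) (auto simp: face_def op_mop_def)

lemma op_faces_Lam: "Lam (op_faces X) = Lam (op_mop X)"
  by (auto simp: Lam_def op_mop_def)

lemma op_faces_loops: "local_loops (op_faces X) = local_loops (op_mop X)"
  by (intro ext) (auto simp: local_loops_def op_faces_face)

lemma (in tree) root_target: "nodes T \<noteq> {} \<Longrightarrow> \<exists>a. (root T, a) \<in> ttarget T"
proof -
  assume "nodes T \<noteq> {}"
  then obtain a where "a \<in> nodes T" by blast
  hence "desc T (Inl a) (Inr (root T))" using desc_root by simp
  then obtain z where "(z, Inr (root T)) \<in> desc_step T" using desc_lastE[of "Inl a" "Inr (root T)"] by blast
  thus ?thesis by (blast elim: desc_step_InrE)
qed

lemma (in tree) edge_adjacent: "nodes T \<noteq> {} \<Longrightarrow> e \<in> edges T \<Longrightarrow> \<exists>a. (e, a) \<in> ttarget T \<or> (e, a) \<in> tsource T"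
proof (cases "e = root T")
  case True
  assume "nodes T \<noteq> {}"
  thus ?thesis using root_target True by blast
next
  case False
  assume "e \<in> edges T"
  hence "desc T (Inr e) (Inr (root T))" using desc_root by simp
  then obtain z where "(Inr e, z) \<in> desc_step T" using False by (auto elim: desc_firstE)
  thus ?thesis by (cases z) auto
qed

lemma (in tree) no_nodes_edges: "nodes T = {} \<Longrightarrow> edges T = {root T}"
proof -
  assume n: "nodes T = {}"
  have "e = root T" if "e \<in> edges T" for e
  proof (rule ccontr)
    assume "e \<noteq> root T"
    moreover have "desc T (Inr e) (Inr (root T))" using desc_root that by simp
    ultimately obtain z where "(Inr e, z) \<in> desc_step T" by (auto elim: desc_firstE)
    thus False using n source_mem by (cases z) auto
  qed
  thus ?thesis using root_mem by blast
qed

lemma (in tree) one_node: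
  assumes n: "nodes T = {p}"
  shows "edges T = insert (root T) (leaves T)" "root T \<notin> leaves T"
    "ttarget T = {(root T, p)}" "tsource T = leaves T \<times> {p}"
proof -
  obtain a where a: "(root T, a) \<in> ttarget T" using root_target n by blast
  hence tg: "(root T, p) \<in> ttarget T" using target_mem[OF a] n by simp
  show t: "ttarget T = {(root T, p)}"
  proof (rule equalityI, rule subrelI)
    fix b a assume ba: "(b, a) \<in> ttarget T"
    hence "a = p" using target_mem[OF ba] n by simp
    thus "(b, a) \<in> {(root T, p)}" using target_unique[OF _ tg] ba by simp
  qed (use tg in simp)
  hence l: "leaves T = edges T - {root T}" by (auto simp: leaves_def)
  thus "edges T = insert (root T) (leaves T)" "root T \<notin> leaves T" using root_mem by auto
  have "(b, a) \<in> tsource T \<longleftrightarrow> b \<in> leaves T \<and> a = p" for b a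
    using source_mem[of b] root_not_source[of a] n l edge_adjacent[of b] t by (cases "b = root T") auto
  thus "tsource T = leaves T \<times> {p}" by auto
qed

text \<open>An opetope to which the corolla and the unit tree of the definition of \<open>P\<close> have already been
  added; \<open>op_mop X\<close> is the complex read off from the trees of \<open>X\<close> itself.\<close>

locale extended =
  fixes X :: "'a elem opetope"
  assumes opetope: "is_opetope X" and two: "2 \<le> odim X" and unit: "nodes (otree X (odim X)) = {}"
begin

abbreviation "M \<equiv> op_mop X"
abbreviation "tr \<equiv> otree X"
abbreviation "sb \<equiv> osub X"

lemma tree_level: "k \<le> odim X \<Longrightarrow> tree (tr k)"
  using opetope by (auto simp: is_opetope_def tree_def)

lemma level: "k < odim X \<Longrightarrow> constellation (tr k) (sb k) (tr (Suc k))"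
proof -
  assume k: "k < odim X"
  hence e: "exact_constellation (tr k) (sb k) (tr (Suc k))"
    using opetope by (auto simp: is_opetope_def)
  thus ?thesis
    by (simp add: constellation_def stree_def stree_axioms_def constellation_axioms_def tree_def
        exact_constellation_def is_constellation_def)
qed

abbreviation incid :: "nat \<Rightarrow> int \<Rightarrow> 'a elem \<Rightarrow> 'a elem \<Rightarrow> bool" where
  "incid k \<equiv> constellation.inc (tr k) (sb k) (tr (Suc k))"

lemma op_dots_above: "k < odim X \<Longrightarrow> op_dots X k (Inr x) = constellation.above (tr k) (sb k) (tr (Suc k)) x"
  by (simp add: op_dots_def constellation.above_def[OF level])

lemma subtree_iff:
  assumes "k < odim X" "x \<in> edges (tr (Suc k))"
  shows "root (op_subtree X k x) = c \<longleftrightarrow> incid k 1 c x \<or> incid k 0 c x"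
    and "c \<in> leaves (op_subtree X k x) \<longleftrightarrow> incid k (-1) c x \<or> incid k 0 c x"
  using constellation.root_iff[OF level[OF assms(1)] assms(2)] op_dots_above[OF assms(1)]
  by (auto simp: op_subtree_def)

lemma low_shape:
  assumes "k < 2"
  shows "\<exists>p l. nodes (tr k) = {p} \<and> leaves (tr k) = {l} \<and> edges (tr k) = {root (tr k), l} \<and> l \<noteq> root (tr k) \<and>
   ttarget (tr k) = {(root (tr k), p)} \<and> tsource (tr k) = {(l, p)}"
proof -
  have u: "unary_corolla (tr k)" using opetope two assms by (auto simp: is_opetope_def less_2_cases_iff)
  interpret T: tree "tr k" using tree_level two assms by simp
  obtain p l where "nodes (tr k) = {p}" "leaves (tr k) = {l}" using u by (auto simp: unary_corolla_def is_singleton_def)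
  thus ?thesis using T.one_node[of p] by auto
qed

text \<open>The linear tree in degree 2 has no null dots, so degree 1 has a single dot, a black one,
  and this dot lies above every edge of degree 2.\<close>

lemma incid_one: "x \<in> edges (tr 2) \<Longrightarrow> incid 1 s (root (tr 1)) x \<longleftrightarrow> s = 1"
proof -
  assume x: "x \<in> edges (tr 2)"
  interpret C: constellation "tr 1" "sb 1" "tr 2" using level[of 1] two by (simp add: numeral_2_eq_2)
  obtain p l where pl: "nodes (tr 1) = {p}" "l \<noteq> root (tr 1)"
    "ttarget (tr 1) = {(root (tr 1), p)}" "tsource (tr 1) = {(l, p)}" using low_shape[of 1] by auto
  have "null_dots (tr 2) = {}" using opetope two
    by (auto simp: is_opetope_def linear_tree_def null_dots_def)
  hence "dots (tr 1) (sb 1) = {Inl p}" using C.whites_eq pl by (auto simp: dots_def)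
  hence a: "C.above x = {Inl p}" using C.above_dots[of x] C.above_nonempty[OF x] by auto
  have "leaves_at (tr 1) (C.above x) (root (tr 1))" "\<not> enters (tr 1) (C.above x) (root (tr 1))"
    using pl a by (auto simp: leaves_at_def enters_def upper_in_def lower_in_def)
  moreover have "\<not> C.above x \<subseteq> Inr ` wset (sb 1) (root (tr 1))" using a by auto
  ultimately have "C.inc s (root (tr 1)) x \<longleftrightarrow> s = 1" using x C.root_mem unfolding C.inc_def by blast
  thus ?thesis by (simp add: numeral_2_eq_2)
qed

text \<open>The extra condition for \<open>k = 0\<close> reflects that the leaf of the tree in
  degree 1 has sign -1 in every edge of degree 2, whereas 0-cells have no sources by
  definition.\<close>

lemma face_iff:
  assumes k: "k + 2 \<le> odim X" and x: "x \<in> edges (tr (k + 2))"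
  shows "face M s A (Cell (int k) x) \<longleftrightarrow>
    (\<exists>z. A = Cell (int k - 1) z \<and> incid (Suc k) s z x \<and> (k = 0 \<longrightarrow> z = root (tr 1)))"
proof -
  have c: "Cell (int k) x \<in> op_cells X" using k x by (auto simp: op_cells_def)
  have k': "Suc k < odim X" "x \<in> edges (tr (Suc (Suc k)))" using k x by auto
  interpret C: constellation "tr (Suc k)" "sb (Suc k)" "tr (Suc (Suc k))" using level k' by blast
  note s = subtree_iff[OF k']
  have ex: "C.inc s z x \<Longrightarrow> s = 1 \<or> s = -1 \<or> s = 0" for z using C.inc_sign[of s z x] by auto
  show ?thesis
  proof (cases "k = 0")
    case True
    have r: "root (op_subtree X 1 x) = root (tr 1)"
      using s(1)[of "root (tr 1)"] incid_one[of x] True k' by (simp add: numeral_2_eq_2)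
    show ?thesis using c True r incid_one[of x] k' by (auto simp: face_def numeral_2_eq_2)
  next
    case False
    have s1: "z = root (op_subtree X (Suc k) x) \<longleftrightarrow> C.inc 1 z x \<or> C.inc 0 z x" for z
      using s(1)[of z] by (simp add: eq_commute)
    have g: "A \<in> op_gamma X (Cell (int k) x) \<longleftrightarrow> (\<exists>z. A = Cell (int k - 1) z \<and> (C.inc 1 z x \<or> C.inc 0 z x))"
      using s1 by auto
    have d: "A \<in> op_delta X (Cell (int k) x) \<longleftrightarrow> (\<exists>z. A = Cell (int k - 1) z \<and> (C.inc (-1) z x \<or> C.inc 0 z x))"
      using s(2) False by auto
    have "face M s A (Cell (int k) x) \<longleftrightarrow> (\<exists>z. A = Cell (int k - 1) z \<and> C.inc s z x)"
    proof (cases "\<exists>z. A = Cell (int k - 1) z")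
      case True
      then obtain z where z: "A = Cell (int k - 1) z" by blast
      have "\<not> (C.inc 1 z x \<and> C.inc (-1) z x)" "\<not> (C.inc 1 z x \<and> C.inc 0 z x)" "\<not> (C.inc (-1) z x \<and> C.inc 0 z x)"
        using C.inc_exclusive[of 1 z x "-1"] C.inc_exclusive[of 1 z x 0] C.inc_exclusive[of "-1" z x 0] by auto
      thus ?thesis unfolding face_def op_mop_simps Diff_iff Int_iff g d
        using c z ex[of z] by auto
    next
      case False
      thus ?thesis unfolding face_def op_mop_simps Diff_iff Int_iff g d by blast
    qed
    thus ?thesis using False by blast
  qed
qed

lemma cellE:
  assumes "A \<in> op_cells X"
  obtains "A = Cell (-1) (root (tr 1))"
  | k x where "A = Cell (int k) x" "k + 2 \<le> odim X" "x \<in> edges (tr (k + 2))"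
  using assms by (auto simp: op_cells_def)

lemma cell_iff: "Cell (int k) x \<in> op_cells X \<longleftrightarrow> k + 2 \<le> odim X \<and> x \<in> edges (tr (k + 2))"
  by (auto simp: op_cells_def)

lemma no_face_bottom: "\<not> face M s A (Cell (-1) x)"
  by (auto simp: face_def)

lemma faceE:
  assumes "face M s A B"
  obtains k z x where "A = Cell (int k - 1) z" "B = Cell (int k) x" "k + 2 \<le> odim X" "x \<in> edges (tr (k + 2))"
    "incid (Suc k) s z x" "k = 0 \<longrightarrow> z = root (tr 1)" "z \<in> edges (tr (Suc k))"
proof -
  have "B \<in> op_cells X" using assms by (auto simp: face_def)
  then obtain k x where B: "B = Cell (int k) x" "k + 2 \<le> odim X" "x \<in> edges (tr (k + 2))"
    using assms no_face_bottom by (elim cellE) auto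
  then obtain z where z: "A = Cell (int k - 1) z" "incid (Suc k) s z x" "k = 0 \<longrightarrow> z = root (tr 1)"
    using assms face_iff[OF B(2,3)] by blast
  have "z \<in> edges (tr (Suc k))" using constellation.inc_mem[OF level z(2)] B by simp
  thus thesis using that z B by blast
qed

lemma face_cell: "face M s A B \<Longrightarrow> A \<in> op_cells X"
proof (elim faceE)
  fix k z x assume a: "A = Cell (int k - 1) z" "k + 2 \<le> odim X" "k = 0 \<longrightarrow> z = root (tr 1)" "z \<in> edges (tr (Suc k))"
  show "A \<in> op_cells X"
  proof (cases k)
    case 0 thus ?thesis using a by (auto simp: op_cells_def)
  next
    case (Suc j) thus ?thesis using a cell_iff[of j z] by simp
  qed
qed

lemma finite_cells: "finite (op_cells X)"
proof -
  have "{Cell (int k) x | k x. k + 2 \<le> odim X \<and> x \<in> edges (tr (k + 2))} =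
    (\<Union>k\<in>{k. k + 2 \<le> odim X}. Cell (int k) ` edges (tr (k + 2)))" by auto
  moreover have "finite {k. k + 2 \<le> odim X}" by (rule finite_subset[of _ "{..odim X}"]) auto
  ultimately show ?thesis using tree.finite_edges[OF tree_level] by (auto simp: op_cells_def)
qed

lemma face_leaf:
  assumes k: "k + 2 \<le> odim X" and x: "x \<in> leaves (tr (k + 2))"
  shows "face M s A (Cell (int k) x) \<longleftrightarrow> (\<exists>z. A = Cell (int k - 1) z \<and>
     (s = 1 \<and> (z, x) \<in> ttarget (tr (Suc k)) \<or> s = -1 \<and> k > 0 \<and> (z, x) \<in> tsource (tr (Suc k))))"
proof -
  have k': "Suc k < odim X" "x \<in> leaves (tr (Suc (Suc k)))" "x \<in> edges (tr (k + 2))"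
    using k x by (auto simp: leaves_def)
  interpret C: constellation "tr (Suc k)" "sb (Suc k)" "tr (Suc (Suc k))" using level k' by blast
  have i: "C.inc s z x \<longleftrightarrow> s = 1 \<and> (z, x) \<in> ttarget (tr (Suc k)) \<or> s = -1 \<and> (z, x) \<in> tsource (tr (Suc k))" for z
    using C.inc_leaf[OF k'(2), of z] C.inc_sign[of s z x] by auto
  show ?thesis using low_shape[of 1] face_iff[OF k k'(3)] i by auto
qed

text \<open>The last tree has no nodes, so a node with target \<open>x\<close> forces a further
  degree, in which this node is a leaf and so a cell with target \<open>x\<close>.\<close>

lemma nonleaf_target:
  assumes k: "k + 2 \<le> odim X" and x: "x \<in> edges (tr (k + 2))" "x \<notin> leaves (tr (k + 2))"
  shows "\<exists>a. (x, a) \<in> ttarget (tr (k + 2)) \<and> k + 3 \<le> odim X \<and> a \<in> leaves (tr (k + 3)) \<and>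
    face M 1 (Cell (int k) x) (Cell (int (Suc k)) a)"
proof -
  obtain a where a: "(x, a) \<in> ttarget (tr (k + 2))" using x by (auto simp: leaves_def)
  hence "a \<in> nodes (tr (k + 2))" using tree.target_mem[OF tree_level[OF k]] by blast
  hence "k + 2 \<noteq> odim X" using unit by auto
  hence k3: "k + 3 \<le> odim X" using k by simp
  interpret C: constellation "tr (k + 2)" "sb (k + 2)" "tr (k + 3)"
    using level[of "k + 2"] k3 by (simp add: numeral_3_eq_3)
  have al: "a \<in> leaves (tr (k + 3))" using C.nodes_eq \<open>a \<in> nodes (tr (k + 2))\<close> by simp
  have "face M 1 (Cell (int k) x) (Cell (int (Suc k)) a)"
    using face_leaf[of "Suc k" a 1 "Cell (int k) x"] k3 al a by (simp add: numeral_3_eq_3)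
  thus ?thesis using a k3 al by blast
qed

text \<open>If \<open>x\<close> is the positive face of a cell, then the upper node of
  \<open>x\<close> is one of the dots above that cell, so \<open>x\<close> is not a leaf. The
  converse is \<open>nonleaf_target\<close>.\<close>

lemma Lam_iff:
  assumes k: "k + 2 \<le> odim X" and x: "x \<in> edges (tr (k + 2))"
  shows "Cell (int k) x \<in> Lam M \<longleftrightarrow> x \<in> leaves (tr (k + 2))"
proof -
  have L: "Cell (int k) x \<in> Lam M \<longleftrightarrow> \<not> (\<exists>B. face M 1 (Cell (int k) x) B)"
    using k x by (auto simp: Lam_def face_def cell_iff)
  have "x \<notin> leaves (tr (k + 2))" if "face M 1 (Cell (int k) x) B" for B
    using that
  proof (elim faceE)
    fix j z y assume a: "Cell (int k) x = Cell (int j - 1) z" "j + 2 \<le> odim X" "y \<in> edges (tr (j + 2))"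
      "incid (Suc j) 1 z y"
    hence j: "j = Suc k" "z = x" by auto
    interpret C: constellation "tr (Suc j)" "sb (Suc j)" "tr (Suc (Suc j))" using level a(2) by simp
    have "C.inc 1 x y" using a(4) j by simp
    then obtain u where "(x, u) \<in> ttarget (tr (Suc j))" by (auto simp: C.inc_def leaves_at_def upper_in_def)
    thus ?thesis using j by (auto simp: leaves_def)
  qed
  thus ?thesis using L nonleaf_target[OF k x] by blast
qed

lemma Lam_cell: "A \<in> Lam M \<Longrightarrow> \<exists>k x. A = Cell (int k) x \<and> k + 2 \<le> odim X \<and> x \<in> leaves (tr (k + 2))"
proof -
  assume A: "A \<in> Lam M"
  hence "A \<in> op_cells X" by (auto simp: Lam_def)
  thus ?thesis
  proof (cases rule: cellE)
    case 1
    interpret T: tree "tr 2" using tree_level two by simp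
    have "root (tr 2) \<in> edges (tr (0 + 2))" "0 + 2 \<le> odim X" using T.root_mem two by (simp_all add: numeral_2_eq_2)
    hence "face M 1 (Cell (-1) (root (tr 1))) (Cell (int 0) (root (tr 2)))"
      using face_iff[of 0 "root (tr 2)" 1] incid_one[of "root (tr 2)" 1] by (simp add: numeral_2_eq_2)
    hence "\<exists>B. face M 1 A B" using 1 by blast
    thus ?thesis using A by (auto simp: Lam_def face_def)
  next
    case (2 k x)
    thus ?thesis using A Lam_iff by blast
  qed
qed

end

context extended
begin

lemma loops_iff:
  assumes k: "k + 2 \<le> odim X" and x: "x \<in> leaves (tr (k + 2))"
  shows "P \<in> local_loops M (Cell (int k) x) B \<longleftrightarrow>
    (\<exists>y z. P = Cell (int k - 1) y \<and> B = Cell (int k - 2) z \<and> 2 \<le> k \<and> (y, x) \<in> tsource (tr (Suc k)) \<and> incid k 0 z y)"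
proof -
  have f: "face M (-1) P (Cell (int k) x) \<longleftrightarrow> (\<exists>y. P = Cell (int k - 1) y \<and> k > 0 \<and> (y, x) \<in> tsource (tr (Suc k)))"
    using face_leaf[OF k x] by auto
  have g: "face M 0 B (Cell (int k - 1) y) \<longleftrightarrow> (\<exists>z. B = Cell (int k - 2) z \<and> 2 \<le> k \<and> incid k 0 z y)"
    if y: "(y, x) \<in> tsource (tr (Suc k))" "k > 0" for y
  proof -
    obtain j where j: "k = Suc j" using y by (cases k) auto
    have yE: "y \<in> edges (tr (j + 2))" using tree.source_mem[OF tree_level y(1)] k j by simp
    have jk: "j + 2 \<le> odim X" using k j by simp
    have "j = 0 \<Longrightarrow> \<not> incid (Suc j) 0 (root (tr 1)) y" using incid_one[of y 0] yE by (simp add: numeral_2_eq_2)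
    thus ?thesis using face_iff[OF jk yE, of 0 B] j by (cases "j = 0") auto
  qed
  show ?thesis unfolding local_loops_def mem_Collect_eq f using g by auto
qed

lemma lord_iff:
  assumes k: "k + 2 \<le> odim X" and x: "x \<in> leaves (tr (k + 2))"
  shows "(P, P') \<in> op_lord X (Cell (int k) x) B \<longleftrightarrow>
    (\<exists>y y' z. P = Cell (int k - 1) y \<and> P' = Cell (int k - 1) y' \<and> B = Cell (int k - 2) z \<and> y \<noteq> y' \<and>
       P \<in> local_loops M (Cell (int k) x) B \<and> P' \<in> local_loops M (Cell (int k) x) B \<and>
       (\<forall>w w'. Inr w \<in> op_dots X k (Inr y) \<and> Inr w' \<in> op_dots X k (Inr y') \<longrightarrow> (w, w') \<in> wless (sb k) z))"
proof -
  have "Cell (int k) x \<in> Lam M" using Lam_iff[OF k] x by (auto simp: leaves_def)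
  thus ?thesis by (auto simp: op_lord_def op_faces_Lam op_faces_loops)
qed

text \<open>Loops on \<open>z\<close> among the sources of one node have disjoint, nonempty and
  convex sets of white dots on the edge \<open>z\<close>, and such intervals of a linear order are
  linearly ordered. Transitivity uses that the middle interval is nonempty.\<close>

lemma lord_linear:
  assumes k: "k + 2 \<le> odim X" and x: "x \<in> leaves (tr (k + 2))"
  shows "strict_linear_order_on (local_loops M (Cell (int k) x) B) (op_lord X (Cell (int k) x) B)"
proof -
  let ?A = "Cell (int k) x"
  have kk: "k < odim X" using k by simp
  interpret C: constellation "tr k" "sb k" "tr (Suc k)" using level[OF kk] .
  have ne: "\<exists>w. Inr w \<in> C.above y" if "C.inc 0 z y" for z y
    using that C.above_nonempty by (auto simp: C.inc_def)
  have disj: "C.above y \<inter> C.above y' = {}" if "(y, x) \<in> tsource (tr (Suc k))" "(y', x) \<in> tsource (tr (Suc k))" "y \<noteq> y'" for y y'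
    using that C.U.sources_disjoint by (auto simp: C.above_def)
  note l = lord_iff[OF k x] and lp = loops_iff[OF k x] and ab = op_dots_above[OF kk]
  have irr: "(P, P) \<notin> op_lord X ?A B" for P using l by auto
  have "(P, P'') \<in> op_lord X ?A B" if a: "(P, P') \<in> op_lord X ?A B" "(P', P'') \<in> op_lord X ?A B" for P P' P''
  proof -
    from a(1) obtain y y' z where 1: "P = Cell (int k - 1) y" "P' = Cell (int k - 1) y'" "B = Cell (int k - 2) z"
      "P \<in> local_loops M ?A B" "P' \<in> local_loops M ?A B"
      "\<And>w w'. Inr w \<in> C.above y \<Longrightarrow> Inr w' \<in> C.above y' \<Longrightarrow> (w, w') \<in> wless (sb k) z"
      unfolding l ab by blast
    from a(2) obtain y'' where 2: "P'' = Cell (int k - 1) y''" "P'' \<in> local_loops M ?A B"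
      "\<And>w w'. Inr w \<in> C.above y' \<Longrightarrow> Inr w' \<in> C.above y'' \<Longrightarrow> (w, w') \<in> wless (sb k) z"
      unfolding l ab using 1 by auto
    have i: "C.inc 0 z y" "C.inc 0 z y'" using 1 by (auto simp: lp)
    hence z: "z \<in> edges (tr k)" by (auto simp: C.inc_def)
    obtain w w' where w: "Inr w \<in> C.above y" "Inr w' \<in> C.above y'" using i ne by blast
    have t: "(v, v'') \<in> wless (sb k) z" if "Inr v \<in> C.above y" "Inr v'' \<in> C.above y''" for v v''
      using 1(6)[OF that(1) w(2)] 2(3)[OF w(2) that(2)] transD[OF C.wless_trans[OF z]] by blast
    have "y \<noteq> y''" using t w C.wless_irrefl[OF z] by blast
    thus ?thesis unfolding l ab using 1 2 t by blast
  qed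
  moreover have "(P, P') \<in> op_lord X ?A B \<or> (P', P) \<in> op_lord X ?A B"
    if P: "P \<in> local_loops M ?A B" "P' \<in> local_loops M ?A B" "P \<noteq> P'" for P P'
  proof -
    obtain y y' z where 1: "P = Cell (int k - 1) y" "P' = Cell (int k - 1) y'" "B = Cell (int k - 2) z"
      "C.inc 0 z y" "C.inc 0 z y'" "(y, x) \<in> tsource (tr (Suc k))" "(y', x) \<in> tsource (tr (Suc k))"
      using P(1,2) unfolding lp by auto
    have yy: "y \<noteq> y'" using P 1 by auto
    have z: "z \<in> edges (tr k)" using 1 by (auto simp: C.inc_def)
    note d = disj[OF 1(6,7) yy]
    obtain w w' where w: "Inr w \<in> C.above y" "Inr w' \<in> C.above y'" using 1 ne by blast
    hence "w \<in> wset (sb k) z" "w' \<in> wset (sb k) z" "w \<noteq> w'" using 1 d by (auto simp: C.inc_def)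
    then consider "(w, w') \<in> wless (sb k) z" | "(w', w) \<in> wless (sb k) z" using C.wless_total[OF z] by blast
    thus ?thesis
    proof cases
      case 1
      have "(P, P') \<in> op_lord X ?A B" unfolding l ab
        using \<open>P = _\<close> \<open>P' = _\<close> \<open>B = _\<close> P C.loops_separated[OF \<open>C.inc 0 z y\<close> \<open>C.inc 0 z y'\<close> d w 1] by blast
      thus ?thesis ..
    next
      case 2
      have "(P', P) \<in> op_lord X ?A B" unfolding l ab
        using \<open>P = _\<close> \<open>P' = _\<close> \<open>B = _\<close> P C.loops_separated[OF \<open>C.inc 0 z y'\<close> \<open>C.inc 0 z y\<close> _ w(2,1) 2] d by (metis Int_commute)
      thus ?thesis ..
    qed
  qed
  ultimately show ?thesis using irr
    unfolding strict_linear_order_on_def trans_def irrefl_def total_on_def by blast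
qed

lemma op_mop_mop: "is_mop M"
  unfolding is_mop_def
proof (intro conjI ballI impI allI)
  show "finite (cells M)" using finite_cells by simp
next
  fix A assume A: "A \<in> cells M"
  thus "-1 \<le> dim M A" by (auto elim: cellE)
  show "dim M A = -1 \<Longrightarrow> delta M A = {}" "dim M A = -1 \<Longrightarrow> gamma M A = {}"
    using A by (auto elim: cellE)
  assume d: "0 \<le> dim M A"
  obtain k x where k: "A = Cell (int k) x" "k + 2 \<le> odim X" "x \<in> edges (tr (k + 2))"
    using A d by (auto elim: cellE)
  have del: "B \<in> delta M A \<longleftrightarrow> face M (-1) B A \<or> face M 0 B A" for B
    using A by (auto simp: face_def)
  have gam: "B \<in> gamma M A \<longleftrightarrow> face M 1 B A \<or> face M 0 B A" for B
    using A by (auto simp: face_def)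
  have "B \<in> cells_dim M (dim M A - 1)" if "face M s B A" for B s
    using face_cell[OF that] that k face_iff[OF k(2,3)] by (auto simp: cells_dim_def)
  thus "delta M A \<subseteq> cells_dim M (dim M A - 1)"
    "gamma M A \<subseteq> cells_dim M (dim M A - 1)"
    unfolding subset_iff del gam by blast+
  show "is_singleton (gamma M A)" using k by simp
next
  fix A assume A: "A \<in> cells M" "delta M A \<inter> gamma M A \<noteq> {}"
  then obtain B where B: "face M 0 B A" by (auto simp: face_def)
  then obtain k z x where k: "B = Cell (int k - 1) z" "A = Cell (int k) x" "k + 2 \<le> odim X" "x \<in> edges (tr (k + 2))"
    "incid (Suc k) 0 z x" by (auto elim: faceE)
  interpret C: constellation "tr (Suc k)" "sb (Suc k)" "tr (Suc (Suc k))" using level k by simp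
  have "B' = B \<and> s = 0" if f: "face M s B' A" for s B' by (metis f face_iff k(3,4) k(2) C.inc_loop_unique k(5) k(1))
  moreover have "B' \<in> delta M A \<longleftrightarrow> face M (-1) B' A \<or> face M 0 B' A"
    "B' \<in> gamma M A \<longleftrightarrow> face M 1 B' A \<or> face M 0 B' A" for B'
    using A by (auto simp: face_def)
  ultimately show "delta M A = gamma M A" by fastforce
next
  show "\<exists>!s. s \<in> cells_dim M (-1)"
    by (rule ex1I[of _ "Cell (-1) (root (tr 1))"]) (auto simp: cells_dim_def op_cells_def)
next
  fix A assume "A \<in> cells_dim M 0"
  hence A: "A \<in> op_cells X" "P_dim A = 0" by (auto simp: cells_dim_def)
  then obtain x where x: "A = Cell (int 0) x" "0 + 2 \<le> odim X" "x \<in> edges (tr (0 + 2))" by (auto elim: cellE)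
  have "B \<in> gamma M A - delta M A \<longleftrightarrow> face M 1 B A" for B
    using A by (auto simp: face_def)
  moreover have "face M 1 B A \<longleftrightarrow> B = Cell (-1) (root (tr 1))" for B
    using face_iff[OF x(2,3), of 1 B] incid_one[of x 1] x by (auto simp: numeral_2_eq_2)
  moreover have "cells_dim M (-1) = {Cell (-1) (root (tr 1))}"
    by (auto simp: cells_dim_def op_cells_def)
  ultimately show "gamma M A - delta M A = cells_dim M (-1)"
    by blast
next
  fix A B
  show "if A \<in> Lam M \<and> B \<in> (\<Union>y\<in>bdry M A. bdry M y)
        then lord M A B \<subseteq> local_loops M A B \<times> local_loops M A B \<and>
             strict_linear_order_on (local_loops M A B) (lord M A B)
        else lord M A B = {}"
  proof (cases "A \<in> Lam M")
    case False
    thus ?thesis by (auto simp: op_lord_def op_faces_Lam)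
  next
    case True
    have sub: "op_lord X A B \<subseteq> local_loops M A B \<times> local_loops M A B"
      by (auto simp: op_lord_def op_faces_loops)
    obtain k x where k: "A = Cell (int k) x" "k + 2 \<le> odim X" "x \<in> leaves (tr (k + 2))"
      using Lam_cell[OF True] by blast
    show ?thesis
    proof (cases "B \<in> (\<Union>y\<in>bdry M A. bdry M y)")
      case True
      thus ?thesis using sub lord_linear[OF k(2,3)] k(1) \<open>A \<in> Lam _\<close> by simp
    next
      case False
      hence "local_loops M A B = {}" by (auto simp: local_loops_def face_def bdry_def)
      thus ?thesis using sub False by auto
    qed
  qed
qed

text \<open>If the tree has nodes, each edge touches one, which is a leaf one degree up. A unit tree
  has a single edge carrying all dots of its degree, and the root one degree up is a loop on
  it.\<close>

lemma prec_up:
  assumes k: "k + 3 \<le> odim X" and x: "x \<in> edges (tr (k + 2))"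
  shows "\<exists>y. y \<in> edges (tr (k + 3)) \<and> prec M (Cell (int k) x) (Cell (int (Suc k)) y)"
proof -
  have fp: "face M s P Q \<Longrightarrow> prec M P Q" for s P Q
    by (auto simp: face_def prec_def bdry_def)
  have k': "Suc k + 2 \<le> odim X" using k by simp
  interpret C: constellation "tr (k + 2)" "sb (k + 2)" "tr (k + 3)"
    using level[of "k + 2"] k by (simp add: numeral_3_eq_3)
  show ?thesis
  proof (cases "nodes (tr (k + 2)) = {}")
    case False
    then obtain a where a: "(x, a) \<in> ttarget (tr (k + 2)) \<or> (x, a) \<in> tsource (tr (k + 2))"
      using C.edge_adjacent x by blast
    hence al: "a \<in> leaves (tr (k + 3))" using C.source_mem C.target_mem C.nodes_eq by blast
    hence "a \<in> leaves (tr (Suc k + 2))" by (simp add: numeral_3_eq_3)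
    hence "\<exists>s. face M s (Cell (int k) x) (Cell (int (Suc k)) a)"
      using face_leaf[OF k', of a _ "Cell (int k) x"] a by auto
    thus ?thesis using fp al by (auto simp: leaves_def)
  next
    case True
    have r: "root (tr (k + 3)) \<in> edges (tr (k + 3))" by (rule C.U.root_mem)
    have "C.above (root (tr (k + 3))) \<subseteq> Inr ` wset (sb (k + 2)) x"
      using C.above_dots[of "root (tr (k + 3))"] True C.no_nodes_edges[OF True] x
      by (auto simp: dots_def white_dots_def)
    hence "C.inc 0 x (root (tr (k + 3)))" unfolding C.inc_def using x r by blast
    hence "face M 0 (Cell (int k) x) (Cell (int (Suc k)) (root (tr (k + 3))))"
      using face_iff[OF k', of "root (tr (k + 3))" 0 "Cell (int k) x"] r by (simp add: numeral_3_eq_3)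
    thus ?thesis using fp r by blast
  qed
qed

definition top_elem :: "'a elem" where
  "top_elem = Cell (int (odim X - 2)) (root (tr (odim X)))"

lemma top_edges: "edges (tr (odim X)) = {root (tr (odim X))}"
  using tree.no_nodes_edges[OF tree_level unit] by simp

lemma greatest_top: "greatest_cell M top_elem"
  unfolding greatest_cell_def
proof (intro conjI ballI)
  obtain n where n: "odim X = n + 2" using two by (metis le_add_diff_inverse2)
  show "top_elem \<in> cells M" using top_edges n cell_iff[of n] by (simp add: top_elem_def)
  have up: "(Cell (int k) x, top_elem) \<in> le_rel M" if "k \<le> n" "x \<in> edges (tr (k + 2))" for k x
    using that
  proof (induction k arbitrary: x rule: inc_induct)
    case base
    thus ?case using top_edges n by (simp add: top_elem_def le_rel_def)
  next
    case (step k)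
    obtain y where y: "y \<in> edges (tr (k + 3))" "prec M (Cell (int k) x) (Cell (int (Suc k)) y)"
      using prec_up[of k x] step n by auto
    have "(Cell (int (Suc k)) y, top_elem) \<in> le_rel M"
      using step.IH[of y] y by (simp add: numeral_3_eq_3)
    thus ?case using y(2) unfolding le_rel_def by (auto intro: converse_rtrancl_into_rtrancl)
  qed
  fix A assume "A \<in> cells M"
  hence "A \<in> op_cells X" by simp
  thus "(A, top_elem) \<in> le_rel M"
  proof (cases rule: cellE)
    case 1
    interpret T: tree "tr 2" using tree_level two by simp
    have r: "root (tr 2) \<in> edges (tr (0 + 2))" "0 + 2 \<le> odim X" using T.root_mem two by (simp_all add: numeral_2_eq_2)
    hence "face M 1 A (Cell (int 0) (root (tr 2)))"
      using face_iff[of 0 "root (tr 2)" 1] incid_one[of "root (tr 2)" 1] 1 by (simp add: numeral_2_eq_2)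
    hence "prec M A (Cell (int 0) (root (tr 2)))" by (auto simp: face_def prec_def bdry_def)
    thus ?thesis using up[OF _ r(1)] unfolding le_rel_def by (auto intro: converse_rtrancl_into_rtrancl)
  next
    case (2 k x)
    thus ?thesis using up n by simp
  qed
qed

lemma two_levels:
  assumes "face M \<beta> P Q" "face M \<alpha> Q R"
  obtains j z y x where "P = Cell (int j - 1) z" "Q = Cell (int j) y" "R = Cell (int (Suc j)) x"
    "j + 3 \<le> odim X" "j + 2 \<le> odim X" "y \<in> edges (tr (j + 2))" "x \<in> edges (tr (Suc j + 2))" "incid (Suc j) \<beta> z y"
      "incid (Suc (Suc j)) \<alpha> y x"
    "j = 0 \<longrightarrow> z = root (tr 1)"
    "constellation2 (tr (Suc j)) (sb (Suc j)) (tr (Suc (Suc j))) (sb (Suc (Suc j))) (tr (Suc (Suc (Suc j))))"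
proof -
  obtain k y x where k: "Q = Cell (int k - 1) y" "R = Cell (int k) x" "k + 2 \<le> odim X" "x \<in> edges (tr (k + 2))"
    "incid (Suc k) \<alpha> y x" by (rule faceE[OF assms(2)], rule that)
  obtain j z y' where j: "P = Cell (int j - 1) z" "Q = Cell (int j) y'" "j + 2 \<le> odim X" "y' \<in> edges (tr (j + 2))"
    "incid (Suc j) \<beta> z y'" "j = 0 \<longrightarrow> z = root (tr 1)" by (rule faceE[OF assms(1)], rule that)
  have kj: "k = Suc j" "y' = y" using k(1) j(2) by auto
  have "constellation2 (tr (Suc j)) (sb (Suc j)) (tr (Suc (Suc j))) (sb (Suc (Suc j))) (tr (Suc (Suc (Suc j))))"
    unfolding constellation2_def using level k(3) kj by simp
  thus thesis using that[of j z y x] k j kj by simp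
qed

lemma two_levels_face:
  assumes "j + 3 \<le> odim X" "x \<in> edges (tr (Suc j + 2))"
  shows "face M \<beta> (Cell (int j - 1) z) (Cell (int j) y) \<and> face M \<alpha> (Cell (int j) y) (Cell (int (Suc j)) x) \<longleftrightarrow>
    incid (Suc j) \<beta> z y \<and> incid (Suc (Suc j)) \<alpha> y x \<and> (j = 0 \<longrightarrow> z = root (tr 1))"
proof -
  have f: "face M \<alpha> (Cell (int j) y) (Cell (int (Suc j)) x) \<longleftrightarrow> incid (Suc (Suc j)) \<alpha> y x"
    using face_iff[of "Suc j" x \<alpha> "Cell (int j) y"] assms by simp
  have "y \<in> edges (tr (j + 2))" if "incid (Suc (Suc j)) \<alpha> y x"
    using constellation.inc_mem[OF level that] assms by simp
  thus ?thesis using f face_iff[of j y \<beta> "Cell (int j - 1) z"] assms by auto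
qed

lemma op_mop_thin:
  assumes f: "face M \<beta> P Q" "face M \<alpha> Q R" "\<alpha> \<noteq> 0" "\<beta> \<noteq> 0"
  shows "\<exists>Q'. Q' \<noteq> Q \<and> (\<exists>\<alpha>' \<beta>'. \<alpha>' \<noteq> 0 \<and> \<beta>' \<noteq> 0 \<and> face M \<beta>' P Q' \<and> face M \<alpha>' Q' R)" (is ?A)
    and "Q' \<noteq> Q \<Longrightarrow> \<alpha>' \<noteq> 0 \<Longrightarrow> \<beta>' \<noteq> 0 \<Longrightarrow> face M \<beta>' P Q' \<Longrightarrow> face M \<alpha>' Q' R \<Longrightarrow> \<alpha> * \<beta> = - (\<alpha>' * \<beta>')"
proof -
  obtain j z y x where j: "P = Cell (int j - 1) z" "Q = Cell (int j) y" "R = Cell (int (Suc j)) x"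
    "j + 3 \<le> odim X" "j + 2 \<le> odim X" "y \<in> edges (tr (j + 2))" "x \<in> edges (tr (Suc j + 2))" "incid (Suc j) \<beta> z y"
      "incid (Suc (Suc j)) \<alpha> y x"
    "j = 0 \<longrightarrow> z = root (tr 1)"
    "constellation2 (tr (Suc j)) (sb (Suc j)) (tr (Suc (Suc j))) (sb (Suc (Suc j))) (tr (Suc (Suc (Suc j))))"
    by (rule two_levels[OF f(1,2)], rule that)
  interpret C: constellation2 "tr (Suc j)" "sb (Suc j)" "tr (Suc (Suc j))" "sb (Suc (Suc j))" "tr (Suc (Suc (Suc j)))"
    using j(11) .
  note ff = two_levels_face[OF j(4,7)]
  obtain y' a' b' where y': "y' \<noteq> y" "a' \<noteq> 0" "b' \<noteq> 0" "C.C1.inc b' z y'" "C.C2.inc a' y' x"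
    using C.thin(1)[OF j(8,9) f(3,4)] by blast
  hence "face M b' P (Cell (int j) y') \<and> face M a' (Cell (int j) y') R"
    using ff[of b' z y' a'] j by blast
  moreover have "Cell (int j) y' \<noteq> Q" using y' j by simp
  ultimately show ?A using y' by blast
  assume a: "Q' \<noteq> Q" "\<alpha>' \<noteq> 0" "\<beta>' \<noteq> 0" "face M \<beta>' P Q'" "face M \<alpha>' Q' R"
  obtain j2 z2 y2 x2 where j2: "P = Cell (int j2 - 1) z2" "Q' = Cell (int j2) y2" "R = Cell (int (Suc j2)) x2"
     "incid (Suc j2) \<beta>' z2 y2" "incid (Suc (Suc j2)) \<alpha>' y2 x2" by (rule two_levels[OF a(4,5)], rule that)
  hence "j2 = j" "z2 = z" "x2 = x" using j by auto
  thus "\<alpha> * \<beta> = - (\<alpha>' * \<beta>')" using C.thin(2)[OF j(8,9) f(3,4)] j2 a j by simp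
qed

lemma op_mop_dfc: "is_dfc M"
  unfolding is_dfc_def
proof (intro conjI)
  show "is_mop M" by (rule op_mop_mop)
  show "\<exists>w. greatest_cell M w \<and> 0 \<le> dim M w"
    using greatest_top by (intro exI[of _ top_elem]) (simp add: top_elem_def)
  show "\<forall>z y. face M 0 z y \<longrightarrow> (\<exists>x. face M 1 y x)"
  proof (intro allI impI)
    fix P Q assume "face M 0 P Q"
    then obtain k z y where k: "Q = Cell (int k) y" "k + 2 \<le> odim X" "y \<in> edges (tr (k + 2))" "incid (Suc k) 0 z y"
      by (auto elim: faceE)
    interpret C: constellation "tr (Suc k)" "sb (Suc k)" "tr (Suc (Suc k))" using level k by simp
    have "y \<notin> leaves (tr (k + 2))" using C.inc_zero_not_leaf k by simp
    thus "\<exists>x. face M 1 Q x" using nonleaf_target[OF k(2,3)] k(1) by blast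
  qed
  show "\<forall>x y z \<alpha> \<beta>. face M \<beta> z y \<and> face M \<alpha> y x \<and> \<alpha> \<noteq> 0 \<and> \<beta> \<noteq> 0 \<longrightarrow>
        (\<exists>!y'. y' \<noteq> y \<and> (\<exists>\<alpha>' \<beta>'. \<alpha>' \<noteq> 0 \<and> \<beta>' \<noteq> 0 \<and> face M \<beta>' z y' \<and> face M \<alpha>' y' x)) \<and>
        (\<forall>y' \<alpha>' \<beta>'. y' \<noteq> y \<and> \<alpha>' \<noteq> 0 \<and> \<beta>' \<noteq> 0 \<and> face M \<beta>' z y' \<and> face M \<alpha>' y' x \<longrightarrow>
           \<alpha> * \<beta> = - (\<alpha>' * \<beta>'))"
  proof (intro allI impI, elim conjE, intro conjI)
    fix R Q P \<alpha> \<beta>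
    assume f: "face M \<beta> P Q" "face M \<alpha> Q R" "\<alpha> \<noteq> 0" "\<beta> \<noteq> 0"
    show "\<forall>y' \<alpha>' \<beta>'. y' \<noteq> Q \<and> \<alpha>' \<noteq> 0 \<and> \<beta>' \<noteq> 0 \<and> face M \<beta>' P y' \<and> face M \<alpha>' y' R \<longrightarrow>
           \<alpha> * \<beta> = - (\<alpha>' * \<beta>')"
      using op_mop_thin(2)[OF f] by blast
    show "\<exists>!y'. y' \<noteq> Q \<and> (\<exists>\<alpha>' \<beta>'. \<alpha>' \<noteq> 0 \<and> \<beta>' \<noteq> 0 \<and> face M \<beta>' P y' \<and> face M \<alpha>' y' R)"
    proof (rule ex_ex1I, rule op_mop_thin(1)[OF f], elim conjE exE, rule ccontr)
      fix y1 y2 \<alpha>1 \<beta>1 \<alpha>2 \<beta>2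
      assume 1: "y1 \<noteq> Q" "\<alpha>1 \<noteq> 0" "\<beta>1 \<noteq> 0" "face M \<beta>1 P y1" "face M \<alpha>1 y1 R"
        and 2: "y2 \<noteq> Q" "\<alpha>2 \<noteq> 0" "\<beta>2 \<noteq> 0" "face M \<beta>2 P y2" "face M \<alpha>2 y2 R" and ne: "y1 \<noteq> y2"
      \<comment> \<open>Three distinct chains would have pairwise opposite products of signs, which
        is impossible for nonzero integers.\<close>
      have "\<alpha> * \<beta> = - (\<alpha>1 * \<beta>1)" "\<alpha> * \<beta> = - (\<alpha>2 * \<beta>2)" "\<alpha>1 * \<beta>1 = - (\<alpha>2 * \<beta>2)"
        using op_mop_thin(2)[OF f 1] op_mop_thin(2)[OF f 2] op_mop_thin(2)[OF 1(4,5,2,3) ne[symmetric] 2(2-5)] by blast+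
      thus False using 1 2 by auto
    qed
  qed
  show "\<forall>x y z. face M 0 z y \<and> face M (-1) y x \<longrightarrow>
        (\<exists>y' \<alpha> \<beta>. y' \<noteq> y \<and> face M \<beta> z y' \<and> face M \<alpha> y' x \<and> (\<alpha>, \<beta>) \<noteq> (-1, 0))"
  proof (intro allI impI, elim conjE)
    fix R Q P assume f: "face M 0 P Q" "face M (-1) Q R"
    obtain j z y x where j: "P = Cell (int j - 1) z" "Q = Cell (int j) y" "R = Cell (int (Suc j)) x"
      "j + 3 \<le> odim X" "x \<in> edges (tr (Suc j + 2))" "incid (Suc j) 0 z y" "incid (Suc (Suc j)) (-1) y x"
      "j = 0 \<longrightarrow> z = root (tr 1)"
      "constellation2 (tr (Suc j)) (sb (Suc j)) (tr (Suc (Suc j))) (sb (Suc (Suc j))) (tr (Suc (Suc (Suc j))))"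
      by (rule two_levels[OF f], rule that)
    interpret C: constellation2 "tr (Suc j)" "sb (Suc j)" "tr (Suc (Suc j))" "sb (Suc (Suc j))" "tr (Suc (Suc (Suc j)))"
      using j(9) .
    obtain y' \<alpha> \<beta> where y': "y' \<noteq> y" "C.C1.inc \<beta> z y'" "C.C2.inc \<alpha> y' x" "(\<alpha>, \<beta>) \<noteq> (-1, 0)"
      using C.loop_source[OF j(6,7)] by blast
    have "face M \<beta> P (Cell (int j) y') \<and> face M \<alpha> (Cell (int j) y') R"
      using two_levels_face[OF j(4,5), of \<beta> z y' \<alpha>] y' j by blast
    moreover have "Cell (int j) y' \<noteq> Q" using y' j by simp
    ultimately show "\<exists>y' \<alpha> \<beta>. y' \<noteq> Q \<and> face M \<beta> P y' \<and> face M \<alpha> y' R \<and> (\<alpha>, \<beta>) \<noteq> (-1, 0)"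
      using y'(4) by blast
  qed
  show "\<forall>x\<in>cells M. dim M x \<ge> 1 \<longrightarrow>
        \<not> (\<exists>p y. p \<ge> 1 \<and> (\<forall>i<p. face M (-1) (y i) x \<and>
              (let y' = y (Suc i mod p) in
                 face M 1 (gam M y') y' \<and> face M (-1) (gam M y') (y i))))"
  proof (intro ballI impI notI, elim exE conjE)
    fix R p Y
    assume p: "(1::nat) \<le> p" and cyc: "\<forall>i<p. face M (-1) (Y i) R \<and>
              (let y' = Y (Suc i mod p) in
                 face M 1 (gam M y') y' \<and> face M (-1) (gam M y') (Y i))"
    let ?g = "\<lambda>i. gam M (Y i)"
    have cyc1: "face M 1 (?g i) (Y i)" if "i < p" for i
    proof -
      have "\<exists>j<p. Suc j mod p = i"
        using that by (cases i) (auto intro: exI[of _ "p - 1"] exI[of _ "i - 1"])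
      thus ?thesis using cyc by (auto simp: Let_def)
    qed
    have cyc2: "face M (-1) (?g (Suc i mod p)) (Y i)" if "i < p" for i
      using cyc that by (auto simp: Let_def)
    \<comment> \<open>The target of the next cell is a source of \<open>Y i\<close>, so it lies
      strictly above the target of \<open>Y i\<close>; all these targets are edges of one
      tree.\<close>
    have step: "\<exists>k z z'. ?g i = Cell (int k - 1) z \<and> ?g (Suc i mod p) = Cell (int k - 1) z' \<and> k + 2 \<le> odim X \<and>
       (Inr z', Inr z) \<in> (desc_step (tr (Suc k)))\<^sup>+" if i: "i < p" for i
    proof -
      obtain k z y where k: "?g i = Cell (int k - 1) z" "Y i = Cell (int k) y" "k + 2 \<le> odim X" "y \<in> edges (tr (k + 2))"
        "incid (Suc k) 1 z y" by (rule faceE[OF cyc1[OF i]], rule that)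
      obtain z' where z': "?g (Suc i mod p) = Cell (int k - 1) z'" "incid (Suc k) (-1) z' y"
        using cyc2[OF i] face_iff[OF k(3,4)] k(2) by auto
      have "face M (-1) (Y i) R" using cyc i by blast
      then obtain k' z2 where "Y i = Cell (int k' - 1) z2" "k' + 2 \<le> odim X"
        by (auto elim: faceE)
      hence "k + 3 \<le> odim X" using k(2) by auto
      hence "constellation2 (tr (Suc k)) (sb (Suc k)) (tr (Suc (Suc k))) (sb (Suc (Suc k))) (tr (Suc (Suc (Suc k))))"
        unfolding constellation2_def using level by simp
      hence "(Inr z', Inr z) \<in> (desc_step (tr (Suc k)))\<^sup>+"
        by (rule constellation2.target_descends[OF _ k(5) z'(2)])
      thus ?thesis using k z' by blast
    qed
    obtain k z where k: "?g 0 = Cell (int k - 1) z" "k + 2 \<le> odim X" using step[of 0] p by auto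
    interpret T: tree "tr (Suc k)" using tree_level k by simp
    have "\<exists>z'. ?g (Suc m mod p) = Cell (int k - 1) z' \<and> (Inr z', Inr z) \<in> (desc_step (tr (Suc k)))\<^sup>+" for m
    proof (induction m)
      case 0 thus ?case using step[of 0] k p by auto
    next
      case (Suc m)
      then obtain z' where z': "?g (Suc m mod p) = Cell (int k - 1) z'" "(Inr z', Inr z) \<in> (desc_step (tr (Suc k)))\<^sup>+" by blast
      have "Suc m mod p < p" using p by simp
      from step[OF this] obtain k2 u u' where u: "?g (Suc m mod p) = Cell (int k2 - 1) u"
        "?g (Suc (Suc m mod p) mod p) = Cell (int k2 - 1) u'" "(Inr u', Inr u) \<in> (desc_step (tr (Suc k2)))\<^sup>+" by blast
      hence "k2 = k" "u = z'" using z' by auto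
      thus ?case using u z' by (auto simp: mod_Suc_eq intro: trancl_trans)
    qed
    from this[of "p - 1"] have "(Inr z, Inr z) \<in> (desc_step (tr (Suc k)))\<^sup>+" using p k by auto
    thus False using T.acyclic_step by (auto simp: acyclic_def)
  qed
qed

end

section \<open>The trees of a dendritic face complex\<close>

lemma Lam_face: "y \<in> Lam A \<longleftrightarrow> y \<in> cells A \<and> (\<forall>z\<in>cells A. \<not> face A 1 y z)"
  by (auto simp: Lam_def face_def)

lemma Lam_transfer:
  assumes "bij_betw f (cells C) (cells D)" "x \<in> cells C"
    and "\<And>y z s. y \<in> cells C \<Longrightarrow> z \<in> cells C \<Longrightarrow> face D s (f y) (f z) \<longleftrightarrow> face C s y z"
  shows "f x \<in> Lam D \<longleftrightarrow> x \<in> Lam C"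
proof -
  have "cells D = f ` cells C" using assms(1) by (simp add: bij_betw_def)
  thus ?thesis unfolding Lam_face using assms(2,3) by simp
qed

lemma mop_lord:
  assumes "is_mop C"
  shows "(y, y') \<in> lord C x z \<Longrightarrow> x \<in> Lam C \<and> y \<noteq> y' \<and> y \<in> local_loops C x z \<and> y' \<in> local_loops C x z"
    and "trans (lord C x z)"
    and "\<lbrakk>x \<in> Lam C; y \<in> local_loops C x z; y' \<in> local_loops C x z; y \<noteq> y'\<rbrakk> \<Longrightarrow> (y, y') \<in> lord C x z \<or> (y', y) \<in> lord C x z"
proof -
  let ?Q = "x \<in> Lam C \<and> z \<in> (\<Union>y\<in>bdry C x. bdry C y)"
  have m: "if ?Q then lord C x z \<subseteq> local_loops C x z \<times> local_loops C x z \<and>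
             strict_linear_order_on (local_loops C x z) (lord C x z)
        else lord C x z = {}" using assms unfolding is_mop_def by (elim conjE) (erule allE, erule allE, assumption)
  show "(y, y') \<in> lord C x z \<Longrightarrow> x \<in> Lam C \<and> y \<noteq> y' \<and> y \<in> local_loops C x z \<and> y' \<in> local_loops C x z"
    "trans (lord C x z)" using m by (cases ?Q; auto simp: strict_linear_order_on_def irrefl_def)+
  assume y: "x \<in> Lam C" "y \<in> local_loops C x z" "y' \<in> local_loops C x z" "y \<noteq> y'"
  hence "?Q" by (auto simp: local_loops_def face_def bdry_def)
  thus "(y, y') \<in> lord C x z \<or> (y', y) \<in> lord C x z"
    using m y by (auto simp: strict_linear_order_on_def total_on_def)
qed

locale dendritic =
  fixes C :: "'a mop"
  assumes dfc: "is_dfc C"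
begin

lemma mop: "is_mop C"
  using dfc by (simp add: is_dfc_def)

lemma finite_cells: "finite (cells C)" and dim_ge: "x \<in> cells C \<Longrightarrow> dim C x \<ge> -1"
  using mop by (auto simp: is_mop_def)

lemma bottom_faces: "x \<in> cells C \<Longrightarrow> dim C x = -1 \<Longrightarrow> delta C x = {} \<and> gamma C x = {}"
  using mop by (simp add: is_mop_def)

lemma faces_dim: "x \<in> cells C \<Longrightarrow> dim C x \<ge> 0 \<Longrightarrow>
    delta C x \<subseteq> cells_dim C (dim C x - 1) \<and> gamma C x \<subseteq> cells_dim C (dim C x - 1) \<and> is_singleton (gamma C x)"
  using mop by (simp add: is_mop_def)

lemma loop_delta: "x \<in> cells C \<Longrightarrow> delta C x \<inter> gamma C x \<noteq> {} \<Longrightarrow> delta C x = gamma C x"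
  using mop by (simp add: is_mop_def)

lemma gamma_eq: "x \<in> cells C \<Longrightarrow> dim C x \<ge> 0 \<Longrightarrow> gamma C x = {gam C x}"
  using faces_dim unfolding gam_def is_singleton_def by fastforce

lemma gam_mem: "x \<in> cells C \<Longrightarrow> dim C x \<ge> 0 \<Longrightarrow> gam C x \<in> cells C \<and> dim C (gam C x) = dim C x - 1"
  using faces_dim[of x] gamma_eq[of x] by (auto simp: cells_dim_def)

lemma face_mem:
  assumes "face C s y x"
  shows "x \<in> cells C" "y \<in> cells C" "dim C x \<ge> 0" "dim C y = dim C x - 1" "s = 1 \<or> s = -1 \<or> s = 0"
proof -
  show x: "x \<in> cells C" and s: "s = 1 \<or> s = -1 \<or> s = 0" using assms by (auto simp: face_def)
  have y: "y \<in> delta C x \<union> gamma C x" using assms by (auto simp: face_def)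
  show d: "dim C x \<ge> 0" using dim_ge x y bottom_faces by fastforce
  have "y \<in> cells_dim C (dim C x - 1)" using faces_dim[OF x d] y by blast
  thus "y \<in> cells C" "dim C y = dim C x - 1" by (auto simp: cells_dim_def)
qed

lemma face_sign_unique: "face C s y x \<Longrightarrow> face C s' y x \<Longrightarrow> s = s'"
  by (auto simp: face_def)

lemma face_pos: "face C 1 y x \<longleftrightarrow> x \<in> cells C \<and> dim C x \<ge> 0 \<and> y = gam C x \<and> gam C x \<notin> delta C x"
  using face_mem(3)[of 1 y x] gamma_eq[of x] by (auto simp: face_def)

lemma face_zero: "face C 0 y x \<longleftrightarrow> x \<in> cells C \<and> dim C x \<ge> 0 \<and> y = gam C x \<and> delta C x = {gam C x}"
  using face_mem(3)[of 0 y x] gamma_eq[of x] loop_delta[of x] by (auto simp: face_def)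

lemma face_neg: "face C (-1) y x \<longleftrightarrow> x \<in> cells C \<and> dim C x \<ge> 0 \<and> y \<in> delta C x \<and> gam C x \<notin> delta C x"
  using face_mem(3)[of "-1" y x] gamma_eq[of x] loop_delta[of x] by (auto simp: face_def)

lemma face_cases: "x \<in> cells C \<Longrightarrow> dim C x \<ge> 0 \<Longrightarrow> face C 1 (gam C x) x \<or> face C 0 (gam C x) x"
  using gamma_eq[of x] by (auto simp: face_def)

lemma loop_only: "face C 0 z x \<Longrightarrow> face C s y x \<Longrightarrow> s = 0 \<and> y = z"
  using face_mem(5)[of s y x] face_zero[of z x] face_zero[of y x] face_pos[of y x] face_neg[of y x] by auto

lemma target_unique: "face C 1 y x \<Longrightarrow> face C 1 y' x \<Longrightarrow> y = y'"
  by (simp add: face_pos)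

lemma loops: "face C 0 z y \<Longrightarrow> \<exists>x. face C 1 y x"
  using dfc unfolding is_dfc_def by (elim conjE) blast

lemma Lam_iff: "a \<in> Lam C \<longleftrightarrow> a \<in> cells C \<and> \<not> (\<exists>x. face C 1 a x)"
  by (auto simp: Lam_def face_def)

lemma Lam_nonloop: "a \<in> Lam C \<Longrightarrow> \<not> face C 0 z a"
  using loops Lam_iff by blast

lemma Lam_target: "a \<in> Lam C \<Longrightarrow> dim C a \<ge> 0 \<Longrightarrow> face C 1 (gam C a) a"
  using face_cases Lam_nonloop Lam_iff by blast

lemma thin_all: "\<forall>x y z \<alpha> \<beta>. face C \<beta> z y \<and> face C \<alpha> y x \<and> \<alpha> \<noteq> 0 \<and> \<beta> \<noteq> 0 \<longrightarrow>
        (\<exists>!y'. y' \<noteq> y \<and> (\<exists>\<alpha>' \<beta>'. \<alpha>' \<noteq> 0 \<and> \<beta>' \<noteq> 0 \<and> face C \<beta>' z y' \<and> face C \<alpha>' y' x)) \<and>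
        (\<forall>y' \<alpha>' \<beta>'. y' \<noteq> y \<and> \<alpha>' \<noteq> 0 \<and> \<beta>' \<noteq> 0 \<and> face C \<beta>' z y' \<and> face C \<alpha>' y' x \<longrightarrow>
           \<alpha> * \<beta> = - (\<alpha>' * \<beta>'))"
  using dfc unfolding is_dfc_def by (elim conjE)

lemma thin_ex:
  assumes "face C \<beta> z y" "face C \<alpha> y x" "\<alpha> \<noteq> 0" "\<beta> \<noteq> 0"
  shows "\<exists>y' \<alpha>' \<beta>'. y' \<noteq> y \<and> \<alpha>' \<noteq> 0 \<and> \<beta>' \<noteq> 0 \<and> face C \<beta>' z y' \<and> face C \<alpha>' y' x \<and> \<alpha> * \<beta> = - (\<alpha>' * \<beta>')"
proof -
  note t = thin_all[THEN spec, THEN spec, THEN spec, THEN spec, THEN spec, THEN mp,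
      OF conjI[OF assms(1) conjI[OF assms(2) conjI[OF assms(3,4)]]]]
  obtain y' \<alpha>' \<beta>' where "y' \<noteq> y" "\<alpha>' \<noteq> 0" "\<beta>' \<noteq> 0" "face C \<beta>' z y'" "face C \<alpha>' y' x"
    using ex1_implies_ex[OF conjunct1[OF t]] by (elim exE conjE) (rule that)
  moreover from this have "\<alpha> * \<beta> = - (\<alpha>' * \<beta>')" using conjunct2[OF t] by blast
  ultimately show ?thesis by (intro exI conjI)
qed

lemma thin_sign:
  assumes "face C \<beta> z y" "face C \<alpha> y x" "\<alpha> \<noteq> 0" "\<beta> \<noteq> 0"
    and "face C \<beta>' z y'" "face C \<alpha>' y' x" "\<alpha>' \<noteq> 0" "\<beta>' \<noteq> 0" "\<alpha> * \<beta> = \<alpha>' * \<beta>'"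
  shows "y = y'"
proof (rule ccontr)
  assume ne: "y \<noteq> y'"
  note t = thin_all[THEN spec, THEN spec, THEN spec, THEN spec, THEN spec, THEN mp,
      OF conjI[OF assms(1) conjI[OF assms(2) conjI[OF assms(3,4)]]]]
  have "\<alpha> * \<beta> = - (\<alpha>' * \<beta>')" using conjunct2[OF t] ne[symmetric] assms(5-8) by blast
  thus False using assms by auto
qed

lemma loop_thin:
  assumes "face C 0 z y" "face C (-1) y x"
  shows "\<exists>y' \<alpha> \<beta>. y' \<noteq> y \<and> face C \<beta> z y' \<and> face C \<alpha> y' x \<and> (\<alpha>, \<beta>) \<noteq> (-1, 0)"
  using dfc assms unfolding is_dfc_def by blast

section \<open>Consequences of thinness and acyclicity for the sources of one cell\<close>

lemma source_unique:
  "face C s c y \<Longrightarrow> face C s c y' \<Longrightarrow> s \<noteq> 0 \<Longrightarrow> face C (-1) y a \<Longrightarrow> face C (-1) y' a \<Longrightarrow> y = y'"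
  using thin_sign[of s c y "-1" a s y' "-1"] by simp

lemma target_source:
  assumes "face C s c g" "face C 1 g a" "s \<noteq> 0"
  shows "\<exists>y. face C (-1) y a \<and> face C s c y"
proof -
  obtain y' \<alpha>' \<beta>' where y': "y' \<noteq> g" "\<alpha>' \<noteq> 0" "\<beta>' \<noteq> 0" "face C \<beta>' c y'" "face C \<alpha>' y' a" "1 * s = - (\<alpha>' * \<beta>')"
    using thin_ex[OF assms(1,2) _ assms(3)] by auto
  hence "\<alpha>' = -1" using face_mem(5)[OF y'(5)] target_unique[OF assms(2), of y'] by auto
  thus ?thesis using y' by auto
qed

text \<open>The given chain has product \<open>- s\<close>, so its partner has product
  \<open>s\<close>: either it runs through the target with sign \<open>s\<close>, or through another
  source with sign \<open>- s\<close>.\<close>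

lemma source_target:
  assumes "face C s c y" "face C (-1) y a" "s \<noteq> 0" "face C 1 g a"
  shows "face C s c g \<or> (\<exists>y'. face C (-1) y' a \<and> face C (- s) c y')"
proof -
  obtain y' \<alpha>' \<beta>' where y': "y' \<noteq> y" "\<alpha>' \<noteq> 0" "\<beta>' \<noteq> 0" "face C \<beta>' c y'" "face C \<alpha>' y' a" "-1 * s = - (\<alpha>' * \<beta>')"
    using thin_ex[OF assms(1,2) _ assms(3)] by auto
  then consider "\<alpha>' = 1" "\<beta>' = s" | "\<alpha>' = -1" "\<beta>' = - s" using face_mem(5)[OF y'(5)] by auto
  thus ?thesis by (metis target_unique assms(4) y')
qed

lemma target_source_sign:
  assumes "face C s c g" "face C 1 g a" "s \<noteq> 0" "face C (-1) y a"
  shows "\<not> face C (- s) c y"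
proof
  assume f: "face C (- s) c y"
  hence "g = y" using thin_sign[OF assms(1,2) _ _ f assms(4)] assms(3) by simp
  thus False using face_sign_unique[OF assms(2)] assms(4) by fastforce
qed

text \<open>Acyclicity in the form of an induction. For a source \<open>y\<close> that is not a
  loop, \<open>source_target\<close> says that the target of \<open>y\<close> is either a positive
  face of the target of \<open>a\<close> or a source of another source \<open>y'\<close>; passing
  from \<open>y\<close> to \<open>y'\<close> is a finite acyclic relation, hence
  well-founded.\<close>

lemma source_induct [consumes 2, case_names base step]:
  assumes y: "face C (-1) y a" "face C 1 (gam C y) y"
    and base: "\<And>y. face C (-1) y a \<Longrightarrow> face C 1 (gam C y) y \<Longrightarrow> face C 1 (gam C y) (gam C a) \<Longrightarrow> P y"
    and step: "\<And>y y'. face C (-1) y a \<Longrightarrow> face C 1 (gam C y) y \<Longrightarrow> face C (-1) y' a \<Longrightarrow>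
        face C (-1) (gam C y) y' \<Longrightarrow> face C 1 (gam C y') y' \<Longrightarrow> P y' \<Longrightarrow> P y"
  shows "P y"
proof -
  have a: "a \<in> cells C" "dim C a \<ge> 1" using face_mem[OF y(1)] face_mem[OF y(2)] by auto
  define r where "r = {(y', y). face C (-1) y' a \<and> face C (-1) y a \<and> face C 1 (gam C y) y \<and> face C (-1) (gam C y) y'}"
  have fin: "finite r"
  proof (rule finite_subset)
    show "r \<subseteq> cells C \<times> cells C" using face_mem by (auto simp: r_def)
  qed (use finite_cells in simp)
  have acy: "acyclic r"
  proof (rule acyclicI, rule allI, rule notI)
    fix x assume "(x, x) \<in> r\<^sup>+"
    then obtain p where p: "p > 0" "(x, x) \<in> r ^^ p" by (auto simp: trancl_power)
    then obtain f where f: "f 0 = x" "f p = x" "\<And>i. i < p \<Longrightarrow> (f i, f (Suc i)) \<in> r"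
      by (auto simp: relpow_fun_conv)
    \<comment> \<open>A cycle of \<open>r\<close> comes as a sequence with \<open>f 0 = f p\<close>,
      while the axiom counts indices modulo \<open>p\<close>.\<close>
    have "(f i, f (Suc i mod p)) \<in> r" if "i < p" for i
    proof (cases "Suc i = p")
      case True
      thus ?thesis using f(1,2) f(3)[OF that] by simp
    qed (use f(3)[OF that] that in simp)
    hence "p \<ge> 1 \<and> (\<forall>i<p. face C (-1) (f i) a \<and>
              (let y' = f (Suc i mod p) in
                 face C 1 (gam C y') y' \<and> face C (-1) (gam C y') (f i)))"
      using p by (auto simp: r_def)
    moreover have "\<not> (\<exists>p y. p \<ge> 1 \<and> (\<forall>i<p. face C (-1) (y i) a \<and>
              (let y' = y (Suc i mod p) in
                 face C 1 (gam C y') y' \<and> face C (-1) (gam C y') (y i))))"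
      using dfc a unfolding is_dfc_def by blast
    ultimately show False by blast
  qed
  have "wf r" using fin acy by (rule finite_acyclic_wf)
  thus ?thesis using y
  proof (induction y rule: wf_induct_rule)
    case (less y)
    have "face C 1 (gam C a) a" using face_mem[OF less.prems(1)] face_cases[of a] loop_only less.prems(1) by fastforce
    from source_target[OF less.prems(2,1) _ this]
    consider "face C 1 (gam C y) (gam C a)" | y' where "face C (-1) y' a" "face C (-1) (gam C y) y'" by auto
    thus ?case
    proof cases
      case 1 thus ?thesis using base less.prems by blast
    next
      case 2
      have t: "face C 1 (gam C y') y'"
        using face_mem[OF 2(2)] face_cases[of y'] loop_only[of "gam C y'" y' "-1" "gam C y"] 2(2) by auto
      have "(y', y) \<in> r" using 2 less.prems by (simp add: r_def)
      hence "P y'" using less.IH 2(1) t by blast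
      thus ?thesis using step less.prems 2 t by blast
    qed
  qed
qed

text \<open>A source that is not a loop would lead, by \<open>source_induct\<close>, to a positive
  face of the target \<open>g\<close>, which is a loop. So all sources are loops, and the second
  face that \<open>loop_thin\<close> provides for the loop \<open>y\<close> can only be
  \<open>g\<close>; hence \<open>y\<close> and \<open>g\<close> are loops on the same cell.\<close>

lemma loop_sources:
  assumes g: "face C 1 g a" "face C 0 c g" and y: "face C (-1) y a"
  shows "face C 0 c y"
proof -
  have ga: "g = gam C a" using g by (simp add: face_pos)
  have loop: "face C 0 (gam C y) y" if "face C (-1) y a" for y
  proof (rule ccontr)
    assume n: "\<not> ?thesis"
    have "dim C y \<ge> 0" using face_mem[OF that] face_mem[OF g(1)] face_mem[OF g(2)] by simp
    hence "face C 1 (gam C y) y" using n face_cases face_mem[OF that] by blast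
    with that show False
    proof (induction y rule: source_induct)
      case (base y)
      thus False using g(2) loop_only[of c g 1] ga by simp
    qed
  qed
  obtain y' \<alpha> \<beta> where y': "y' \<noteq> y" "face C \<beta> (gam C y) y'" "face C \<alpha> y' a" "(\<alpha>, \<beta>) \<noteq> (-1, 0)"
    using loop_thin[OF loop[OF y] y] by blast
  have "\<alpha> \<noteq> 0" using y'(3) loop_only y by fastforce
  moreover have "\<alpha> \<noteq> -1" by (metis loop y' loop_only)
  ultimately have "y' = g" using face_mem(5)[OF y'(3)] y' g target_unique by blast
  hence "gam C y = c" using loop_only[OF g(2)] y' by blast
  thus ?thesis using loop[OF y] by simp
qed

text \<open>Otherwise the target of \<open>g\<close> is a positive face of \<open>g\<close>, and
  \<open>target_source\<close> finds a source of \<open>a\<close> having it with sign +, which is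
  not a loop.\<close>

lemma loop_target:
  assumes g: "face C 1 g a" "dim C g \<ge> 0" and all: "\<And>y. face C (-1) y a \<Longrightarrow> \<exists>z. face C 0 z y"
  shows "face C 0 (gam C g) g" by (metis face_cases g face_mem target_source all loop_only)

section \<open>Iterated targets\<close>

abbreviation "n \<equiv> mop_dim C"
abbreviation "it \<equiv> iter_target C"

lemma prec_face: "prec C y x \<longleftrightarrow> (\<exists>s. face C s y x)"
  by (auto simp: prec_def bdry_def face_def)

lemma le_rel_dim: "(x, y) \<in> le_rel C \<Longrightarrow> x = y \<or> dim C x < dim C y"
  unfolding le_rel_def
proof (induction rule: rtrancl_induct)
  case (step y z)
  then obtain s where "face C s y z" by (auto simp: prec_face)
  thus ?case using step.IH face_mem(4) by fastforce
qed simp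

lemma top_greatest: "greatest_cell C (top_cell C)" and top_dim: "dim C (top_cell C) = int n"
proof -
  obtain w where w: "greatest_cell C w" "dim C w \<ge> 0" using dfc by (auto simp: is_dfc_def)
  have "w' = w" if "greatest_cell C w'" for w'
  proof (rule ccontr)
    assume "w' \<noteq> w"
    hence "dim C w < dim C w'" "dim C w' < dim C w"
      using that w le_rel_dim[of w w'] le_rel_dim[of w' w] unfolding greatest_cell_def by auto
    thus False by simp
  qed
  hence "top_cell C = w" unfolding top_cell_def using w(1) by blast
  thus "greatest_cell C (top_cell C)" "dim C (top_cell C) = int n" using w by (auto simp: mop_dim_def)
qed

lemma le_top: "x \<in> cells C \<Longrightarrow> x = top_cell C \<or> dim C x < int n"
  using top_greatest le_rel_dim top_dim unfolding greatest_cell_def by metis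

lemma top_cells: "top_cell C \<in> cells C"
  using top_greatest by (simp add: greatest_cell_def)

lemma cofaces:
  assumes "x \<in> cells C" "x \<noteq> top_cell C" shows "\<exists>y s. face C s x y"
proof -
  have "(x, top_cell C) \<in> {(y, x). prec C y x}\<^sup>*" using top_greatest assms by (auto simp: greatest_cell_def le_rel_def)
  then obtain y where "prec C x y" using assms by (auto elim: converse_rtranclE)
  thus ?thesis by (auto simp: prec_face)
qed

lemma no_coface_top: "\<not> face C s (top_cell C) y"
proof
  assume f: "face C s (top_cell C) y"
  hence "dim C y = int n + 1" "y \<in> cells C" using face_mem[OF f] top_dim by auto
  thus False using le_top[of y] top_dim by auto
qed

lemma it_top: "it n = top_cell C"
  by (simp add: iter_target_def)

lemma it_step: "k < n \<Longrightarrow> it k = gam C (it (Suc k))"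
proof -
  assume "k < n"
  hence "n - k = Suc (n - Suc k)" by simp
  thus ?thesis by (simp add: iter_target_def)
qed

lemma it_mem: "k \<le> n \<Longrightarrow> it k \<in> cells C \<and> dim C (it k) = int k"
proof (induction k rule: inc_induct)
  case base thus ?case using it_top top_cells top_dim by simp
next
  case (step k)
  thus ?case using it_step[of k] gam_mem[of "it (Suc k)"] by simp
qed

lemma cells_dim_top: "cells_dim C (int n) = {it n}"
  using le_top top_cells top_dim it_top unfolding cells_dim_def by fastforce

section \<open>The trees of the complex, and signs seen from \<Lambda>\<close>

definition TT :: "nat \<Rightarrow> ('a, 'a) rtree" where
  "TT e = Z_tree C (e + 2)"

definition Lm :: "int \<Rightarrow> 'a set" where
  "Lm k = Lam C \<inter> cells_dim C k"

lemma Lm_iff: "a \<in> Lm k \<longleftrightarrow> a \<in> Lam C \<and> dim C a = k"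
  by (auto simp: Lm_def cells_dim_def Lam_def)

text \<open>The shift by two in \<open>TT\<close> makes the index of a tree equal to the dimension
  of its edges.\<close>

lemma TT_simps:
  "nodes (TT e) = Lm (int e + 1)" "edges (TT e) = cells_dim C (int e)" "root (TT e) = it e"
  "(y, a) \<in> tsource (TT e) \<longleftrightarrow> a \<in> Lm (int e + 1) \<and> face C (-1) y a"
  "(y, a) \<in> ttarget (TT e) \<longleftrightarrow> a \<in> Lm (int e + 1) \<and> face C 1 y a"
  using face_mem[of "-1" y a] face_mem[of 1 y a] by (auto simp: TT_def Z_tree_def Lm_def cells_dim_def)

lemma cells_dim_iff: "x \<in> cells_dim C k \<longleftrightarrow> x \<in> cells C \<and> dim C x = k"
  by (auto simp: cells_dim_def)

lemma leaves_TT: "y \<in> leaves (TT e) \<longleftrightarrow> y \<in> cells_dim C (int e) \<and> \<not> (\<exists>a\<in>Lm (int e + 1). face C 1 y a)"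
  by (auto simp: leaves_def TT_simps)

text \<open>\<open>loop_sources\<close> applies at each node of the path, because nodes lie in
  \<Lambda> and so have their target as a positive face.\<close>

lemma loops_above:
  assumes t: "tree (TT e)" and l: "face C 0 c b" and d: "desc (TT e) (Inr b') (Inr b)"
  shows "face C 0 c b'"
proof -
  interpret T: tree "TT e" by (rule t)
  have "(Inr b', Inr b) \<in> (desc_step (TT e))\<^sup>*" using d by (simp add: desc_def)
  hence "case (Inr b' :: 'a + 'a) of Inr x \<Rightarrow> face C 0 c x | Inl a \<Rightarrow> face C 0 c (gam C a)"
  proof (induction rule: converse_rtrancl_induct)
    case base thus ?case using l by simp
  next
    case (step x y)
    show ?case
    proof (cases x)
      case (Inl a)
      then obtain z where z: "y = Inr z" "(z, a) \<in> ttarget (TT e)" using step.hyps(1) by (cases y) auto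
      hence "z = gam C a" by (simp add: TT_simps face_pos)
      thus ?thesis using step.IH Inl z by simp
    next
      case (Inr z)
      then obtain a where a: "y = Inl a" "(z, a) \<in> tsource (TT e)" using step.hyps(1) by (cases y) auto
      hence za: "face C (-1) z a" "a \<in> Lam C" by (auto simp: TT_simps Lm_iff)
      hence "face C 1 (gam C a) a" using Lam_target face_mem by blast
      thus ?thesis using step.IH Inr a loop_sources za by simp
    qed
  qed
  thus ?thesis by simp
qed

text \<open>A signed face of the target of a node is, with the same sign, a face of one of its
  sources (\<open>target_source\<close>); climbing in this way ends at a leaf.\<close>

lemma signed_leaf:
  assumes t: "tree (TT e)" and y: "face C s c y" "s \<noteq> 0" "dim C y = int e"
  shows "\<exists>l. l \<in> leaves (TT e) \<and> desc (TT e) (Inr l) (Inr y) \<and> face C s c l"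
proof -
  interpret T: tree "TT e" by (rule t)
  have "y \<in> edges (TT e)" using y face_mem[OF y(1)] by (simp add: TT_simps cells_dim_iff)
  hence "face C s c y \<longrightarrow> (\<exists>l. l \<in> leaves (TT e) \<and> desc (TT e) (Inr l) (Inr y) \<and> face C s c l)"
  proof (induction rule: T.edge_up_induct)
    case (1 y)
    have "(\<exists>l. l \<in> leaves (TT e) \<and> desc (TT e) (Inr l) (Inr y) \<and> face C s c l)" if f: "face C s c y"
    proof (cases "y \<in> leaves (TT e)")
      case True
      thus ?thesis using f 1(1) desc_refl[of "Inr y" "TT e"] by auto
    next
      case False
      obtain a where a: "(y, a) \<in> ttarget (TT e)" using False 1(1) by (auto simp: leaves_def)
      hence "face C 1 y a" "a \<in> Lm (int e + 1)" by (auto simp: TT_simps)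
      then obtain y' where y': "face C (-1) y' a" "face C s c y'" using target_source[OF f _ y(2)] by blast
      hence s: "(y', a) \<in> tsource (TT e)" using \<open>a \<in> Lm _\<close> by (simp add: TT_simps)
      then obtain l where "l \<in> leaves (TT e)" "desc (TT e) (Inr l) (Inr y')" "face C s c l"
        using 1(2)[OF a s] y'(2) by blast
      thus ?thesis using T.desc_source[OF s] T.desc_target[OF a] desc_trans by blast
    qed
    thus ?case by blast
  qed
  thus ?thesis using y by blast
qed


lemma Lm_target: "a \<in> Lm (int e + 1) \<Longrightarrow> face C 1 (gam C a) a"
  using Lam_target by (simp add: Lm_iff)

text \<open>If \<open>y\<close> is the positive face of any cell, then \<open>signed_leaf\<close>
  one dimension up replaces this cell by one of \<Lambda>, that is, by a node of \<open>TT e\<close>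
  with target \<open>y\<close>.\<close>

lemma leaves_Lm_step:
  assumes t: "tree (TT (Suc e))" and l: "leaves (TT (Suc e)) = Lm (int (Suc e))"
  shows "leaves (TT e) = Lm (int e)"
proof (rule set_eqI)
  fix y
  have "\<exists>a\<in>Lm (int e + 1). face C 1 y a" if y: "dim C y = int e" and x: "face C 1 y x" for x
  proof -
    have "dim C x = int (Suc e)" using face_mem[OF x] y by simp
    then obtain a where "a \<in> leaves (TT (Suc e))" "face C 1 y a" using signed_leaf[OF t x] by auto
    thus ?thesis using l by (auto simp: add.commute)
  qed
  thus "y \<in> leaves (TT e) \<longleftrightarrow> y \<in> Lm (int e)"
    unfolding leaves_TT Lm_iff Lam_iff cells_dim_iff by blast
qed

text \<open>The cells of \<Lambda> having \<open>c\<close> as a face of sign 1 and -1 are the upper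
  and the lower node of the string of \<open>c\<close>. So this is the predicate \<open>M\<close> of
  \<open>sign_chain\<close>, now for a dendritic face complex.\<close>

definition above_sign :: "nat \<Rightarrow> int \<Rightarrow> 'a \<Rightarrow> 'a \<Rightarrow> bool" where
  "above_sign e s c x \<longleftrightarrow> (\<exists>u\<in>Lm (int e). face C s c u \<and> desc (TT e) (Inr u) (Inr x))"

definition good_level :: "nat \<Rightarrow> bool" where
  "good_level e \<longleftrightarrow> tree (TT e) \<and> leaves (TT e) = Lm (int e)"

lemma signed_unique:
  assumes "tree (TT e)" "u \<in> Lm (int e + 1)" "u' \<in> Lm (int e + 1)" "face C s c u" "face C s c u'" "s \<noteq> 0"
  shows "u = u'"
proof -
  interpret T: tree "TT e" by fact
  from face_mem(5)[OF assms(4)] assms(6) consider "s = 1" | "s = -1" by auto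
  thus ?thesis by (metis T.upper_unique assms TT_simps T.lower_unique)
qed

text \<open>By thinness the signed incidence of \<open>c\<close> is additive along the nodes of the tree, so that it
  can be computed from the leaves.\<close>

lemma face_above_sign:
  assumes g: "good_level (Suc e)" and T': "tree (TT e)" and s: "s = 1 \<or> s = -1" and x: "x \<in> cells_dim C (int (Suc e))"
  shows "face C s c x \<longleftrightarrow> above_sign (Suc e) s c x \<and> \<not> above_sign (Suc e) (- s) c x"
proof -
  interpret T: tree "TT (Suc e)" using g by (simp add: good_level_def)
  have lv: "leaves (TT (Suc e)) = Lm (int (Suc e))" using g by (simp add: good_level_def)
  have x': "x \<in> edges (TT (Suc e))" using x by (simp add: TT_simps)
  have "\<forall>s. s = 1 \<or> s = -1 \<longrightarrow> (face C s c x \<longleftrightarrow> above_sign (Suc e) s c x \<and> \<not> above_sign (Suc e) (- s) c x)"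
    using x'
  proof (induction rule: T.edge_up_induct)
    case (1 x)
    show ?case
    proof (cases "x \<in> leaves (TT (Suc e))")
      case True
      hence "Inr x \<in> tops (TT (Suc e))" by (simp add: tops_def)
      hence "desc (TT (Suc e)) (Inr u) (Inr x) \<longleftrightarrow> u = x" for u
        using T.tops_maximal[of "Inr x" "Inr u"] desc_refl[of "Inr x" "TT (Suc e)"] 1(1) by auto
      hence "above_sign (Suc e) s c x \<longleftrightarrow> face C s c x" for s
        using True lv by (auto simp: above_sign_def)
      thus ?thesis using face_sign_unique[of 1 c x "-1"] by auto
    next
      case False
      then obtain a where a: "(x, a) \<in> ttarget (TT (Suc e))" using 1(1) by (auto simp: leaves_def)
      hence fa: "face C 1 x a" and aL: "a \<in> Lm (int (Suc e) + 1)" by (auto simp: TT_simps)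
      have src: "(y, a) \<in> tsource (TT (Suc e)) \<longleftrightarrow> face C (-1) y a" for y using aL by (simp add: TT_simps)
      have pq: "above_sign (Suc e) s c x \<longleftrightarrow> (\<exists>y. face C (-1) y a \<and> above_sign (Suc e) s c y)" for s
      proof
        assume "above_sign (Suc e) s c x"
        then obtain u where u: "u \<in> Lm (int (Suc e))" "face C s c u" "desc (TT (Suc e)) (Inr u) (Inr x)"
          by (auto simp: above_sign_def)
        hence "Inr u \<in> tops (TT (Suc e))" using lv by (simp add: tops_def)
        moreover have "u \<noteq> x" using u lv False by blast
        ultimately obtain y where "(y, a) \<in> tsource (TT (Suc e))" "desc (TT (Suc e)) (Inr u) (Inr y)"
          using T.desc_edge_cases[OF u(3)] a T.upper_unique by blast
        thus "\<exists>y. face C (-1) y a \<and> above_sign (Suc e) s c y" using u src by (auto simp: above_sign_def)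
      next
        assume "\<exists>y. face C (-1) y a \<and> above_sign (Suc e) s c y"
        then obtain y u where u: "face C (-1) y a" "u \<in> Lm (int (Suc e))" "face C s c u" "desc (TT (Suc e)) (Inr u) (Inr y)"
          by (auto simp: above_sign_def)
        hence "desc (TT (Suc e)) (Inr u) (Inr x)"
          using T.desc_source[of y a] src T.desc_target[OF a] desc_trans by blast
        thus "above_sign (Suc e) s c x" using u by (auto simp: above_sign_def)
      qed
      \<comment> \<open>In \<open>TT e\<close> the edge \<open>c\<close> has at most one node on
        each side, and this node lies above at most one source of \<open>a\<close>.\<close>
      have uniq: "y = y'" if y: "face C (-1) y a" "face C (-1) y' a" "above_sign (Suc e) s c y" "above_sign (Suc e) s c y'"
        "s \<noteq> 0" for y y' s
      proof -
        obtain u where u: "u \<in> Lm (int (Suc e))" "face C s c u" "desc (TT (Suc e)) (Inr u) (Inr y)"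
          using y(3) by (auto simp: above_sign_def)
        obtain u' where u': "u' \<in> Lm (int (Suc e))" "face C s c u'" "desc (TT (Suc e)) (Inr u') (Inr y')"
          using y(4) by (auto simp: above_sign_def)
        have "u = u'" using signed_unique[OF T' _ _ u(2) u'(2) y(5)] u(1) u'(1) by (simp add: add.commute)
        thus ?thesis using T.sources_disjoint[of y a y'] src y u u' by blast
      qed
      have IH: "face C s c y \<longleftrightarrow> above_sign (Suc e) s c y \<and> \<not> above_sign (Suc e) (- s) c y"
        if "face C (-1) y a" "s = 1 \<or> s = -1" for s y
        using 1(2)[OF a] src that by blast
      show ?thesis
      proof (intro allI impI iffI)
        fix s :: int assume s: "s = 1 \<or> s = -1" and f: "face C s c x"
        hence s0: "s \<noteq> 0" "- s = 1 \<or> - s = -1" "- s \<noteq> 0" by auto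
        obtain y where y: "face C (-1) y a" "face C s c y" using target_source[OF f fa s0(1)] by blast
        hence ys: "above_sign (Suc e) s c y" "\<not> above_sign (Suc e) (- s) c y" using IH s by blast+
        have "\<not> above_sign (Suc e) (- s) c x"
        proof
          assume "above_sign (Suc e) (- s) c x"
          then obtain y' where y': "face C (-1) y' a" "above_sign (Suc e) (- s) c y'" using pq by blast
          hence "\<not> above_sign (Suc e) s c y'" using uniq[OF y(1) y'(1) ys(1) _ s0(1)] ys by blast
          hence "face C (- s) c y'" using IH[OF y'(1) s0(2)] y'(2) by simp
          thus False using target_source_sign[OF f fa s0(1) y'(1)] by blast
        qed
        thus "above_sign (Suc e) s c x \<and> \<not> above_sign (Suc e) (- s) c x" using pq y ys by blast
      next
        fix s :: int assume s: "s = 1 \<or> s = -1" and f: "above_sign (Suc e) s c x \<and> \<not> above_sign (Suc e) (- s) c x"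
        hence s0: "s \<noteq> 0" "- s = 1 \<or> - s = -1" by auto
        obtain y where y: "face C (-1) y a" "above_sign (Suc e) s c y" "\<not> above_sign (Suc e) (- s) c y" using f pq by blast
        hence "face C s c y" using IH s by blast
        from source_target[OF this y(1) s0(1) fa]
        show "face C s c x"
        proof
          assume "\<exists>y'. face C (-1) y' a \<and> face C (- s) c y'"
          hence "above_sign (Suc e) (- s) c x" using IH s0 pq by blast
          thus ?thesis using f by blast
        qed
      qed
    qed
  qed
  thus ?thesis using s by blast
qed

lemma root_above: "tree (TT e) \<Longrightarrow> u \<in> cells_dim C (int e) \<Longrightarrow> desc (TT e) (Inr u) (Inr (it e))"
  using tree.desc_root[of "TT e" "Inr u"] by (simp add: TT_simps)

text \<open>Every cell lies above the root, so for the root cell the formula of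
  \<open>face_above_sign\<close> only asks whether \<open>c\<close> has a lower and an upper node.
  Having a lower but no upper node means being a leaf other than the root edge, and
  \<open>nl\<close> guarantees that the root edge is no leaf.\<close>

lemma it_source_iff:
  assumes e: "Suc (Suc e) \<le> n" and g: "good_level (Suc (Suc e))" "good_level (Suc e)"
    and nl: "face C 1 (it (Suc e)) (it (Suc (Suc e)))"
  shows "face C (-1) c (it (Suc (Suc e))) \<longleftrightarrow> c \<in> Lm (int (Suc e))"
proof -
  let ?A = "it (Suc (Suc e))"
  have T: "tree (TT (Suc e))" and lv: "leaves (TT (Suc e)) = Lm (int (Suc e))"
    and T2: "tree (TT (Suc (Suc e)))" using g by (simp_all add: good_level_def)
  interpret T: tree "TT (Suc e)" by (rule T)
  have A: "?A \<in> cells_dim C (int (Suc (Suc e)))" using it_mem[OF e] by (simp add: cells_dim_iff)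
  have ab: "above_sign (Suc (Suc e)) s c ?A \<longleftrightarrow> (\<exists>u\<in>Lm (int (Suc e) + 1). face C s c u)" for s c
    using root_above[OF T2] by (auto simp: above_sign_def Lm_def)
  note fs = face_above_sign[OF g(1) T _ A]
  show ?thesis
  proof
    assume f: "face C (-1) c ?A"
    hence "\<not> (\<exists>u\<in>Lm (int (Suc e) + 1). face C 1 c u)" using fs[of "-1"] ab by simp
    moreover have "c \<in> cells_dim C (int (Suc e))" using face_mem[OF f] it_mem[OF e] by (simp add: cells_dim_iff)
    ultimately show "c \<in> Lm (int (Suc e))" using lv leaves_TT by blast
  next
    assume c: "c \<in> Lm (int (Suc e))"
    hence cl: "c \<in> leaves (TT (Suc e))" using lv by simp
    have "\<exists>u\<in>Lm (int (Suc e) + 1). face C 1 (it (Suc e)) u" using fs[of 1] nl ab by simp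
    hence ne: "c \<noteq> it (Suc e)" using cl leaves_TT by blast
    have "c \<in> cells_dim C (int (Suc e))" using cl leaves_TT by blast
    hence "desc (TT (Suc e)) (Inr c) (Inr (it (Suc e)))" using root_above[OF T] by blast
    then obtain z where "(Inr c, z) \<in> desc_step (TT (Suc e))" using T.desc_firstE ne by (metis sum.inject(2))
    then obtain l where "(c, l) \<in> tsource (TT (Suc e))" by (cases z) auto
    hence "\<exists>u\<in>Lm (int (Suc e) + 1). face C (-1) c u" by (auto simp: TT_simps)
    moreover have "\<not> (\<exists>u\<in>Lm (int (Suc e) + 1). face C 1 c u)" using cl leaves_TT by blast
    ultimately show "face C (-1) c ?A" using fs[of "-1"] ab by simp
  qed
qed

text \<open>If the next iterated target is a loop, then everything above it is a loop. As \<Lambda>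
  contains no loops, it has no cells in that dimension, and the tree \<open>TT (Suc e)\<close> is a
  single edge. So the loop case is as degenerate as the top dimension.\<close>

lemma top_shape:
  assumes e: "e < n" and g: "\<And>f. e < f \<Longrightarrow> f \<le> n \<Longrightarrow> good_level f"
  shows "(cells_dim C (int (Suc e)) = {it (Suc e)} \<and> Lm (int (Suc e)) = {it (Suc e)}) \<or>
    (Suc (Suc e) \<le> n \<and> face C 1 (it (Suc e)) (it (Suc (Suc e))) \<and>
      (\<forall>y. face C (-1) y (it (Suc (Suc e))) \<longleftrightarrow> y \<in> Lm (int (Suc e))))"
proof (cases "Suc e = n")
  case True
  have "it n \<in> Lam C" using Lam_iff no_coface_top it_top top_cells by simp
  hence "Lm (int n) = {it n}" using cells_dim_top by (auto simp: Lm_def)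
  thus ?thesis using cells_dim_top True by simp
next
  case False
  hence e2: "Suc (Suc e) \<le> n" using e by simp
  let ?A = "it (Suc (Suc e))"
  have it: "it (Suc e) = gam C ?A" using it_step[of "Suc e"] e2 by simp
  have Am: "?A \<in> cells C" "dim C ?A = int (Suc (Suc e))" using it_mem[OF e2] by auto
  have g2: "good_level (Suc (Suc e))" "good_level (Suc e)" using g e2 by simp_all
  from face_cases[of ?A] Am it consider "face C 1 (it (Suc e)) ?A" | "face C 0 (it (Suc e)) ?A" by auto
  thus ?thesis
  proof cases
    case 1
    thus ?thesis using it_source_iff[OF e2 g2] e2 by blast
  next
    case 2
    have T2: "tree (TT (Suc (Suc e)))" "leaves (TT (Suc (Suc e))) = Lm (int (Suc (Suc e)))"
      and T1: "tree (TT (Suc e))" "leaves (TT (Suc e)) = Lm (int (Suc e))" using g2 by (simp_all add: good_level_def)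
    interpret T1: tree "TT (Suc e)" by (rule T1)
    have "face C 0 (it (Suc e)) u" if "u \<in> cells_dim C (int (Suc (Suc e)))" for u
      using loops_above[OF T2(1) 2 root_above[OF T2(1) that]] .
    hence "Lm (int (Suc (Suc e))) = {}" using Lam_nonloop by (auto simp: Lm_def)
    hence nn: "nodes (TT (Suc e)) = {}" by (simp add: TT_simps)
    from T1.no_nodes_edges[OF nn] have ed: "cells_dim C (int (Suc e)) = {it (Suc e)}" by (simp add: TT_simps)
    have "leaves (TT (Suc e)) = {it (Suc e)}" using ed nn leaves_TT[of _ "Suc e"] by (auto simp: TT_simps)
    thus ?thesis using ed T1(2) by simp
  qed
qed

end

lemma desc_stepI: "(x, y) \<in> desc_step T \<Longrightarrow> x \<in> vertices T \<Longrightarrow> y \<in> vertices T \<Longrightarrow> desc T x y"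
  by (auto simp: desc_def)

context dendritic
begin

lemma good_level_top: "good_level n"
proof -
  have N: "Lm (int n + 1) = {}"
    using le_top top_dim by (auto simp: Lm_iff Lam_iff) fastforce
  have E: "cells_dim C (int n) = {it n}" by (rule cells_dim_top)
  have "rooted_tree (TT n)"
    unfolding rooted_tree_def by (auto simp: TT_simps N E desc_def)
  moreover have "leaves (TT n) = Lm (int n)" by (auto simp: Lam_iff no_coface_top it_top top_cells E Lm_def leaves_TT _ N)
  ultimately show ?thesis by (simp add: good_level_def tree_def)
qed

lemma node_descends:
  assumes a: "a \<in> Lm (int e + 1)"
  shows "desc (TT e) (Inl a) (Inr (gam C a))" "face C (-1) c a \<Longrightarrow> desc (TT e) (Inr c) (Inl a)"
proof -
  have t: "face C 1 (gam C a) a" using Lm_target[OF a] .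
  hence "gam C a \<in> cells_dim C (int e)" using face_mem[OF t] a by (simp add: cells_dim_iff Lm_iff)
  thus "desc (TT e) (Inl a) (Inr (gam C a))" using a t by (intro desc_stepI) (simp_all add: TT_simps)
  assume f: "face C (-1) c a"
  hence "c \<in> cells_dim C (int e)" using face_mem[OF f] a by (simp add: cells_dim_iff Lm_iff)
  thus "desc (TT e) (Inr c) (Inl a)" using a f by (intro desc_stepI) (simp_all add: TT_simps)
qed

text \<open>Going down from a loop on \<open>c\<close>, one stays on loops on \<open>c\<close> until a node of the zig-zag is met.\<close>

lemma loop_step:
  assumes y: "face C 0 c y" "face C (-1) y a" and x: "face C 1 x a"
  shows "face C 0 c x \<or> (\<exists>y' \<alpha> \<beta>. \<alpha> \<noteq> 0 \<and> \<beta> \<noteq> 0 \<and> face C \<beta> c y' \<and> face C \<alpha> y' a)"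
    by (metis loop_thin y loop_only face_mem(5) x target_unique)

text \<open>In the general case of \<open>top_shape\<close> the nodes of \<open>TT e\<close> are
  exactly the sources of the one cell \<open>it (Suc (Suc e))\<close>. Thinness for this cell shows
  that an edge has at most one node on each side, and acyclicity in the form of
  \<open>source_induct\<close> gives the paths to the root.\<close>

lemma good_level_step:
  assumes e: "e < n" and g: "\<And>f. e < f \<Longrightarrow> f \<le> n \<Longrightarrow> good_level f"
  shows "good_level e"
proof -
  have T1: "tree (TT (Suc e))" and lv1: "leaves (TT (Suc e)) = Lm (int (Suc e))"
    using g[of "Suc e"] e by (simp_all add: good_level_def)
  have lv: "leaves (TT e) = Lm (int e)" using leaves_Lm_step[OF T1 lv1] .
  have L1: "Lm (int e + 1) = Lm (int (Suc e))" by (simp add: add.commute)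
  have itg: "it e = gam C (it (Suc e))" using it_step[OF e] .
  have itm: "it e \<in> cells_dim C (int e)" using it_mem[of e] e by (simp add: cells_dim_iff)
  have it1: "it (Suc e) \<in> cells C" "dim C (it (Suc e)) \<ge> 0" using it_mem[of "Suc e"] e by simp_all
  from top_shape[OF e g]
  consider (corolla) "cells_dim C (int (Suc e)) = {it (Suc e)}" "Lm (int (Suc e)) = {it (Suc e)}"
    | (general) "Suc (Suc e) \<le> n" "face C 1 (it (Suc e)) (it (Suc (Suc e)))"
       "\<And>y. face C (-1) y (it (Suc (Suc e))) \<longleftrightarrow> y \<in> Lm (int (Suc e))" by blast
  note cs = this
  have Lnl: "face C 1 (gam C a) a" if "a \<in> Lm (int (Suc e))" for a using Lm_target that L1 by blast
  have unique: "a = a'" if "a \<in> Lm (int (Suc e))" "a' \<in> Lm (int (Suc e))" "face C s c a" "face C s c a'" "s \<noteq> 0" for a a' s c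
    using cs
  proof cases
    case corolla thus ?thesis using that by simp
  next
    case general
    thus ?thesis using source_unique[OF that(3,4,5)] that by blast
  qed
  have root_source: "\<not> face C (-1) (it e) a" if a: "a \<in> Lm (int (Suc e))" for a
    using cs
  proof cases
    case corolla
    hence "face C 1 (it e) a" using a itg Lnl by simp
    thus ?thesis using face_sign_unique by fastforce
  next
    case general
    \<comment> \<open>If the root edge is a positive face of \<open>it (Suc e)\<close>, thinness
      forbids it as a negative face of a source. Otherwise \<open>it (Suc e)\<close> is a loop on
      it, and then so is the source \<open>a\<close>, which lies in \<Lambda>.\<close>
    show ?thesis by (metis loop_sources general(2) general(3) a Lam_nonloop Lm_iff face_cases it1 itg target_source_sign)
  qed
  have path: "desc (TT e) (Inr (gam C a)) (Inr (it e))" if a: "a \<in> Lm (int (Suc e))" for a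
    using cs
  proof cases
    case corolla
    thus ?thesis using a itg itm by (simp add: desc_refl TT_simps)
  next
    case general
    have "face C (-1) a (it (Suc (Suc e)))" "face C 1 (gam C a) a" using general(3) a Lnl by blast+
    thus ?thesis
    proof (induction rule: source_induct)
      case (base y)
      hence "gam C y = it e" using general(2) itg by (simp add: face_pos)
      thus ?case using itm by (simp add: desc_refl TT_simps)
    next
      case (step y y')
      hence "y' \<in> Lm (int e + 1)" using general(3) L1 by blast
      thus ?case using node_descends[of y' e] step desc_trans by blast
    qed
  qed
  have path': "desc (TT e) (Inr c) (Inr (it e))" if a: "a \<in> Lm (int (Suc e))" "face C s c a" "s \<noteq> 0" for a s c
    by (metis face_mem(5) a(2) a(3) path a(1) face_pos node_descends L1 desc_trans)
  have signed: "desc (TT e) (Inr c) (Inr (it e))" if f: "face C s c y" "s \<noteq> 0" "dim C y = int (Suc e)" for s c y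
    using signed_leaf[OF T1 f] lv1 path' f(2) by blast
  have all: "desc (TT e) (Inr c) (Inr (it e))" if c: "c \<in> cells_dim C (int e)" for c
  proof -
    have "c \<in> cells C" "c \<noteq> top_cell C" using c e top_dim by (auto simp: cells_dim_iff)
    then obtain y s where y: "face C s c y" using cofaces by blast
    have dy: "dim C y = int (Suc e)" "y \<in> cells C" using face_mem[OF y] c by (simp_all add: cells_dim_iff)
    show ?thesis
    proof (cases "s = 0")
      case False thus ?thesis using signed y dy by blast
    next
      case True
      \<comment> \<open>If \<open>c\<close> is only known as the base of a loop, the path from this
        loop to the root is followed: either the root is still a loop on \<open>c\<close>, so that
        \<open>c\<close> is the root edge of \<open>TT e\<close>, or \<open>loop_step\<close> has
        supplied a cell with \<open>c\<close> as a signed face.\<close>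
      let ?ok = "\<lambda>y. face C 0 c y \<or> (\<exists>s y'. s \<noteq> 0 \<and> face C s c y')"
      have "desc (TT (Suc e)) (Inr y) (Inr (it (Suc e)))" using root_above[OF T1] dy by (simp add: cells_dim_iff)
      hence "(Inr y, Inr (it (Suc e))) \<in> (desc_step (TT (Suc e)))\<^sup>*" by (simp add: desc_def)
      hence "case (Inr (it (Suc e)) :: 'a + 'a) of Inr b \<Rightarrow> ?ok b | Inl a \<Rightarrow> \<exists>b. face C (-1) b a \<and> ?ok b"
      proof (induction rule: rtrancl_induct)
        case base thus ?case using True y by simp
      next
        case (step u v)
        show ?case
        proof (cases v)
          case (Inl a)
          then obtain b where "u = Inr b" "(b, a) \<in> tsource (TT (Suc e))" using step.hyps(2) by (cases u) auto
          thus ?thesis using step.IH Inl by (auto simp: TT_simps)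
        next
          case (Inr x)
          then obtain a where a: "u = Inl a" "face C 1 x a" using step.hyps(2) by (cases u) (auto simp: TT_simps)
          then obtain b where b: "face C (-1) b a" "?ok b" using step.IH by auto
          have "?ok x" by (metis loop_step a(2) b)
          thus ?thesis using Inr by simp
        qed
      qed
      hence "?ok (it (Suc e))" by simp
      thus ?thesis
      proof
        assume "face C 0 c (it (Suc e))"
        hence "c = it e" using itg by (simp add: face_zero)
        thus ?thesis using itm by (simp add: desc_refl TT_simps)
      next
        assume "\<exists>s y'. s \<noteq> 0 \<and> face C s c y'"
        then obtain s y' where "s \<noteq> 0" "face C s c y'" by blast
        moreover from this have "dim C y' = int (Suc e)" using face_mem[of s c y'] c by (simp add: cells_dim_iff)
        ultimately show ?thesis using signed by blast
      qed
    qed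
  qed
  have fin: "finite (Lm k)" "finite (cells_dim C k)" for k
    using finite_cells by (auto simp: Lm_def cells_dim_def)
  have "rooted_tree (TT e)"
    unfolding rooted_tree_def
  proof (intro conjI)
    show "finite (nodes (TT e))" "finite (edges (TT e))" using fin by (simp_all add: TT_simps)
    have m: "c \<in> cells_dim C (int e)" if "a \<in> Lm (int e + 1)" "face C s c a" for s c a
      using face_mem[OF that(2)] that(1) by (simp add: cells_dim_iff Lm_iff)
    show "tsource (TT e) \<subseteq> edges (TT e) \<times> nodes (TT e)" "ttarget (TT e) \<subseteq> edges (TT e) \<times> nodes (TT e)"
      using m by (auto simp: TT_simps)
    show "\<forall>a\<in>nodes (TT e). \<exists>!b. (b, a) \<in> ttarget (TT e)" by (metis TT_simps Lm_target face_pos)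
    show "\<forall>b a a'. (b, a) \<in> ttarget (TT e) \<and> (b, a') \<in> ttarget (TT e) \<longrightarrow> a = a'"
      using unique[where s = 1] L1 by (simp add: TT_simps) blast
    show "\<forall>b a a'. (b, a) \<in> tsource (TT e) \<and> (b, a') \<in> tsource (TT e) \<longrightarrow> a = a'"
      using unique[where s = "-1"] L1 by (simp add: TT_simps) blast
    show "root (TT e) \<in> edges (TT e)" using itm by (simp add: TT_simps)
    show "\<nexists>a. (root (TT e), a) \<in> tsource (TT e)" using root_source L1 by (simp add: TT_simps)
    show "\<forall>b\<in>edges (TT e). desc (TT e) (Inr b) (Inr (root (TT e)))" using all by (simp add: TT_simps)
  qed
  thus ?thesis using lv by (simp add: good_level_def tree_def)
qed

lemma good: "e \<le> n \<Longrightarrow> good_level e"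
proof (induction "n - e" arbitrary: e rule: less_induct)
  case less
  show ?case
  proof (cases "e = n")
    case True thus ?thesis using good_level_top by simp
  next
    case False
    thus ?thesis using good_level_step[of e] less by simp
  qed
qed

lemma TT_tree: "e \<le> n \<Longrightarrow> tree (TT e)"
  and TT_leaves: "e \<le> n \<Longrightarrow> leaves (TT e) = Lm (int e)"
  using good by (simp_all add: good_level_def)

end

section \<open>Loops and white dots\<close>

text \<open>One constellation of Z(C): \<open>TT e\<close> carries the strings, and the dots of
  these strings are the tops of \<open>TT (Suc e)\<close>.\<close>

locale dendritic_level = dendritic C for C :: "'a mop" +
  fixes e :: nat
  assumes level: "Suc e \<le> mop_dim C"
begin

sublocale T: tree "TT e" using TT_tree level by simp
sublocale U: tree "TT (Suc e)" using TT_tree level by simp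

abbreviation "TS \<equiv> TT (Suc e)"

lemma Lm_Suc: "Lm (int e + 1) = Lm (int (Suc e))" "Lm (int (Suc e) + 1) = Lm (int (e + 2))"
  by (simp_all add: add.commute)

lemma leaves_U: "leaves TS = Lm (int (Suc e))"
  using TT_leaves level by simp

lemma U_source: "(y, a) \<in> tsource TS \<longleftrightarrow> a \<in> Lm (int (e + 2)) \<and> face C (-1) y a"
  and U_target: "(y, a) \<in> ttarget TS \<longleftrightarrow> a \<in> Lm (int (e + 2)) \<and> face C 1 y a"
  by (simp_all add: TT_simps Lm_Suc del: of_nat_add)

definition whites :: "'a \<Rightarrow> 'a set" where
  "whites c = Z_white C (e + 2) c"

text \<open>Says which ends of the string of \<open>c\<close> lie above \<open>x\<close>. Both may
  do so; then \<open>c\<close> is an inner edge of the part above \<open>x\<close> and not a signed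
  face of \<open>x\<close>.\<close>

definition joint :: "int \<Rightarrow> 'a \<Rightarrow> 'a \<Rightarrow> bool" where
  "joint s c x \<longleftrightarrow> above_sign (Suc e) s c x"

lemma null_dots_U: "w \<in> null_dots TS \<longleftrightarrow> w \<in> Lm (int (e + 2)) \<and> w \<in> null_cells C"
proof -
  have "w \<in> Lm (int (e + 2)) \<Longrightarrow> (\<nexists>y. face C (-1) y w) \<longleftrightarrow> delta C w = {}"
    using Lm_target[of w "Suc e"] by (auto simp: face_neg face_pos Lm_Suc simp del: of_nat_add)
  thus ?thesis by (auto simp: null_dots_def U_source TT_simps Lm_Suc null_cells_def Lm_iff Lam_iff simp del: of_nat_add)
qed

lemma whites_iff: "w \<in> whites c \<longleftrightarrow> w \<in> null_dots TS \<and> gam C (gam C w) = c"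
  by (auto simp: whites_def Z_white_def null_dots_U Lm_def)

text \<open>A cell without sources satisfies the hypothesis of \<open>loop_target\<close>
  vacuously.\<close>

lemma null_loop:
  assumes "w \<in> null_dots TS"
  shows "face C 1 (gam C w) w" "face C 0 (gam C (gam C w)) (gam C w)" "desc TS (Inl w) (Inr (gam C w))"
proof -
  have w: "w \<in> Lm (int (Suc e) + 1)" "delta C w = {}" using assms by (auto simp: null_dots_U null_cells_def)
  show t: "face C 1 (gam C w) w" using Lm_target[OF w(1)] .
  have "dim C (gam C w) \<ge> 0" using face_mem[OF t] w by (simp add: Lm_iff)
  thus "face C 0 (gam C (gam C w)) (gam C w)"
    by (rule loop_target[OF t]) (use w in \<open>auto simp: face_neg\<close>)
  show "desc TS (Inl w) (Inr (gam C w))" using node_descends(1)[OF w(1)] .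
qed

lemma white_loop: "w \<in> whites c \<Longrightarrow> face C 0 c (gam C w)"
  using null_loop(2)[of w] by (simp add: whites_iff)

lemma desc_null:
  assumes w: "w \<in> null_dots TS" and d: "desc TS (Inl w) (Inr x)"
  shows "desc TS (Inr (gam C w)) (Inr x)" using w null_loop U_target null_dots_U U.desc_through_step d by auto

lemma tops_loop:
  assumes x: "face C 0 c x" and t: "t \<in> tops TS" "desc TS t (Inr x)"
  shows "\<exists>w\<in>whites c. t = Inl w"
proof (cases t)
  case (Inr l)
  hence "face C 0 c l" using loops_above[OF U.tree_axioms x] t by blast
  moreover have "l \<in> Lam C" using t Inr leaves_U by (auto simp: tops_def Lm_iff)
  ultimately show ?thesis using Lam_nonloop by blast
next
  case (Inl w)
  hence w: "w \<in> null_dots TS" using t by (auto simp: tops_def)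
  hence "face C 0 c (gam C w)" using loops_above[OF U.tree_axioms x] desc_null t Inl by blast
  hence "gam C (gam C w) = c" by (simp add: face_zero)
  thus ?thesis using w Inl whites_iff by blast
qed

text \<open>Together with \<open>tops_loop\<close> this reads sign 0 off from the dots. Going down,
  a node all of whose sources are loops has a loop as target (\<open>loop_target\<close>), on the
  same cell by \<open>loop_sources\<close>; at a null node the loop comes from the white dot
  itself.\<close>

lemma loop_tops:
  assumes x: "x \<in> cells_dim C (int (Suc e))"
    and t: "\<And>t. t \<in> tops TS \<Longrightarrow> desc TS t (Inr x) \<Longrightarrow> \<exists>w\<in>whites c. t = Inl w"
  shows "face C 0 c x"
proof -
  have "x \<in> edges TS" using x by (simp add: TT_simps)
  hence "(\<forall>t\<in>tops TS. desc TS t (Inr x) \<longrightarrow> (\<exists>w\<in>whites c. t = Inl w)) \<longrightarrow> face C 0 c x"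
  proof (induction rule: U.edge_up_induct)
    case (1 x)
    show ?case
    proof
      assume t: "\<forall>t\<in>tops TS. desc TS t (Inr x) \<longrightarrow> (\<exists>w\<in>whites c. t = Inl w)"
      have "x \<notin> leaves TS"
        using t[rule_format, of "Inr x"] 1(1) desc_refl[of "Inr x" "TS"] by (auto simp: tops_def)
      then obtain a where a: "(x, a) \<in> ttarget TS" using 1(1) by (auto simp: leaves_def)
      hence fa: "face C 1 x a" "a \<in> Lm (int (e + 2))" by (auto simp: U_target)
      have src: "face C 0 c y" if y: "face C (-1) y a" for y
      proof -
        have s: "(y, a) \<in> tsource TS" using y fa by (simp add: U_source)
        hence "desc TS (Inr y) (Inr x)" using U.desc_source U.desc_target[OF a] desc_trans by blast
        hence "\<forall>t\<in>tops TS. desc TS t (Inr y) \<longrightarrow> (\<exists>w\<in>whites c. t = Inl w)"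
          using t desc_trans by blast
        thus ?thesis using 1(2)[OF a s] by blast
      qed
      show "face C 0 c x"
      proof (cases "\<exists>y. face C (-1) y a")
        case True
        then obtain y where y: "face C (-1) y a" by blast
        have "dim C x \<ge> 0" using 1(1) by (simp add: TT_simps cells_dim_iff)
        hence l: "face C 0 (gam C x) x" using loop_target[OF fa(1)] src by blast
        have "face C 0 (gam C x) y" using loop_sources[OF fa(1) l y] .
        hence "gam C x = c" using loop_only[OF src[OF y]] by blast
        thus ?thesis using l by simp
      next
        case False
        hence an: "a \<in> null_dots TS" using fa by (auto simp: null_dots_def U_source TT_simps Lm_Suc simp del: of_nat_add)
        hence "Inl a \<in> tops TS" by (simp add: tops_def)
        hence "a \<in> whites c" using t U.desc_target[OF a] by blast
        moreover have "x = gam C a" using fa by (simp add: face_pos)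
        ultimately show ?thesis using white_loop by simp
      qed
    qed
  qed
  thus ?thesis using t by blast
qed

lemma face_joint:
  "s = 1 \<or> s = -1 \<Longrightarrow> x \<in> cells_dim C (int (Suc e)) \<Longrightarrow> face C s c x \<longleftrightarrow> joint s c x \<and> \<not> joint (- s) c x"
  unfolding joint_def using face_above_sign[OF good[OF level] T.tree_axioms] by blast

lemma joint_mono: "joint s c y \<Longrightarrow> desc TS (Inr y) (Inr x) \<Longrightarrow> joint s c x"
  unfolding joint_def above_sign_def using desc_trans by blast

lemma joint_source: "joint s c y \<Longrightarrow> face C (-1) y a \<Longrightarrow> face C 1 x a \<Longrightarrow> a \<in> Lm (int (e + 2)) \<Longrightarrow> joint s c x"
  using U.desc_source U.desc_target U_source U_target joint_mono desc_trans by blast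

lemma joint_unique:
  assumes y: "face C (-1) y a" "face C (-1) y' a" "a \<in> Lm (int (e + 2))" and j: "joint s c y" "joint s c y'" "s \<noteq> 0"
  shows "y = y'" by (metis j(1) joint_def above_sign_def Lm_Suc j(2) signed_unique T.tree_axioms j(3) U.sources_disjoint y U_source)

lemma joint_not_loop: "joint s c y \<Longrightarrow> \<not> face C 0 c' y" using joint_def above_sign_def tops_loop leaves_U tops_def by blast

lemma cell_of_face: "face C s y a \<Longrightarrow> a \<in> Lm (int (e + 2)) \<Longrightarrow> y \<in> cells_dim C (int (Suc e))"
  using face_mem[of s y a] by (simp add: cells_dim_iff Lm_iff)

lemma face_joint_imp: "face C s c y \<Longrightarrow> s \<noteq> 0 \<Longrightarrow> y \<in> cells_dim C (int (Suc e)) \<Longrightarrow> joint s c y \<and> \<not> joint (- s) c y"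
  using face_joint[of s y c] face_mem(5)[of s c y] by auto

text \<open>Just below \<open>w\<close> the path consists of loops on \<open>c\<close>. Where it
  stops doing so, \<open>loop_step\<close> finds a signed face \<open>c\<close> at the node, so an
  end of the string is above; this remains true further down.\<close>

lemma white_incident:
  assumes w: "w \<in> whites c" and d: "desc TS (Inl w) (Inr x)"
  shows "face C 0 c x \<or> (\<exists>s. (s = 1 \<or> s = -1) \<and> joint s c x)"
proof -
  let ?ok = "\<lambda>x. face C 0 c x \<or> (\<exists>s. (s = 1 \<or> s = -1) \<and> joint s c x)"
  have "w \<in> null_dots TS" using w whites_iff by blast
  from desc_null[OF this d] have "(Inr (gam C w), Inr x) \<in> (desc_step TS)\<^sup>*" by (simp add: desc_def)
  hence "case (Inr x :: 'a + 'a) of Inr b \<Rightarrow> ?ok b | Inl a \<Rightarrow> \<exists>b. face C (-1) b a \<and> ?ok b"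
  proof (induction rule: rtrancl_induct)
    case base thus ?case using white_loop[OF w] by simp
  next
    case (step u v)
    show ?case
    proof (cases v)
      case (Inl a)
      then obtain b where "u = Inr b" "(b, a) \<in> tsource TS" using step.hyps(2) by (cases u) auto
      thus ?thesis using step.IH Inl by (auto simp: U_source)
    next
      case (Inr x)
      then obtain a where a: "u = Inl a" "face C 1 x a" "a \<in> Lm (int (e + 2))"
        using step.hyps(2) by (cases u) (auto simp: U_target)
      then obtain b where b: "face C (-1) b a" "?ok b" using step.IH by auto
      have "?ok x"
      proof (cases "face C 0 c b")
        case True
        from loop_step[OF True b(1) a(2)] show ?thesis
        proof
          assume "\<exists>y' \<alpha> \<beta>. \<alpha> \<noteq> 0 \<and> \<beta> \<noteq> 0 \<and> face C \<beta> c y' \<and> face C \<alpha> y' a"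
          then obtain y' \<alpha> \<beta> where y': "\<alpha> \<noteq> 0" "\<beta> \<noteq> 0" "face C \<beta> c y'" "face C \<alpha> y' a" by blast
          have j: "joint \<beta> c y'" using face_joint_imp[OF y'(3,2) cell_of_face[OF y'(4) a(3)]] by blast
          have bs: "\<beta> = 1 \<or> \<beta> = -1" using face_mem(5)[OF y'(3)] y'(2) by auto
          have "joint \<beta> c x" by (metis target_unique y'(4) j face_mem(5) y'(1) joint_source a(2,3))
          thus ?thesis using bs by blast
        qed blast
      next
        case False
        thus ?thesis using b joint_source[OF _ b(1) a(2,3)] by blast
      qed
      thus ?thesis using Inr by simp
    qed
  qed
  thus ?thesis by simp
qed

end

section \<open>The order on the white dots of an edge\<close>

context tree
begin

lemma edge_path:
  assumes "desc T (Inr x) (Inr y)"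
  shows "\<exists>m b a. b 0 = x \<and> b m = y \<and> (\<forall>i<m. (b i, a i) \<in> tsource T \<and> (b (Suc i), a i) \<in> ttarget T)"
proof -
  let ?P = "\<lambda>y. \<exists>m b a. b 0 = x \<and> b m = y \<and> (\<forall>i<m. (b i, a i) \<in> tsource T \<and> (b (Suc i), a i) \<in> ttarget T)"
  have "(Inr x, Inr y) \<in> (desc_step T)\<^sup>*" using assms by (simp add: desc_def)
  hence "case (Inr y :: 'n + 'e) of Inr y \<Rightarrow> ?P y | Inl a \<Rightarrow> \<exists>y. (y, a) \<in> tsource T \<and> ?P y"
  proof (induction rule: rtrancl_induct)
    case base
    have "?P x" by (intro exI[of _ "0::nat"] exI[of _ "\<lambda>_. x"]) simp
    thus ?case by simp
  next
    case (step u v)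
    show ?case
    proof (cases v)
      case (Inl a)
      then obtain z where "u = Inr z" "(z, a) \<in> tsource T" using step.hyps(2) by (cases u) auto
      thus ?thesis using step.IH Inl by auto
    next
      case (Inr z)
      then obtain a where a: "u = Inl a" "(z, a) \<in> ttarget T" using step.hyps(2) by (cases u) auto
      then obtain y m b' a' where y: "(y, a) \<in> tsource T" "b' 0 = x" "b' m = y"
        "\<forall>i<m. (b' i, a' i) \<in> tsource T \<and> (b' (Suc i), a' i) \<in> ttarget T" using step.IH by auto
      have "?P z"
        by (rule exI[of _ "Suc m"], rule exI[of _ "b'(Suc m := z)"], rule exI[of _ "a'(m := a)"])
          (use y a in \<open>auto simp: less_Suc_eq\<close>)
      thus ?thesis using Inr by simp
    qed
  qed
  thus ?thesis by simp
qed

lemma path_desc: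
  assumes p: "\<forall>i<m. (b i, a i) \<in> tsource T \<and> (b (Suc i), a i) \<in> ttarget T" and b: "b 0 \<in> edges T"
  shows "i \<le> j \<Longrightarrow> j \<le> m \<Longrightarrow> desc T (Inr (b i)) (Inr (b j))"
proof (induction j rule: dec_induct)
  case base
  have "b i \<in> edges T" using base p b target_mem[of "b i" "a (i - 1)"] by (cases i) auto
  thus ?case using desc_refl[of "Inr (b i)" T] by simp
next
  case (step j)
  hence "desc T (Inr (b j)) (Inl (a j))" "desc T (Inl (a j)) (Inr (b (Suc j)))"
    using p desc_source desc_target by simp_all
  thus ?case using step desc_trans by (meson Suc_leD)
qed

text \<open>Descending paths are unique, so the listed path meets every edge between its
  ends.\<close>

lemma path_covers:
  assumes p: "\<forall>i<m. (b i, a i) \<in> tsource T \<and> (b (Suc i), a i) \<in> ttarget T"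
    and z: "desc T (Inr (b 0)) (Inr z)" "desc T (Inr z) (Inr (b m))"
  shows "\<exists>j\<le>m. b j = z"
proof (rule ccontr)
  assume n: "\<not> ?thesis"
  have "i \<le> m \<Longrightarrow> desc T (Inr (b i)) (Inr z)" for i
  proof (induction i)
    case 0 thus ?case using z by simp
  next
    case (Suc i)
    hence d: "desc T (Inr (b i)) (Inr z)" "b i \<noteq> z" using n by auto
    have "desc T (Inl (a i)) (Inr z)" using desc_through_step[OF d(1)] p Suc.prems d(2) by simp
    thus ?case using desc_through_step[of "Inl (a i)" "Inr z" "Inr (b (Suc i))"] p Suc.prems by simp
  qed
  hence "b m = z" using z(2) desc_antisym by blast
  thus False using n by blast
qed

end

context dendritic_level
begin

text \<open>Two sources \<open>y\<close>, \<open>y'\<close> of a node \<open>a\<close> in the order in which the string of \<open>c\<close> passes through them.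
  The order on the white dots of \<open>c\<close> is the induced lexicographic order, see \<open>loop_order_iff\<close>.\<close>

definition before :: "'a \<Rightarrow> 'a \<Rightarrow> 'a \<Rightarrow> 'a \<Rightarrow> bool" where
  "before c a y y' \<longleftrightarrow> face C (-1) c y \<or> face C 1 c y' \<or> (y, y') \<in> lord C a c"

text \<open>The string of \<open>c\<close> as it appears in \<open>TS\<close>: its end nodes have
  become leaves and its white dots null dots.\<close>

definition strand :: "'a \<Rightarrow> ('a + 'a) set" where
  "strand c = Inr ` {l \<in> Lm (int (Suc e)). face C 1 c l \<or> face C (-1) c l} \<union> Inl ` whites c"

abbreviation "lx c \<equiv> U.lex (before c)"

lemma strand_tops: "strand c \<subseteq> tops TS"
  using leaves_U whites_iff by (auto simp: strand_def tops_def)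

lemma lord_loop: "(y, y') \<in> lord C a c \<Longrightarrow> face C 0 c y \<and> face C 0 c y' \<and> face C (-1) y a \<and> face C (-1) y' a"
  using mop_lord(1)[OF mop] by (auto simp: local_loops_def)

lemma strand_meets:
  assumes "t \<in> strand c" "desc TS t (Inr y)"
  shows "face C 0 c y \<or> (\<exists>s. (s = 1 \<or> s = -1) \<and> joint s c y)"
proof -
  consider l where "t = Inr l" "l \<in> Lm (int (Suc e))" "face C 1 c l \<or> face C (-1) c l"
    | w where "t = Inl w" "w \<in> whites c" using assms(1) by (auto simp: strand_def)
  thus ?thesis by (metis assms(2) joint_def above_sign_def white_incident)
qed

text \<open>Suppose \<open>c\<close> is not incident to \<open>y\<close>. Then both ends of the
  string are above \<open>y\<close>, none is above \<open>y'\<close>, and \<open>y'\<close> is a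
  loop on \<open>c\<close>. The second face given by \<open>loop_thin\<close> for \<open>y'\<close>
  is a loop or has \<open>c\<close> with a sign, and it is the target or a source of
  \<open>a\<close>; each possibility contradicts the assumption on \<open>y\<close>.\<close>

lemma source_incident:
  assumes y: "face C (-1) y a" "face C (-1) y' a" "a \<in> Lm (int (e + 2))" "y \<noteq> y'"
    and t: "t \<in> strand c" "t' \<in> strand c" "desc TS t (Inr y)" "desc TS t' (Inr y')"
  shows "face C 0 c y \<or> face C 1 c y \<or> face C (-1) c y"
proof (rule ccontr)
  assume n: "\<not> ?thesis"
  obtain s where s: "s = 1 \<or> s = -1" "joint s c y" using strand_meets[OF t(1,3)] n by blast
  have yc: "y \<in> cells_dim C (int (Suc e))" using cell_of_face y by blast
  have "joint 1 c y \<and> joint (-1) c y" using face_joint[OF _ yc, of 1 c] face_joint[OF _ yc, of "-1" c] n s by auto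
  hence j: "s = 1 \<or> s = -1 \<Longrightarrow> joint s c y" for s by auto
  hence "\<not> joint s c y'" if "s = 1 \<or> s = -1" for s using joint_unique[OF y(1,2,3)] y(4) that by force
  hence l: "face C 0 c y'" using strand_meets[OF t(2,4)] by blast
  obtain y'' \<alpha> \<beta> where y'': "y'' \<noteq> y'" "face C \<beta> c y''" "face C \<alpha> y'' a" "(\<alpha>, \<beta>) \<noteq> (-1, 0)"
    using loop_thin[OF l y(2)] by blast
  have a0: "\<alpha> = 1 \<or> \<alpha> = -1" using loop_only[of y'' a "-1" y] y''(3) y(1) face_mem(5)[OF y''(3)] by auto
  have yc'': "y'' \<in> cells_dim C (int (Suc e))" using cell_of_face y'' y by blast
  show False
  proof (cases "\<beta> = 0")
    case True
    hence "face C 1 y'' a" using a0 y'' by auto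
    hence "face C 0 c y" using loop_sources[of y'' a c y] y''(2) y(1) True by simp
    thus False using n by blast
  next
    case False
    have b: "\<beta> = 1 \<or> \<beta> = -1" "- \<beta> = 1 \<or> - \<beta> = -1" using False face_mem(5)[OF y''(2)] by auto
    have jb: "joint \<beta> c y''" "\<not> joint (- \<beta>) c y''" using face_joint_imp[OF y''(2) False yc''] by auto
    show False
    proof (cases "\<alpha> = 1")
      case True
      thus False using joint_source[OF j[OF b(2)] y(1) _ y(3)] y''(3) jb by blast
    next
      case False
      hence "face C (-1) y'' a" using a0 y'' by auto
      hence "y'' = y" using joint_unique[OF _ y(1,3) jb(1) j[OF b(1)]] b by auto
      thus False using jb j b by blast
    qed
  qed
qed

text \<open>By \<open>source_incident\<close> each of the two sources is a loop on \<open>c\<close>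
  or has \<open>c\<close> as a signed face. A signed one is put first or last by its sign, so only
  two loops need the local order.\<close>

lemma before_total:
  assumes y: "face C (-1) y a" "face C (-1) y' a" "a \<in> Lm (int (e + 2))" "y \<noteq> y'"
    and t: "t \<in> strand c" "t' \<in> strand c" "desc TS t (Inr y)" "desc TS t' (Inr y')"
  shows "before c a y y' \<or> before c a y' y"
proof -
  have "face C 0 c y \<or> face C 1 c y \<or> face C (-1) c y" using source_incident[OF y t] .
  moreover have "face C 0 c y' \<or> face C 1 c y' \<or> face C (-1) c y'"
    using source_incident[OF y(2,1,3) y(4)[symmetric] t(2,1,4,3)] .
  moreover have "(y, y') \<in> lord C a c \<or> (y', y) \<in> lord C a c" if "face C 0 c y" "face C 0 c y'"
    using mop_lord(3)[OF mop, of a y c y'] that y by (auto simp: Lm_iff local_loops_def)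
  ultimately show ?thesis unfolding before_def by blast
qed

text \<open>Two sources of \<open>a\<close> cannot have \<open>c\<close> with the same nonzero sign
  (\<open>source_unique\<close>), so at most one is forced to be first and at most one to be
  last.\<close>

lemma before_asym:
  assumes y: "face C (-1) y a" "face C (-1) y' a" "y \<noteq> y'" and b: "before c a y y'"
  shows "\<not> before c a y' y"
proof
  assume b': "before c a y' y"
  have u: "s \<noteq> 0 \<Longrightarrow> \<not> (face C s c y \<and> face C s c y')" for s using source_unique[of s c y y' a] y by blast
  have ex: "\<not> (face C 1 c z \<and> face C (-1) c z)" "\<not> (face C 0 c z \<and> face C 1 c z)" "\<not> (face C 0 c z \<and> face C (-1) c z)" for z
    using face_sign_unique[of 1 c z "-1"] face_sign_unique[of 0 c z 1] face_sign_unique[of 0 c z "-1"] by auto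
  have l: "\<not> ((y, y') \<in> lord C a c \<and> (y', y) \<in> lord C a c)"
    using mop_lord(1)[OF mop] transD[OF mop_lord(2)[OF mop], of y y' a c y] by blast
  show False using b b' u[of 1] u[of "-1"] ex[of y] ex[of y'] l lord_loop[of y y' a c] lord_loop[of y' y a c]
    unfolding before_def by auto
qed

lemma before_trans:
  assumes y: "face C (-1) y a" "face C (-1) y' a" "face C (-1) y'' a" "y \<noteq> y'" "y' \<noteq> y''"
    and b: "before c a y y'" "before c a y' y''"
  shows "y \<noteq> y'' \<and> before c a y y''"
proof
  show "y \<noteq> y''" using before_asym[OF y(1,2,4) b(1)] b(2) by blast
  have u: "s \<noteq> 0 \<Longrightarrow> \<not> (face C s c y' \<and> face C s c y'') \<and> \<not> (face C s c y \<and> face C s c y')" for s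
    using source_unique[of s c y' y'' a] source_unique[of s c y y' a] y by blast
  have ex: "\<not> (face C 1 c z \<and> face C (-1) c z)" "\<not> (face C 0 c z \<and> face C 1 c z)" "\<not> (face C 0 c z \<and> face C (-1) c z)" for z
    using face_sign_unique[of 1 c z "-1"] face_sign_unique[of 0 c z 1] face_sign_unique[of 0 c z "-1"] by auto
  have l: "(y, y') \<in> lord C a c \<Longrightarrow> (y', y'') \<in> lord C a c \<Longrightarrow> (y, y'') \<in> lord C a c"
    using transD[OF mop_lord(2)[OF mop]] .
  note lp = lord_loop[of y y' a c] lord_loop[of y' y'' a c]
  from b(1) consider "face C (-1) c y" | "face C 1 c y'" | "(y, y') \<in> lord C a c" by (auto simp: before_def)
  thus "before c a y y''" by (metis before_def b(2) ex lp(2) lp(1) l)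
qed

lemma lx_total: "t \<in> strand c \<Longrightarrow> t' \<in> strand c \<Longrightarrow> t \<noteq> t' \<Longrightarrow> lx c t t' \<or> lx c t' t"
proof (rule U.lex_total[OF strand_tops])
  show "before c a y y' \<or> before c a y' y" if "(y, a) \<in> tsource TS" "(y', a) \<in> tsource TS" "y \<noteq> y'"
    "t \<in> strand c" "t' \<in> strand c" "desc TS t (Inr y)" "desc TS t' (Inr y')" for a y y' t t'
    using that before_total unfolding U_source by blast
qed

lemma lx_asym: "lx c t t' \<Longrightarrow> \<not> lx c t' t"
  by (rule U.lex_asym) (simp_all only: U_source, metis before_asym)

lemma lx_trans: "lx c t t' \<Longrightarrow> lx c t' t'' \<Longrightarrow> lx c t t''"
  by (rule U.lex_trans) (simp_all only: U_source, metis before_trans)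

lemma lx_convex:
  assumes "t1 \<in> strand c" "t2 \<in> strand c" "lx c t1 t2" "lx c t2 t3"
    "desc TS t1 (Inr x)" "desc TS t3 (Inr x)"
  shows "desc TS t2 (Inr x)" using U.lex_convex before_asym U_source assms strand_tops by blast

lemma strand_meet:
  assumes "t \<in> strand c" "t' \<in> strand c" "t \<noteq> t'"
  shows "\<exists>a y y'. a \<in> Lm (int (e + 2)) \<and> face C (-1) y a \<and> face C (-1) y' a \<and> y \<noteq> y' \<and>
    desc TS t (Inr y) \<and> desc TS t' (Inr y')"
proof -
  have "t \<in> tops TS" "t' \<in> tops TS" using strand_tops assms by blast+
  hence "\<not> desc TS t t'" "\<not> desc TS t' t" "t \<in> vertices TS" "t' \<in> vertices TS"
    using U.tops_maximal U.tops_vertices assms(3) by blast+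
  from U.meet_ex[OF this(3,4,1,2)] show ?thesis by (auto simp: U_source)
qed

text \<open>The branch through which \<open>l\<close> reaches the meet has the lower end of the
  string above it, so it is not a loop. Being incident to \<open>c\<close>, it must have sign -1,
  and such a branch comes first.\<close>

lemma lower_first:
  assumes l: "l \<in> Lm (int (Suc e))" "face C (-1) c l" and t: "t \<in> strand c" "t \<noteq> Inr l"
  shows "lx c (Inr l) t"
proof -
  have ls: "Inr l \<in> strand c" using l by (auto simp: strand_def)
  obtain a y y' where m: "a \<in> Lm (int (e + 2))" "face C (-1) y a" "face C (-1) y' a" "y \<noteq> y'"
    "desc TS (Inr l) (Inr y)" "desc TS t (Inr y')"
    using strand_meet[OF ls t(1)] t(2) by metis
  have j: "joint (-1) c y" using l m(5) by (auto simp: joint_def above_sign_def)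
  have "y \<in> cells_dim C (int (Suc e))" using cell_of_face m by blast
  hence "face C (-1) c y" using source_incident[OF m(2,3,1,4) ls t(1) m(5,6)] j joint_not_loop
      face_joint_imp[of 1 c y] by auto
  thus ?thesis using m by (intro U.lexI[of y a y']) (auto simp: U_source before_def)
qed

lemma upper_last:
  assumes l: "l \<in> Lm (int (Suc e))" "face C 1 c l" and t: "t \<in> strand c" "t \<noteq> Inr l"
  shows "lx c t (Inr l)"
proof -
  have ls: "Inr l \<in> strand c" using l by (auto simp: strand_def)
  obtain a y y' where m: "a \<in> Lm (int (e + 2))" "face C (-1) y a" "face C (-1) y' a" "y \<noteq> y'"
    "desc TS (Inr l) (Inr y)" "desc TS t (Inr y')"
    using strand_meet[OF ls t(1)] t(2) by metis
  have j: "joint 1 c y" using l m(5) by (auto simp: joint_def above_sign_def)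
  have "y \<in> cells_dim C (int (Suc e))" using cell_of_face m by blast
  hence "face C 1 c y" using source_incident[OF m(2,3,1,4) ls t(1) m(5,6)] j joint_not_loop
      face_joint_imp[of "-1" c y] by auto
  thus ?thesis using m by (intro U.lexI[of y' a y]) (auto simp: U_source before_def)
qed

end

section \<open>Existence of the zig-zag\<close>

context dendritic_level
begin

lemma level_dims:
  assumes c: "c \<in> cells_dim C (int e)" and f: "face C s c x"
  shows "x \<in> cells_dim C (int (Suc e))" "face C s' x a \<Longrightarrow> a \<in> Lam C \<Longrightarrow> a \<in> Lm (int (e + 2))" using face_mem f c cells_dim_iff Lm_iff
    by auto

definition chains :: "'a \<Rightarrow> ('a \<times> 'a) set" where
  "chains c = {(b', a'). a' \<in> Lam C \<and> (\<exists>\<alpha> \<beta>. \<alpha> \<noteq> 0 \<and> \<beta> \<noteq> 0 \<and> face C \<beta> c b' \<and> face C \<alpha> b' a')}"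

lemma chains_iff:
  assumes c: "c \<in> cells_dim C (int e)"
  shows "(x, a) \<in> chains c \<longleftrightarrow> (face C 1 c x \<or> face C (-1) c x) \<and> ((x, a) \<in> tsource TS \<or> (x, a) \<in> ttarget TS)"
proof
  assume "(x, a) \<in> chains c"
  then obtain \<alpha> \<beta> where f: "a \<in> Lam C" "\<alpha> \<noteq> 0" "\<beta> \<noteq> 0" "face C \<beta> c x" "face C \<alpha> x a" by (auto simp: chains_def)
  have "a \<in> Lm (int (e + 2))" using level_dims(2)[OF c f(4,5,1)] .
  thus "(face C 1 c x \<or> face C (-1) c x) \<and> ((x, a) \<in> tsource TS \<or> (x, a) \<in> ttarget TS)"
    unfolding U_source U_target using f face_mem(5)[OF f(4)] face_mem(5)[OF f(5)] by auto
next
  assume "(face C 1 c x \<or> face C (-1) c x) \<and> ((x, a) \<in> tsource TS \<or> (x, a) \<in> ttarget TS)"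
  hence "\<exists>\<beta>::int. \<beta> \<noteq> 0 \<and> face C \<beta> c x" "\<exists>\<alpha>::int. \<alpha> \<noteq> 0 \<and> face C \<alpha> x a" "a \<in> Lam C"
    unfolding U_source U_target Lm_iff by (metis zero_neq_one zero_neq_neg_one)+
  thus "(x, a) \<in> chains c" by (auto simp: chains_def)
qed

text \<open>One half of the zig-zag: a descending path that starts at a leaf and runs through all
  cells having \<open>c\<close> as a face of sign \<open>s\<close>. Indices grow towards the
  root.\<close>

definition side_path :: "'a \<Rightarrow> int \<Rightarrow> nat \<Rightarrow> (nat \<Rightarrow> 'a) \<Rightarrow> (nat \<Rightarrow> 'a) \<Rightarrow> bool" where
  "side_path c s m b a \<longleftrightarrow>
     (\<forall>i<m. (b i, a i) \<in> tsource TS \<and> (b (Suc i), a i) \<in> ttarget TS) \<and>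
     b 0 \<in> leaves TS \<and> (\<forall>x. face C s c x \<longleftrightarrow> (\<exists>j\<le>m. b j = x))"

lemma side_path_adjacent:
  assumes p: "side_path c s m b a" and x: "face C s c x"
  shows "(x, d) \<in> tsource TS \<Longrightarrow> (\<exists>j<m. x = b j \<and> d = a j) \<or> x = b m"
    and "(x, d) \<in> ttarget TS \<Longrightarrow> \<exists>j<m. x = b (Suc j) \<and> d = a j"
proof -
  obtain j where j: "j \<le> m" "b j = x" using p x by (auto simp: side_path_def)
  show "(\<exists>j<m. x = b j \<and> d = a j) \<or> x = b m" if "(x, d) \<in> tsource TS"
  proof (cases "j = m")
    case False
    hence "(x, a j) \<in> tsource TS" "j < m" using p j by (auto simp: side_path_def)
    thus ?thesis using U.lower_unique[OF that] j by blast
  qed (use j in blast)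
  show "\<exists>j<m. x = b (Suc j) \<and> d = a j" if t: "(x, d) \<in> ttarget TS"
  proof (cases j)
    case 0
    hence "x \<in> leaves TS" using p j by (auto simp: side_path_def)
    thus ?thesis using t by (auto simp: leaves_def)
  next
    case (Suc i)
    hence "(x, a i) \<in> ttarget TS" "i < m" using p j by (auto simp: side_path_def)
    thus ?thesis using U.upper_unique[OF t] j Suc by blast
  qed
qed

lemma zigzagI:
  assumes pq: "p \<le> q"
    and signs: "\<And>i. i \<in> {1..q} \<Longrightarrow> (i \<le> p \<longrightarrow> face C (-1) c (b i)) \<and> (i > p \<longrightarrow> face C 1 c (b i))"
    and steps: "\<And>i. i \<in> {1..<q} \<Longrightarrow>
       (i < p \<longrightarrow> (b i, a i) \<in> tsource TS \<and> (b (Suc i), a i) \<in> ttarget TS) \<and>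
       (i = p \<longrightarrow> (b i, a i) \<in> tsource TS \<and> (b (Suc i), a i) \<in> tsource TS) \<and>
       (i > p \<longrightarrow> (b i, a i) \<in> ttarget TS \<and> (b (Suc i), a i) \<in> tsource TS)"
    and ch: "chains c = (\<Union>i\<in>{1..<q}. {(b i, a i), (b (Suc i), a i)})"
  shows "is_zigzag C c p q b a"
proof -
  have "a i \<in> Lam C" if "i \<in> {1..<q}" for i
    using steps[OF that] by (cases i p rule: linorder_cases) (auto simp: U_source Lm_iff)
  thus ?thesis unfolding is_zigzag_def chains_def[symmetric]
    using pq signs steps ch by (simp add: U_source U_target)
qed

text \<open>Both halves are listed downwards from their leaves, so the right half is read backwards,
  with index \<open>q - i\<close>. \<open>a0\<close> is the node at which the halves meet; when one
  half is empty, \<open>B1\<close> and \<open>B2\<close> say that the other one ends at an edge with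
  no lower node.\<close>

lemma zigzag_build:
  assumes c: "c \<in> cells_dim C (int e)"
    and L: "p = 0 \<and> (\<forall>x. \<not> face C (-1) c x) \<or> p = Suc m \<and> side_path c (-1) m bl al"
    and R: "q = p \<and> (\<forall>x. \<not> face C 1 c x) \<or> q = p + Suc k \<and> side_path c 1 k bu au"
    and B: "p > 0 \<Longrightarrow> q > p \<Longrightarrow> (bl m, a0) \<in> tsource TS \<and> (bu k, a0) \<in> tsource TS"
    and B1: "\<And>a. p > 0 \<Longrightarrow> q = p \<Longrightarrow> (bl m, a) \<notin> tsource TS"
    and B2: "\<And>a. p = 0 \<Longrightarrow> q > p \<Longrightarrow> (bu k, a) \<notin> tsource TS"
  shows "is_zigzag C c p q (\<lambda>i. if i \<le> p then bl (i - 1) else bu (q - i))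
    (\<lambda>i. if i < p then al (i - 1) else if i = p then a0 else au (q - i - 1))"
    (is "is_zigzag C c p q ?b ?a")
proof -
  have Ls: "side_path c (-1) m bl al" "p = Suc m" if "p > 0" using L that by auto
  have Rs: "side_path c 1 k bu au" "q = p + Suc k" if "q > p" using R that by auto
  have pq: "p \<le> q" using R by auto
  have signs: "(i \<le> p \<longrightarrow> face C (-1) c (?b i)) \<and> (i > p \<longrightarrow> face C 1 c (?b i))" if i: "i \<in> {1..q}" for i
  proof (cases "i \<le> p")
    case True
    hence p0: "p > 0" using i by simp
    have "\<forall>x. face C (-1) c x \<longleftrightarrow> (\<exists>j\<le>m. bl j = x)" using Ls(1)[OF p0] by (simp add: side_path_def)
    moreover have "i - 1 \<le> m" using True Ls(2)[OF p0] by simp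
    ultimately have "face C (-1) c (bl (i - 1))" by blast
    thus ?thesis using True by simp
  next
    case False
    hence p0: "q > p" using i by simp
    have "\<forall>x. face C 1 c x \<longleftrightarrow> (\<exists>j\<le>k. bu j = x)" using Rs(1)[OF p0] by (simp add: side_path_def)
    moreover have "q - i \<le> k" using False Rs(2)[OF p0] by simp
    ultimately have "face C 1 c (bu (q - i))" by blast
    thus ?thesis using False by simp
  qed
  have steps: "((i < p \<longrightarrow> (?b i, ?a i) \<in> tsource TS \<and> (?b (Suc i), ?a i) \<in> ttarget TS) \<and>
        (i = p \<longrightarrow> (?b i, ?a i) \<in> tsource TS \<and> (?b (Suc i), ?a i) \<in> tsource TS) \<and>
        (i > p \<longrightarrow> (?b i, ?a i) \<in> ttarget TS \<and> (?b (Suc i), ?a i) \<in> tsource TS))"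
    if i: "i \<in> {1..<q}" for i
  proof -
    consider "i < p" | "i = p" | "i > p" by linarith
    thus ?thesis
    proof cases
      case 1
      hence "p > 0" by simp
      note l = Ls[OF this]
      have "i - 1 < m" "Suc (i - 1) = i" using 1 i l(2) by auto
      thus ?thesis using l(1) 1 unfolding side_path_def by auto
    next
      case 2
      hence "p > 0" "q > p" using i by auto
      hence "bl (p - 1) = bl m" "bu (q - Suc p) = bu k" using Ls(2) Rs(2) by auto
      thus ?thesis using 2 B \<open>p > 0\<close> \<open>q > p\<close> by simp
    next
      case 3
      hence "q > p" using i by auto
      note r = Rs[OF this]
      define j where "j = q - i - 1"
      have j: "j < k" "q - i = Suc j" "q - Suc i = j" "q - i - 1 = j" using 3 i r(2) by (auto simp: j_def)
      have "(bu j, au j) \<in> tsource TS" "(bu (Suc j), au j) \<in> ttarget TS"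
        using r(1) j(1) unfolding side_path_def by blast+
      thus ?thesis using 3 j(2-4) by simp
    qed
  qed
  have "chains c = (\<Union>i\<in>{1..<q}. {(?b i, ?a i), (?b (Suc i), ?a i)})"
  proof (rule set_eqI, rule iffI)
    fix z assume "z \<in> chains c"
    then obtain x d where z: "z = (x, d)" and ch: "(x, d) \<in> chains c" by (cases z) auto
    have adj: "(x, d) \<in> tsource TS \<or> (x, d) \<in> ttarget TS"
      and sg: "face C (-1) c x \<or> face C 1 c x" using ch chains_iff[OF c] by auto
    have "\<exists>i\<in>{1..<q}. (x = ?b i \<or> x = ?b (Suc i)) \<and> d = ?a i"
    proof (cases "face C (-1) c x")
      case True
      hence p0: "p > 0" using L by auto
      note l = Ls[OF p0]
      note ad = side_path_adjacent[OF l(1) True, of d]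
      show ?thesis
      proof (cases "\<exists>j<m. (x = bl j \<or> x = bl (Suc j)) \<and> d = al j")
        case True
        then obtain j where j: "j < m" "x = bl j \<or> x = bl (Suc j)" "d = al j" by blast
        thus ?thesis using l(2) pq by (intro bexI[of _ "Suc j"]) auto
      next
        case False
        hence xm: "x = bl m" "(x, d) \<in> tsource TS" using ad adj by blast+
        hence qp: "q > p" using B1[OF p0] pq by (metis le_neq_implies_less)
        hence "d = a0" using B[OF p0 qp] xm U.lower_unique by blast
        thus ?thesis using xm l(2) qp p0 by (intro bexI[of _ p]) auto
      qed
    next
      case False
      hence f: "face C 1 c x" using sg by blast
      hence qp: "q > p" using R by auto
      note r = Rs[OF qp]
      note ad = side_path_adjacent[OF r(1) f, of d]
      show ?thesis
      proof (cases "\<exists>j<k. (x = bu j \<or> x = bu (Suc j)) \<and> d = au j")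
        case True
        then obtain j where j: "j < k" "x = bu j \<or> x = bu (Suc j)" "d = au j" by blast
        hence "q - (q - Suc j) = Suc j" "q - Suc (q - Suc j) = j" "q - (q - Suc j) - 1 = j" "q - Suc j > p" "q - Suc j < q"
          using r(2) by auto
        thus ?thesis using j by (intro bexI[of _ "q - Suc j"]) auto
      next
        case False
        hence xm: "x = bu k" "(x, d) \<in> tsource TS" using ad adj by blast+
        hence p0: "p > 0" using B2 qp by auto
        hence "d = a0" using B[OF p0 qp] xm U.lower_unique by blast
        thus ?thesis using xm r(2) qp p0 by (intro bexI[of _ p]) auto
      qed
    qed
    thus "z \<in> (\<Union>i\<in>{1..<q}. {(?b i, ?a i), (?b (Suc i), ?a i)})" unfolding z by blast
  next
    fix z assume "z \<in> (\<Union>i\<in>{1..<q}. {(?b i, ?a i), (?b (Suc i), ?a i)})"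
    then obtain i where i: "i \<in> {1..<q}" "z = (?b i, ?a i) \<or> z = (?b (Suc i), ?a i)" by blast
    have "i \<in> {1..q}" "Suc i \<in> {1..q}" using i by auto
    hence s: "face C 1 c (?b i) \<or> face C (-1) c (?b i)" "face C 1 c (?b (Suc i)) \<or> face C (-1) c (?b (Suc i))"
      using signs[of i] signs[of "Suc i"] by (meson not_le)+
    have "(?b i, ?a i) \<in> tsource TS \<or> (?b i, ?a i) \<in> ttarget TS"
      "(?b (Suc i), ?a i) \<in> tsource TS \<or> (?b (Suc i), ?a i) \<in> ttarget TS"
      using steps[OF i(1)] by (meson linorder_neqE_nat)+
    thus "z \<in> chains c" using i(2) s chains_iff[OF c] by blast
  qed
  from zigzagI[OF pq signs steps this] show ?thesis .
qed

lemma joint_iff: "l \<in> Lm (int (Suc e)) \<Longrightarrow> face C s c l \<Longrightarrow> s \<noteq> 0 \<Longrightarrow> joint s c x \<longleftrightarrow> desc TS (Inr l) (Inr x)"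
  unfolding joint_def above_sign_def using signed_unique[OF T.tree_axioms, of _ l s c] unfolding Lm_Suc by blast

lemma no_side:
  assumes c: "c \<in> cells_dim C (int e)" and s: "s = 1 \<or> s = -1" and n: "\<not> (\<exists>l\<in>Lm (int (Suc e)). face C s c l)"
  shows "\<not> face C s c x" "\<not> joint s c x"
proof -
  show j: "\<not> joint s c x" using n by (auto simp: joint_def above_sign_def)
  show "\<not> face C s c x" using face_joint[OF s, of x c] level_dims(1)[OF c, of s x] j by blast
qed

text \<open>If the string has only one end, no edge on the path from this end to the root has the
  other end above it, so by \<open>face_joint\<close> all of them have \<open>c\<close> as a face of
  sign \<open>s\<close>.\<close>

lemma single_side:
  assumes c: "c \<in> cells_dim C (int e)" and s: "s = 1 \<or> s = -1"
    and l: "l \<in> Lm (int (Suc e))" "face C s c l" and n: "\<not> (\<exists>l\<in>Lm (int (Suc e)). face C (-s) c l)"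
  shows "\<exists>m b a. side_path c s m b a \<and> (\<forall>d. (b m, d) \<notin> tsource TS)"
proof -
  have lE: "l \<in> edges TS" "l \<in> leaves TS" using l leaves_U by (auto simp: leaves_def)
  hence d: "desc TS (Inr l) (Inr (root TS))" using U.desc_root[of "Inr l"] by simp
  obtain m b a where p: "b 0 = l" "b m = root TS"
    "\<forall>i<m. (b i, a i) \<in> tsource TS \<and> (b (Suc i), a i) \<in> ttarget TS"
    using U.edge_path[OF d] by blast
  have s': "- s = 1 \<or> - s = -1" "s \<noteq> 0" using s by auto
  have "face C s c x \<longleftrightarrow> (\<exists>j\<le>m. b j = x)" for x
  proof
    assume f: "face C s c x"
    hence x: "x \<in> cells_dim C (int (Suc e))" using level_dims(1)[OF c] by blast
    hence "joint s c x" using face_joint[OF s] f by blast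
    hence "desc TS (Inr (b 0)) (Inr x)" using joint_iff[OF l s'(2)] p(1) by simp
    moreover have "desc TS (Inr x) (Inr (b m))" using U.desc_root[of "Inr x"] x p(2) by (simp add: TT_simps)
    ultimately show "\<exists>j\<le>m. b j = x" using U.path_covers[OF p(3)] by blast
  next
    assume "\<exists>j\<le>m. b j = x"
    then obtain j where j: "j \<le> m" "b j = x" by blast
    have d: "desc TS (Inr l) (Inr x)" using U.path_desc[OF p(3), of 0 j] p(1) lE j by simp
    hence "x \<in> edges TS" using U.desc_vertices by fastforce
    thus "face C s c x" using face_joint[OF s, of x c] joint_iff[OF l s'(2)] d no_side(2)[OF c s'(1) n]
      by (simp add: TT_simps)
  qed
  hence "side_path c s m b a" unfolding side_path_def using p lE by blast
  thus ?thesis using p(2) U.root_not_source by metis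
qed

text \<open>An edge has \<open>c\<close> with sign \<open>s\<close> exactly if it lies below
  \<open>l\<close> but not below \<open>u\<close>; these are the edges on the path from
  \<open>l\<close> as far as \<open>y\<close>, just above the node where both paths meet.\<close>

lemma double_side:
  assumes c: "c \<in> cells_dim C (int e)" and s: "s = 1 \<or> s = -1"
    and l: "l \<in> Lm (int (Suc e))" "face C s c l" and u: "u \<in> Lm (int (Suc e))" "face C (- s) c u"
    and y: "(y, d) \<in> tsource TS" "(y', d) \<in> tsource TS" "y \<noteq> y'"
      "desc TS (Inr l) (Inr y)" "desc TS (Inr u) (Inr y')"
  shows "\<exists>m b a. side_path c s m b a \<and> b m = y"
proof -
  have lE: "l \<in> edges TS" "l \<in> leaves TS" using l leaves_U by (auto simp: leaves_def)
  obtain m b a where p: "b 0 = l" "b m = y"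
    "\<forall>i<m. (b i, a i) \<in> tsource TS \<and> (b (Suc i), a i) \<in> ttarget TS"
    using U.edge_path[OF y(4)] by blast
  have s': "s \<noteq> 0" "- s \<noteq> 0" using s by auto
  have "face C s c x \<longleftrightarrow> (\<exists>j\<le>m. b j = x)" for x
  proof
    assume f: "face C s c x"
    hence x: "x \<in> cells_dim C (int (Suc e))" using level_dims(1)[OF c] by blast
    hence j: "joint s c x" "\<not> joint (- s) c x" using face_joint[OF s] f by blast+
    hence dl: "desc TS (Inr l) (Inr x)" and du: "\<not> desc TS (Inr u) (Inr x)"
      using joint_iff[OF l s'(1)] joint_iff[OF u s'(2)] by blast+
    have "desc TS (Inr x) (Inr y)"
    proof (rule ccontr)
      assume "\<not> ?thesis"
      hence "desc TS (Inr y) (Inr x)" "y \<noteq> x" using U.desc_total[OF dl y(4)] by auto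
      hence "desc TS (Inl d) (Inr x)" using U.desc_through_step[of "Inr y" "Inr x" "Inl d"] y(1) by simp
      hence "desc TS (Inr u) (Inr x)" using y(5) U.desc_source[OF y(2)] desc_trans by blast
      thus False using du by blast
    qed
    thus "\<exists>j\<le>m. b j = x" using U.path_covers[OF p(3)] dl p by simp
  next
    assume "\<exists>j\<le>m. b j = x"
    then obtain j where j: "j \<le> m" "b j = x" by blast
    have d: "desc TS (Inr l) (Inr x)" "desc TS (Inr x) (Inr y)"
      using U.path_desc[OF p(3), of 0 j] U.path_desc[OF p(3), of j m] p(1,2) lE j by simp_all
    hence "\<not> desc TS (Inr u) (Inr x)" using U.sources_disjoint[OF y(1,2)] y(3,5) desc_trans by blast
    thus "face C s c x" using face_joint[OF s, of x c] joint_iff[OF l s'(1)] joint_iff[OF u s'(2)] d U.desc_vertices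
      by (fastforce simp: TT_simps)
  qed
  hence "side_path c s m b a" unfolding side_path_def using p lE by blast
  thus ?thesis using p(2) by blast
qed

lemma zigzag_ex:
  assumes c: "c \<in> cells_dim C (int e)" shows "\<exists>p q b a. is_zigzag C c p q b a"
proof (cases "\<exists>l\<in>Lm (int (Suc e)). face C (-1) c l")
  case False
  note nl = no_side(1)[OF c _ False]
  show ?thesis
  proof (cases "\<exists>u\<in>Lm (int (Suc e)). face C 1 c u")
    case False
    note nu = no_side(1)[OF c _ False]
    show ?thesis using zigzag_build[OF c, of 0 undefined undefined undefined 0] nl nu by blast
  next
    case True
    then obtain u where u: "u \<in> Lm (int (Suc e))" "face C 1 c u" by blast
    obtain k bu au where "side_path c 1 k bu au" "\<forall>d. (bu k, d) \<notin> tsource TS"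
      using single_side[OF c _ u] False by auto
    thus ?thesis using zigzag_build[OF c, of 0 undefined undefined undefined "0 + Suc k" k bu au] nl by blast
  qed
next
  case True
  then obtain l where l: "l \<in> Lm (int (Suc e))" "face C (-1) c l" by blast
  show ?thesis
  proof (cases "\<exists>u\<in>Lm (int (Suc e)). face C 1 c u")
    case False
    note nu = no_side(1)[OF c _ False]
    obtain m bl al where "side_path c (-1) m bl al" "\<forall>d. (bl m, d) \<notin> tsource TS"
      using single_side[OF c _ l] False by auto
    thus ?thesis using zigzag_build[OF c, of "Suc m" m bl al "Suc m"] nu by blast
  next
    case True
    then obtain u where u: "u \<in> Lm (int (Suc e))" "face C 1 c u" by blast
    have ne: "l \<noteq> u" using l u face_sign_unique[of 1 c u "-1"] by auto
    have "Inr l \<in> strand c" "Inr u \<in> strand c" using l u by (auto simp: strand_def)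
    then obtain d y y' where m: "d \<in> Lm (int (e + 2))" "face C (-1) y d" "face C (-1) y' d" "y \<noteq> y'"
      "desc TS (Inr l) (Inr y)" "desc TS (Inr u) (Inr y')"
      using strand_meet[of "Inr l" c "Inr u"] ne by auto
    hence s: "(y, d) \<in> tsource TS" "(y', d) \<in> tsource TS" by (simp_all add: U_source)
    obtain m bl al where 1: "side_path c (-1) m bl al" "bl m = y"
      using double_side[OF c _ l, of u y d y'] u s m by auto
    obtain k bu au where 2: "side_path c 1 k bu au" "bu k = y'"
      using double_side[OF c _ u, of l y' d y] l s m by auto
    show ?thesis using zigzag_build[OF c, of "Suc m" m bl al "Suc m + Suc k" k bu au d] 1 2 s by simp blast
  qed
qed

end

section \<open>The order on the white dots is the lexicographic one\<close>

context dendritic_level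
begin

lemma loop_incl_desc:
  assumes c: "c \<in> cells_dim C (int e)" and i: "(u, v) \<in> loop_incl C c" and u: "u \<in> cells_dim C (int (Suc e))"
  shows "desc TS (Inr u) (Inr v)"
  using i unfolding loop_incl_def
proof (induction rule: rtrancl_induct)
  case base thus ?case using u desc_refl[of "Inr u" "TS"] by (simp add: TT_simps)
next
  case (step y z)
  then obtain a where a: "a \<in> Lam C" "face C 1 z a" "face C (-1) y a" "face C 0 c y" by auto
  hence "a \<in> Lm (int (e + 2))" using level_dims(2)[OF c] by blast
  hence "desc TS (Inr y) (Inl a)" "desc TS (Inl a) (Inr z)"
    using U.desc_source U.desc_target a by (simp_all add: U_source U_target)
  thus ?case using step.IH desc_trans by blast
qed

text \<open>By \<open>loops_above\<close> all edges on the path from \<open>u\<close> to the loop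
  \<open>v\<close> are loops on \<open>c\<close>, so each node on it gives a step of
  \<open>loop_incl\<close>.\<close>

lemma loops_between:
  assumes c: "c \<in> cells_dim C (int e)" and d: "desc TS (Inr u) (Inr v)" and v: "face C 0 c v"
  shows "(u, v) \<in> loop_incl C c"
proof -
  obtain m b a where p: "b 0 = u" "b m = v"
    "\<forall>i<m. (b i, a i) \<in> tsource TS \<and> (b (Suc i), a i) \<in> ttarget TS"
    using U.edge_path[OF d] by blast
  have uE: "b 0 \<in> edges TS" using p(1) U.desc_vertices[OF d] by simp
  have l: "face C 0 c (b i)" if "i \<le> m" for i
    using loops_above[OF U.tree_axioms v] U.path_desc[OF p(3) uE, of i m] that p(2) by simp
  have "i \<le> m \<Longrightarrow> (b 0, b i) \<in> loop_incl C c" for i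
  proof (induction i)
    case 0 thus ?case by (simp add: loop_incl_def)
  next
    case (Suc i)
    have "a i \<in> Lam C" "face C (-1) (b i) (a i)" "face C 1 (b (Suc i)) (a i)"
      using p(3) Suc.prems by (auto simp: U_source U_target Lm_iff)
    hence "(b i, b (Suc i)) \<in> {(b', b). face C 0 c b' \<and> face C 0 c b \<and> (\<exists>a\<in>Lam C. face C 1 b a \<and> face C (-1) b' a)}"
      using l[of i] l[of "Suc i"] Suc.prems by auto
    thus ?case using Suc unfolding loop_incl_def by (meson Suc_leD rtrancl.rtrancl_into_rtrancl)
  qed
  thus ?thesis using p by blast
qed

text \<open>Left of \<open>p\<close> indices grow towards the root, right of \<open>p\<close> away
  from it. This locates the meet of two white dots that join the zig-zag at given nodes.\<close>

lemma zigzag_desc: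
  assumes c: "c \<in> cells_dim C (int e)" and z: "is_zigzag C c p q b a"
  shows "\<lbrakk>1 \<le> i; i < j; j \<le> p; j < q\<rbrakk> \<Longrightarrow> desc TS (Inl (a i)) (Inr (b j))"
    and "\<lbrakk>p \<le> i; 1 \<le> i; i < j; j < q\<rbrakk> \<Longrightarrow> desc TS (Inl (a j)) (Inr (b (Suc i)))"
    and "i \<in> {1..<q} \<Longrightarrow> a i \<in> Lm (int (e + 2))"
proof -
  have sg: "face C (-1) c (b i) \<or> face C 1 c (b i)" if "i \<in> {1..q}" for i
    using z that unfolding is_zigzag_def by (meson not_le)
  have L: "a i \<in> Lam C" if "i \<in> {1..<q}" for i using z that unfolding is_zigzag_def by blast
  have st: "(i < p \<longrightarrow> face C (-1) (b i) (a i) \<and> face C 1 (b (Suc i)) (a i)) \<and>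
        (i = p \<longrightarrow> face C (-1) (b i) (a i) \<and> face C (-1) (b (Suc i)) (a i)) \<and>
        (i > p \<longrightarrow> face C 1 (b i) (a i) \<and> face C (-1) (b (Suc i)) (a i))" if "i \<in> {1..<q}" for i
    using z that unfolding is_zigzag_def by blast
  have Lm: "a i \<in> Lm (int (e + 2))" if i: "i \<in> {1..<q}" for i
  proof -
    have "\<exists>s. face C s (b i) (a i)" using st[OF i] by (meson linorder_neqE_nat)
    moreover have "\<exists>s. face C s c (b i)" using sg[of i] i by auto
    ultimately show ?thesis using level_dims(2)[OF c _ _ L[OF i]] by blast
  qed
  show "i \<in> {1..<q} \<Longrightarrow> a i \<in> Lm (int (e + 2))" by (rule Lm)
  show "desc TS (Inl (a i)) (Inr (b j))" if h: "1 \<le> i" "i < j" "j \<le> p" "j < q"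
  proof -
    have "Suc i \<le> j" using h by simp
    thus ?thesis using h(3,4)
    proof (induction j rule: dec_induct)
      case base
      thus ?case using st[of i] Lm[of i] h(1) by (intro U.desc_target) (simp add: U_target)
    next
      case (step k)
      have k: "k \<in> {1..<q}" "k < p" using step by auto
      have "desc TS (Inr (b k)) (Inl (a k))" "desc TS (Inl (a k)) (Inr (b (Suc k)))"
        using st[OF k(1)] Lm[OF k(1)] k(2) by (auto intro!: U.desc_source U.desc_target simp: U_source U_target simp del: of_nat_add)
      thus ?case using step desc_trans by (meson Suc_leD Suc_lessD)
    qed
  qed
  show "desc TS (Inl (a j)) (Inr (b (Suc i)))" if h: "p \<le> i" "1 \<le> i" "i < j" "j < q"
  proof -
    have "Suc i \<le> j" using h by simp
    thus ?thesis using h(4)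
    proof (induction j rule: dec_induct)
      case base
      thus ?case using st[of "Suc i"] Lm[of "Suc i"] h by (intro U.desc_target) (simp add: U_target)
    next
      case (step k)
      have k: "k \<in> {1..<q}" "p < k" "Suc k \<in> {1..<q}" using step h by auto
      have "desc TS (Inl (a (Suc k))) (Inr (b (Suc k)))" "desc TS (Inr (b (Suc k))) (Inl (a k))"
        using st[OF k(1)] st[OF k(3)] Lm[OF k(1)] Lm[OF k(3)] k(2)
        by (auto intro!: U.desc_source U.desc_target simp: U_source U_target simp del: of_nat_add)
      thus ?case using step desc_trans by (meson Suc_lessD)
    qed
  qed
qed

lemma order1_lex:
  assumes c: "c \<in> cells_dim C (int e)" and w: "w \<in> whites c" "w' \<in> whites c"
    and o: "order1 C c (gam C w) (gam C w')"
  shows "lx c (Inl w) (Inl w')"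
proof -
  obtain p q b a i j v v' where z: "is_zigzag C c p q b a" and ij: "i \<in> {1..<q}" "j \<in> {1..<q}" "i < j"
    and v: "face C 0 c v" "face C (-1) v (a i)" "(gam C w, v) \<in> loop_incl C c"
    and v': "face C 0 c v'" "face C (-1) v' (a j)" "(gam C w', v') \<in> loop_incl C c"
    using o unfolding order1_def by blast
  have wd: "desc TS (Inl w) (Inr (gam C w))" "desc TS (Inl w') (Inr (gam C w'))"
    using null_loop(3) w whites_iff by blast+
  have ld: "gam C w \<in> cells_dim C (int (Suc e))" "gam C w' \<in> cells_dim C (int (Suc e))"
    using white_loop[OF w(1)] white_loop[OF w(2)] level_dims(1)[OF c] by blast+
  have dv: "desc TS (Inl w) (Inr v)" "desc TS (Inl w') (Inr v')"
    using loop_incl_desc[OF c] v(3) v'(3) ld wd desc_trans by blast+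
  note La = zigzag_desc(3)[OF c z]
  have va: "desc TS (Inl w) (Inl (a i))" "desc TS (Inl w') (Inl (a j))"
    using dv U.desc_source[of v "a i"] U.desc_source[of v' "a j"] v(2) v'(2) La[OF ij(1)] La[OF ij(2)] desc_trans
    by (auto simp: U_source simp del: of_nat_add)
  have sgl: "face C (-1) c (b k)" if "k \<in> {1..q}" "k \<le> p" for k using z that unfolding is_zigzag_def by (elim conjE) blast
  have sgr: "face C 1 c (b k)" if "k \<in> {1..q}" "p < k" for k using z that unfolding is_zigzag_def by (elim conjE) blast
  have st: "(i < p \<longrightarrow> face C (-1) (b i) (a i) \<and> face C 1 (b (Suc i)) (a i)) \<and>
        (i = p \<longrightarrow> face C (-1) (b i) (a i) \<and> face C (-1) (b (Suc i)) (a i)) \<and>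
        (i > p \<longrightarrow> face C 1 (b i) (a i) \<and> face C (-1) (b (Suc i)) (a i))" if "i \<in> {1..<q}" for i
    using z that unfolding is_zigzag_def by blast
  have ls: "\<not> face C s c v" "\<not> face C s c v'" if "s \<noteq> 0" for s
    using face_sign_unique[OF v(1), of s] face_sign_unique[OF v'(1), of s] that by auto
  \<comment> \<open>The two white dots meet at \<open>a j\<close> in the left half, at
    \<open>a p\<close> across the middle, at \<open>a i\<close> in the right half. At least one of
    the branches there is an edge of the zig-zag, whose sign puts it first or last.\<close>
  consider (left) "j \<le> p" | (middle) "i < p" "p < j" | (right) "p \<le> i" by linarith
  thus ?thesis
  proof cases
    case left
    have f: "face C (-1) (b j) (a j)" "face C (-1) c (b j)"
      using st[OF ij(2)] sgl[of j] left ij by auto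
    hence "b j \<noteq> v'" using ls(2)[of "-1"] by auto
    moreover have "desc TS (Inl w) (Inr (b j))"
      using zigzag_desc(1)[OF c z _ ij(3) left] ij va(1) desc_trans by auto
    ultimately show ?thesis using f v'(2) dv(2) La[OF ij(2)]
      by (intro U.lexI[of "b j" "a j" v']) (auto simp: U_source before_def simp del: of_nat_add)
  next
    case middle
    have p: "p \<in> {1..<q}" using middle ij by auto
    have f: "face C (-1) (b p) (a p)" "face C (-1) (b (Suc p)) (a p)" "face C (-1) c (b p)" "face C 1 c (b (Suc p))"
      using st[OF p] sgl[of p] sgr[of "Suc p"] p by auto
    hence "b p \<noteq> b (Suc p)" using face_sign_unique[OF f(3), of 1] by auto
    moreover have "desc TS (Inl w) (Inr (b p))" "desc TS (Inl w') (Inr (b (Suc p)))"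
      using zigzag_desc(1)[OF c z, of i p] zigzag_desc(2)[OF c z, of p j] middle ij va desc_trans by auto
    ultimately show ?thesis using f La[OF p]
      by (intro U.lexI[of "b p" "a p" "b (Suc p)"]) (auto simp: U_source before_def simp del: of_nat_add)
  next
    case right
    have f: "face C (-1) (b (Suc i)) (a i)" "face C 1 c (b (Suc i))"
      using st[OF ij(1)] sgr[of "Suc i"] right ij by auto
    hence "v \<noteq> b (Suc i)" using ls(1)[of 1] by auto
    moreover have "desc TS (Inl w') (Inr (b (Suc i)))"
      using zigzag_desc(2)[OF c z right _ ij(3)] ij va(2) desc_trans by auto
    ultimately show ?thesis using f v(2) dv(1) La[OF ij(1)]
      by (intro U.lexI[of v "a i" "b (Suc i)"]) (auto simp: U_source before_def simp del: of_nat_add)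
  qed
qed

lemma loop_path_desc:
  assumes c: "c \<in> cells_dim C (int e)" and w: "w \<in> whites c" and p: "loop_path C c p a b"
    and b: "b 0 = gam C w"
  shows "i < p \<Longrightarrow> desc TS (Inl w) (Inr (b i))"
proof (induction i)
  case 0
  thus ?case using null_loop(3) w whites_iff b by simp
next
  case (Suc i)
  have st: "face C 0 c (b i)" "face C (-1) (b i) (a (Suc i))" "face C 1 (b (Suc i)) (a (Suc i))" "a (Suc i) \<in> Lam C"
    using p Suc.prems by (auto simp: loop_path_def)
  hence "a (Suc i) \<in> Lm (int (e + 2))" using level_dims(2)[OF c] by blast
  hence "desc TS (Inr (b i)) (Inl (a (Suc i)))" "desc TS (Inl (a (Suc i))) (Inr (b (Suc i)))"
    using st by (auto intro!: U.desc_source U.desc_target simp: U_source U_target simp del: of_nat_add)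
  thus ?case using Suc desc_trans by (meson Suc_lessD)
qed

text \<open>The common last node of the two loop paths is the meet, and \<open>before\<close>
  contains the local order there.\<close>

lemma order2_lex:
  assumes c: "c \<in> cells_dim C (int e)" and w: "w \<in> whites c" "w' \<in> whites c"
    and o: "order2 C c (gam C w) (gam C w')"
  shows "lx c (Inl w) (Inl w')"
proof -
  obtain p q a a' b b' where o: "loop_path C c p a b" "loop_path C c q a' b'" "b 0 = gam C w" "b' 0 = gam C w'"
    "a p = a' q" "b (p - 1) \<noteq> b' (q - 1)" "(b (p - 1), b' (q - 1)) \<in> lord C (a p) c"
    using o unfolding order2_def by blast
  have p: "p \<ge> 1" "q \<ge> 1" using o by (auto simp: loop_path_def)
  have d: "desc TS (Inl w) (Inr (b (p - 1)))" "desc TS (Inl w') (Inr (b' (q - 1)))"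
    using loop_path_desc[OF c w(1) o(1,3)] loop_path_desc[OF c w(2) o(2,4)] p by simp_all
  have f: "face C 0 c (b (p - 1))" "face C (-1) (b (p - 1)) (a p)" "face C (-1) (b' (q - 1)) (a p)"
    using lord_loop[OF o(7)] by auto
  have "a p \<in> Lam C" using o(1) by (auto simp: loop_path_def)
  hence "a p \<in> Lm (int (e + 2))" using level_dims(2)[OF c f(1,2)] by blast
  thus ?thesis using d f o(6,7)
    by (intro U.lexI[of "b (p - 1)" "a p" "b' (q - 1)"]) (auto simp: U_source before_def simp del: of_nat_add)
qed

text \<open>The path down from \<open>u\<close> runs through loops on \<open>c\<close> until, by
  \<open>loop_step\<close>, it reaches a node with a cell having \<open>c\<close> as a signed face;
  this is a node of the zig-zag.\<close>

lemma loop_joins: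
  assumes c: "c \<in> cells_dim C (int e)" and u: "face C 0 c u" and d: "desc TS (Inr u) (Inr y)"
  shows "face C 0 c y \<or> (\<exists>v a. face C 0 c v \<and> (u, v) \<in> loop_incl C c \<and> face C (-1) v a \<and> a \<in> Lm (int (e + 2)) \<and>
     desc TS (Inl a) (Inr y) \<and> (\<exists>y'. (y', a) \<in> chains c))"
proof -
  let ?J = "\<lambda>y. face C 0 c y \<or> (\<exists>v a. face C 0 c v \<and> (u, v) \<in> loop_incl C c \<and> face C (-1) v a \<and> a \<in> Lm (int (e + 2)) \<and>
     desc TS (Inl a) (Inr y) \<and> (\<exists>y'. (y', a) \<in> chains c))"
  have "(Inr u, Inr y) \<in> (desc_step TS)\<^sup>*" using d by (simp add: desc_def)
  hence "case (Inr y :: 'a + 'a) of Inr y \<Rightarrow> ?J y \<and> desc TS (Inr u) (Inr y)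
     | Inl a \<Rightarrow> \<exists>y. (y, a) \<in> tsource TS \<and> ?J y \<and> desc TS (Inr u) (Inr y)"
  proof (induction rule: rtrancl_induct)
    case base thus ?case using u d U.desc_vertices desc_refl by force
  next
    case (step s t)
    show ?case
    proof (cases t)
      case (Inl a)
      then obtain z where "s = Inr z" "(z, a) \<in> tsource TS" using step.hyps(2) by (cases s) auto
      thus ?thesis using step.IH Inl by auto
    next
      case (Inr x)
      then obtain a where a: "s = Inl a" "(x, a) \<in> ttarget TS" using step.hyps(2) by (cases s) auto
      then obtain z where z: "(z, a) \<in> tsource TS" "?J z" "desc TS (Inr u) (Inr z)"
        using step.IH by auto
      have zx: "desc TS (Inr z) (Inr x)" "desc TS (Inl a) (Inr x)"
        using U.desc_source[OF z(1)] U.desc_target[OF a(2)] desc_trans by blast+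
      have f: "face C (-1) z a" "face C 1 x a" "a \<in> Lm (int (e + 2))" using z(1) a(2) by (auto simp: U_source U_target)
      have "?J x"
      proof (cases "face C 0 c z")
        case True
        from loop_step[OF True f(1,2)] show ?thesis
        proof
          assume "\<exists>y' \<alpha> \<beta>. \<alpha> \<noteq> 0 \<and> \<beta> \<noteq> 0 \<and> face C \<beta> c y' \<and> face C \<alpha> y' a"
          hence "\<exists>y'. (y', a) \<in> chains c" using f(3) by (auto simp: chains_def Lm_iff)
          thus ?thesis using True loops_between[OF c z(3) True] f zx(2) by blast
        qed blast
      next
        case False
        thus ?thesis using z(2) zx(1) desc_trans by blast
      qed
      thus ?thesis using Inr z(3) zx(1) desc_trans by auto
    qed
  qed
  thus ?thesis by simp
qed

text \<open>If both branches at the meet are loops, the paths from \<open>w\<close> and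
  \<open>w'\<close> to it are loop paths and the local order gives \<open>order2\<close>. Otherwise
  each white dot joins the zig-zag at some node, and the indices of the two nodes are compared: the
  wrong order is excluded by \<open>order1_lex\<close>, equality by the position of the
  meet.\<close>

lemma lex_loop_order:
  assumes c: "c \<in> cells_dim C (int e)" and w: "w \<in> whites c" "w' \<in> whites c" and l: "lx c (Inl w) (Inl w')"
  shows "order1 C c (gam C w) (gam C w') \<or> order2 C c (gam C w) (gam C w')"
proof -
  let ?u = "gam C w" and ?u' = "gam C w'"
  have n1: "\<not> order1 C c ?u' ?u" using order1_lex[OF c w(2,1)] l lx_asym by blast
  obtain a y y' where m: "(y, a) \<in> tsource TS" "(y', a) \<in> tsource TS" "y \<noteq> y'"
    "desc TS (Inl w) (Inr y)" "desc TS (Inl w') (Inr y')" "before c a y y'"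
    using l unfolding U.lex_def by blast
  have f: "face C (-1) y a" "face C (-1) y' a" "a \<in> Lm (int (e + 2))" using m by (auto simp: U_source)
  have du: "desc TS (Inr ?u) (Inr y)" "desc TS (Inr ?u') (Inr y')"
    using desc_null m w whites_iff by blast+
  have ul: "face C 0 c ?u" "face C 0 c ?u'" using white_loop w by blast+
  have nn: "w \<in> null_dots TS" "w' \<in> null_dots TS" using w whites_iff by blast+
  show ?thesis
  proof (cases "face C 0 c y \<and> face C 0 c y'")
    case True
    hence lo: "(y, y') \<in> lord C a c" using m(6) face_sign_unique[of 0 c y "-1"] face_sign_unique[of 0 c y' 1]
      by (auto simp: before_def)
    have path: "\<exists>p A B. loop_path C c p A B \<and> B 0 = gam C w \<and> A 0 \<in> null_cells C \<and> A p = a \<and> B (p - 1) = y"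
      if h: "w \<in> whites c" "desc TS (Inr (gam C w)) (Inr y)" "face C 0 c y" "face C (-1) y a" for w y
    proof -
      obtain m b d where p: "b 0 = gam C w" "b m = y"
        "\<forall>i<m. (b i, d i) \<in> tsource TS \<and> (b (Suc i), d i) \<in> ttarget TS"
        using U.edge_path[OF h(2)] by blast
      have uE: "b 0 \<in> edges TS" using p(1) U.desc_vertices[OF h(2)] by simp
      have lp: "face C 0 c (b i)" if "i \<le> m" for i
        using loops_above[OF U.tree_axioms h(3)] U.path_desc[OF p(3) uE, of i m] that p(2) by simp
      \<comment> \<open>The path starts at the null cell \<open>w\<close> and ends at the meet
        \<open>a\<close>; in between come the nodes \<open>d\<close> of the tree path, shifted by
        one.\<close>
      let ?A = "\<lambda>i. if i = 0 then w else if i = Suc m then a else d (i - 1)"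
      have wn: "w \<in> null_dots TS" using h(1) whites_iff by blast
      have wL: "w \<in> Lam C" "w \<in> null_cells C" "face C 1 (gam C w) w"
        using null_loop(1)[OF wn] wn by (auto simp: null_dots_U Lm_iff)
      have dd: "d i \<in> Lam C" "face C (-1) (b i) (d i)" "face C 1 (b (Suc i)) (d i)" if "i < m" for i
        using p(3) that by (auto simp: U_source U_target Lm_iff)
      have "loop_path C c (Suc m) ?A b"
        unfolding loop_path_def
      proof (intro conjI allI impI)
        show "?A i \<in> Lam C" if "i \<le> Suc m" for i
          using that wL f(3) dd(1)[of "i - 1"] by (auto simp: Lm_iff)
        fix i assume i: "i < Suc m"
        show "face C 0 c (b i)" using lp i by simp
        show "face C 1 (b i) (?A i)" using i wL p(1) dd(3)[of "i - 1"] by (cases i) auto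
        show "face C (-1) (b i) (?A (Suc i))" using i dd(2)[of i] p(2) h(4) by (cases "i = m") auto
      qed simp
      thus ?thesis using p wL by (intro exI[of _ "Suc m"] exI[of _ ?A] exI[of _ b]) simp
    qed
    obtain p A B where 1: "loop_path C c p A B" "B 0 = ?u" "A 0 \<in> null_cells C" "A p = a" "B (p - 1) = y"
      using path[OF w(1) du(1)] True f by blast
    obtain q A' B' where 2: "loop_path C c q A' B'" "B' 0 = ?u'" "A' 0 \<in> null_cells C" "A' q = a" "B' (q - 1) = y'"
      using path[OF w(2) du(2)] True f by blast
    have "?u \<noteq> ?u'" by (metis du U.sources_disjoint m(1,2) m(3))
    thus ?thesis using 1 2 n1 lo m(3) unfolding order2_def by metis
  next
    case False
    obtain p q b A where z: "is_zigzag C c p q b A" using zigzag_ex[OF c] by blast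
    have idx: "\<exists>i\<in>{1..<q}. d = A i" if "(x, d) \<in> chains c" for x d
    proof -
      have "chains c = (\<Union>i\<in>{1..<q}. {(b i, A i), (b (Suc i), A i)})"
        using z unfolding is_zigzag_def chains_def by (elim conjE)
      thus ?thesis using that by auto
    qed
    have inc: "face C 0 c y \<or> face C 1 c y \<or> face C (-1) c y" "face C 0 c y' \<or> face C 1 c y' \<or> face C (-1) c y'"
      using source_incident[OF f m(3) _ _ m(4,5)] source_incident[OF f(2,1,3) m(3)[symmetric] _ _ m(5,4)] w
      by (auto simp: strand_def)
    have ach: "\<exists>x. (x, a) \<in> chains c" using False inc chains_iff[OF c] m(1,2) by blast
    have join: "\<exists>v d. face C 0 c v \<and> (u, v) \<in> loop_incl C c \<and> face C (-1) v d \<and> (\<exists>x. (x, d) \<in> chains c) \<and>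
       (v = y \<and> d = a \<or> desc TS (Inl d) (Inr y))"
      if h: "face C 0 c u" "desc TS (Inr u) (Inr y)" "face C (-1) y a" for u y by (metis loops_between c h(3) ach loop_joins h(1,2))
    obtain v d where 1: "face C 0 c v" "(?u, v) \<in> loop_incl C c" "face C (-1) v d" "\<exists>x. (x, d) \<in> chains c"
       "v = y \<and> d = a \<or> desc TS (Inl d) (Inr y)" using join[OF ul(1) du(1) f(1)] by blast
    obtain v' d' where 2: "face C 0 c v'" "(?u', v') \<in> loop_incl C c" "face C (-1) v' d'" "\<exists>x. (x, d') \<in> chains c"
       "v' = y' \<and> d' = a \<or> desc TS (Inl d') (Inr y')" using join[OF ul(2) du(2) f(2)] by blast
    obtain i where i: "i \<in> {1..<q}" "d = A i" using idx 1(4) by blast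
    obtain j where j: "j \<in> {1..<q}" "d' = A j" using idx 2(4) by blast
    have dims: "0 \<le> dim C c" "dim C c \<le> int n - 2"
    proof -
      show "0 \<le> dim C c" using c by (simp add: cells_dim_iff)
      have "w \<in> cells C" "dim C w = int (e + 2)" using nn(1) by (auto simp: null_dots_U Lm_iff Lam_iff)
      hence "int (e + 2) \<le> int n" using le_top[of w] top_dim by auto
      thus "dim C c \<le> int n - 2" using c by (simp add: cells_dim_iff)
    qed
    have nd: "\<not> desc TS (Inl a) (Inr y)" "\<not> desc TS (Inl a) (Inr y')"
      using U.no_back_step[of "Inr y" "Inl a"] U.no_back_step[of "Inr y'" "Inl a"] m by auto
    consider "i < j" | "j < i" | "i = j" by linarith
    thus ?thesis
    proof cases
      case 1
      hence "order1 C c ?u ?u'" unfolding order1_def using dims z i j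
        \<open>face C 0 c v\<close> \<open>(?u, v) \<in> _\<close> \<open>face C (-1) v d\<close> 2 by blast
      thus ?thesis ..
    next
      case 2
      hence "order1 C c ?u' ?u" unfolding order1_def using dims z i j 1
        \<open>face C 0 c v'\<close> \<open>(?u', v') \<in> _\<close> \<open>face C (-1) v' d'\<close> by blast
      thus ?thesis using n1 by blast
    next
      case 3
      hence dd: "d = d'" using i j by simp
      \<comment> \<open>A common node of the zig-zag can lie above at most one of \<open>y\<close>
        and \<open>y'\<close>; it cannot be \<open>a\<close> for one dot and lie above a branch of
        \<open>a\<close> for the other; and if it is \<open>a\<close> for both, then
        \<open>y\<close> and \<open>y'\<close> are both loops.\<close>
      have "\<not> (desc TS (Inl d) (Inr y) \<and> desc TS (Inl d) (Inr y'))"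
        using U.sources_disjoint[OF m(1,2)] m(3) by blast
      thus ?thesis using 1 2 dd nd False by metis
    qed
  qed
qed

lemma loop_order_iff:
  assumes w: "w \<in> whites c" "w' \<in> whites c"
  shows "(gam C w, gam C w') \<in> loop_order C c \<longleftrightarrow> lx c (Inl w) (Inl w')"
proof -
  have c: "c \<in> cells_dim C (int e)"
  proof -
    have "w \<in> null_dots TS" using w whites_iff by blast
    hence "dim C w = int (e + 2)" "face C 1 (gam C w) w" "face C 0 c (gam C w)"
      using null_loop(1) white_loop[OF w(1)] by (auto simp: null_dots_U Lm_iff)
    thus ?thesis using face_mem[of 1 "gam C w" w] face_mem[of 0 c "gam C w"] by (simp add: cells_dim_iff)
  qed
  have nl: "gam C w \<in> null_loops C c" if "w \<in> whites c" for w
  proof -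
    have wn: "w \<in> null_dots TS" using that whites_iff by blast
    thus ?thesis using white_loop[OF that] null_loop(1)[OF wn] by (auto simp: null_loops_def null_dots_U Lm_iff)
  qed
  show ?thesis unfolding loop_order_def
    using nl w lex_loop_order[OF c w] order1_lex[OF c w] order2_lex[OF c w] by blast
qed

end

section \<open>The constellations of a dendritic face complex\<close>

context dendritic_level
begin

definition WW :: "('a, 'a) subdiv" where
  "WW = Z_sub C (e + 2)"

lemma WW_simps: "wset WW c = whites c"
  "(w, w') \<in> wless WW c \<longleftrightarrow> w \<in> whites c \<and> w' \<in> whites c \<and> lx c (Inl w) (Inl w')"
    by (auto simp: WW_def Z_sub_def whites_def loop_order_iff)

lemma WW_subdivision: "is_subdivision (TT e) WW"
  unfolding is_subdivision_def
proof (intro conjI ballI impI)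
  fix c
  have st: "Inl w \<in> strand c" if "w \<in> whites c" for w using that by (simp add: strand_def)
  have "whites c \<subseteq> cells C" by (auto simp: whites_iff null_dots_U Lm_iff Lam_iff)
  thus "finite (wset WW c)" using finite_cells finite_subset by (auto simp: WW_simps)
  show "wless WW c \<subseteq> wset WW c \<times> wset WW c" by (auto simp: WW_simps)
  have "trans (wless WW c)" using lx_trans by (auto simp: trans_def WW_simps)
  moreover have "irrefl (wless WW c)" using U.lex_irrefl by (auto simp: irrefl_def WW_simps)
  moreover have "total_on (whites c) (wless WW c)"
    unfolding total_on_def WW_simps using lx_total st by blast
  ultimately show "strict_linear_order_on (wset WW c) (wless WW c)"
    by (simp add: strict_linear_order_on_def WW_simps)
  fix c' assume "c \<noteq> c'"
  thus "wset WW c \<inter> wset WW c' = {}" by (auto simp: WW_simps whites_iff)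
qed

sublocale S: stree "TT e" WW
  using WW_subdivision by unfold_locales

lemma white_dots_WW: "white_dots (TT e) WW = null_dots TS"
proof -
  have "gam C (gam C w) \<in> cells_dim C (int e)" if w: "w \<in> null_dots TS" for w
    using face_mem[OF null_loop(1)[OF w]] face_mem[OF null_loop(2)[OF w]] w
    by (simp add: cells_dim_iff null_dots_U Lm_iff)
  thus ?thesis by (auto simp: white_dots_def WW_simps whites_iff TT_simps)
qed

lemma nodes_TT: "nodes (TT e) = leaves TS"
  by (simp add: leaves_U TT_simps Lm_Suc(1))

lemma dot_tops: "t \<in> dots (TT e) WW \<Longrightarrow> dot_vertex t \<in> tops TS"
  using nodes_TT white_dots_WW by (cases t) (auto simp: tops_def)

lemma T_source: "(c, a) \<in> tsource (TT e) \<longleftrightarrow> a \<in> Lm (int (Suc e)) \<and> face C (-1) c a"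
  and T_target: "(c, a) \<in> ttarget (TT e) \<longleftrightarrow> a \<in> Lm (int (Suc e)) \<and> face C 1 c a"
  by (simp_all only: TT_simps Lm_Suc)

text \<open>Passes from the order along the string to the lexicographic one, where convexity is
  available. The end nodes come first and last by \<open>lower_first\<close> and
  \<open>upper_last\<close>.\<close>

lemma string_less_lx:
  assumes "string_less (TT e) WW c d d'"
  shows "dot_vertex d \<in> strand c \<and> dot_vertex d' \<in> strand c \<and> lx c (dot_vertex d) (dot_vertex d')"
proof (cases d)
  case (Inl l)
  hence l: "l \<in> Lm (int (Suc e))" "face C (-1) c l" using assms
    by (auto simp: string_less_def T_source simp del: of_nat_Suc)
  hence ls: "Inr l \<in> strand c" by (simp add: strand_def)
  show ?thesis
  proof (cases d')
    case (Inl u)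
    hence u: "u \<in> Lm (int (Suc e))" "face C 1 c u" using assms \<open>d = _\<close>
      by (auto simp: T_target simp del: of_nat_Suc)
    hence "Inr u \<in> strand c" "u \<noteq> l" using face_sign_unique[OF u(2), of "-1"] l by (auto simp: strand_def)
    thus ?thesis using lower_first[OF l] ls Inl \<open>d = _\<close> by simp
  next
    case (Inr w)
    hence "Inl w \<in> strand c" using assms \<open>d = _\<close> by (simp add: strand_def WW_simps)
    thus ?thesis using lower_first[OF l] ls Inr \<open>d = _\<close> by simp
  qed
next
  case (Inr w)
  hence w: "w \<in> whites c" "Inl w \<in> strand c" using assms by (auto simp: string_less_def WW_simps strand_def)
  show ?thesis
  proof (cases d')
    case (Inl u)
    hence u: "u \<in> Lm (int (Suc e))" "face C 1 c u" using assms \<open>d = _\<close>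
      by (auto simp: T_target simp del: of_nat_Suc)
    hence "Inr u \<in> strand c" by (simp add: strand_def)
    thus ?thesis using upper_last[OF u] w Inl \<open>d = _\<close> by simp
  next
    case (Inr w')
    hence "w' \<in> whites c" "lx c (Inl w) (Inl w')" using assms \<open>d = _\<close> by (auto simp: WW_simps)
    thus ?thesis using w Inr \<open>d = _\<close> by (simp add: strand_def)
  qed
qed

text \<open>The kernel rule, by uniqueness of bottoms. By convexity nothing of the set precedes a
  bottom on its string, in particular not the lower node; so \<open>x\<close> is a loop on the
  carrying edge or has it as positive face, and this edge is the target of \<open>x\<close>. Hence
  all bottoms lie on one string, where two of them would be comparable.\<close>

lemma dots_connected:
  assumes x: "x \<in> cells_dim C (int (Suc e))"
  shows "induces_connected (subdivide (TT e) WW) {t \<in> dots (TT e) WW. desc TS (dot_vertex t) (Inr x)}"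
    (is "induces_connected _ ?D")
proof (rule S.connectedI)
  have minimal: "d' \<notin> ?D" if b: "bottom (TT e) WW ?D d" and c: "c \<in> edges (TT e)" and s: "string_less (TT e) WW c d' d" for d d' c
  proof
    assume d': "d' \<in> ?D"
    obtain d1 where d1: "parent (TT e) WW d d1" "d1 = d' \<or> string_less (TT e) WW c d' d1" using S.parent_ex[OF c s] by blast
    obtain c1 where c1: "c1 \<in> edges (TT e)" "string_less (TT e) WW c1 d1 d" using d1(1) unfolding S.parent_iff by blast
    have "c1 = c" using S.carried_unique[OF S.string_less_carried[OF c1] S.string_less_carried[OF c s]] .
    hence l1: "string_less (TT e) WW c d1 d" using c1 by simp
    have "d1 \<in> ?D"
    proof (cases "d1 = d'")
      case False
      hence l2: "string_less (TT e) WW c d' d1" using d1 by blast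
      have "desc TS (dot_vertex d1) (Inr x)"
        by (rule lx_convex[of "dot_vertex d'" c _ "dot_vertex d"])
          (use string_less_lx[OF l1] string_less_lx[OF l2] d' b in \<open>auto simp: bottom_def\<close>)
      moreover have "d1 \<in> dots (TT e) WW"
        using l1 c T.source_mem[of c] by (cases d1) (auto simp: string_less_def white_dots_def)
      ultimately show ?thesis by blast
    qed (use d' in simp)
    thus False using b d1(1) by (auto simp: bottom_def)
  qed
  have carrier: "carried (TT e) WW d (gam C x)" if b: "bottom (TT e) WW ?D d" for d
  proof -
    have dD: "d \<in> dots (TT e) WW" "desc TS (dot_vertex d) (Inr x)" using b by (auto simp: bottom_def)
    have low: "\<not> joint (-1) c x" if c: "carried (TT e) WW d c" for c
    proof
      assume "joint (-1) c x"
      then obtain l where l: "l \<in> Lm (int (Suc e))" "face C (-1) c l" "desc TS (Inr l) (Inr x)"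
        by (auto simp: joint_def above_sign_def)
      hence "Inl l \<in> ?D" using l by (simp add: TT_simps Lm_Suc(1) del: of_nat_Suc)
      moreover have "string_less (TT e) WW c (Inl l) d" using c l
        by (cases d) (auto simp: T_source WW_simps simp del: of_nat_Suc)
      ultimately show False using minimal[OF b S.carried_mem[OF c]] by blast
    qed
    obtain c where c: "carried (TT e) WW d c" "face C 0 c x \<or> joint 1 c x"
    proof (cases d)
      case (Inl u)
      hence u: "u \<in> Lm (int (Suc e))" using dD by (simp add: TT_simps Lm_Suc(1) del: of_nat_Suc)
      hence f: "face C 1 (gam C u) u" using Lm_target[of u e] by (simp add: Lm_Suc(1) del: of_nat_Suc)
      have "carried (TT e) WW d (gam C u)" using Inl u f by (simp add: T_target del: of_nat_Suc)
      moreover have "joint 1 (gam C u) x" using u f dD Inl by (auto simp: joint_def above_sign_def)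
      ultimately show thesis using that by blast
    next
      case (Inr w)
      then obtain c where w: "c \<in> edges (TT e)" "w \<in> whites c" using dD by (auto simp: white_dots_def WW_simps)
      hence k: "carried (TT e) WW d c" using Inr by (simp add: WW_simps)
      hence "face C 0 c x \<or> joint 1 c x" using white_incident[OF w(2)] dD Inr low by auto
      thus thesis using that k by blast
    qed
    have "c = gam C x" by (metis face_zero c low face_joint x face_pos)
    thus ?thesis using c by simp
  qed
  fix d d' assume b: "bottom (TT e) WW ?D d" "bottom (TT e) WW ?D d'"
  let ?c = "gam C x"
  have c: "carried (TT e) WW d ?c" "carried (TT e) WW d' ?c" using carrier b by blast+
  hence cE: "?c \<in> edges (TT e)" using S.carried_mem by blast
  have dD: "d \<in> ?D" "d' \<in> ?D" using b by (auto simp: bottom_def)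
  have "d = d' \<or> string_less (TT e) WW ?c d d' \<or> string_less (TT e) WW ?c d' d"
    using c by (cases d; cases d') (auto dest: T.upper_unique S.wless_total[OF cE])
  thus "d = d'" using minimal[OF b(1) cE] minimal[OF b(2) cE] dD by blast
qed

lemma constellation_Z: "exact_constellation (TT e) WW TS"
  unfolding exact_constellation_def is_constellation_def
proof (intro conjI ballI)
  show "rooted_tree (TT e)" "rooted_tree TS" by (rule T.rooted, rule U.rooted)
  show "is_subdivision (TT e) WW" by (rule WW_subdivision)
  show "bij_betw (\<lambda>a. a) (nodes (TT e)) (leaves TS)" "bij_betw (\<lambda>w. w) (white_dots (TT e) WW) (null_dots TS)"
    using nodes_TT white_dots_WW by (simp_all add: bij_betw_def)
  fix a assume a: "a \<in> nodes TS"
  hence aL: "a \<in> Lm (int (Suc e) + 1)" by (simp add: TT_simps)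
  hence t: "face C 1 (gam C a) a" by (rule Lm_target)
  have at: "(gam C a, a) \<in> ttarget TS" using t a by (simp add: TT_simps)
  have x: "gam C a \<in> cells_dim C (int (Suc e))" using U.target_mem[OF at] by (simp add: TT_simps)
  have "desc TS (dot_vertex t) (Inl a) \<longleftrightarrow> desc TS (dot_vertex t) (Inr (gam C a))"
    if td: "t \<in> dots (TT e) WW" for t
  proof
    show "desc TS (dot_vertex t) (Inl a) \<Longrightarrow> desc TS (dot_vertex t) (Inr (gam C a))"
      using U.desc_target[OF at] desc_trans by blast
    assume d: "desc TS (dot_vertex t) (Inr (gam C a))"
    have "Inr (gam C a) \<notin> tops TS" using at by (auto simp: tops_def leaves_def)
    hence "dot_vertex t \<noteq> Inr (gam C a)" using dot_tops[OF td] by metis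
    then obtain z where z: "desc TS (dot_vertex t) z" "(z, Inr (gam C a)) \<in> desc_step TS"
      using U.desc_lastE[OF d] by blast
    then obtain a' where "z = Inl a'" "(gam C a, a') \<in> ttarget TS" by (cases z) auto
    thus "desc TS (dot_vertex t) (Inl a)" using U.upper_unique[OF at] z(1) by blast
  qed
  hence "{t \<in> dots (TT e) WW. desc TS (dot_vertex t) (Inl a)} =
    {t \<in> dots (TT e) WW. desc TS (dot_vertex t) (Inr (gam C a))}" by blast
  thus "induces_connected (subdivide (TT e) WW)
        {t \<in> dots (TT e) WW. desc TS (dot_vertex t) (Inl a)}"
    using dots_connected[OF x] by simp
qed

end

section \<open>Corollas\<close>

lemma corolla_simps [simp]:
  "nodes (corolla a L r) = {a}" "edges (corolla a L r) = insert r L" "root (corolla a L r) = r"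
  "tsource (corolla a L r) = L \<times> {a}" "ttarget (corolla a L r) = {(r, a)}"
  by (simp_all add: corolla_def)

lemma rooted_corolla: "finite L \<Longrightarrow> r \<notin> L \<Longrightarrow> rooted_tree (corolla a L r)"
proof -
  assume "finite L" "r \<notin> L"
  let ?T = "corolla a L r"
  have "desc ?T (Inr b) (Inr r)" if "b \<in> insert r L" for b
  proof (cases "b = r")
    case False
    hence "desc ?T (Inr b) (Inl a)" "desc ?T (Inl a) (Inr r)" using that by (auto intro!: desc_stepI)
    thus ?thesis by (rule desc_trans)
  qed (use desc_refl[of "Inr r" ?T] in simp)
  thus ?thesis using \<open>finite L\<close> \<open>r \<notin> L\<close> by (auto simp: rooted_tree_def)
qed

lemma leaves_corolla: "r \<notin> L \<Longrightarrow> leaves (corolla a L r) = L"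
  and null_dots_corolla: "null_dots (corolla a L r) = (if L = {} then {a} else {})"
  by (auto simp: leaves_def null_dots_def)

lemma connected_singleton: "D \<subseteq> {d} \<Longrightarrow> induces_connected T D"
  by (auto simp: induces_connected_def)

lemma empty_subdivision: "is_subdivision T empty_subdiv"
  by (auto simp: is_subdivision_def empty_subdiv_def strict_linear_order_on_def)

lemma white_dots_empty: "white_dots T empty_subdiv = {}"
  by (simp add: white_dots_def empty_subdiv_def)

text \<open>With a single dot the kernel rule is trivial. This covers the two lowest constellations
  of Z and, for P, the one from the corolla into the unit tree.\<close>

lemma exact_single_node:
  fixes T :: "('a, 'e) rtree" and U :: "('w, 'a) rtree"
  assumes "rooted_tree T" "nodes T = {a}" "rooted_tree U" "leaves U = {a}" "null_dots U = {}"
  shows "exact_constellation T empty_subdiv U"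
proof -
  let ?E = "empty_subdiv :: ('e, 'w) subdiv"
  have d: "dots T ?E = {Inl a}" using assms(2) white_dots_empty[of T] by (auto simp: dots_def)
  have "induces_connected (subdivide T ?E) {t \<in> dots T ?E. P t}" for P
    by (rule connected_singleton[of _ "Inl a"]) (auto simp: d)
  thus ?thesis using assms white_dots_empty[of T] empty_subdivision[of T]
    by (simp add: exact_constellation_def is_constellation_def bij_betw_def)
qed

text \<open>Without null dots and with one source at every node, the way up from the root is unique,
  and it ends at a leaf.\<close>

lemma (in tree) linear_unique_leaf:
  assumes "linear_tree T" shows "\<exists>l. leaves T = {l}"
proof -
  have nn: "null_dots T = {}" using assms by (auto simp: linear_tree_def null_dots_def)
  have "\<exists>l. \<forall>t\<in>tops T. desc T t (Inr x) \<longrightarrow> t = Inr l" if "x \<in> edges T" for x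
    using that
  proof (induction rule: edge_up_induct)
    case (1 x)
    show ?case
    proof (cases "x \<in> leaves T")
      case True
      hence "Inr x \<in> tops T" by (simp add: tops_def)
      thus ?thesis using tops_maximal by blast
    next
      case False
      then obtain a where a: "(x, a) \<in> ttarget T" using 1(1) by (auto simp: leaves_def)
      hence "a \<in> nodes T" using target_mem by blast
      then obtain y where y: "(y, a) \<in> tsource T" "\<And>y'. (y', a) \<in> tsource T \<Longrightarrow> y' = y"
        using assms unfolding linear_tree_def by blast
      obtain l where l: "\<forall>t\<in>tops T. desc T t (Inr y) \<longrightarrow> t = Inr l" using 1(2)[OF a y(1)] by blast
      have "t = Inr l" if t: "t \<in> tops T" "desc T t (Inr x)" for t
      proof -
        have "t \<noteq> Inr x" using t(1) False by (auto simp: tops_def)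
        moreover have "t \<noteq> Inl b" for b using t(1) nn by (auto simp: tops_def)
        ultimately obtain y' where "(y', a) \<in> tsource T" "desc T t (Inr y')"
          using desc_edge_cases[OF t(2,1)] a upper_unique by blast
        thus ?thesis using y(2) l t by blast
      qed
      thus ?thesis by blast
    qed
  qed
  from this[OF root_mem] obtain l where l: "\<forall>t\<in>tops T. desc T t (Inr (root T)) \<longrightarrow> t = Inr l" by blast
  have sub: "x = l" if "x \<in> leaves T" for x
    using l desc_root[of "Inr x"] that by (auto simp: tops_def leaves_def)
  obtain t where t: "t \<in> tops T" "desc T t (Inr (root T))" using top_above[OF root_mem] by blast
  hence "Inr l \<in> tops T" using l by metis
  hence "l \<in> leaves T" by (auto simp: tops_def)
  thus ?thesis using sub by blast
qed

text \<open>The definition of the trees makes sense up to degree n + 2. This longer sequence is an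
  extended opetope whose names are cells of \<open>C\<close>, so its complex differs from
  \<open>C\<close> only by tags.\<close>

definition Z_ext :: "'a mop \<Rightarrow> 'a opetope" where
  "Z_ext C = \<lparr>odim = mop_dim C + 2, otree = Z_tree C, osub = Z_sub C\<rparr>"

context dendritic
begin

lemma bottom_cell: "\<exists>s. cells_dim C (-1) = {s}"
proof -
  have "\<exists>!s. s \<in> cells_dim C (-1)" using mop by (simp add: is_mop_def)
  thus ?thesis by blast
qed

lemma bottom_face: "x \<in> cells_dim C 0 \<Longrightarrow> face C 1 (the_elem (cells_dim C (-1))) x"
proof -
  assume x: "x \<in> cells_dim C 0"
  obtain s where s: "cells_dim C (-1) = {s}" using bottom_cell by blast
  have "gamma C x - delta C x = cells_dim C (-1)" using mop x by (simp add: is_mop_def)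
  thus ?thesis using s x by (auto simp: face_def cells_dim_iff)
qed

text \<open>Every 0-cell has the bottom cell as its positive face, so thinness in a 1-cell yields a
  source, and \<open>source_unique\<close> only one.\<close>

lemma TT_linear: "linear_tree (TT 0)"
  unfolding linear_tree_def
proof
  fix a assume "a \<in> nodes (TT 0)"
  hence a: "a \<in> Lm 1" "a \<in> Lm (int 0 + 1)" by (simp_all add: TT_simps)
  hence t: "face C 1 (gam C a) a" using Lm_target by blast
  let ?s = "the_elem (cells_dim C (-1))"
  have "gam C a \<in> cells_dim C 0" using face_mem[OF t] a by (simp add: cells_dim_iff Lm_iff)
  then obtain y where y: "face C (-1) y a" using target_source[OF bottom_face t] by auto
  have bs: "face C 1 ?s y" if "face C (-1) y a" for y
    using bottom_face face_mem[OF that] a by (simp add: cells_dim_iff Lm_iff)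
  show "\<exists>!b. (b, a) \<in> tsource (TT 0)"
  proof (rule ex1I[of _ y])
    show "(y, a) \<in> tsource (TT 0)" using y a by (simp add: TT_simps)
    fix y' assume "(y', a) \<in> tsource (TT 0)"
    hence "face C (-1) y' a" by (simp add: TT_simps)
    thus "y' = y" using source_unique[OF bs bs _ _ y] y by simp
  qed
qed

lemma first_leaf_eq: "Lm 0 = {first_leaf C}" "leaves (TT 0) = {first_leaf C}"
proof -
  interpret T: tree "TT 0" using TT_tree by simp
  obtain l where l: "leaves (TT 0) = {l}" using T.linear_unique_leaf[OF TT_linear] by blast
  hence L: "Lm 0 = {l}" using TT_leaves[of 0] by simp
  hence "first_leaf C = l" unfolding first_leaf_def Lm_def by auto
  thus "Lm 0 = {first_leaf C}" "leaves (TT 0) = {first_leaf C}" using l L by auto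
qed

lemma low_tree:
  assumes "k < 2"
  shows "Z_tree C k = corolla (first_leaf C) {first_leaf C} (the_elem (cells_dim C (-1)))"
    "Z_sub C k = empty_subdiv" "rooted_tree (Z_tree C k)" "leaves (Z_tree C k) = {first_leaf C}" "nodes (Z_tree C k) = {first_leaf C}"
    "null_dots (Z_tree C k) = {}" "first_leaf C \<noteq> the_elem (cells_dim C (-1))"
proof -
  show t: "Z_tree C k = corolla (first_leaf C) {first_leaf C} (the_elem (cells_dim C (-1)))" "Z_sub C k = empty_subdiv"
    using assms by (simp_all add: Z_tree_def Z_sub_def)
  obtain s where s: "cells_dim C (-1) = {s}" using bottom_cell by blast
  hence "dim C s = -1" by (auto simp: cells_dim_def)
  moreover have "dim C (first_leaf C) = 0" using first_leaf_eq(1) by (metis Lm_iff singletonI)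
  ultimately show ne: "first_leaf C \<noteq> the_elem (cells_dim C (-1))" using s by auto
  thus "rooted_tree (Z_tree C k)" "leaves (Z_tree C k) = {first_leaf C}"
    unfolding t by (auto intro!: rooted_corolla leaves_corolla)
  show "nodes (Z_tree C k) = {first_leaf C}" "null_dots (Z_tree C k) = {}"
    unfolding t by (simp_all add: null_dots_corolla)
qed

lemma Z_tree_TT: "Z_tree C (Suc (Suc e)) = TT e"
  by (simp add: TT_def)

lemma Z_ext_opetope: "is_opetope (Z_ext C)"
proof -
  have rooted: "rooted_tree (Z_tree C k)" if "k \<le> n + 2" for k
  proof (cases "k < 2")
    case False
    then obtain e where "k = Suc (Suc e)" by (metis add_2_eq_Suc le_Suc_ex not_less)
    thus ?thesis using TT_tree[of e] that by (simp add: Z_tree_TT tree_def)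
  qed (use low_tree in blast)
  have con: "exact_constellation (Z_tree C k) (Z_sub C k) (Z_tree C (Suc k))" if k: "k < n + 2" for k
  proof -
    consider "k = 0" | "k = 1" | e where "k = Suc (Suc e)" by (metis One_nat_def not0_implies_Suc)
    thus ?thesis
    proof cases
      case 1
      thus ?thesis using exact_single_node[of "Z_tree C 0" "first_leaf C" "Z_tree C 1"] low_tree[of 0] low_tree[of 1] by simp
    next
      case 2
      have "Z_tree C (Suc 1) = TT 0" using Z_tree_TT[of 0] by simp
      moreover have "null_dots (TT 0) = {}" using TT_linear by (auto simp: linear_tree_def null_dots_def)
      moreover have "rooted_tree (TT 0)" using TT_tree[of 0] by (simp add: tree_def)
      ultimately show ?thesis using exact_single_node[of "Z_tree C 1" "first_leaf C" "TT 0"] low_tree[of 1] first_leaf_eq 2 by simp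
    next
      case 3
      then interpret L: dendritic_level C e using k by unfold_locales simp
      show ?thesis using L.constellation_Z 3 by (simp add: Z_tree_TT L.WW_def)
    qed
  qed
  have "unary_corolla (Z_tree C k)" if "k < 2" for k using low_tree[OF that] by (simp add: unary_corolla_def)
  moreover have "linear_tree (Z_tree C 2)" using TT_linear Z_tree_TT[of 0] by (simp add: numeral_2_eq_2)
  ultimately show ?thesis unfolding is_opetope_def Z_ext_def using rooted con by simp
qed

lemma Z_ext_unit: "nodes (Z_tree C (n + 2)) = {}" using Lm_iff Lam_iff le_top top_dim TT_simps(1) TT_def by fastforce

lemma Z_ob_opetope: "is_opetope (Z_ob C)"
  using Z_ext_opetope unfolding is_opetope_def Z_ext_def Z_ob_def by auto

end

lemma Z_ext_extended: "is_dfc C \<Longrightarrow> extended (Z_ext C)"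
proof -
  assume "is_dfc C"
  then interpret dendritic C by unfold_locales
  show ?thesis using Z_ext_opetope Z_ext_unit by unfold_locales (simp_all add: Z_ext_def)
qed

section \<open>Isomorphisms of trees and opetopes\<close>

lemma tree_iso_sym:
  assumes "tree_iso T U fn fe" and rt: "root T \<in> edges T"
  shows "tree_iso U T (inv_into (nodes T) fn) (inv_into (edges T) fe)"
proof -
  note f = assms(1)[unfolded tree_iso_def]
  let ?gn = "inv_into (nodes T) fn" and ?ge = "inv_into (edges T) fe"
  have g: "bij_betw ?gn (nodes U) (nodes T)" "bij_betw ?ge (edges U) (edges T)"
    using f bij_betw_inv_into by blast+
  have r: "fn (?gn a) = a" "?gn a \<in> nodes T" if "a \<in> nodes U" for a
    using f that bij_betw_inv_into_right g(1) bij_betwE by metis+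
  have s: "fe (?ge b) = b" "?ge b \<in> edges T" if "b \<in> edges U" for b
    using f that bij_betw_inv_into_right g(2) bij_betwE by metis+
  show ?thesis
    unfolding tree_iso_def
  proof (intro conjI ballI)
    fix a b assume "a \<in> nodes U" "b \<in> edges U"
    thus "((?ge b, ?gn a) \<in> tsource T) = ((b, a) \<in> tsource U)" "((?ge b, ?gn a) \<in> ttarget T) = ((b, a) \<in> ttarget U)"
      using f r s by metis+
  next
    have "inj_on fe (edges T)" using f by (auto simp: bij_betw_def)
    hence "?ge (fe (root T)) = root T" using rt by (rule inv_into_f_f)
    thus "?ge (root U) = root T" using f by simp
  qed (use g in auto)
qed

lemma tree_iso_comp:
  assumes f: "tree_iso T U fn fe" and g: "tree_iso U V gn ge"
  shows "tree_iso T V (\<lambda>x. gn (fn x)) (\<lambda>x. ge (fe x))"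
proof -
  note f' = f[unfolded tree_iso_def] and g' = g[unfolded tree_iso_def]
  have "bij_betw (\<lambda>x. gn (fn x)) (nodes T) (nodes V)" "bij_betw (\<lambda>x. ge (fe x)) (edges T) (edges V)"
    using bij_betw_trans[of fn "nodes T" "nodes U" gn] bij_betw_trans[of fe "edges T" "edges U" ge] f' g'
    by (simp_all add: comp_def)
  moreover have "fn a \<in> nodes U" if "a \<in> nodes T" for a using f' that by (auto simp: bij_betw_def)
  moreover have "fe b \<in> edges U" if "b \<in> edges T" for b using f' that by (auto simp: bij_betw_def)
  ultimately show ?thesis using f' g' by (simp add: tree_iso_def)
qed

lemma tree_iso_id: "tree_iso T T (\<lambda>x. x) (\<lambda>x. x)"
  by (simp add: tree_iso_def bij_betw_def)

lemma tree_iso_cong: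
  assumes "\<And>a. a \<in> nodes T \<Longrightarrow> fn a = gn a" "\<And>b. b \<in> edges T \<Longrightarrow> fe b = ge b" "root T \<in> edges T"
  shows "tree_iso T U fn fe \<longleftrightarrow> tree_iso T U gn ge"
  unfolding tree_iso_def using assms bij_betw_cong[of "nodes T" fn gn] bij_betw_cong[of "edges T" fe ge] by simp

lemma tree_iso_desc:
  assumes T: "rooted_tree T" and f: "tree_iso T U fn fe" and d: "desc T x y"
  shows "desc U (map_sum fn fe x) (map_sum fn fe y)"
proof -
  interpret tree T using T by unfold_locales
  note f' = f[unfolded tree_iso_def]
  have v: "map_sum fn fe x \<in> vertices U" if "x \<in> vertices T" for x
    using that f' by (cases x) (auto simp: bij_betw_def)
  have st: "(map_sum fn fe x, map_sum fn fe y) \<in> desc_step U" if "(x, y) \<in> desc_step T" for x y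
    using that f' source_mem target_mem by (cases x; cases y) auto
  have "(x, y) \<in> (desc_step T)\<^sup>*" using d by (simp add: desc_def)
  hence "(map_sum fn fe x, map_sum fn fe y) \<in> (desc_step U)\<^sup>*"
    by (induction rule: rtrancl_induct) (auto intro: rtrancl_into_rtrancl st)
  thus ?thesis using d v by (simp add: desc_def)
qed

lemma tree_iso_desc_iff:
  assumes T: "rooted_tree T" and U: "rooted_tree U" and f: "tree_iso T U fn fe" and v: "x \<in> vertices T" "y \<in> vertices T"
  shows "desc U (map_sum fn fe x) (map_sum fn fe y) \<longleftrightarrow> desc T x y"
proof
  have inj: "inj_on fn (nodes T)" "inj_on fe (edges T)" using f by (auto simp: tree_iso_def bij_betw_def)
  have i: "map_sum (inv_into (nodes T) fn) (inv_into (edges T) fe) (map_sum fn fe z) = z" if "z \<in> vertices T" for z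
    using that inj by (cases z) auto
  assume "desc U (map_sum fn fe x) (map_sum fn fe y)"
  from tree_iso_desc[OF U tree_iso_sym[OF f tree.root_mem] this] show "desc T x y" using i v T by (simp add: tree_def)
qed (rule tree_iso_desc[OF T f])

lemma tree_iso_leaves:
  assumes U: "rooted_tree U" and f: "tree_iso T U fn fe" and b: "b \<in> edges T" and T: "rooted_tree T"
  shows "fe b \<in> leaves U \<longleftrightarrow> b \<in> leaves T"
proof -
  interpret U: tree U using U by unfold_locales
  interpret T: tree T using T by unfold_locales
  note f' = f[unfolded tree_iso_def]
  have "(\<exists>a. (fe b, a) \<in> ttarget U) \<longleftrightarrow> (\<exists>a. (b, a) \<in> ttarget T)"
  proof
    assume "\<exists>a. (fe b, a) \<in> ttarget U"
    then obtain a where a: "(fe b, a) \<in> ttarget U" by blast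
    then obtain a' where "a' \<in> nodes T" "a = fn a'" using U.target_mem f' by (metis bij_betw_imp_surj_on imageE)
    thus "\<exists>a. (b, a) \<in> ttarget T" using a b f' by blast
  next
    assume "\<exists>a. (b, a) \<in> ttarget T"
    thus "\<exists>a. (fe b, a) \<in> ttarget U" using T.target_mem f' by blast
  qed
  thus ?thesis using b f' by (auto simp: leaves_def bij_betw_def)
qed

lemma subdiv_iso_id: "subdiv_iso T W W (\<lambda>x. x) (\<lambda>x. x)"
  by (simp add: subdiv_iso_def bij_betw_def)

lemma subdiv_iso_comp:
  assumes "tree_iso T U fn fe" "subdiv_iso T W V fe fw" "subdiv_iso U V V' ge gw"
  shows "subdiv_iso T W V' (\<lambda>x. ge (fe x)) (\<lambda>x. gw (fw x))"
  unfolding subdiv_iso_def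
proof (intro ballI conjI)
  fix b assume b: "b \<in> edges T"
  hence fb: "fe b \<in> edges U" using assms(1) by (auto simp: tree_iso_def bij_betw_def)
  note 1 = assms(2)[unfolded subdiv_iso_def, rule_format, OF b]
  note 2 = assms(3)[unfolded subdiv_iso_def, rule_format, OF fb]
  show "bij_betw (\<lambda>x. gw (fw x)) (wset W b) (wset V' (ge (fe b)))"
    using bij_betw_trans[OF conjunct1[OF 1] conjunct1[OF 2]] by (simp add: comp_def)
  fix w w' assume w: "w \<in> wset W b" "w' \<in> wset W b"
  hence "fw w \<in> wset V (fe b)" "fw w' \<in> wset V (fe b)" using conjunct1[OF 1] by (auto simp: bij_betw_def)
  thus "((gw (fw w), gw (fw w')) \<in> wless V' (ge (fe b))) = ((w, w') \<in> wless W b)"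
    using 1 2 w by blast
qed

lemma subdiv_iso_cong:
  assumes "\<And>b. b \<in> edges T \<Longrightarrow> fe b = ge b" "\<And>w. w \<in> white_dots T W \<Longrightarrow> fw w = gw w"
  shows "subdiv_iso T W V fe fw \<longleftrightarrow> subdiv_iso T W V ge gw"
proof -
  have w: "fw w = gw w" if "b \<in> edges T" "w \<in> wset W b" for b w
    using assms(2) that by (auto simp: white_dots_def)
  have "bij_betw fw (wset W b) A \<longleftrightarrow> bij_betw gw (wset W b) A" if "b \<in> edges T" for b A
    using w[OF that] by (rule bij_betw_cong)
  thus ?thesis unfolding subdiv_iso_def using assms(1) w by simp
qed

text \<open>The map of white dots is a bijection edge by edge. Since the sets of a subdivision are
  disjoint, these bijections fit together, and the image of a dot shows on which edge the dot
  lies.\<close>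

lemma subdiv_iso_white_bij:
  assumes T: "tree_iso T U fn fe" and f: "subdiv_iso T W V fe fw" and W: "is_subdivision T W" and V: "is_subdivision U V"
  shows "bij_betw fw (white_dots T W) (white_dots U V)"
    and "b \<in> edges T \<Longrightarrow> w \<in> white_dots T W \<Longrightarrow> fw w \<in> wset V (fe b) \<longleftrightarrow> w \<in> wset W b"
proof -
  have e: "fe ` edges T = edges U" "inj_on fe (edges T)" using T by (auto simp: tree_iso_def bij_betw_def)
  have s: "fw ` wset W b = wset V (fe b)" "inj_on fw (wset W b)" if "b \<in> edges T" for b
    using f that by (auto simp: subdiv_iso_def bij_betw_def)
  have dj: "b = b'" if "b \<in> edges U" "b' \<in> edges U" "w \<in> wset V b" "w \<in> wset V b'" for b b' w
    using V that unfolding is_subdivision_def by blast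
  show m: "fw w \<in> wset V (fe b) \<longleftrightarrow> w \<in> wset W b" if bw: "b \<in> edges T" "w \<in> white_dots T W" for b w
  proof
    assume a: "fw w \<in> wset V (fe b)"
    obtain b' where b': "b' \<in> edges T" "w \<in> wset W b'" using bw(2) by (auto simp: white_dots_def)
    hence "fw w \<in> wset V (fe b')" using s by blast
    hence "fe b = fe b'" using dj[of "fe b" "fe b'" "fw w"] a e bw b' by blast
    thus "w \<in> wset W b" using e(2) bw b' by (auto dest: inj_onD)
  qed (use s bw in blast)
  have "inj_on fw (white_dots T W)"
  proof (rule inj_onI)
    fix w w' assume w: "w \<in> white_dots T W" "w' \<in> white_dots T W" "fw w = fw w'"
    obtain b where b: "b \<in> edges T" "w \<in> wset W b" using w by (auto simp: white_dots_def)
    hence "w' \<in> wset W b" using m[OF b(1) w(2)] m[OF b(1) w(1)] w(3) by simp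
    thus "w = w'" using s(2)[OF b(1)] b(2) w(3) by (auto dest: inj_onD)
  qed
  moreover have "fw ` white_dots T W = white_dots U V"
    by (simp add: white_dots_def image_UN s(1) e(1)[symmetric])
  ultimately show "bij_betw fw (white_dots T W) (white_dots U V)" by (simp add: bij_betw_def)
qed

lemma subdiv_iso_sym:
  assumes T: "tree_iso T U fn fe" and f: "subdiv_iso T W V fe fw" and W: "is_subdivision T W" and V: "is_subdivision U V"
  shows "subdiv_iso U V W (inv_into (edges T) fe) (inv_into (white_dots T W) fw)"
  unfolding subdiv_iso_def
proof (intro ballI)
  fix b' assume b': "b' \<in> edges U"
  have e: "fe ` edges T = edges U" "inj_on fe (edges T)" using T by (auto simp: tree_iso_def bij_betw_def)
  then obtain b where b: "b \<in> edges T" "b' = fe b" using b' by blast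
  have ib: "inv_into (edges T) fe b' = b" using b e by simp
  note fb = f[unfolded subdiv_iso_def, rule_format, OF b(1)]
  have inj: "inj_on fw (white_dots T W)" using subdiv_iso_white_bij(1)[OF assms] by (simp add: bij_betw_def)
  have sub: "wset W b \<subseteq> white_dots T W" using b by (auto simp: white_dots_def)
  have i: "inv_into (white_dots T W) fw (fw w) = w" if "w \<in> wset W b" for w using that sub inj by auto
  have im: "fw ` wset W b = wset V b'" using fb b by (simp add: bij_betw_def)
  have "bij_betw (inv_into (white_dots T W) fw) (wset V b') (wset W b)"
    by (rule bij_betw_inv_into_subset[OF subdiv_iso_white_bij(1)[OF assms] sub im])
  moreover have "(inv_into (white_dots T W) fw v, inv_into (white_dots T W) fw v') \<in> wless W b \<longleftrightarrow> (v, v') \<in> wless V b'"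
    if v: "v \<in> wset V b'" "v' \<in> wset V b'" for v v'
  proof -
    obtain w w' where "w \<in> wset W b" "w' \<in> wset W b" "v = fw w" "v' = fw w'" using v im by blast
    thus ?thesis using i fb b(2) by simp
  qed
  ultimately show "bij_betw (inv_into (white_dots T W) fw) (wset V b') (wset W (inv_into (edges T) fe b')) \<and>
      (\<forall>w\<in>wset V b'. \<forall>w'\<in>wset V b'. ((inv_into (white_dots T W) fw w, inv_into (white_dots T W) fw w') \<in> wless W (inv_into (edges T) fe b')) =
       ((w, w') \<in> wless V b'))" unfolding ib by blast
qed

text \<open>The maps act on nodes, edges and white dots of \<open>T\<close> and on nodes and edges
  of \<open>U\<close>; \<open>compat\<close> is commutation with the structure maps, which are
  identities by exactness.\<close>

locale constellation_iso = C: constellation T W U + D: constellation T' W' U'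
  for T :: "('a, 'e) rtree" and W :: "('e, 'w) subdiv" and U :: "('w, 'a) rtree"
    and T' :: "('b, 'f) rtree" and W' :: "('f, 'v) subdiv" and U' :: "('v, 'b) rtree" +
  fixes fn :: "'a \<Rightarrow> 'b" and fe :: "'e \<Rightarrow> 'f" and fw :: "'w \<Rightarrow> 'v" and gn :: "'w \<Rightarrow> 'v" and ge :: "'a \<Rightarrow> 'b"
  assumes f: "tree_iso T T' fn fe" and fw: "subdiv_iso T W W' fe fw" and g: "tree_iso U U' gn ge"
    and compat: "\<And>a. a \<in> nodes T \<Longrightarrow> ge a = fn a" "\<And>w. w \<in> white_dots T W \<Longrightarrow> gn w = fw w"
begin

lemma fe_bij: "bij_betw fe (edges T) (edges T')" and fn_bij: "bij_betw fn (nodes T) (nodes T')"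
  and ge_bij: "bij_betw ge (edges U) (edges U')"
  using f g by (auto simp: tree_iso_def)

lemma fw_bij: "bij_betw fw (white_dots T W) (white_dots T' W')"
  and fw_wset: "b \<in> edges T \<Longrightarrow> w \<in> white_dots T W \<Longrightarrow> fw w \<in> wset W' (fe b) \<longleftrightarrow> w \<in> wset W b"
  using subdiv_iso_white_bij[OF f fw C.subdivision D.subdivision] by blast+

lemma dots_image: "map_sum fn fw ` dots T W = dots T' W'"
proof -
  have "map_sum fn fw ` dots T W = Inl ` (fn ` nodes T) \<union> Inr ` (fw ` white_dots T W)"
    by (simp add: dots_def image_Un image_image)
  thus ?thesis using fn_bij fw_bij by (simp add: dots_def bij_betw_def)
qed

lemma above_iff:
  assumes x: "x \<in> edges U" and t: "t \<in> dots T W"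
  shows "map_sum fn fw t \<in> D.above (ge x) \<longleftrightarrow> t \<in> C.above x"
proof -
  have "dot_vertex (map_sum fn fw t) = map_sum gn ge (dot_vertex t)"
    using t compat by (cases t) auto
  moreover have "dot_vertex t \<in> vertices U" using C.U.tops_vertices C.dot_vertex_tops t by blast
  ultimately show ?thesis
    using tree_iso_desc_iff[OF C.U.rooted D.U.rooted g, of "dot_vertex t" "Inr x"] x t dots_image
    by (auto simp: C.above_iff D.above_iff)
qed

lemma upper_iff: "c \<in> edges T \<Longrightarrow> x \<in> edges U \<Longrightarrow> upper_in T' (D.above (ge x)) (fe c) \<longleftrightarrow> upper_in T (C.above x) c"
  and lower_iff: "c \<in> edges T \<Longrightarrow> x \<in> edges U \<Longrightarrow> lower_in T' (D.above (ge x)) (fe c) \<longleftrightarrow> lower_in T (C.above x) c"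
proof -
  assume c: "c \<in> edges T" and x: "x \<in> edges U"
  have m: "Inl (fn a) \<in> D.above (ge x) \<longleftrightarrow> Inl a \<in> C.above x" if "a \<in> nodes T" for a
    using above_iff[OF x, of "Inl a"] that by simp
  have s: "a \<in> nodes T' \<Longrightarrow> \<exists>a'\<in>nodes T. a = fn a'" for a using fn_bij by (auto simp: bij_betw_def)
  note f' = f[unfolded tree_iso_def]
  show "upper_in T' (D.above (ge x)) (fe c) \<longleftrightarrow> upper_in T (C.above x) c"
    unfolding upper_in_def using m s f' c C.target_mem D.target_mem by metis
  show "lower_in T' (D.above (ge x)) (fe c) \<longleftrightarrow> lower_in T (C.above x) c"
    unfolding lower_in_def using m s f' c C.source_mem D.source_mem by metis
qed

lemma above_image:
  assumes x: "x \<in> edges U" shows "D.above (ge x) = map_sum fn fw ` C.above x"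
proof (rule set_eqI, rule iffI)
  fix d assume d: "d \<in> D.above (ge x)"
  then obtain t where "t \<in> dots T W" "d = map_sum fn fw t" using D.above_dots dots_image by blast
  thus "d \<in> map_sum fn fw ` C.above x" using above_iff[OF x] d by blast
qed (use above_iff[OF x] C.above_dots in blast)

lemma white_iff:
  assumes c: "c \<in> edges T" and x: "x \<in> edges U"
  shows "D.above (ge x) \<subseteq> Inr ` wset W' (fe c) \<longleftrightarrow> C.above x \<subseteq> Inr ` wset W c"
proof -
  have "map_sum fn fw t \<in> Inr ` wset W' (fe c) \<longleftrightarrow> t \<in> Inr ` wset W c" if "t \<in> C.above x" for t
    using that C.above_dots[of x] fw_wset[OF c] by (cases t) auto
  thus ?thesis unfolding above_image[OF x] by blast
qed

lemma wless_iff: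
  assumes i: "C.inc 0 z y" "C.inc 0 z y'"
  shows "(\<forall>w w'. Inr w \<in> D.above (ge y) \<and> Inr w' \<in> D.above (ge y') \<longrightarrow> (w, w') \<in> wless W' (fe z)) \<longleftrightarrow>
    (\<forall>w w'. Inr w \<in> C.above y \<and> Inr w' \<in> C.above y' \<longrightarrow> (w, w') \<in> wless W z)"
proof -
  have m: "Inr u \<in> D.above (ge v) \<longleftrightarrow> (\<exists>w. u = fw w \<and> Inr w \<in> C.above v)" if "v \<in> edges U" for u v
  proof -
    have "Inr u = map_sum fn fw t \<longleftrightarrow> (\<exists>w. t = Inr w \<and> u = fw w)" for t by (cases t) auto
    thus ?thesis unfolding above_image[OF that] image_iff by auto
  qed
  have "(fw w, fw w') \<in> wless W' (fe z) \<longleftrightarrow> (w, w') \<in> wless W z"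
    if "Inr w \<in> C.above y" "Inr w' \<in> C.above y'" for w w'
  proof -
    have "z \<in> edges T" "w \<in> wset W z" "w' \<in> wset W z" using i that by (auto simp: C.inc_def)
    thus ?thesis using fw unfolding subdiv_iso_def by blast
  qed
  thus ?thesis using m C.inc_mem i by metis
qed

lemma inc_iff:
  assumes "c \<in> edges T" "x \<in> edges U"
  shows "D.inc s (fe c) (ge x) \<longleftrightarrow> C.inc s c x"
proof -
  have "fe c \<in> edges T'" "ge x \<in> edges U'" using assms fe_bij ge_bij by (auto simp: bij_betw_def)
  thus ?thesis unfolding C.inc_def D.inc_def leaves_at_def enters_def
    using assms upper_iff[OF assms] lower_iff[OF assms] white_iff[OF assms] by simp
qed

end

text \<open>An isomorphism of opetopes without the condition on values outside the trees. Such maps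
  can be composed, inverted and extended freely; \<open>restrict_map\<close> normalises them at the
  end.\<close>

definition level_iso :: "'a opetope \<Rightarrow> 'a opetope \<Rightarrow> 'a opetope_map \<Rightarrow> bool" where
  "level_iso Y Y' f \<longleftrightarrow> odim Y = odim Y' \<and>
     (\<forall>k\<le>odim Y. tree_iso (otree Y k) (otree Y' k) (mnode f k) (medge f k)) \<and>
     (\<forall>k<odim Y. subdiv_iso (otree Y k) (osub Y k) (osub Y' k) (medge f k) (mwhite f k)) \<and>
     (\<forall>k<odim Y. (\<forall>a\<in>onodes Y k. medge f (Suc k) a = mnode f k a) \<and>
                  (\<forall>w\<in>owhites Y k. mnode f (Suc k) w = mwhite f k w))"

definition restrict_map :: "'a opetope \<Rightarrow> 'a opetope_map \<Rightarrow> 'a opetope_map" where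
  "restrict_map Y f = \<lparr>mnode = \<lambda>k. restrict (mnode f k) (onodes Y k),
     medge = \<lambda>k. restrict (medge f k) (oedges Y k), mwhite = \<lambda>k. restrict (mwhite f k) (owhites Y k)\<rparr>"

lemma opetope_level:
  assumes "is_opetope Y" "k < odim Y"
  shows "constellation (otree Y k) (osub Y k) (otree Y (Suc k))"
    by (metis assms is_opetope_def constellation_def stree_def stree_axioms_def constellation_axioms_def tree_def exact_constellation_def is_constellation_def)

lemma level_iso_constellation:
  assumes Y: "is_opetope Y" "is_opetope Y'" and f: "level_iso Y Y' f" and k: "k < odim Y"
  shows "constellation_iso (otree Y k) (osub Y k) (otree Y (Suc k)) (otree Y' k) (osub Y' k) (otree Y' (Suc k))
    (mnode f k) (medge f k) (mwhite f k) (mnode f (Suc k)) (medge f (Suc k))"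
proof -
  have k': "k < odim Y'" using f k by (simp add: level_iso_def)
  show ?thesis unfolding constellation_iso_def constellation_iso_axioms_def
    using opetope_level[OF Y(1) k] opetope_level[OF Y(2) k'] f k
    by (auto simp: level_iso_def onodes_def owhites_def)
qed

lemma opetope_isos_iff:
  "f \<in> opetope_isos Y Y' \<longleftrightarrow> level_iso Y Y' f \<and> f = restrict_map Y f"
proof -
  have "f = restrict_map Y f \<longleftrightarrow> (\<forall>k. mnode f k \<in> extensional (onodes Y k) \<and>
          medge f k \<in> extensional (oedges Y k) \<and> mwhite f k \<in> extensional (owhites Y k))"
  proof
    assume e: "f = restrict_map Y f"
    have "mnode f k = restrict (mnode f k) (onodes Y k)" "medge f k = restrict (medge f k) (oedges Y k)"
      "mwhite f k = restrict (mwhite f k) (owhites Y k)" for k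
      using arg_cong[OF e, of "\<lambda>g. mnode g k"] arg_cong[OF e, of "\<lambda>g. medge g k"] arg_cong[OF e, of "\<lambda>g. mwhite g k"]
      by (simp_all add: restrict_map_def)
    thus "\<forall>k. mnode f k \<in> extensional (onodes Y k) \<and>
          medge f k \<in> extensional (oedges Y k) \<and> mwhite f k \<in> extensional (owhites Y k)"
      by (metis restrict_extensional)
  next
    assume "\<forall>k. mnode f k \<in> extensional (onodes Y k) \<and>
          medge f k \<in> extensional (oedges Y k) \<and> mwhite f k \<in> extensional (owhites Y k)"
    thus "f = restrict_map Y f" by (simp add: restrict_map_def extensional_restrict)
  qed
  thus ?thesis unfolding opetope_isos_def level_iso_def by auto
qed

lemma level_iso_restrict:
  assumes Y: "is_opetope Y"
  shows "level_iso Y Y' (restrict_map Y f) \<longleftrightarrow> level_iso Y Y' f"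
proof -
  let ?r = "restrict_map Y f"
  have rt: "root (otree Y k) \<in> edges (otree Y k)" if "k \<le> odim Y" for k
    using Y that tree.root_mem by (auto simp: is_opetope_def tree_def)
  have t: "tree_iso (otree Y k) (otree Y' k) (mnode ?r k) (medge ?r k) \<longleftrightarrow> tree_iso (otree Y k) (otree Y' k) (mnode f k) (medge f k)"
    if "k \<le> odim Y" for k
    by (rule tree_iso_cong) (use that rt in \<open>auto simp: restrict_map_def onodes_def oedges_def\<close>)
  have s: "subdiv_iso (otree Y k) (osub Y k) (osub Y' k) (medge ?r k) (mwhite ?r k) \<longleftrightarrow>
      subdiv_iso (otree Y k) (osub Y k) (osub Y' k) (medge f k) (mwhite f k)" if "k < odim Y" for k
    by (rule subdiv_iso_cong) (use that in \<open>auto simp: restrict_map_def oedges_def owhites_def\<close>)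
  have c: "medge ?r (Suc k) a = medge f (Suc k) a" "mnode ?r k a = mnode f k a" if "k < odim Y" "a \<in> onodes Y k" for k a
    using that constellation.nodes_eq[OF opetope_level[OF Y that(1)]]
    by (auto simp: restrict_map_def onodes_def oedges_def leaves_def)
  have d: "mnode ?r (Suc k) w = mnode f (Suc k) w" "mwhite ?r k w = mwhite f k w" if "k < odim Y" "w \<in> owhites Y k" for k w
    using that constellation.whites_eq[OF opetope_level[OF Y that(1)]]
    by (auto simp: restrict_map_def onodes_def owhites_def null_dots_def)
  show ?thesis unfolding level_iso_def using t s c d by auto
qed

lemma restrict_map_idem: "restrict_map Y (restrict_map Y f) = restrict_map Y f"
  by (simp add: restrict_map_def)

lemma restrict_map_iso: "is_opetope Y \<Longrightarrow> level_iso Y Y' f \<Longrightarrow> restrict_map Y f \<in> opetope_isos Y Y'"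
  by (simp add: opetope_isos_iff level_iso_restrict restrict_map_idem)

definition id_map :: "'a opetope_map" where
  "id_map = \<lparr>mnode = \<lambda>k x. x, medge = \<lambda>k x. x, mwhite = \<lambda>k x. x\<rparr>"

definition comp_map :: "'a opetope_map \<Rightarrow> 'a opetope_map \<Rightarrow> 'a opetope_map" where
  "comp_map g f = \<lparr>mnode = \<lambda>k x. mnode g k (mnode f k x), medge = \<lambda>k x. medge g k (medge f k x),
     mwhite = \<lambda>k x. mwhite g k (mwhite f k x)\<rparr>"

definition inv_map :: "'a opetope \<Rightarrow> 'a opetope_map \<Rightarrow> 'a opetope_map" where
  "inv_map Y f = \<lparr>mnode = \<lambda>k. inv_into (onodes Y k) (mnode f k), medge = \<lambda>k. inv_into (oedges Y k) (medge f k),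
     mwhite = \<lambda>k. inv_into (owhites Y k) (mwhite f k)\<rparr>"

lemma level_iso_id: "level_iso Y Y id_map"
  by (simp add: level_iso_def id_map_def tree_iso_id subdiv_iso_id)

lemma level_iso_onto:
  assumes Y: "is_opetope Y" "is_opetope Y'" and f: "level_iso Y Y' f"
  shows "bij_betw (mnode f k) (onodes Y k) (onodes Y' k)" "bij_betw (medge f k) (oedges Y k) (oedges Y' k)"
    "bij_betw (mwhite f k) (owhites Y k) (owhites Y' k)"
proof -
  have d: "odim Y = odim Y'" using f by (simp add: level_iso_def)
  show "bij_betw (mnode f k) (onodes Y k) (onodes Y' k)" "bij_betw (medge f k) (oedges Y k) (oedges Y' k)"
    using f by (cases "k \<le> odim Y", auto simp: level_iso_def tree_iso_def onodes_def oedges_def bij_betw_def)+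
  show "bij_betw (mwhite f k) (owhites Y k) (owhites Y' k)"
  proof (cases "k < odim Y")
    case True
    thus ?thesis using constellation_iso.fw_bij[OF level_iso_constellation[OF Y f True]] d
      by (simp add: owhites_def)
  qed (use d in \<open>simp add: owhites_def bij_betw_def\<close>)
qed

lemma level_iso_comp:
  assumes Y: "is_opetope Y" "is_opetope Y'" and f: "level_iso Y Y' f" and g: "level_iso Y' Y'' g"
  shows "level_iso Y Y'' (comp_map g f)"
proof -
  have d: "odim Y' = odim Y" "odim Y'' = odim Y" using f g by (simp_all add: level_iso_def)
  note o = level_iso_onto[OF Y f]
  have "tree_iso (otree Y k) (otree Y'' k) (\<lambda>x. mnode g k (mnode f k x)) (\<lambda>x. medge g k (medge f k x))" if "k \<le> odim Y" for k
    by (rule tree_iso_comp[of _ "otree Y' k"]) (use f g d that in \<open>simp_all add: level_iso_def\<close>)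
  moreover have "subdiv_iso (otree Y k) (osub Y k) (osub Y'' k) (\<lambda>x. medge g k (medge f k x)) (\<lambda>x. mwhite g k (mwhite f k x))" if "k < odim Y" for k
    by (rule subdiv_iso_comp[of _ "otree Y' k" "mnode f k" _ _ "osub Y' k"]) (use f g d that in \<open>simp_all add: level_iso_def\<close>)
  moreover have "medge g (Suc k) (medge f (Suc k) a) = mnode g k (mnode f k a)" if "k < odim Y" "a \<in> onodes Y k" for k a
  proof -
    have "mnode f k a \<in> onodes Y' k" using bij_betwE[OF o(1)] that by blast
    thus ?thesis using f g that by (simp add: level_iso_def)
  qed
  moreover have "mnode g (Suc k) (mnode f (Suc k) a) = mwhite g k (mwhite f k a)" if "k < odim Y" "a \<in> owhites Y k" for k a
  proof -
    have "mwhite f k a \<in> owhites Y' k" using bij_betwE[OF o(3)] that by blast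
    thus ?thesis using f g that by (simp add: level_iso_def)
  qed
  ultimately show ?thesis using d by (simp add: level_iso_def comp_map_def)
qed

lemma level_iso_inv:
  assumes Y: "is_opetope Y" "is_opetope Y'" and f: "level_iso Y Y' f"
  shows "level_iso Y' Y (inv_map Y f)"
proof -
  have d: "odim Y' = odim Y" using f by (simp add: level_iso_def)
  note o = level_iso_onto[OF Y f]
  have sd: "is_subdivision (otree Y k) (osub Y k)" "is_subdivision (otree Y' k) (osub Y' k)" if "k < odim Y" for k
    using Y that d by (auto simp: is_opetope_def exact_constellation_def is_constellation_def)
  have t: "tree_iso (otree Y k) (otree Y' k) (mnode f k) (medge f k)" if "k \<le> odim Y" for k
    using f that by (simp add: level_iso_def)
  have "tree_iso (otree Y' k) (otree Y k) (mnode (inv_map Y f) k) (medge (inv_map Y f) k)" if "k \<le> odim Y" for k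
    using tree_iso_sym[OF t[OF that]] that Y(1) tree.root_mem[of "otree Y k"]
    by (simp add: inv_map_def onodes_def oedges_def is_opetope_def tree_def)
  moreover have "subdiv_iso (otree Y' k) (osub Y' k) (osub Y k) (medge (inv_map Y f) k) (mwhite (inv_map Y f) k)" if k: "k < odim Y" for k
  proof -
    have "subdiv_iso (otree Y k) (osub Y k) (osub Y' k) (medge f k) (mwhite f k)" using f k by (simp add: level_iso_def)
    from subdiv_iso_sym[OF t this sd[OF k]] k show ?thesis by (simp add: inv_map_def oedges_def owhites_def)
  qed
  moreover have "medge (inv_map Y f) (Suc k) a = mnode (inv_map Y f) k a" if k: "k < odim Y" "a \<in> onodes Y' k" for k a
  proof -
    obtain b where b: "b \<in> onodes Y k" "a = mnode f k b" using o(1)[of k] k by (auto simp: bij_betw_def)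
    hence "b \<in> oedges Y (Suc k)" using constellation.nodes_eq[OF opetope_level[OF Y(1) k(1)]] k
      by (auto simp: onodes_def oedges_def leaves_def)
    moreover have "a = medge f (Suc k) b" using f k b by (simp add: level_iso_def)
    ultimately show ?thesis using b inv_into_f_f[OF bij_betw_imp_inj_on[OF o(1)[of k]] b(1)]
        inv_into_f_f[OF bij_betw_imp_inj_on[OF o(2)[of "Suc k"]], of b] by (simp add: inv_map_def)
  qed
  moreover have "mnode (inv_map Y f) (Suc k) a = mwhite (inv_map Y f) k a" if k: "k < odim Y" "a \<in> owhites Y' k" for k a
  proof -
    obtain b where b: "b \<in> owhites Y k" "a = mwhite f k b" using o(3)[of k] k by (auto simp: bij_betw_def)
    hence "b \<in> onodes Y (Suc k)" using constellation.whites_eq[OF opetope_level[OF Y(1) k(1)]] k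
      by (auto simp: onodes_def owhites_def null_dots_def)
    moreover have "a = mnode f (Suc k) b" using f k b by (simp add: level_iso_def)
    ultimately show ?thesis using b inv_into_f_f[OF bij_betw_imp_inj_on[OF o(3)[of k]] b(1)]
        inv_into_f_f[OF bij_betw_imp_inj_on[OF o(1)[of "Suc k"]], of b] by (simp add: inv_map_def)
  qed
  ultimately show ?thesis using d by (simp add: level_iso_def)
qed

section \<open>The groupoid of opetopes\<close>

lemma restrict_map_cong:
  assumes "\<And>k a. a \<in> onodes Y k \<Longrightarrow> mnode f k a = mnode g k a" "\<And>k a. a \<in> oedges Y k \<Longrightarrow> medge f k a = medge g k a"
    "\<And>k a. a \<in> owhites Y k \<Longrightarrow> mwhite f k a = mwhite g k a"
  shows "restrict_map Y f = restrict_map Y g"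
  unfolding restrict_map_def using assms by (simp add: fun_eq_iff)

lemma KJBM_simps:
  "Ob KJBM = {Y. is_opetope Y}" "Hom KJBM = opetope_isos" "Id KJBM Y = restrict_map Y id_map"
  "Comp KJBM Y Y' Y'' g f = restrict_map Y (comp_map g f)"
  by (simp_all add: KJBM_def restrict_map_def id_map_def comp_map_def compose_def)

lemma opetope_isos_mem:
  assumes "is_opetope Y" "is_opetope Y'" "f \<in> opetope_isos Y Y'"
  shows "a \<in> onodes Y k \<Longrightarrow> mnode f k a \<in> onodes Y' k" "b \<in> oedges Y k \<Longrightarrow> medge f k b \<in> oedges Y' k"
    "w \<in> owhites Y k \<Longrightarrow> mwhite f k w \<in> owhites Y' k"
  using level_iso_onto[OF assms(1,2)] assms(3) bij_betwE unfolding opetope_isos_iff by blast+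

lemma KJBM_comp_closed:
  "is_opetope Y \<Longrightarrow> is_opetope Y' \<Longrightarrow> f \<in> opetope_isos Y Y' \<Longrightarrow> g \<in> opetope_isos Y' Y'' \<Longrightarrow>
   restrict_map Y (comp_map g f) \<in> opetope_isos Y Y''"
  using restrict_map_iso level_iso_comp opetope_isos_iff by metis

lemma opetope_isos_restrict: "f \<in> opetope_isos Y Y' \<Longrightarrow> restrict_map Y f = f"
  by (simp add: opetope_isos_iff)

lemma KJBM_category: "is_category KJBM"
  unfolding is_category_def KJBM_simps
proof (intro conjI ballI)
  fix Y :: "'a opetope" assume "Y \<in> {Y. is_opetope Y}"
  thus "restrict_map Y id_map \<in> opetope_isos Y Y" using restrict_map_iso level_iso_id by blast
next
  fix Y Y' Y'' :: "'a opetope" and f g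
  assume "Y \<in> {Y. is_opetope Y}" "Y' \<in> {Y. is_opetope Y}" "f \<in> opetope_isos Y Y'" "g \<in> opetope_isos Y' Y''"
  thus "restrict_map Y (comp_map g f) \<in> opetope_isos Y Y''" using KJBM_comp_closed by blast
next
  fix Y Y' :: "'a opetope" and f assume a: "Y \<in> {Y. is_opetope Y}" "Y' \<in> {Y. is_opetope Y}" and f: "f \<in> opetope_isos Y Y'"
  hence o: "is_opetope Y" "is_opetope Y'" by auto
  have "restrict_map Y (comp_map f (restrict_map Y id_map)) = restrict_map Y f"
    by (rule restrict_map_cong) (simp_all add: comp_map_def restrict_map_def id_map_def)
  thus "restrict_map Y (comp_map f (restrict_map Y id_map)) = f" using opetope_isos_restrict[OF f] by simp
  have "restrict_map Y (comp_map (restrict_map Y' id_map) f) = restrict_map Y f"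
    by (rule restrict_map_cong) (use opetope_isos_mem[OF o f] in \<open>simp_all add: comp_map_def restrict_map_def id_map_def\<close>)
  thus "restrict_map Y (comp_map (restrict_map Y' id_map) f) = f" using opetope_isos_restrict[OF f] by simp
next
  fix Y0 Y1 Y2 Y3 :: "'a opetope" and f g h
  assume "Y0 \<in> {Y. is_opetope Y}" "Y1 \<in> {Y. is_opetope Y}" and f: "f \<in> opetope_isos Y0 Y1"
  hence o: "is_opetope Y0" "is_opetope Y1" by auto
  show "restrict_map Y0 (comp_map (restrict_map Y1 (comp_map h g)) f) = restrict_map Y0 (comp_map h (restrict_map Y0 (comp_map g f)))"
    by (rule restrict_map_cong) (use opetope_isos_mem[OF o f] in \<open>simp_all add: comp_map_def restrict_map_def id_map_def\<close>)
qed

lemma KJBM_inverse: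
  assumes o: "is_opetope Y" "is_opetope Y'" and f: "f \<in> opetope_isos Y Y'"
  shows "is_iso KJBM Y Y' f"
proof -
  let ?g = "restrict_map Y' (inv_map Y f)"
  have l: "level_iso Y Y' f" using f opetope_isos_iff by blast
  have g: "?g \<in> opetope_isos Y' Y" using restrict_map_iso[OF o(2)] level_iso_inv[OF o l] by blast
  note b = level_iso_onto[OF o l]
  have "restrict_map Y (comp_map ?g f) = restrict_map Y id_map"
    by (rule restrict_map_cong)
      (use opetope_isos_mem[OF o f] b in \<open>auto simp: comp_map_def restrict_map_def id_map_def inv_map_def bij_betw_def\<close>)
  moreover have "restrict_map Y' (comp_map f ?g) = restrict_map Y' id_map"
    by (rule restrict_map_cong)
      (use bij_betw_inv_into_right[OF b(1)] bij_betw_inv_into_right[OF b(2)] bij_betw_inv_into_right[OF b(3)]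
        in \<open>auto simp: comp_map_def restrict_map_def id_map_def inv_map_def\<close>)
  ultimately show ?thesis unfolding is_iso_def KJBM_simps using f g by blast
qed

lemma KJBM_groupoid: "is_groupoid KJBM"
  unfolding is_groupoid_def using KJBM_category KJBM_inverse by (auto simp: KJBM_simps)

section \<open>The groupoid of dendritic face complexes\<close>

lemma core_simps: "Ob (core C) = Ob C" "Hom (core C) X Y = {f. is_iso C X Y f}" "Id (core C) = Id C" "Comp (core C) = Comp C"
  by (simp_all add: core_def)

lemma iso_comp:
  assumes C: "is_category C" and o: "X \<in> Ob C" "Y \<in> Ob C" "Z \<in> Ob C" and f: "is_iso C X Y f" and g: "is_iso C Y Z g"
  shows "is_iso C X Z (Comp C X Y Z g f)"
proof -
  have cl: "\<And>X Y Z f g. \<lbrakk>X \<in> Ob C; Y \<in> Ob C; Z \<in> Ob C; f \<in> Hom C X Y; g \<in> Hom C Y Z\<rbrakk> \<Longrightarrow> Comp C X Y Z g f \<in> Hom C X Z"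
    and il: "\<And>X Y f. \<lbrakk>X \<in> Ob C; Y \<in> Ob C; f \<in> Hom C X Y\<rbrakk> \<Longrightarrow> Comp C X Y Y (Id C Y) f = f"
    and as: "\<And>W X Y Z f g h. \<lbrakk>W \<in> Ob C; X \<in> Ob C; Y \<in> Ob C; Z \<in> Ob C; f \<in> Hom C W X; g \<in> Hom C X Y; h \<in> Hom C Y Z\<rbrakk> \<Longrightarrow>
      Comp C W X Z (Comp C X Y Z h g) f = Comp C W Y Z h (Comp C W X Y g f)"
    using C unfolding is_category_def by blast+
  obtain f' where f': "f \<in> Hom C X Y" "f' \<in> Hom C Y X" "Comp C X Y X f' f = Id C X" "Comp C Y X Y f f' = Id C Y"
    using f by (auto simp: is_iso_def)
  obtain g' where g': "g \<in> Hom C Y Z" "g' \<in> Hom C Z Y" "Comp C Y Z Y g' g = Id C Y" "Comp C Z Y Z g g' = Id C Z"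
    using g by (auto simp: is_iso_def)
  let ?h = "Comp C X Y Z g f" and ?h' = "Comp C Z Y X f' g'"
  have h: "?h \<in> Hom C X Z" "?h' \<in> Hom C Z X" using cl o f' g' by blast+
  have "Comp C X Z X ?h' ?h = Comp C X Y X f' (Comp C X Z Y g' ?h)" using as o f' g' h by blast
  also have "Comp C X Z Y g' ?h = Comp C X Y Y (Comp C Y Z Y g' g) f" using as[of X Y Z Y f g g'] o f' g' by simp
  also have "\<dots> = f" using g' il o f' by simp
  finally have 1: "Comp C X Z X ?h' ?h = Id C X" using f' by simp
  have "Comp C Z X Z ?h ?h' = Comp C Z Y Z g (Comp C Z X Y f ?h')" using as o f' g' h by blast
  also have "Comp C Z X Y f ?h' = Comp C Z Y Y (Comp C Y X Y f f') g'" using as[of Z Y X Y g' f' f] o f' g' by simp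
  also have "\<dots> = g'" using f' il o g' by simp
  finally have 2: "Comp C Z X Z ?h ?h' = Id C Z" using g' by simp
  show ?thesis unfolding is_iso_def using h 1 2 by blast
qed

lemma core_groupoid:
  assumes "is_category C" shows "is_groupoid (core C)"
proof -
  have id: "is_iso C X X (Id C X)" if "X \<in> Ob C" for X
    using assms that unfolding is_iso_def is_category_def by blast
  have hom: "f \<in> Hom C X Y" if "is_iso C X Y f" for X Y f using that by (simp add: is_iso_def)
  have il: "\<And>X Y f. \<lbrakk>X \<in> Ob C; Y \<in> Ob C; f \<in> Hom C X Y\<rbrakk> \<Longrightarrow> Comp C X X Y f (Id C X) = f \<and> Comp C X Y Y (Id C Y) f = f"
    and as: "\<And>W X Y Z f g h. \<lbrakk>W \<in> Ob C; X \<in> Ob C; Y \<in> Ob C; Z \<in> Ob C; f \<in> Hom C W X; g \<in> Hom C X Y; h \<in> Hom C Y Z\<rbrakk> \<Longrightarrow>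
      Comp C W X Z (Comp C X Y Z h g) f = Comp C W Y Z h (Comp C W X Y g f)"
    using assms unfolding is_category_def by blast+
  have cat: "is_category (core C)"
    unfolding is_category_def core_simps by (intro conjI ballI impI) (simp_all add: id iso_comp[OF assms] hom il as)
  have "is_iso (core C) X Y f" if f: "is_iso C X Y f" for X Y f
  proof -
    obtain g where "f \<in> Hom C X Y" "g \<in> Hom C Y X" "Comp C X Y X g f = Id C X" "Comp C Y X Y f g = Id C Y"
      using f by (auto simp: is_iso_def)
    moreover from this have "is_iso C Y X g" by (auto simp: is_iso_def)
    ultimately show ?thesis using f unfolding is_iso_def[of "core C"] core_simps by blast
  qed
  thus ?thesis using cat by (simp add: is_groupoid_def core_simps)
qed

lemma mop_cells:
  assumes "is_mop C"
  shows "x \<in> cells C \<Longrightarrow> delta C x \<subseteq> cells C \<and> gamma C x \<subseteq> cells C"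
    and "(y, y') \<in> lord C x z \<Longrightarrow> x \<in> cells C \<and> y \<in> cells C \<and> y' \<in> cells C \<and> z \<in> cells C"
proof -
  have bt: "x \<in> cells C \<Longrightarrow> dim C x \<ge> -1" "x \<in> cells C \<Longrightarrow> dim C x = -1 \<Longrightarrow> delta C x = {} \<and> gamma C x = {}"
    "x \<in> cells C \<Longrightarrow> dim C x \<ge> 0 \<Longrightarrow> delta C x \<subseteq> cells_dim C (dim C x - 1) \<and> gamma C x \<subseteq> cells_dim C (dim C x - 1)" for x
    using assms by (simp_all add: is_mop_def)
  show m: "delta C x \<subseteq> cells C \<and> gamma C x \<subseteq> cells C" if x: "x \<in> cells C" for x using bt(3) x cells_dim_def bt(1) bt(2) by fastforce
  assume l: "(y, y') \<in> lord C x z"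
  hence "x \<in> Lam C" "y \<in> local_loops C x z" "y' \<in> local_loops C x z" using mop_lord(1)[OF assms] by blast+
  thus "x \<in> cells C \<and> y \<in> cells C \<and> y' \<in> cells C \<and> z \<in> cells C"
    using m by (auto simp: local_loops_def face_def)
qed

text \<open>Isomorphism in terms of signed faces, with equivalences instead of implications, so that
  inverses are immediate. \<open>mop_iso_is_iso\<close> and \<open>is_iso_mop_iso\<close> translate
  to and from isomorphisms of the category.\<close>

definition mop_iso :: "'a mop \<Rightarrow> 'a mop \<Rightarrow> ('a \<Rightarrow> 'a) \<Rightarrow> bool" where
  "mop_iso C D f \<longleftrightarrow> bij_betw f (cells C) (cells D) \<and> (\<forall>x\<in>cells C. dim D (f x) = dim C x) \<and>
     (\<forall>x\<in>cells C. \<forall>y\<in>cells C. \<forall>s. face D s (f y) (f x) \<longleftrightarrow> face C s y x) \<and>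
     (\<forall>x\<in>cells C. \<forall>z\<in>cells C. \<forall>y\<in>cells C. \<forall>y'\<in>cells C. (f y, f y') \<in> lord D (f x) (f z) \<longleftrightarrow> (y, y') \<in> lord C x z)"

lemma mop_iso_sym:
  assumes "mop_iso C D f" shows "mop_iso D C (inv_into (cells C) f)"
proof -
  note f = assms[unfolded mop_iso_def]
  let ?g = "inv_into (cells C) f"
  have g: "bij_betw ?g (cells D) (cells C)" using f bij_betw_inv_into by blast
  have r: "f (?g x) = x" "?g x \<in> cells C" if "x \<in> cells D" for x
    using f that bij_betw_inv_into_right bij_betwE[OF g] by metis+
  show ?thesis unfolding mop_iso_def
  proof (intro conjI ballI allI)
    show "bij_betw ?g (cells D) (cells C)" by (rule g)
    fix x assume x: "x \<in> cells D"
    show "dim C (?g x) = dim D x" using f r[OF x] by metis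
    fix y assume y: "y \<in> cells D"
    show "face C s (?g y) (?g x) \<longleftrightarrow> face D s y x" for s using f r[OF x] r[OF y] by metis
    fix z z' assume z: "z \<in> cells D" "z' \<in> cells D"
    show "(?g z, ?g z') \<in> lord C (?g x) (?g y) \<longleftrightarrow> (z, z') \<in> lord D x y"
      using f r[OF x] r[OF y] r[OF z(1)] r[OF z(2)] by metis
  qed
qed

lemma mop_iso_comp:
  assumes f: "mop_iso C D f" and g: "mop_iso D E g" shows "mop_iso C E (\<lambda>x. g (f x))"
proof -
  have m: "x \<in> cells C \<Longrightarrow> f x \<in> cells D" for x using f by (auto simp: mop_iso_def bij_betw_def)
  have "bij_betw (\<lambda>x. g (f x)) (cells C) (cells E)"
    using bij_betw_trans[of f "cells C" "cells D" g "cells E"] f g by (simp add: mop_iso_def comp_def)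
  thus ?thesis using f g m by (simp add: mop_iso_def)
qed

lemma mop_iso_cong:
  assumes "\<And>x. x \<in> cells C \<Longrightarrow> f x = g x" shows "mop_iso C D f \<longleftrightarrow> mop_iso C D g"
  unfolding mop_iso_def using assms bij_betw_cong[of "cells C" f g] by simp

lemma mop_iso_hom:
  assumes C: "is_mop C" and D: "is_mop D" and f: "mop_iso C D f"
  shows "restrict f (cells C) \<in> mop_hom C D"
proof -
  note f' = f[unfolded mop_iso_def]
  have im: "f ` cells C = cells D" "inj_on f (cells C)" using f' by (auto simp: bij_betw_def)
  have del: "y \<in> delta A x \<longleftrightarrow> face A (-1) y x \<or> face A 0 y x"
    "y \<in> gamma A x \<longleftrightarrow> face A 1 y x \<or> face A 0 y x" if "x \<in> cells A" for A :: "'a mop" and x y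
    using that by (auto simp: face_def)
  have img: "f ` delta C x = delta D (f x)" "f ` gamma C x = gamma D (f x)" if x: "x \<in> cells C" for x
  proof -
    have fx: "f x \<in> cells D" using x im by blast
    have c: "delta C x \<subseteq> cells C" "gamma C x \<subseteq> cells C" "delta D (f x) \<subseteq> cells D" "gamma D (f x) \<subseteq> cells D"
      using mop_cells(1)[OF C x] mop_cells(1)[OF D fx] by auto
    have d: "f y \<in> delta D (f x) \<longleftrightarrow> y \<in> delta C x" "f y \<in> gamma D (f x) \<longleftrightarrow> y \<in> gamma C x" if "y \<in> cells C" for y
      unfolding del[OF x] del[OF fx] using f' x that by blast+
    have sub: "\<And>y. y \<in> cells D \<Longrightarrow> \<exists>z\<in>cells C. y = f z" using im by blast
    show "f ` delta C x = delta D (f x)" using c d sub by blast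
    show "f ` gamma C x = gamma D (f x)" using c d sub by blast
  qed
  have bij: "bij_betw (restrict f (cells C)) (delta C x) (delta D (f x))"
    "restrict f (cells C) ` gamma C x = gamma D (f x)" if x: "x \<in> cells C" for x
  proof -
    have c: "delta C x \<subseteq> cells C" "gamma C x \<subseteq> cells C" using mop_cells(1)[OF C x] by auto
    have r: "restrict f (cells C) ` delta C x = f ` delta C x" "restrict f (cells C) ` gamma C x = f ` gamma C x"
      using c by auto
    have "inj_on (restrict f (cells C)) (delta C x)"
      using inj_on_subset[OF im(2) c(1)] c(1) by (simp add: inj_on_def subset_iff)
    thus "bij_betw (restrict f (cells C)) (delta C x) (delta D (f x))"
      "restrict f (cells C) ` gamma C x = gamma D (f x)" using r img[OF x] by (simp_all add: bij_betw_def)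
  qed
  have "(restrict f (cells C) y, restrict f (cells C) y') \<in> lord D (restrict f (cells C) x) (restrict f (cells C) z)"
    if "(y, y') \<in> lord C x z" for x y y' z
    using mop_cells(2)[OF C that] f' that by simp
  thus ?thesis unfolding mop_hom_def using bij f' im by auto
qed

lemma DFC_simps:
  "Ob DFC = {C. is_dfc C}" "Hom DFC = mop_hom" "Id DFC C = restrict (\<lambda>x. x) (cells C)"
  "Comp DFC C D E g f = compose (cells C) g f"
  by (auto simp: DFC_def full_subcategory_def MOP_def is_dfc_def)

lemma mop_iso_is_iso:
  assumes C: "is_dfc C" and D: "is_dfc D" and f: "mop_iso C D f"
  shows "is_iso DFC C D (restrict f (cells C))"
proof -
  have m: "is_mop C" "is_mop D" using C D by (simp_all add: is_dfc_def)
  let ?g = "restrict (inv_into (cells C) f) (cells D)"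
  have b: "bij_betw f (cells C) (cells D)" using f by (simp add: mop_iso_def)
  have "restrict f (cells C) \<in> mop_hom C D" "?g \<in> mop_hom D C"
    using mop_iso_hom[OF m f] mop_iso_hom[OF m(2,1) mop_iso_sym[OF f]] by blast+
  moreover have "compose (cells C) ?g (restrict f (cells C)) = restrict (\<lambda>x. x) (cells C)"
    using b by (auto simp: compose_def fun_eq_iff bij_betw_def)
  moreover have "compose (cells D) (restrict f (cells C)) ?g = restrict (\<lambda>x. x) (cells D)"
    using bij_betw_inv_into_right[OF b] bij_betwE[OF bij_betw_inv_into[OF b]] by (auto simp: compose_def)
  ultimately show ?thesis unfolding is_iso_def DFC_simps by blast
qed

text \<open>Signs are defined by differences and intersections of sets of faces; injectivity keeps a
  source that is not the target from being sent to the target.\<close>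

lemma mop_hom_face:
  assumes C: "is_mop C" and f: "f \<in> mop_hom C D" and inj: "inj_on f (cells C)" and a: "face C s y x"
  shows "face D s (f y) (f x)"
proof -
  have x: "x \<in> cells C" and y: "y \<in> cells C" using a mop_cells(1)[OF C] by (auto simp: face_def)
  have fx: "f x \<in> cells D" using f x by (auto simp: mop_hom_def)
  have d: "dim C x \<ge> 0"
  proof (rule ccontr)
    assume "\<not> ?thesis"
    hence "dim C x = -1" using C x unfolding is_mop_def by fastforce
    hence "delta C x = {} \<and> gamma C x = {}" using C x unfolding is_mop_def by blast
    thus False using a by (auto simp: face_def)
  qed
  have im: "f ` delta C x = delta D (f x)" "f ` gamma C x = gamma D (f x)"
    using f x d by (auto simp: mop_hom_def bij_betw_def)
  have c: "delta C x \<subseteq> cells C" "gamma C x \<subseteq> cells C" using mop_cells(1)[OF C x] by auto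
  have "f y \<in> f ` delta C x \<longleftrightarrow> y \<in> delta C x" "f y \<in> f ` gamma C x \<longleftrightarrow> y \<in> gamma C x"
    using inj_on_image_mem_iff[OF inj y c(1)] inj_on_image_mem_iff[OF inj y c(2)] by auto
  thus ?thesis using a fx unfolding face_def im by auto
qed

lemma is_iso_mop_iso:
  assumes C: "is_dfc C" and D: "is_dfc D" and f: "is_iso DFC C D f"
  shows "mop_iso C D f" "f \<in> extensional (cells C)"
proof -
  have m: "is_mop C" "is_mop D" using C D by (simp_all add: is_dfc_def)
  obtain g where f: "f \<in> mop_hom C D" and g: "g \<in> mop_hom D C"
    and gf: "compose (cells C) g f = restrict (\<lambda>x. x) (cells C)"
    and fg: "compose (cells D) f g = restrict (\<lambda>x. x) (cells D)"
    using f unfolding is_iso_def DFC_simps by blast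
  have fm: "f x \<in> cells D" if "x \<in> cells C" for x using f that by (auto simp: mop_hom_def)
  have gm: "g x \<in> cells C" if "x \<in> cells D" for x using g that by (auto simp: mop_hom_def)
  have gf': "g (f x) = x" if "x \<in> cells C" for x using fun_cong[OF gf, of x] that by (simp add: compose_def)
  have fg': "f (g x) = x" if "x \<in> cells D" for x using fun_cong[OF fg, of x] that by (simp add: compose_def)
  show "f \<in> extensional (cells C)" using f by (auto simp: mop_hom_def PiE_def)
  have b: "bij_betw f (cells C) (cells D)" by (rule bij_betw_byWitness[where f' = g]) (use fm gm gf' fg' in auto)
  have bg: "bij_betw g (cells D) (cells C)" by (rule bij_betw_byWitness[where f' = f]) (use fm gm gf' fg' in auto)
  have fi: "face D s (f y) (f x)" if "face C s y x" for s x y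
    using mop_hom_face[OF m(1) f _ that] b by (simp add: bij_betw_def)
  have gi: "face C s (g y) (g x)" if "face D s y x" for s x y
    using mop_hom_face[OF m(2) g _ that] bg by (simp add: bij_betw_def)
  have lf: "(f y, f y') \<in> lord D (f x) (f z)" if "(y, y') \<in> lord C x z" for x y y' z
    using f that by (auto simp: mop_hom_def)
  have lg: "(g y, g y') \<in> lord C (g x) (g z)" if "(y, y') \<in> lord D x z" for x y y' z
    using g that by (auto simp: mop_hom_def)
  show "mop_iso C D f" unfolding mop_iso_def
  proof (intro conjI ballI allI)
    show "bij_betw f (cells C) (cells D)" by (rule b)
    fix x assume x: "x \<in> cells C"
    show "dim D (f x) = dim C x" using f x by (auto simp: mop_hom_def)
    fix y assume y: "y \<in> cells C"
    show "face D s (f y) (f x) \<longleftrightarrow> face C s y x" for s using fi gi[of s "f y" "f x"] gf'[OF x] gf'[OF y] by auto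
    fix z z' assume z: "z \<in> cells C" "z' \<in> cells C"
    show "(f z, f z') \<in> lord D (f x) (f y) \<longleftrightarrow> (z, z') \<in> lord C x y"
      using lf[of z z' x y] lg[of "f z" "f z'" "f x" "f y"] gf'[OF x] gf'[OF y] gf'[OF z(1)] gf'[OF z(2)] by auto
  qed
qed

lemma DFC_category: "is_category DFC"
proof -
  have id: "restrict (\<lambda>x. x) (cells C) \<in> mop_hom C C" if "is_dfc C" for C :: "'a mop"
    using mop_iso_hom[of C C "\<lambda>x. x"] that by (simp add: is_dfc_def mop_iso_def bij_betw_def)
  have comp: "compose (cells C) g f \<in> mop_hom C E" if C: "is_dfc C" "is_dfc D" and f: "f \<in> mop_hom C D"
    and g: "g \<in> mop_hom D E" for C D E :: "'a mop" and f g
  proof -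
    have m: "is_mop C" using C by (simp add: is_dfc_def)
    have fm: "f x \<in> cells D" if "x \<in> cells C" for x using f that by (auto simp: mop_hom_def)
    have gm: "g x \<in> cells E" if "x \<in> cells D" for x using g that by (auto simp: mop_hom_def)
    let ?h = "compose (cells C) g f"
    have 0: "?h \<in> cells C \<rightarrow>\<^sub>E cells E" using fm gm by (auto simp: compose_def)
    have 1: "dim E (?h x) = dim C x" if "x \<in> cells C" for x
      using f g that fm by (auto simp: mop_hom_def compose_def)
    have 2: "bij_betw ?h (delta C x) (delta E (?h x))" "?h ` gamma C x = gamma E (?h x)" if x: "x \<in> cells C" "dim C x \<ge> 0" for x
    proof -
      have c: "delta C x \<subseteq> cells C" "gamma C x \<subseteq> cells C" using mop_cells(1)[OF m x(1)] by auto
      have fx: "f x \<in> cells D" "dim D (f x) \<ge> 0" "?h x = g (f x)" using f x by (auto simp: mop_hom_def compose_def)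
      have F: "bij_betw f (delta C x) (delta D (f x))" "f ` gamma C x = gamma D (f x)" using f x by (auto simp: mop_hom_def)
      have G: "bij_betw g (delta D (f x)) (delta E (g (f x)))" "g ` gamma D (f x) = gamma E (g (f x))"
        using g fx by (auto simp: mop_hom_def)
      have "bij_betw (g \<circ> f) (delta C x) (delta E (g (f x)))" using bij_betw_trans[OF F(1) G(1)] .
      moreover have "bij_betw ?h (delta C x) A \<longleftrightarrow> bij_betw (g \<circ> f) (delta C x) A" for A
        by (rule bij_betw_cong) (use c in \<open>auto simp: compose_def\<close>)
      ultimately show "bij_betw ?h (delta C x) (delta E (?h x))" using fx by simp
      have "?h ` gamma C x = g ` (f ` gamma C x)" using c by (auto simp: compose_def)
      thus "?h ` gamma C x = gamma E (?h x)" using F G fx by simp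
    qed
    have 3: "(?h y, ?h y') \<in> lord E (?h x) (?h z)" if l: "(y, y') \<in> lord C x z" for x y y' z
    proof -
      have "(f y, f y') \<in> lord D (f x) (f z)" using f l by (auto simp: mop_hom_def)
      hence "(g (f y), g (f y')) \<in> lord E (g (f x)) (g (f z))" using g by (auto simp: mop_hom_def)
      thus ?thesis using mop_cells(2)[OF m l] by (simp add: compose_def)
    qed
    show ?thesis unfolding mop_hom_def using 0 1 2 3 by blast
  qed
  have ext: "f x \<in> cells D" "f \<in> extensional (cells C)" if "f \<in> mop_hom C D" "x \<in> cells C" for C D :: "'a mop" and f x
    using that by (auto simp: mop_hom_def PiE_def)
  show ?thesis unfolding is_category_def DFC_simps mem_Collect_eq
  proof (intro conjI ballI)
    fix C D :: "'a mop" and f assume f: "f \<in> mop_hom C D"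
    hence e: "f \<in> cells C \<rightarrow>\<^sub>E cells D" by (auto simp: mop_hom_def)
    show "compose (cells C) f (restrict (\<lambda>x. x) (cells C)) = f" "compose (cells C) (restrict (\<lambda>x. x) (cells D)) f = f"
      using e by (auto simp: compose_def fun_eq_iff PiE_def extensional_def)
  next
    fix B C D E :: "'a mop" and f g h assume "f \<in> mop_hom B C"
    thus "compose (cells B) (compose (cells C) h g) f = compose (cells B) h (compose (cells B) g f)"
      using ext(1) by (auto simp: compose_def)
  qed (use id comp in auto)
qed

lemma DFC_core_groupoid: "is_groupoid DFC_core"
  unfolding DFC_core_def by (rule core_groupoid[OF DFC_category])

section \<open>The functor from opetopes\<close>

text \<open>A cell of dimension \<open>k\<close> is an edge in degree \<open>k + 2\<close>; for the
  bottom cell this is degree 1, where it is the root edge.\<close>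

fun cell_map :: "'a elem opetope_map \<Rightarrow> 'a elem \<Rightarrow> 'a elem" where
  "cell_map f (Cell k x) = Cell k (medge f (nat (k + 2)) x)"
| "cell_map f (Atom x) = Atom x"

text \<open>Faces and local orders come from the sets of dots above edges and from the subdivision
  orders, and \<open>constellation_iso\<close> shows degree by degree that these are
  preserved.\<close>

lemma op_mop_iso:
  assumes X: "extended X" "extended X'" and f: "level_iso X X' f"
  shows "mop_iso (op_mop X) (op_mop X') (cell_map f)"
proof -
  interpret A: extended X by (rule X(1))
  interpret B: extended X' by (rule X(2))
  have d: "odim X' = odim X" using f by (simp add: level_iso_def)
  have ti: "tree_iso (A.tr k) (B.tr k) (mnode f k) (medge f k)" if "k \<le> odim X" for k
    using f that by (simp add: level_iso_def)
  have rt: "medge f 1 (root (A.tr 1)) = root (B.tr 1)" using ti[of 1] A.two by (simp add: tree_iso_def)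
  have eb: "bij_betw (medge f k) (edges (A.tr k)) (edges (B.tr k))" if "k \<le> odim X" for k
    using ti[OF that] by (simp add: tree_iso_def)
  have cm: "cell_map f (Cell (int k) x) = Cell (int k) (medge f (k + 2) x)" for k x by (simp add: nat_add_distrib)
  have cm1: "cell_map f (Cell (int k - 1) x) = Cell (int k - 1) (medge f (Suc k) x)" for k x
  proof -
    have "nat (int k - 1 + 2) = Suc k" by simp
    thus ?thesis by simp
  qed
  have mem: "cell_map f P \<in> op_cells X'" if "P \<in> op_cells X" for P
    using that
  proof (cases rule: A.cellE)
    case 1
    thus ?thesis using rt by (simp add: op_cells_def)
  next
    case (2 k x)
    have "medge f (k + 2) x \<in> edges (B.tr (k + 2))" using bij_betwE[OF eb[OF 2(2)]] 2(3) by blast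
    thus ?thesis unfolding 2(1) cm B.cell_iff using 2(2) d by simp
  qed
  have inj: "P = Q" if "P \<in> op_cells X" "Q \<in> op_cells X" "cell_map f P = cell_map f Q" for P Q
    using that(1)
  proof (cases rule: A.cellE)
    case 1
    from that(2) have "Q = Cell (-1) (root (A.tr 1))"
    proof (cases rule: A.cellE)
      case (2 j y)
      thus ?thesis using that(3) 1 by simp
    qed
    thus ?thesis using 1 by simp
  next
    case (2 k x)
    from that(2) show ?thesis
    proof (cases rule: A.cellE)
      case 1 thus ?thesis using 2 that(3) by simp
    next
      case (2 j y)
      have "Cell (int k) (medge f (k + 2) x) = Cell (int j) (medge f (j + 2) y)"
        using that(3) unfolding \<open>P = _\<close> 2(1) cm .
      hence jk: "j = k" and m: "medge f (k + 2) x = medge f (k + 2) y" by auto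
      have "x = y" using bij_betw_imp_inj_on[OF eb[OF \<open>k + 2 \<le> odim X\<close>]] m \<open>x \<in> _\<close> 2(3) unfolding jk by (rule inj_onD)
      thus ?thesis unfolding \<open>P = _\<close> 2(1) jk by simp
    qed
  qed
  have onto: "\<exists>P\<in>op_cells X. cell_map f P = Q" if "Q \<in> op_cells X'" for Q
    using that
  proof (cases rule: B.cellE)
    case 1
    thus ?thesis using rt by (intro bexI[of _ "Cell (-1) (root (A.tr 1))"]) (simp_all add: op_cells_def)
  next
    case (2 k y)
    then obtain x where "x \<in> edges (A.tr (k + 2))" "y = medge f (k + 2) x"
      using eb[of "k + 2"] d by (auto simp: bij_betw_def)
    thus ?thesis using 2 d cm A.cell_iff[of k x] by (intro bexI[of _ "Cell (int k) x"]) auto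
  qed
  have bij: "bij_betw (cell_map f) (op_cells X) (op_cells X')"
    unfolding bij_betw_def inj_on_def using inj mem onto by blast
  have con: "constellation_iso (A.tr k) (A.sb k) (A.tr (Suc k)) (B.tr k) (B.sb k) (B.tr (Suc k))
    (mnode f k) (medge f k) (mwhite f k) (mnode f (Suc k)) (medge f (Suc k))" if "k < odim X" for k
    using level_iso_constellation[OF A.opetope B.opetope f that] .
  have faces: "face B.M s (cell_map f P) (cell_map f Q) \<longleftrightarrow> face A.M s P Q"
    if P: "P \<in> op_cells X" and Q: "Q \<in> op_cells X" for P Q s
    using Q
  proof (cases rule: A.cellE)
    case 1
    thus ?thesis using A.no_face_bottom B.no_face_bottom by simp
  next
    case (2 k x)
    have x': "k + 2 \<le> odim X'" "medge f (k + 2) x \<in> edges (B.tr (k + 2))"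
      using bij_betwE[OF eb[OF 2(2)]] 2 d by auto
    interpret I: constellation_iso "A.tr (Suc k)" "A.sb (Suc k)" "A.tr (Suc (Suc k))" "B.tr (Suc k)" "B.sb (Suc k)"
      "B.tr (Suc (Suc k))" "mnode f (Suc k)" "medge f (Suc k)" "mwhite f (Suc k)" "mnode f (Suc (Suc k))" "medge f (Suc (Suc k))"
      using con[of "Suc k"] 2 by simp
    show ?thesis
    proof (cases "\<exists>z. P = Cell (int k - 1) z")
      case True
      then obtain z where z: "P = Cell (int k - 1) z" by blast
      have z0: "k = 0 \<Longrightarrow> z = root (A.tr 1)" using P z by (auto simp: op_cells_def)
      have zE: "z \<in> edges (A.tr (Suc k))"
      proof (cases k)
        case 0
        thus ?thesis using z0 A.two tree.root_mem[OF A.tree_level[of 1]] by simp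
      next
        case (Suc j)
        hence "Cell (int j) z \<in> op_cells X" using P z by simp
        thus ?thesis unfolding A.cell_iff using Suc by simp
      qed
      have i: "I.D.inc s (medge f (Suc k) z) (medge f (Suc (Suc k)) x) \<longleftrightarrow> I.C.inc s z x"
        using I.inc_iff[OF zE] 2 by simp
      have r0: "k = 0 \<Longrightarrow> medge f (Suc k) z = root (B.tr 1)" using z0 rt by simp
      show ?thesis unfolding 2(1) z cm cm1 B.face_iff[OF x'] A.face_iff[OF 2(2,3)]
        using i z0 r0 by auto
    next
      case False
      have "\<not> (\<exists>z. cell_map f P = Cell (int k - 1) z)"
        using False by (cases P) auto
      thus ?thesis unfolding 2(1) cm B.face_iff[OF x'] A.face_iff[OF 2(2,3)] using False by blast
    qed
  qed
  have lords: "(cell_map f Y, cell_map f Y') \<in> op_lord X' (cell_map f P) (cell_map f Q) \<longleftrightarrow> (Y, Y') \<in> op_lord X P Q"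
    if c: "P \<in> op_cells X" "Q \<in> op_cells X" "Y \<in> op_cells X" "Y' \<in> op_cells X" for P Q Y Y'
  proof -
    have lam: "cell_map f P \<in> Lam B.M \<longleftrightarrow> P \<in> Lam A.M"
      by (rule Lam_transfer) (simp_all add: bij c(1) faces)
    show ?thesis
    proof (cases "P \<in> Lam A.M")
      case False
      thus ?thesis using lam by (auto simp: op_lord_def op_faces_Lam)
    next
      case True
      obtain k x where k: "P = Cell (int k) x" "k + 2 \<le> odim X" "x \<in> leaves (A.tr (k + 2))"
        using A.Lam_cell[OF True] by blast
      obtain k' x' where k': "cell_map f P = Cell (int k') x'" "k' + 2 \<le> odim X'" "x' \<in> leaves (B.tr (k' + 2))"
        using B.Lam_cell[of "cell_map f P"] True lam by blast
      have kk: "k' = k" "x' = medge f (k + 2) x" using k'(1) unfolding k(1) cm by auto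
      note k' = k'[unfolded kk]
      interpret I: constellation_iso "A.tr k" "A.sb k" "A.tr (Suc k)" "B.tr k" "B.sb k"
        "B.tr (Suc k)" "mnode f k" "medge f k" "mwhite f k" "mnode f (Suc k)" "medge f (Suc k)"
        using con[of k] k by simp
      have kl: "k < odim X" "k < odim X'" using k d by auto
      have loops: "cell_map f Z \<in> local_loops B.M (cell_map f P) (cell_map f Q) \<longleftrightarrow> Z \<in> local_loops A.M P Q"
        if "Z \<in> op_cells X" for Z using faces that c by (auto simp: local_loops_def)
      show ?thesis
      proof (cases "Y \<in> local_loops A.M P Q \<and> Y' \<in> local_loops A.M P Q")
        case False
        hence "\<not> (cell_map f Y \<in> local_loops B.M (cell_map f P) (cell_map f Q) \<and>
          cell_map f Y' \<in> local_loops B.M (cell_map f P) (cell_map f Q))" using loops c by blast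
        thus ?thesis using False unfolding op_lord_def op_faces_loops by auto
      next
        case True
        then obtain y y' z where y: "Y = Cell (int k - 1) y" "Y' = Cell (int k - 1) y'" "Q = Cell (int k - 2) z" "2 \<le> k"
          "I.C.inc 0 z y" "I.C.inc 0 z y'" unfolding k(1) A.loops_iff[OF k(2,3)] by auto
        obtain j where j: "k = Suc (Suc j)" using y(4) by (metis Suc_le_D numeral_2_eq_2 Suc_le_mono)
        have zE: "z \<in> edges (A.tr k)" "y \<in> edges (A.tr (Suc k))" "y' \<in> edges (A.tr (Suc k))"
          using I.C.inc_mem y by blast+
        have mp: "cell_map f Y = Cell (int k - 1) (medge f (Suc k) y)" "cell_map f Y' = Cell (int k - 1) (medge f (Suc k) y')"
          "cell_map f Q = Cell (int k - 2) (medge f k z)" unfolding y cm1 using cm[of j z] by simp_all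
        have ne: "medge f (Suc k) y \<noteq> medge f (Suc k) y' \<longleftrightarrow> y \<noteq> y'"
          using I.ge_bij zE by (auto simp: bij_betw_def dest: inj_onD)
        have l': "cell_map f Y \<in> local_loops B.M (cell_map f P) (cell_map f Q)"
          "cell_map f Y' \<in> local_loops B.M (cell_map f P) (cell_map f Q)" using loops c True by blast+
        have 1: "(Y, Y') \<in> op_lord X P Q \<longleftrightarrow> y \<noteq> y' \<and> (\<forall>w w'. Inr w \<in> I.C.above y \<and> Inr w' \<in> I.C.above y' \<longrightarrow> (w, w') \<in> wless (A.sb k) z)"
          using A.lord_iff[OF k(2,3), of Y Y' Q] True k(1) y(1-3) A.op_dots_above[OF kl(1)] by auto
        have 2: "(cell_map f Y, cell_map f Y') \<in> op_lord X' (cell_map f P) (cell_map f Q) \<longleftrightarrow>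
          medge f (Suc k) y \<noteq> medge f (Suc k) y' \<and> (\<forall>w w'. Inr w \<in> I.D.above (medge f (Suc k) y) \<and> Inr w' \<in> I.D.above (medge f (Suc k) y') \<longrightarrow>
            (w, w') \<in> wless (B.sb k) (medge f k z))"
          using B.lord_iff[OF k'(2,3), of "cell_map f Y" "cell_map f Y'" "cell_map f Q"] l' k'(1) mp B.op_dots_above[OF kl(2)] by auto
        show ?thesis unfolding 1 2 ne I.wless_iff[OF y(5,6)] ..
      qed
    qed
  qed
  have dims: "P_dim (cell_map f P) = P_dim P" for P by (cases P) auto
  show ?thesis unfolding mop_iso_def op_mop_simps using bij dims faces lords by blast
qed

definition ext_op :: "'a opetope \<Rightarrow> 'a opetope" where
  "ext_op Y = \<lparr>odim = odim Y + 2, otree = ext_tree Y, osub = ext_sub Y\<rparr>"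

lemma ext_op_simps [simp]: "odim (ext_op Y) = odim Y + 2" "otree (ext_op Y) = ext_tree Y" "osub (ext_op Y) = ext_sub Y"
  by (simp_all add: ext_op_def)

lemma P_ob_op_mop: "P_ob Y = op_mop (ext_op Y)"
proof -
  have d: "dots_above Y k x = op_dots (ext_op Y) k x" for k x
    by (simp add: dots_above_def op_dots_def)
  have s: "sub_tree Y k x = op_subtree (ext_op Y) k x" for k x
    by (simp add: sub_tree_def op_subtree_def d)
  have c: "P_cells Y = op_cells (ext_op Y)" by (simp add: P_cells_def op_cells_def)
  have g: "P_gamma Y = op_gamma (ext_op Y)"
  proof
    fix x show "P_gamma Y x = op_gamma (ext_op Y) x" by (cases x) (simp_all add: s)
  qed
  have e: "P_delta Y = op_delta (ext_op Y)"
  proof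
    fix x show "P_delta Y x = op_delta (ext_op Y) x" by (cases x) (simp_all add: s)
  qed
  have f: "P_faces Y = op_faces (ext_op Y)" by (simp add: P_faces_def op_faces_def c g e)
  have "P_lord Y = op_lord (ext_op Y)"
    by (intro ext) (simp add: P_lord_def op_lord_def f d)
  thus ?thesis by (simp add: P_ob_def op_mop_def f)
qed

text \<open>Guarantees that \<open>fresh\<close> can be chosen outside the finite set of
  nodes.\<close>

lemma elem_infinite: "infinite (UNIV :: 'a elem set)"
proof -
  let ?f = "\<lambda>n::nat. Cell (int n) (Atom undefined) :: 'a elem"
  have "inj ?f" by (rule injI) simp
  thus ?thesis by (metis finite_imageD infinite_UNIV_nat finite_subset subset_UNIV)
qed

lemma fresh_notin:
  fixes Y :: "'a elem opetope"
  assumes "is_opetope Y" shows "fresh Y \<notin> nodes (otree Y (odim Y))"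
proof -
  have "finite (nodes (otree Y (odim Y)))" using assms tree.finite_nodes by (auto simp: is_opetope_def tree_def)
  hence "\<exists>x. x \<notin> nodes (otree Y (odim Y))" using elem_infinite by (metis ex_new_if_finite)
  thus ?thesis unfolding fresh_def by (rule someI_ex)
qed

lemma ext_tree_simps:
  "k \<le> odim Y \<Longrightarrow> ext_tree Y k = otree Y k"
  "ext_tree Y (Suc (odim Y)) = corolla (fresh Y) (nodes (otree Y (odim Y))) (fresh Y)"
  "ext_tree Y (odim Y + 2) = unit_tree (fresh Y)" "ext_tree Y (Suc (Suc (odim Y))) = unit_tree (fresh Y)"
  by (simp_all add: ext_tree_def)

lemma unit_tree_simps [simp]:
  "nodes (unit_tree b) = {}" "edges (unit_tree b) = {b}" "root (unit_tree b) = b" "tsource (unit_tree b) = {}"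
    "ttarget (unit_tree b) = {}"
  by (simp_all add: unit_tree_def)

lemma rooted_unit_tree: "rooted_tree (unit_tree b)"
  by (auto simp: rooted_tree_def desc_def)

text \<open>The main new condition is the kernel rule between degrees n and n + 1, which asks that
  the whole subdivided tree of degree n be connected. Its bottom lies on the root edge, since any
  other edge has a lower node, and is therefore unique.\<close>

lemma ext_op_opetope:
  fixes Y :: "'a elem opetope"
  assumes Y: "is_opetope Y"
  shows "is_opetope (ext_op Y)"
proof -
  let ?n = "odim Y" and ?N = "nodes (otree Y (odim Y))"
  have rY: "rooted_tree (otree Y k)" if "k \<le> ?n" for k using Y that by (simp add: is_opetope_def)
  interpret T: tree "otree Y ?n" using rY by (simp add: tree_def)
  have fr: "fresh Y \<notin> ?N" by (rule fresh_notin[OF Y])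
  have rc: "rooted_tree (ext_tree Y (Suc ?n))" unfolding ext_tree_simps by (rule rooted_corolla[OF T.finite_nodes fr])
  have rooted: "rooted_tree (ext_tree Y k)" if "k \<le> ?n + 2" for k
  proof -
    have "k \<le> ?n \<or> k = Suc ?n \<or> k = ?n + 2" using that by arith
    then consider "k \<le> ?n" | "k = Suc ?n" | "k = ?n + 2" by blast
    thus ?thesis by (metis rY ext_tree_simps rc rooted_unit_tree)
  qed
  have con: "exact_constellation (ext_tree Y k) (ext_sub Y k) (ext_tree Y (Suc k))" if k: "k < ?n + 2" for k
  proof -
    consider "k < ?n" | "k = ?n" | "k = Suc ?n" using k by linarith
    thus ?thesis
    proof cases
      case 1
      hence "exact_constellation (otree Y k) (osub Y k) (otree Y (Suc k))" using Y by (simp add: is_opetope_def)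
      thus ?thesis using 1 by (simp add: ext_tree_simps ext_sub_def)
    next
      case 3
      have s: "ext_sub Y (Suc ?n) = empty_subdiv" by (simp add: ext_sub_def)
      show ?thesis unfolding 3 s ext_tree_simps
      proof (rule exact_single_node)
        show "rooted_tree (corolla (fresh Y) ?N (fresh Y))" using rc by (simp add: ext_tree_simps)
      qed (auto simp: rooted_unit_tree leaves_def null_dots_def)
    next
      case 2
      let ?W = "ext_sub Y ?n" and ?U = "corolla (fresh Y) ?N (fresh Y)"
      have ws: "wset ?W b = (if ?N = {} \<and> b = root (otree Y ?n) then {fresh Y} else {})" "wless ?W b = {}" for b
        by (simp_all add: ext_sub_def empty_subdiv_def)
      have sd: "is_subdivision (otree Y ?n) ?W"
        unfolding is_subdivision_def ws by (auto simp: strict_linear_order_on_def)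
      interpret S: stree "otree Y ?n" ?W using sd by unfold_locales
      have wd: "white_dots (otree Y ?n) ?W = (if ?N = {} then {fresh Y} else {})"
        using T.root_mem by (auto simp: white_dots_def ws)
      have carrier: "carried (otree Y ?n) ?W d (root (otree Y ?n))"
        if b: "bottom (otree Y ?n) ?W D d" and D: "dots (otree Y ?n) ?W \<subseteq> D" "D \<subseteq> dots (otree Y ?n) ?W" for d D
      proof (cases d)
        case (Inr w)
        hence "Inr w \<in> dots (otree Y ?n) ?W" using b D by (auto simp: bottom_def)
        hence "w \<in> wset ?W (root (otree Y ?n))" using wd ws by auto
        thus ?thesis using Inr T.root_mem by simp
      next
        case (Inl a)
        hence a: "a \<in> ?N" using b D by (auto simp: bottom_def)
        hence no: "wset ?W c = {}" for c by (auto simp: ws)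
        obtain c where c: "(c, a) \<in> ttarget (otree Y ?n)" using T.target_ex a by blast
        have "c = root (otree Y ?n)"
        proof (rule ccontr)
          assume "c \<noteq> root (otree Y ?n)"
          moreover have "desc (otree Y ?n) (Inr c) (Inr (root (otree Y ?n)))" using T.desc_root T.target_mem[OF c] by simp
          ultimately obtain z where "(Inr c, z) \<in> desc_step (otree Y ?n)" using T.desc_firstE by (metis sum.inject(2))
          then obtain l where l: "(c, l) \<in> tsource (otree Y ?n)" by (cases z) auto
          have s: "string_less (otree Y ?n) ?W c (Inl l) d" using l c Inl by simp
          obtain d1 where d1: "parent (otree Y ?n) ?W d d1" using S.parent_ex[OF _ s] T.target_mem[OF c] by blast
          then obtain c1 where "c1 \<in> edges (otree Y ?n)" "string_less (otree Y ?n) ?W c1 d1 d" unfolding S.parent_iff by blast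
          hence "d1 \<in> dots (otree Y ?n) ?W" using no T.source_mem by (cases d1) (auto simp: string_less_def)
          thus False using b d1 D by (auto simp: bottom_def)
        qed
        thus ?thesis using c Inl by simp
      qed
      have whole: "induces_connected (subdivide (otree Y ?n) ?W) (dots (otree Y ?n) ?W)"
      proof (rule S.connectedI)
        fix d d' assume b: "bottom (otree Y ?n) ?W (dots (otree Y ?n) ?W) d" "bottom (otree Y ?n) ?W (dots (otree Y ?n) ?W) d'"
        have "carried (otree Y ?n) ?W d (root (otree Y ?n))" "carried (otree Y ?n) ?W d' (root (otree Y ?n))" using carrier b by blast+
        moreover have "d \<in> dots (otree Y ?n) ?W" "d' \<in> dots (otree Y ?n) ?W" using b by (auto simp: bottom_def)
        ultimately show "d = d'" using wd by (cases d; cases d') (auto dest: T.upper_unique split: if_splits)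
      qed
      have all: "desc ?U (dot_vertex t) (Inl (fresh Y))" if "t \<in> dots (otree Y ?n) ?W" for t
      proof (cases t)
        case (Inl a)
        thus ?thesis using that by (intro desc_stepI) auto
      next
        case (Inr w)
        hence "w = fresh Y" using that wd by (auto split: if_splits)
        thus ?thesis using Inr desc_refl[of "Inl (fresh Y)" ?U] by simp
      qed
      have "{t \<in> dots (otree Y ?n) ?W. desc ?U (dot_vertex t) (Inl (fresh Y))} = dots (otree Y ?n) ?W" using all by blast
      hence "exact_constellation (otree Y ?n) ?W ?U"
        using rY[of ?n] rc sd whole wd
        by (simp add: exact_constellation_def is_constellation_def bij_betw_def ext_tree_simps leaves_corolla[OF fr] null_dots_corolla)
      thus ?thesis using 2 by (simp add: ext_tree_simps)
    qed
  qed
  have u: "unary_corolla (ext_tree Y 0)" using Y by (simp add: is_opetope_def ext_tree_simps)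
  have u1: "unary_corolla (ext_tree Y 1)"
  proof (cases "?n = 0")
    case True
    hence N: "is_singleton ?N" using Y by (simp add: is_opetope_def unary_corolla_def)
    have "ext_tree Y 1 = corolla (fresh Y) ?N (fresh Y)" using ext_tree_simps(2)[of Y] True by simp
    thus ?thesis using N by (simp add: unary_corolla_def leaves_corolla[OF fr])
  next
    case False
    thus ?thesis using Y by (simp add: is_opetope_def ext_tree_simps)
  qed
  \<comment> \<open>Degree 2 is an added tree in low dimensions: the unit tree in dimension 0, and
    in dimension 1 the corolla, which has one leaf because degree 1 has one node.\<close>
  have l2: "linear_tree (ext_tree Y 2)"
  proof -
    consider "?n = 0" | "?n = 1" | "?n \<ge> 2" by linarith
    thus ?thesis
    proof cases
      case 1
      hence "nodes (ext_tree Y 2) = {}" using ext_tree_simps(3)[of Y] by (simp add: numeral_2_eq_2)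
      thus ?thesis by (simp add: linear_tree_def)
    next
      case 2
      hence "is_singleton ?N" using u1 by (simp add: unary_corolla_def ext_tree_simps)
      then obtain p where p: "?N = {p}" by (auto simp: is_singleton_def)
      have "ext_tree Y 2 = corolla (fresh Y) ?N (fresh Y)" using ext_tree_simps(2)[of Y] 2 by (simp flip: numeral_2_eq_2)
      thus ?thesis using p by (simp add: linear_tree_def)
    next
      case 3
      thus ?thesis using Y by (simp add: is_opetope_def ext_tree_simps)
    qed
  qed
  show ?thesis unfolding is_opetope_def using rooted con u u1 l2 by simp
qed

lemma ext_op_extended:
  fixes Y :: "'a elem opetope"
  assumes "is_opetope Y" shows "extended (ext_op Y)"
  using ext_op_opetope[OF assms] by unfold_locales (simp_all add: ext_tree_simps)

lemma P_ob_dfc: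
  fixes Y :: "'a elem opetope"
  assumes "is_opetope Y" shows "is_dfc (P_ob Y)"
  using extended.op_mop_dfc[OF ext_op_extended[OF assms]] by (simp add: P_ob_op_mop)

section \<open>Extending isomorphisms over the two added trees\<close>

definition truncate :: "'a opetope \<Rightarrow> 'a opetope" where
  "truncate X = \<lparr>odim = odim X - 2, otree = otree X, osub = osub X\<rparr>"

lemma truncate_simps [simp]: "odim (truncate X) = odim X - 2" "otree (truncate X) = otree X" "osub (truncate X) = osub X"
  by (simp_all add: truncate_def)

text \<open>The forced extension: a leaf of the corolla goes where the corresponding node in degree
  n goes, and everything else has only one possible image. The node in degree n + 1 is the edge in
  degree n + 2, and a white dot in degree n is that node; hence the roots taken one and two degrees
  higher.\<close>

definition extend_map :: "'a opetope \<Rightarrow> 'a opetope \<Rightarrow> 'a opetope_map \<Rightarrow> 'a opetope_map" where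
  "extend_map X X' f =
     \<lparr>mnode = \<lambda>k x. if k \<le> odim X - 2 then mnode f k x else root (otree X' (Suc k)),
      medge = \<lambda>k x. if k \<le> odim X - 2 then medge f k x
        else if k = odim X - 1 \<and> x \<in> nodes (otree X (odim X - 2)) then mnode f (odim X - 2) x
        else root (otree X' k),
      mwhite = \<lambda>k x. if k < odim X - 2 then mwhite f k x else root (otree X' (Suc (Suc k)))\<rparr>"

context extended
begin

text \<open>Exactness read from the top: the only edge \<open>t\<close> of the last tree is a leaf,
  so it is the only node one degree below. That tree is a corolla on the nodes of
  \<open>tr m\<close>; its node is a null dot, and so a white dot of \<open>tr m\<close>, exactly if
  \<open>tr m\<close> has no nodes.\<close>

lemma top_level:
  assumes m: "odim X = Suc (Suc m)"
  defines "t \<equiv> root (tr (Suc (Suc m)))" and "r \<equiv> root (tr (Suc m))"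
  shows "nodes (tr (Suc m)) = {t}" "edges (tr (Suc m)) = insert r (nodes (tr m))" "r \<notin> nodes (tr m)"
    "ttarget (tr (Suc m)) = {(r, t)}" "tsource (tr (Suc m)) = nodes (tr m) \<times> {t}"
    "nodes (tr (Suc (Suc m))) = {}" "edges (tr (Suc (Suc m))) = {t}"
    "\<And>b. b \<in> edges (tr m) \<Longrightarrow> wset (sb m) b = (if nodes (tr m) = {} then {t} else {})"
    "\<And>b w w'. b \<in> edges (tr m) \<Longrightarrow> (w, w') \<notin> wless (sb m) b"
    "\<And>b. b \<in> edges (tr (Suc m)) \<Longrightarrow> wset (sb (Suc m)) b = {}"
    "white_dots (tr m) (sb m) \<subseteq> {t}" "white_dots (tr (Suc m)) (sb (Suc m)) = {}"
proof -
  interpret B: constellation "tr (Suc m)" "sb (Suc m)" "tr (Suc (Suc m))" using level m by simp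
  interpret A: constellation "tr m" "sb m" "tr (Suc m)" using level m by simp
  show n2: "nodes (tr (Suc (Suc m))) = {}" using unit m by simp
  thus e2: "edges (tr (Suc (Suc m))) = {t}" using B.U.no_nodes_edges by (simp add: t_def)
  have "leaves (tr (Suc (Suc m))) = {t}" using e2 n2 B.U.target_mem by (auto simp: leaves_def)
  thus n1: "nodes (tr (Suc m)) = {t}" using B.nodes_eq by simp
  note one = B.one_node[OF n1, folded r_def, folded A.nodes_eq]
  show "edges (tr (Suc m)) = insert r (nodes (tr m))" "r \<notin> nodes (tr m)" "ttarget (tr (Suc m)) = {(r, t)}"
    and S: "tsource (tr (Suc m)) = nodes (tr m) \<times> {t}" using one by simp_all
  have w: "white_dots (tr m) (sb m) = (if nodes (tr m) = {} then {t} else {})"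
    unfolding A.whites_eq null_dots_def n1 S by auto
  thus "white_dots (tr m) (sb m) \<subseteq> {t}" by simp
  show ws: "wset (sb m) b = (if nodes (tr m) = {} then {t} else {})" if b: "b \<in> edges (tr m)" for b
  proof (cases "nodes (tr m) = {}")
    case True
    hence "edges (tr m) = {root (tr m)}" by (rule A.no_nodes_edges)
    thus ?thesis using w b by (auto simp: white_dots_def)
  next
    case False
    thus ?thesis using w b by (auto simp: white_dots_def)
  qed
  show "(w, w') \<notin> wless (sb m) b" if b: "b \<in> edges (tr m)" for b w w'
    using A.wless_mem[OF b] A.wless_irrefl[OF b] ws[OF b] by (auto split: if_splits)
  show W: "white_dots (tr (Suc m)) (sb (Suc m)) = {}" using n2 B.whites_eq by (simp add: null_dots_def)
  thus "wset (sb (Suc m)) b = {}" if "b \<in> edges (tr (Suc m))" for b using that by (auto simp: white_dots_def)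
qed

end

lemma extend_map_iso:
  assumes X: "extended X" "extended X'" and d: "odim X = odim X'"
    and f: "level_iso (truncate X) (truncate X') f"
  shows "level_iso X X' (extend_map X X' f)"
proof -
  interpret A: extended X by (rule X)
  interpret B: extended X' by (rule X)
  obtain m where m: "odim X = Suc (Suc m)" using A.two by (metis add_2_eq_Suc le_Suc_ex)
  hence m': "odim X' = Suc (Suc m)" using d by simp
  note a = A.top_level[OF m] and b = B.top_level[OF m']
  let ?g = "extend_map X X' f"
  have f': "tree_iso (A.tr k) (B.tr k) (mnode f k) (medge f k)" if "k \<le> m" for k
    using f m that by (simp add: level_iso_def)
  have g: "mnode ?g k = mnode f k" "medge ?g k = medge f k" if "k \<le> m" for k
    using that m by (simp_all add: extend_map_def)
  have g': "mwhite ?g k = mwhite f k" if "k < m" for k using that m by (simp add: extend_map_def)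
  have gt: "mwhite ?g m w = root (B.tr (Suc (Suc m)))" "mnode ?g (Suc m) w = root (B.tr (Suc (Suc m)))" for w
    using m by (simp_all add: extend_map_def)
  have gt2: "medge ?g (Suc m) w = (if w \<in> nodes (A.tr m) then mnode f m w else root (B.tr (Suc m)))"
    "medge ?g (Suc (Suc m)) w = root (B.tr (Suc (Suc m)))" for w
    using m by (simp_all add: extend_map_def)
  have fn: "bij_betw (mnode f m) (nodes (A.tr m)) (nodes (B.tr m))" and fe: "bij_betw (medge f m) (edges (A.tr m)) (edges (B.tr m))"
    using f'[of m] by (simp_all add: tree_iso_def)
  have corner: "tree_iso (A.tr (Suc m)) (B.tr (Suc m)) (mnode ?g (Suc m)) (medge ?g (Suc m))"
    unfolding tree_iso_def
  proof (intro conjI ballI)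
    show "bij_betw (mnode ?g (Suc m)) (nodes (A.tr (Suc m))) (nodes (B.tr (Suc m)))"
      unfolding a(1) b(1) by (simp add: gt)
    have im: "medge ?g (Suc m) ` nodes (A.tr m) = nodes (B.tr m)" "inj_on (medge ?g (Suc m)) (nodes (A.tr m))"
      using fn by (simp_all add: bij_betw_def gt2 inj_on_def)
    have r: "medge ?g (Suc m) (root (A.tr (Suc m))) = root (B.tr (Suc m))" using a(3) by (simp add: gt2)
    thus "medge ?g (Suc m) (root (A.tr (Suc m))) = root (B.tr (Suc m))" .
    show "bij_betw (medge ?g (Suc m)) (edges (A.tr (Suc m))) (edges (B.tr (Suc m)))"
      unfolding a(2) b(2) bij_betw_def using im r a(3) b(3) by simp
    fix u v assume uv: "u \<in> nodes (A.tr (Suc m))" "v \<in> edges (A.tr (Suc m))"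
    have n: "medge ?g (Suc m) v \<in> nodes (B.tr m) \<longleftrightarrow> v \<in> nodes (A.tr m)"
      "medge ?g (Suc m) v = root (B.tr (Suc m)) \<longleftrightarrow> v = root (A.tr (Suc m))"
      using uv(2) im(1) r b(3) unfolding a(2) by (metis imageI insertE)+
    show "((medge ?g (Suc m) v, mnode ?g (Suc m) u) \<in> tsource (B.tr (Suc m))) = ((v, u) \<in> tsource (A.tr (Suc m)))"
      "((medge ?g (Suc m) v, mnode ?g (Suc m) u) \<in> ttarget (B.tr (Suc m))) = ((v, u) \<in> ttarget (A.tr (Suc m)))"
      using n uv(1) unfolding a(1,4,5) b(4,5) by (simp_all add: gt)
  qed
  have k3: "k \<le> m \<or> k = Suc m \<or> k = Suc (Suc m)" if "k \<le> odim X" for k using that m by arith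
  have t: "tree_iso (A.tr k) (B.tr k) (mnode ?g k) (medge ?g k)" if k: "k \<le> odim X" for k
    using k3[OF k]
  proof (elim disjE)
    assume k: "k = Suc (Suc m)"
    show ?thesis unfolding k tree_iso_def a(6,7) b(6,7) by (simp add: bij_betw_def gt2)
  qed (use f' g corner in simp_all)
  have k2: "k < m \<or> k = m \<or> k = Suc m" if "k < odim X" for k using that m by arith
  have s: "subdiv_iso (A.tr k) (A.sb k) (B.sb k) (medge ?g k) (mwhite ?g k)" if k: "k < odim X" for k
    using k2[OF k]
  proof (elim disjE)
    assume "k < m"
    thus ?thesis using f m g g' by (simp add: level_iso_def)
  next
    assume k: "k = m"
    have e: "medge f m c \<in> edges (B.tr m)" if "c \<in> edges (A.tr m)" for c using fe that by (auto simp: bij_betw_def)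
    have n: "nodes (A.tr m) = {} \<longleftrightarrow> nodes (B.tr m) = {}" using fn by (auto simp: bij_betw_def)
    show ?thesis unfolding k subdiv_iso_def g(2)[OF order_refl]
      using a(8,9) b(8,9) e n by (auto simp: bij_betw_def gt)
  next
    assume k: "k = Suc m"
    have e: "medge ?g (Suc m) c \<in> edges (B.tr (Suc m))" if "c \<in> edges (A.tr (Suc m))" for c
      using corner that by (auto simp: bij_betw_def tree_iso_def)
    show ?thesis unfolding k subdiv_iso_def using a(10) b(10) e by (auto simp: bij_betw_def)
  qed
  have c: "(\<forall>u\<in>onodes X k. medge ?g (Suc k) u = mnode ?g k u) \<and> (\<forall>w\<in>owhites X k. mnode ?g (Suc k) w = mwhite ?g k w)"
    if k: "k < odim X" for k
    using k2[OF k]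
  proof (elim disjE)
    assume "k < m"
    thus ?thesis using f m g g' by (simp add: level_iso_def onodes_def owhites_def)
  next
    assume k: "k = m"
    show ?thesis unfolding k using g(1)[of m] by (simp add: gt gt2 onodes_def)
  next
    assume k: "k = Suc m"
    show ?thesis unfolding k by (simp add: gt gt2 owhites_def a(12))
  qed
  show ?thesis unfolding level_iso_def using d t s c by blast
qed

lemma level_iso_levels:
  assumes f: "level_iso X X' f"
    and Y: "odim Y = odim X" "\<And>k. k \<le> odim X \<Longrightarrow> otree Y k = otree X k" "\<And>k. k < odim X \<Longrightarrow> osub Y k = osub X k"
    and Y': "odim Y' = odim X'" "\<And>k. k \<le> odim X' \<Longrightarrow> otree Y' k = otree X' k" "\<And>k. k < odim X' \<Longrightarrow> osub Y' k = osub X' k"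
  shows "level_iso Y Y' f"
  using f Y Y' by (simp add: level_iso_def onodes_def owhites_def)

lemma ext_op_iso:
  fixes Y :: "'a elem opetope"
  assumes o: "is_opetope Y" "is_opetope Y'" and f: "level_iso Y Y' f"
  shows "level_iso (ext_op Y) (ext_op Y') (extend_map (ext_op Y) (ext_op Y') f)"
proof (rule extend_map_iso)
  show "extended (ext_op Y)" "extended (ext_op Y')" using o ext_op_extended by blast+
  show "odim (ext_op Y) = odim (ext_op Y')" using f by (simp add: level_iso_def)
  show "level_iso (truncate (ext_op Y)) (truncate (ext_op Y')) f"
    by (rule level_iso_levels[OF f]) (simp_all add: ext_tree_simps ext_sub_def)
qed

lemma extend_map_edge:
  assumes "odim Y = odim Y'"
  shows "medge (extend_map (ext_op Y) (ext_op Y') f) k x = ext_edge_map Y Y' f k x"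
  using assms by (simp add: extend_map_def ext_edge_map_def ext_tree_def)

lemma P_cellE:
  fixes Y :: "'a elem opetope"
  assumes "P \<in> P_cells Y" and Y: "is_opetope Y"
  obtains k x where "P = Cell k x" "nat (k + 2) \<le> odim Y + 2" "x \<in> edges (ext_tree Y (nat (k + 2)))"
proof -
  consider "P = Cell (-1) (root (ext_tree Y 1))"
    | k x where "P = Cell (int k) x" "k \<le> odim Y" "x \<in> edges (ext_tree Y (k + 2))"
    using assms by (auto simp: P_cells_def)
  thus ?thesis
  proof cases
    case 1
    have "root (ext_tree Y 1) \<in> edges (ext_tree Y 1)"
      using extended.tree_level[OF ext_op_extended[OF Y], of 1] tree.root_mem by simp
    thus ?thesis using that[OF 1] by simp
  next
    case 2
    have "nat (int k + 2) = k + 2" by simp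
    thus ?thesis using that[OF 2(1)] 2 by simp
  qed
qed

lemma P_mor_cell_map:
  assumes "odim Y = odim Y'"
  shows "P_mor Y Y' f = restrict (cell_map (extend_map (ext_op Y) (ext_op Y') f)) (cells (P_ob Y))"
proof -
  have "P_act Y Y' f P = cell_map (extend_map (ext_op Y) (ext_op Y') f) P" for P
    by (cases P) (simp_all add: extend_map_edge[OF assms])
  hence "P_act Y Y' f = cell_map (extend_map (ext_op Y) (ext_op Y') f)" by (rule ext)
  thus ?thesis by (simp add: P_mor_def P_ob_def P_faces_def)
qed

lemma P_mor_iso:
  fixes Y :: "'a elem opetope"
  assumes o: "is_opetope Y" "is_opetope Y'" and f: "f \<in> opetope_isos Y Y'"
  shows "mop_iso (P_ob Y) (P_ob Y') (P_mor Y Y' f)" "P_mor Y Y' f \<in> Hom DFC_core (P_ob Y) (P_ob Y')"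
proof -
  have l: "level_iso Y Y' f" using f opetope_isos_iff by blast
  hence d: "odim Y = odim Y'" by (simp add: level_iso_def)
  have i: "mop_iso (P_ob Y) (P_ob Y') (cell_map (extend_map (ext_op Y) (ext_op Y') f))"
    unfolding P_ob_op_mop using op_mop_iso[OF ext_op_extended ext_op_extended ext_op_iso] o l by blast
  thus "mop_iso (P_ob Y) (P_ob Y') (P_mor Y Y' f)"
    unfolding P_mor_cell_map[OF d] by (subst mop_iso_cong[of _ _ "cell_map (extend_map (ext_op Y) (ext_op Y') f)"]) simp_all
  show "P_mor Y Y' f \<in> Hom DFC_core (P_ob Y) (P_ob Y')"
    using mop_iso_is_iso[OF P_ob_dfc[OF o(1)] P_ob_dfc[OF o(2)] i]
    by (simp add: P_mor_cell_map[OF d] DFC_core_def core_simps)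
qed

lemma ext_edge_map_eq:
  assumes k: "k \<le> odim Y + 2" and x: "x \<in> edges (ext_tree Y k)"
  shows "ext_edge_map Y Y (restrict_map Y id_map) k x = x"
proof -
  have "k \<le> odim Y \<or> k = Suc (odim Y) \<or> k = Suc (Suc (odim Y))" using k by arith
  thus ?thesis using x
    by (elim disjE) (auto simp: ext_edge_map_def ext_tree_simps restrict_map_def id_map_def onodes_def oedges_def)
qed

text \<open>The root of the added corolla is sent to \<open>fresh Y'\<close>; as this is not a node
  in degree n, the second map treats it as a root again.\<close>

lemma ext_edge_map_comp:
  fixes Y :: "'a elem opetope"
  assumes o: "is_opetope Y" "is_opetope Y'" "is_opetope Y''" and f: "f \<in> opetope_isos Y Y'" and g: "g \<in> opetope_isos Y' Y''"
    and k: "k \<le> odim Y + 2" and x: "x \<in> edges (ext_tree Y k)"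
  shows "ext_edge_map Y Y'' (restrict_map Y (comp_map g f)) k x = ext_edge_map Y' Y'' g k (ext_edge_map Y Y' f k x)"
proof -
  have d: "odim Y' = odim Y" "odim Y'' = odim Y" using f g by (auto simp: opetope_isos_def)
  have n: "mnode f (odim Y) a \<in> nodes (otree Y' (odim Y))" if "a \<in> nodes (otree Y (odim Y))" for a
    using opetope_isos_mem(1)[OF o(1,2) f, of a "odim Y"] that d by (simp add: onodes_def)
  have "k \<le> odim Y \<or> k = Suc (odim Y) \<or> k = Suc (Suc (odim Y))" using k by arith
  thus ?thesis using x n d fresh_notin[OF o(2)]
    by (elim disjE) (auto simp: ext_edge_map_def ext_tree_simps restrict_map_def comp_map_def onodes_def oedges_def)
qed

lemma P_is_functor: "is_functor (KJBM :: ('a elem opetope, 'a elem opetope_map) category) DFC_core P_functor"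
proof -
  have m: "P_mor Y Y' f P \<in> P_cells Y'" if "is_opetope Y" "is_opetope Y'" "f \<in> opetope_isos Y Y'" "P \<in> P_cells Y"
    for Y Y' :: "'a elem opetope" and f P
    using P_mor_iso(1)[OF that(1-3)] that(4) by (auto simp: mop_iso_def bij_betw_def P_ob_def P_faces_def)
  show ?thesis unfolding is_functor_def KJBM_simps P_functor_def cfunctor.select_convs mem_Collect_eq
  proof (intro conjI ballI)
    fix Y :: "'a elem opetope" assume Y: "Y \<in> {Y. is_opetope Y}"
    thus "P_ob Y \<in> Ob DFC_core" by (simp add: DFC_core_def core_simps DFC_simps P_ob_dfc)
    have "P_act Y Y (restrict_map Y id_map) P = P" if P: "P \<in> P_cells Y" for P
      using P by (rule P_cellE) (use ext_edge_map_eq[of _ Y] Y in simp_all)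
    thus "P_mor Y Y (restrict_map Y id_map) = Id DFC_core (P_ob Y)"
      by (simp add: DFC_core_def core_simps DFC_simps P_mor_def P_ob_def P_faces_def fun_eq_iff)
  next
    fix Y Y' :: "'a elem opetope" and f assume "Y \<in> {Y. is_opetope Y}" "Y' \<in> {Y. is_opetope Y}" "f \<in> opetope_isos Y Y'"
    thus "P_mor Y Y' f \<in> Hom DFC_core (P_ob Y) (P_ob Y')" using P_mor_iso(2) by blast
  next
    fix Y Y' Y'' :: "'a elem opetope" and f g
    assume "Y \<in> {Y. is_opetope Y}" "Y' \<in> {Y. is_opetope Y}" "Y'' \<in> {Y. is_opetope Y}"
      and f: "f \<in> opetope_isos Y Y'" and g: "g \<in> opetope_isos Y' Y''"
    hence o: "is_opetope Y" "is_opetope Y'" "is_opetope Y''" by auto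
    have "P_act Y Y'' (restrict_map Y (comp_map g f)) P = P_mor Y' Y'' g (P_mor Y Y' f P)" if P: "P \<in> P_cells Y" for P
    proof -
      have p: "P_act Y Y' f P \<in> P_cells Y'" using m[OF o(1,2) f P] P by (simp add: P_mor_def)
      show ?thesis using P
        by (rule P_cellE) (use o p P ext_edge_map_comp[OF o f g] in \<open>simp_all add: P_mor_def\<close>)
    qed
    thus "P_mor Y Y'' (restrict_map Y (comp_map g f)) =
        Comp DFC_core (P_ob Y) (P_ob Y') (P_ob Y'') (P_mor Y' Y'' g) (P_mor Y Y' f)"
      by (simp add: DFC_core_def core_simps DFC_simps P_mor_def[of Y Y''] P_ob_def P_faces_def compose_def fun_eq_iff)
  qed
qed

section \<open>The functor from dendritic face complexes\<close>

locale dendritic_iso = C: dendritic C + D: dendritic D for C :: "'a mop" and D :: "'a mop" +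
  fixes f :: "'a \<Rightarrow> 'a"
  assumes iso: "mop_iso C D f"
begin

lemma f_bij: "bij_betw f (cells C) (cells D)"
  and f_dim: "x \<in> cells C \<Longrightarrow> dim D (f x) = dim C x"
  and f_face: "x \<in> cells C \<Longrightarrow> y \<in> cells C \<Longrightarrow> face D s (f y) (f x) \<longleftrightarrow> face C s y x"
  and f_lord: "x \<in> cells C \<Longrightarrow> z \<in> cells C \<Longrightarrow> y \<in> cells C \<Longrightarrow> y' \<in> cells C \<Longrightarrow>
    (f y, f y') \<in> lord D (f x) (f z) \<longleftrightarrow> (y, y') \<in> lord C x z"
  using iso by (simp_all add: mop_iso_def)

lemma f_mem: "x \<in> cells C \<Longrightarrow> f x \<in> cells D"
  and f_inj: "x \<in> cells C \<Longrightarrow> y \<in> cells C \<Longrightarrow> f x = f y \<longleftrightarrow> x = y"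
  and f_onto: "y \<in> cells D \<Longrightarrow> \<exists>x\<in>cells C. y = f x"
  using f_bij by (auto simp: bij_betw_def dest: inj_onD)

lemma f_faces: "face C s y x \<Longrightarrow> face D s (f y) (f x)"
  using f_face C.face_mem by blast

lemma f_faces_back: "face D s y' (f x) \<Longrightarrow> x \<in> cells C \<Longrightarrow> \<exists>y\<in>cells C. y' = f y \<and> face C s y x"
  using D.face_mem(2) f_onto f_face by metis

lemma f_cells_dim: "x \<in> cells C \<Longrightarrow> f x \<in> cells_dim D k \<longleftrightarrow> x \<in> cells_dim C k"
  by (simp add: cells_dim_def f_dim f_mem)

lemma bij_cells:
  assumes "A \<subseteq> cells C" "B \<subseteq> cells D" "\<And>x. x \<in> cells C \<Longrightarrow> f x \<in> B \<longleftrightarrow> x \<in> A"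
  shows "bij_betw f A B"
proof -
  have "inj_on f A" using assms(1) f_bij by (auto simp: bij_betw_def intro: inj_on_subset)
  moreover have "f ` A = B" using assms f_onto by blast
  ultimately show ?thesis by (simp add: bij_betw_def)
qed

lemma f_top: "mop_dim D = mop_dim C" "f (top_cell C) = top_cell D"
proof -
  have t: "dim D (f (top_cell C)) = int (mop_dim C)" using f_dim[OF C.top_cells] C.top_dim by simp
  have 1: "f (top_cell C) = top_cell D \<or> mop_dim C < mop_dim D" using D.le_top[OF f_mem[OF C.top_cells]] t by auto
  obtain x where x: "x \<in> cells C" "top_cell D = f x" using f_onto D.top_cells by blast
  hence "dim C x = int (mop_dim D)" using f_dim D.top_dim by simp
  hence "x = top_cell C \<or> mop_dim D < mop_dim C" using C.le_top[OF x(1)] by auto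
  thus "f (top_cell C) = top_cell D" using 1 x by auto
  thus "mop_dim D = mop_dim C" using t D.top_dim by simp
qed

lemma f_gam: "x \<in> cells C \<Longrightarrow> dim C x \<ge> 0 \<Longrightarrow> gam D (f x) = f (gam C x)"
  using C.face_cases[of x] f_faces D.face_pos D.face_zero by metis

lemma f_it: "k \<le> mop_dim C \<Longrightarrow> f (iter_target C k) = iter_target D k"
proof (induction k rule: inc_induct)
  case base
  show ?case using C.it_top D.it_top f_top by simp
next
  case (step k)
  thus ?case using C.it_step[of k] D.it_step[of k] f_gam[of "iter_target C (Suc k)"] C.it_mem[of "Suc k"] f_top by simp
qed

lemma f_Lam: "x \<in> cells C \<Longrightarrow> f x \<in> Lam D \<longleftrightarrow> x \<in> Lam C"
  by (rule Lam_transfer[OF f_bij _ f_face])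

lemma f_null: "x \<in> cells C \<Longrightarrow> f x \<in> null_cells D \<longleftrightarrow> x \<in> null_cells C"
proof -
  assume x: "x \<in> cells C"
  have C': "delta C x = {} \<longleftrightarrow> (\<forall>y. \<not> face C (-1) y x \<and> \<not> face C 0 y x)" using x by (auto simp: face_def)
  have D': "delta D (f x) = {} \<longleftrightarrow> (\<forall>y. \<not> face D (-1) y (f x) \<and> \<not> face D 0 y (f x))" using f_mem[OF x] by (auto simp: face_def)
  have "delta C x = {} \<longleftrightarrow> delta D (f x) = {}" unfolding C' D' using f_faces f_faces_back x by metis
  thus ?thesis using x f_mem by (simp add: null_cells_def)
qed

lemma Lm_sub: "C.Lm k \<subseteq> cells C" "D.Lm k \<subseteq> cells D" and f_Lm: "x \<in> cells C \<Longrightarrow> f x \<in> D.Lm k \<longleftrightarrow> x \<in> C.Lm k"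
  by (auto simp: C.Lm_def D.Lm_def) (use f_Lam f_cells_dim in \<open>auto simp: Lam_def\<close>)

lemma f_first_leaf: "f (first_leaf C) = first_leaf D" using C.first_leaf_eq f_Lm Lm_sub D.first_leaf_eq by blast

lemma f_bottom: "f (the_elem (cells_dim C (-1))) = the_elem (cells_dim D (-1))"
  using C.bottom_cell D.bottom_cell cells_dim_def f_cells_dim by fastforce

lemma tree_TT:
  assumes "e \<le> mop_dim C"
  shows "tree_iso (C.TT e) (D.TT e) f f"
proof -
  have c: "cells_dim C k \<subseteq> cells C" "cells_dim D k \<subseteq> cells D" for k by (auto simp: cells_dim_def)
  have "bij_betw f (C.Lm k) (D.Lm k)" for k by (rule bij_cells[OF Lm_sub f_Lm])
  moreover have "bij_betw f (cells_dim C k) (cells_dim D k)" for k by (rule bij_cells[OF c f_cells_dim])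
  moreover have "(f b, f a) \<in> tsource (D.TT e) \<longleftrightarrow> (b, a) \<in> tsource (C.TT e)" "(f b, f a) \<in> ttarget (D.TT e) \<longleftrightarrow> (b, a) \<in> ttarget (C.TT e)"
    if "a \<in> nodes (C.TT e)" "b \<in> edges (C.TT e)" for a b
  proof -
    have "a \<in> cells C" "b \<in> cells C" using that Lm_sub(1) by (auto simp: C.TT_simps cells_dim_def)
    thus "(f b, f a) \<in> tsource (D.TT e) \<longleftrightarrow> (b, a) \<in> tsource (C.TT e)" "(f b, f a) \<in> ttarget (D.TT e) \<longleftrightarrow> (b, a) \<in> ttarget (C.TT e)"
      by (simp_all add: C.TT_simps D.TT_simps f_Lm f_face)
  qed
  ultimately show ?thesis unfolding tree_iso_def using f_it[OF assms] by (simp add: C.TT_simps D.TT_simps)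
qed

text \<open>By \<open>loop_order_iff\<close> it suffices to transport the lexicographic order, which
  consists of descent, signed faces and local orders. Neither zig-zags nor loop paths have to be
  compared.\<close>

lemma white_level:
  assumes e: "Suc e \<le> mop_dim C"
  shows "subdiv_iso (C.TT e) (Z_sub C (e + 2)) (Z_sub D (e + 2)) f f"
proof -
  interpret L: dendritic_level C e using e by unfold_locales
  interpret M: dendritic_level D e using e f_top by unfold_locales simp
  have wc: "w \<in> cells C" if "w \<in> L.whites c" for w c
    using that by (auto simp: L.whites_def Z_white_def Lam_def)
  have wh: "f w \<in> M.whites (f c) \<longleftrightarrow> w \<in> L.whites c" if w: "w \<in> cells C" and c: "c \<in> cells C" for w c
  proof -
    have "f (gam C (gam C w)) = gam D (gam D (f w))" "gam C (gam C w) \<in> cells C" if "dim C w = int (e + 2)"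
    proof -
      have g: "gam C w \<in> cells C" "dim C (gam C w) = int (Suc e)" using C.gam_mem[of w] w that by auto
      thus "gam C (gam C w) \<in> cells C" using C.gam_mem[of "gam C w"] by simp
      show "f (gam C (gam C w)) = gam D (gam D (f w))" using f_gam[of w] f_gam[of "gam C w"] w g that by simp
    qed
    thus ?thesis
      using f_Lam[OF w] f_null[OF w] f_cells_dim[OF w, of "int (e + 2)"] f_inj c
      by (auto simp: L.whites_def M.whites_def Z_white_def cells_dim_def simp del: of_nat_add)
  qed
  have ti: "tree_iso (C.TT (Suc e)) (D.TT (Suc e)) f f" using tree_TT e by blast
  have lx: "M.lx (f c) (map_sum f f t) (map_sum f f t')" if c: "c \<in> cells C" and l: "L.lx c t t'" for c t t'
  proof -
    obtain a y y' where a: "(y, a) \<in> tsource (C.TT (Suc e))" "(y', a) \<in> tsource (C.TT (Suc e))" "y \<noteq> y'"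
      "desc (C.TT (Suc e)) t (Inr y)" "desc (C.TT (Suc e)) t' (Inr y')" "L.before c a y y'"
      using l unfolding L.U.lex_def by blast
    have f: "a \<in> C.Lm (int (e + 2))" "face C (-1) y a" "face C (-1) y' a" using a by (auto simp: L.U_source)
    hence m: "a \<in> cells C" "y \<in> cells C" "y' \<in> cells C" using C.face_mem by blast+
    show ?thesis
    proof (rule M.U.lexI)
      show "(f y, f a) \<in> tsource (D.TT (Suc e))" "(f y', f a) \<in> tsource (D.TT (Suc e))"
        using f m f_Lm by (simp_all add: M.U_source f_face del: of_nat_add)
      show "f y \<noteq> f y'" using f_inj m a by simp
      show "desc (D.TT (Suc e)) (map_sum f f t) (Inr (f y))" "desc (D.TT (Suc e)) (map_sum f f t') (Inr (f y'))"
        using tree_iso_desc[OF L.U.rooted ti a(4)] tree_iso_desc[OF L.U.rooted ti a(5)] by simp_all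
      show "M.before (f c) (f a) (f y) (f y')"
        using a(6) c m by (simp add: L.before_def M.before_def f_face f_lord)
    qed
  qed
  show ?thesis unfolding subdiv_iso_def
  proof (intro ballI conjI)
    fix c assume "c \<in> edges (C.TT e)"
    hence c: "c \<in> cells C" by (simp add: C.TT_simps cells_dim_def)
    have "bij_betw f (L.whites c) (M.whites (f c))"
    proof (rule bij_cells)
      show "L.whites c \<subseteq> cells C" using wc by blast
      show "M.whites (f c) \<subseteq> cells D" by (auto simp: M.whites_def Z_white_def Lam_def)
    qed (use wh c in blast)
    thus "bij_betw f (wset (Z_sub C (e + 2)) c) (wset (Z_sub D (e + 2)) (f c))"
      using L.WW_simps(1) M.WW_simps(1) by (simp add: L.WW_def M.WW_def)
    fix w w' assume "w \<in> wset (Z_sub C (e + 2)) c" "w' \<in> wset (Z_sub C (e + 2)) c"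
    hence w: "w \<in> L.whites c" "w' \<in> L.whites c" using L.WW_simps(1) by (simp_all add: L.WW_def)
    hence fw: "f w \<in> M.whites (f c)" "f w' \<in> M.whites (f c)" using wh wc c by blast+
    have "M.lx (f c) (Inl (f w)) (Inl (f w')) \<longleftrightarrow> L.lx c (Inl w) (Inl w')"
    proof
      \<comment> \<open>Only preservation has been shown so far; reflection follows because the
        order in \<open>C\<close> is total on white dots and the one in \<open>D\<close> is
        asymmetric.\<close>
      assume m: "M.lx (f c) (Inl (f w)) (Inl (f w'))"
      hence "w \<noteq> w'" using M.U.lex_irrefl by metis
      moreover have "\<not> L.lx c (Inl w') (Inl w)" using lx[OF c, of "Inl w'" "Inl w"] M.lx_asym m by auto
      ultimately show "L.lx c (Inl w) (Inl w')" using L.lx_total[of "Inl w" c "Inl w'"] w by (auto simp: L.strand_def)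
    next
      assume "L.lx c (Inl w) (Inl w')"
      from lx[OF c this] show "M.lx (f c) (Inl (f w)) (Inl (f w'))" by simp
    qed
    thus "((f w, f w') \<in> wless (Z_sub D (e + 2)) (f c)) = ((w, w') \<in> wless (Z_sub C (e + 2)) c)"
      using L.WW_simps(2) M.WW_simps(2) w fw by (simp add: L.WW_def M.WW_def)
  qed
qed

lemma Z_level_iso: "level_iso (Z_ob C) (Z_ob D) \<lparr>mnode = \<lambda>_. f, medge = \<lambda>_. f, mwhite = \<lambda>_. f\<rparr>"
proof -
  have "tree_iso (Z_tree C k) (Z_tree D k) f f" if k: "k \<le> mop_dim C" for k
  proof (cases "k < 2")
    case True
    have "first_leaf C \<noteq> the_elem (cells_dim C (-1))" "first_leaf D \<noteq> the_elem (cells_dim D (-1))"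
      using C.low_tree(7)[OF True] D.low_tree(7)[OF True] .
    thus ?thesis unfolding C.low_tree(1)[OF True] D.low_tree(1)[OF True] tree_iso_def using f_first_leaf f_bottom
      by (auto simp: bij_betw_def)
  next
    case False
    then obtain e where "k = e + 2" by (metis le_add_diff_inverse2 not_less)
    thus ?thesis using tree_TT[of e] k by (simp add: C.TT_def D.TT_def)
  qed
  moreover have "subdiv_iso (Z_tree C k) (Z_sub C k) (Z_sub D k) f f" if k: "k < mop_dim C" for k
  proof (cases "k < 2")
    case True
    show ?thesis unfolding C.low_tree(2)[OF True] D.low_tree(2)[OF True] subdiv_iso_def
      by (simp add: empty_subdiv_def bij_betw_def)
  next
    case False
    then obtain e where "k = e + 2" by (metis le_add_diff_inverse2 not_less)
    thus ?thesis using white_level[of e] k by (simp add: C.TT_def)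
  qed
  ultimately show ?thesis by (simp add: level_iso_def Z_ob_def f_top)
qed

end

lemma Z_mor_restrict: "Z_mor C D f = restrict_map (Z_ob C) \<lparr>mnode = \<lambda>_. f, medge = \<lambda>_. f, mwhite = \<lambda>_. f\<rparr>"
  by (simp add: Z_mor_def restrict_map_def)

lemma (in dendritic) Z_ob_cells:
  shows "onodes (Z_ob C) k \<subseteq> cells C" "oedges (Z_ob C) k \<subseteq> cells C" "owhites (Z_ob C) k \<subseteq> cells C"
proof -
  have b: "the_elem (cells_dim C (-1)) \<in> cells C" using bottom_cell cells_dim_iff by fastforce
  have l: "first_leaf C \<in> cells C" using first_leaf_eq by (auto simp: Lm_def Lam_def)
  have "nodes (Z_tree C k) \<subseteq> cells C \<and> edges (Z_tree C k) \<subseteq> cells C"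
  proof (cases "k < 2")
    case True
    thus ?thesis using b l by (simp add: low_tree(1))
  next
    case False
    thus ?thesis by (auto simp: Z_tree_def cells_dim_def)
  qed
  thus "onodes (Z_ob C) k \<subseteq> cells C" "oedges (Z_ob C) k \<subseteq> cells C"
    by (simp_all add: onodes_def oedges_def Z_ob_def)
  show "owhites (Z_ob C) k \<subseteq> cells C"
    by (auto simp: owhites_def Z_ob_def Z_sub_def white_dots_def empty_subdiv_def Z_white_def Lam_def)
qed

lemma Z_mor_iso:
  assumes "is_dfc C" "is_dfc D" "mop_iso C D f"
  shows "Z_mor C D f \<in> opetope_isos (Z_ob C) (Z_ob D)"
proof -
  interpret dendritic_iso C D f using assms by unfold_locales
  show ?thesis unfolding Z_mor_restrict by (rule restrict_map_iso[OF C.Z_ob_opetope Z_level_iso])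
qed

lemma DFC_core_simps:
  "Ob DFC_core = {C. is_dfc C}" "Hom DFC_core C D = {f. is_iso DFC C D f}" "Id DFC_core C = restrict (\<lambda>x. x) (cells C)"
  "Comp DFC_core C D E g f = compose (cells C) g f"
  by (simp_all add: DFC_core_def core_simps DFC_simps)

lemma Z_is_functor: "is_functor DFC_core KJBM Z_functor"
  unfolding is_functor_def KJBM_simps DFC_core_simps Z_functor_def cfunctor.select_convs mem_Collect_eq
proof (intro conjI ballI)
  fix C :: "'a mop" assume "C \<in> {C. is_dfc C}"
  then interpret dendritic C by unfold_locales simp
  show "is_opetope (Z_ob C)" by (rule Z_ob_opetope)
  show "Z_mor C C (restrict (\<lambda>x. x) (cells C)) = restrict_map (Z_ob C) id_map"
    unfolding Z_mor_restrict
    by (rule restrict_map_cong) (simp_all add: id_map_def subsetD[OF Z_ob_cells(1)] subsetD[OF Z_ob_cells(2)] subsetD[OF Z_ob_cells(3)])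
next
  fix C D :: "'a mop" and f assume "C \<in> {C. is_dfc C}" "D \<in> {C. is_dfc C}" "f \<in> {f. is_iso DFC C D f}"
  thus "Z_mor C D f \<in> opetope_isos (Z_ob C) (Z_ob D)" using Z_mor_iso is_iso_mop_iso(1) by blast
next
  fix C D E :: "'a mop" and f g assume a: "C \<in> {C. is_dfc C}" "D \<in> {C. is_dfc C}" "f \<in> {f. is_iso DFC C D f}"
  hence d: "is_dfc C" "is_dfc D" by simp_all
  then interpret C: dendritic C + D: dendritic D by unfold_locales
  have "Z_mor C D f \<in> opetope_isos (Z_ob C) (Z_ob D)" using Z_mor_iso is_iso_mop_iso(1) a by blast
  note m = opetope_isos_mem[OF C.Z_ob_opetope D.Z_ob_opetope this]
  show "Z_mor C E (compose (cells C) g f) = restrict_map (Z_ob C) (comp_map (Z_mor D E g) (Z_mor C D f))"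
    unfolding Z_mor_restrict[of C E]
    by (rule restrict_map_cong)
      (use m in \<open>auto simp: comp_map_def Z_mor_def compose_def subsetD[OF C.Z_ob_cells(1)] subsetD[OF C.Z_ob_cells(2)] subsetD[OF C.Z_ob_cells(3)]\<close>)
qed

section \<open>The unit\<close>

lemma (in dendritic) dim_cases: "x \<in> cells C \<Longrightarrow> dim C x = -1 \<or> (\<exists>k. dim C x = int k)"
  using dim_ge[of x] zero_le_imp_eq_int[of "dim C x"] by fastforce

lemma (in dendritic) cell_edge:
  assumes "x \<in> cells C"
  shows "nat (dim C x + 2) \<le> n + 2" "x \<in> edges (Z_tree C (nat (dim C x + 2)))"
proof -
  have d: "dim C x \<le> int n" using le_top[OF assms] top_dim by auto
  thus "nat (dim C x + 2) \<le> n + 2" by linarith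
  show "x \<in> edges (Z_tree C (nat (dim C x + 2)))"
  proof (cases "dim C x = -1")
    case True
    obtain s where "cells_dim C (-1) = {s}" using bottom_cell by blast
    moreover have "x \<in> cells_dim C (-1)" using assms True by (simp add: cells_dim_iff)
    ultimately show ?thesis using low_tree(1)[of 1] True by simp
  next
    case False
    then obtain e where e: "dim C x = int e" using dim_cases[OF assms] by blast
    hence "nat (dim C x + 2) = Suc (Suc e)" by simp
    thus ?thesis using assms by (simp add: Z_tree_TT TT_simps cells_dim_iff)
  qed
qed

locale dendritic_elem = dendritic C for C :: "'a elem mop"
begin

sublocale X: extended "Z_ext C"
  by (rule Z_ext_extended[OF dfc])

lemma Z_ext_simps: "odim (Z_ext C) = Suc (Suc n)" "otree (Z_ext C) = Z_tree C" "osub (Z_ext C) = Z_sub C"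
  by (simp_all add: Z_ext_def)

definition tag :: "'a elem \<Rightarrow> 'a elem" where
  "tag x = Cell (dim C x) x"

lemma root_one: "root (Z_tree C 1) = the_elem (cells_dim C (-1))" "cells_dim C (-1) = {root (Z_tree C 1)}"
  using low_tree(1) bottom_cell by auto

lemma tag_bij: "bij_betw tag (cells C) (op_cells (Z_ext C))"
proof -
  have "tag x \<in> op_cells (Z_ext C)" if x: "x \<in> cells C" for x
  proof (cases "dim C x = -1")
    case True
    hence "x = root (Z_tree C 1)" using x root_one(2) cells_dim_iff by blast
    thus ?thesis using True by (simp add: tag_def op_cells_def Z_ext_simps)
  next
    case False
    then obtain k where k: "dim C x = int k" using dim_cases[OF x] by blast
    have "nat (dim C x + 2) = k + 2" using k by simp
    thus ?thesis using cell_edge[OF x] k X.cell_iff[of k x] by (simp add: tag_def Z_ext_simps)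
  qed
  moreover have "P \<in> tag ` cells C" if "P \<in> op_cells (Z_ext C)" for P
    using that
  proof (cases rule: X.cellE)
    case 1
    have "root (Z_tree C 1) \<in> cells_dim C (-1)" using root_one by simp
    thus ?thesis using 1 by (intro rev_image_eqI[of "root (Z_tree C 1)"]) (simp_all add: tag_def cells_dim_iff Z_ext_simps)
  next
    case (2 k x)
    hence "x \<in> cells_dim C (int k)" using Z_tree_TT[of k] by (simp add: Z_ext_simps TT_simps)
    thus ?thesis using 2(1) by (intro rev_image_eqI[of x]) (simp_all add: tag_def cells_dim_iff)
  qed
  ultimately show ?thesis unfolding bij_betw_def by (auto simp: inj_on_def tag_def)
qed

text \<open>The ends of the string of \<open>c\<close> above \<open>x\<close> are described by
  \<open>joint\<close>, and the white dots by \<open>tops_loop\<close> and \<open>loop_tops\<close>.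
  So the signs of the opetope are given by the formula \<open>face_joint\<close> that also gives
  those of \<open>C\<close>.\<close>

lemma incid_face:
  assumes e: "Suc e \<le> n" and x: "x \<in> cells_dim C (int (Suc e))"
  shows "X.incid (Suc (Suc e)) s c x \<longleftrightarrow> face C s c x"
proof -
  interpret L: dendritic_level C e using e by unfold_locales
  interpret K: constellation "TT e" L.WW L.TS
    using L.constellation_Z by unfold_locales
  have ab: "Inl u \<in> K.above x \<longleftrightarrow> u \<in> Lm (int (Suc e)) \<and> desc L.TS (Inr u) (Inr x)" for u
    using L.nodes_TT L.leaves_U by (simp add: K.above_iff del: of_nat_Suc)
  have up: "upper_in (TT e) (K.above x) c \<longleftrightarrow> L.joint 1 c x" and low: "lower_in (TT e) (K.above x) c \<longleftrightarrow> L.joint (-1) c x" for c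
    unfolding upper_in_def lower_in_def L.joint_def above_sign_def ab L.T_source L.T_target by blast+
  have xE: "x \<in> edges L.TS" using x by (simp add: TT_simps)
  have white: "K.above x \<subseteq> Inr ` wset L.WW c \<longleftrightarrow> face C 0 c x"
  proof
    assume w: "K.above x \<subseteq> Inr ` wset L.WW c"
    show "face C 0 c x"
    proof (rule L.loop_tops[OF x])
      fix t assume t: "t \<in> tops L.TS" "desc L.TS t (Inr x)"
      obtain d where d: "d \<in> dots (TT e) L.WW" "dot_vertex d = t" using K.tops_dot[OF t(1)] by blast
      hence "d \<in> K.above x" using t(2) by (simp add: K.above_iff)
      thus "\<exists>w\<in>L.whites c. t = Inl w" using w d(2) L.WW_simps(1) by auto
    qed
  next
    assume l: "face C 0 c x"
    show "K.above x \<subseteq> Inr ` wset L.WW c"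
    proof
      fix d assume d: "d \<in> K.above x"
      hence "dot_vertex d \<in> tops L.TS" "desc L.TS (dot_vertex d) (Inr x)"
        using K.dot_vertex_tops by (simp_all add: K.above_iff)
      then obtain w where w: "w \<in> L.whites c" "dot_vertex d = Inl w" using L.tops_loop[OF l] by blast
      hence "d = Inr w" by (cases d) simp_all
      thus "d \<in> Inr ` wset L.WW c" using w L.WW_simps(1) by blast
    qed
  qed
  have cE: "c \<in> edges (TT e)" if "face C s c x"
    using face_mem[OF that] x by (simp add: TT_simps cells_dim_iff)
  have "K.inc s c x \<longleftrightarrow> face C s c x"
  proof -
    have "K.inc s c x \<longleftrightarrow> c \<in> edges (TT e) \<and> (s = 1 \<or> s = -1 \<or> s = 0) \<and> face C s c x"
      unfolding K.inc_def leaves_at_def enters_def up low white using L.face_joint[OF _ x] xE by auto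
    thus ?thesis using cE face_mem(5)[of s c x] by blast
  qed
  thus ?thesis by (simp add: Z_ext_simps Z_tree_TT L.WW_def)
qed

lemma tag_face:
  assumes x: "x \<in> cells C" and y: "y \<in> cells C"
  shows "face X.M s (tag y) (tag x) \<longleftrightarrow> face C s y x"
proof (cases "dim C x = -1")
  case True
  thus ?thesis using X.no_face_bottom face_mem(3)[of s y x] by (auto simp: tag_def)
next
  case False
  then obtain k where k: "dim C x = int k" using dim_cases[OF x] by blast
  have kn: "k + 2 \<le> odim (Z_ext C)" "x \<in> edges (Z_tree C (k + 2))"
    using cell_edge[OF x] k by (simp_all add: Z_ext_simps nat_add_distrib)
  have y': "tag y = Cell (int k - 1) z \<longleftrightarrow> z = y \<and> dim C y = int k - 1" for z by (auto simp: tag_def)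
  have F: "face X.M s (tag y) (tag x) \<longleftrightarrow>
      dim C y = int k - 1 \<and> X.incid (Suc k) s y x \<and> (k = 0 \<longrightarrow> y = root (Z_tree C 1))"
    using X.face_iff[OF kn(1), of x s "tag y"] kn(2) y' k by (auto simp: tag_def[of x] Z_ext_simps)
  show ?thesis
  proof (cases k)
    case 0
    have b: "face C 1 (root (Z_tree C 1)) x" unfolding root_one(1) by (rule bottom_face) (use x k 0 in \<open>simp add: cells_dim_iff\<close>)
    have "face C s y x \<Longrightarrow> y = root (Z_tree C 1)" using face_mem[of s y x] root_one(2) k 0 cells_dim_iff[of y "-1"] by auto
    moreover have "dim C y = -1 \<Longrightarrow> y = root (Z_tree C 1)" using root_one(2) y cells_dim_iff[of y "-1"] by auto
    moreover have "X.incid 1 s (root (Z_tree C 1)) x \<longleftrightarrow> s = 1" using X.incid_one[of x s] kn 0 by (simp add: Z_ext_simps numeral_2_eq_2)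
    ultimately show ?thesis using F 0 b face_sign_unique[OF b] face_mem(4)[OF b] k by auto
  next
    case (Suc e)
    have "Suc e \<le> n" "x \<in> cells_dim C (int (Suc e))" using kn(1) k Suc x by (simp_all add: Z_ext_simps cells_dim_iff)
    hence "X.incid (Suc k) s y x \<longleftrightarrow> face C s y x" using incid_face Suc by blast
    thus ?thesis using F Suc face_mem(4)[of s y x] k by auto
  qed
qed

lemma tag_Lam: "x \<in> cells C \<Longrightarrow> tag x \<in> Lam X.M \<longleftrightarrow> x \<in> Lam C"
  by (rule Lam_transfer) (simp_all add: tag_bij tag_face)

text \<open>Two loops on \<open>z\<close> that are sources of \<open>x\<close> are the branches at
  which any white dots above them meet. Hence those white dots are ordered as \<open>before\<close>
  orders \<open>y\<close> and \<open>y'\<close> at \<open>x\<close>, and between loops this is the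
  local order.\<close>

lemma tag_lord:
  assumes c: "x \<in> cells C" "z \<in> cells C" "y \<in> cells C" "y' \<in> cells C"
  shows "(tag y, tag y') \<in> op_lord (Z_ext C) (tag x) (tag z) \<longleftrightarrow> (y, y') \<in> lord C x z"
proof (cases "x \<in> Lam C \<and> face C 0 z y \<and> face C 0 z y' \<and> face C (-1) y x \<and> face C (-1) y' x \<and> y \<noteq> y'")
  case False
  have "(y, y') \<notin> lord C x z"
  proof
    assume l: "(y, y') \<in> lord C x z"
    thus False using False mop_lord(1)[OF mop l] by (auto simp: local_loops_def)
  qed
  moreover have "(tag y, tag y') \<notin> op_lord (Z_ext C) (tag x) (tag z)"
  proof
    assume "(tag y, tag y') \<in> op_lord (Z_ext C) (tag x) (tag z)"
    hence "tag x \<in> Lam X.M" "tag y \<noteq> tag y'" "tag y \<in> local_loops X.M (tag x) (tag z)"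
      "tag y' \<in> local_loops X.M (tag x) (tag z)"
      unfolding op_lord_def op_faces_Lam op_faces_loops by auto
    thus False using False c tag_face tag_Lam by (auto simp: local_loops_def)
  qed
  ultimately show ?thesis by blast
next
  case True
  hence xL: "x \<in> Lam C" and z: "face C 0 z y" "face C 0 z y'" and y: "face C (-1) y x" "face C (-1) y' x" "y \<noteq> y'" by blast+
  obtain e where e: "dim C z = int e"
  proof -
    have "dim C z \<noteq> -1"
    proof
      assume "dim C z = -1"
      hence "y \<in> cells_dim C 0" using face_mem(4)[OF z(1)] c by (simp add: cells_dim_iff)
      thus False using loop_only[OF z(1) bottom_face] by simp
    qed
    thus thesis using that dim_cases[OF c(2)] by blast
  qed
  have dims: "dim C y = int (Suc e)" "dim C y' = int (Suc e)" "dim C x = int (e + 2)"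
    using face_mem(4)[OF z(1)] face_mem(4)[OF z(2)] face_mem(4)[OF y(1)] e by auto
  have en: "e + 2 \<le> n" using le_top[OF c(1)] top_dim dims(3) by auto
  interpret L: dendritic_level C e using en by unfold_locales simp
  interpret K: constellation "TT e" L.WW L.TS
    using L.constellation_Z by unfold_locales
  have xm: "x \<in> Lm (int (e + 2))" using xL dims by (simp add: Lm_iff)
  have xl: "x \<in> leaves (Z_tree C (e + 2 + 2))" using TT_leaves[of "e + 2"] en xm by (simp add: TT_def)
  have k: "e + 2 + 2 \<le> odim (Z_ext C)" "e + 2 < odim (Z_ext C)" using en by (simp_all add: Z_ext_simps)
  have ab: "op_dots (Z_ext C) (e + 2) (Inr v) = K.above v" for v
    using X.op_dots_above[OF k(2)] by (simp add: Z_ext_simps Z_tree_TT L.WW_def)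
  have tx: "tag x = Cell (int (e + 2)) x" "tag y = Cell (int (e + 2) - 1) y" "tag y' = Cell (int (e + 2) - 1) y'"
    "tag z = Cell (int (e + 2) - 2) z" using dims e by (simp_all add: tag_def)
  have lo: "tag v \<in> local_loops X.M (tag x) (tag z)" if "face C 0 z v" "face C (-1) v x" for v
    using that tag_face face_mem(2) c by (simp add: local_loops_def)
  have op: "(tag y, tag y') \<in> op_lord (Z_ext C) (tag x) (tag z) \<longleftrightarrow>
      (\<forall>w w'. Inr w \<in> K.above y \<and> Inr w' \<in> K.above y' \<longrightarrow> (w, w') \<in> wless L.WW z)"
    using X.lord_iff[OF k(1), of x "tag y" "tag y'" "tag z"] xl lo[OF z(1) y(1)] lo[OF z(2) y(2)] y(3)
    unfolding ab tx Z_ext_simps by (auto simp: L.WW_def)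
  have src: "(y, x) \<in> tsource L.TS" "(y', x) \<in> tsource L.TS" using y xm L.U_source by blast+
  have wh: "w \<in> L.whites z" if w: "Inr w \<in> K.above v" and v: "face C 0 z v" for w v
  proof -
    have "Inl w \<in> tops L.TS" "desc L.TS (Inl w) (Inr v)"
      using w K.dot_vertex_tops[of "Inr w"] by (simp_all add: K.above_iff)
    thus ?thesis using L.tops_loop[OF v] by blast
  qed
  have dd: "desc L.TS (Inl w) (Inr v)" if "Inr w \<in> K.above v" for w v using that by (simp add: K.above_iff)
  have ex: "\<exists>w. Inr w \<in> K.above v" if v: "face C 0 z v" "dim C v = int (Suc e)" for v
  proof -
    have "v \<in> edges L.TS" using face_mem(1)[OF v(1)] v(2) by (simp add: TT_simps cells_dim_iff)
    then obtain d where d: "d \<in> K.above v" using K.above_nonempty by blast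
    hence "dot_vertex d \<in> tops L.TS" "desc L.TS (dot_vertex d) (Inr v)"
      using K.dot_vertex_tops by (simp_all add: K.above_iff)
    then obtain w where "dot_vertex d = Inl w" using L.tops_loop[OF v(1)] by blast
    thus ?thesis using d by (cases d) auto
  qed
  show ?thesis unfolding op
  proof
    assume a: "\<forall>w w'. Inr w \<in> K.above y \<and> Inr w' \<in> K.above y' \<longrightarrow> (w, w') \<in> wless L.WW z"
    obtain w w' where w: "Inr w \<in> K.above y" "Inr w' \<in> K.above y'" using ex z dims by blast
    hence "L.lx z (Inl w) (Inl w')" using a L.WW_simps(2) by blast
    hence "L.before z x y y'" using L.U.lex_meet src y(3) dd w by blast
    thus "(y, y') \<in> lord C x z" using z face_sign_unique[OF z(1)] face_sign_unique[OF z(2)] unfolding L.before_def by fastforce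
  next
    assume l: "(y, y') \<in> lord C x z"
    show "\<forall>w w'. Inr w \<in> K.above y \<and> Inr w' \<in> K.above y' \<longrightarrow> (w, w') \<in> wless L.WW z"
      by (metis l L.before_def L.U.lexI src y(3) dd wh z L.WW_simps(2))
  qed
qed

lemma tag_iso: "mop_iso C X.M tag"
  unfolding mop_iso_def using tag_bij tag_face tag_lord by (simp add: tag_def)

lemma Z_ob_truncate: "truncate (Z_ext C) = Z_ob C"
  by (simp add: Z_ext_def Z_ob_def)

text \<open>\<open>tag\<close> lands in the complex of \<open>Z_ext C\<close>, where the added trees
  still bear names of cells of \<open>C\<close>. The extension of the identity replaces the names of
  their roots by \<open>fresh\<close>, as in P.\<close>

definition unit_map :: "'a elem \<Rightarrow> 'a elem" where
  "unit_map = restrict (\<lambda>x. cell_map (extend_map (Z_ext C) (ext_op (Z_ob C)) id_map) (tag x)) (cells C)"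

lemma unit_iso: "is_iso DFC C (P_ob (Z_ob C)) unit_map"
proof -
  have "level_iso (Z_ext C) (ext_op (Z_ob C)) (extend_map (Z_ext C) (ext_op (Z_ob C)) id_map)"
  proof (rule extend_map_iso[OF X.extended_axioms ext_op_extended[OF Z_ob_opetope]])
    show "odim (Z_ext C) = odim (ext_op (Z_ob C))" by (simp add: Z_ext_def Z_ob_def)
    show "level_iso (truncate (Z_ext C)) (truncate (ext_op (Z_ob C))) id_map"
      by (rule level_iso_levels[OF level_iso_id[of "Z_ob C"]]) (simp_all add: Z_ob_truncate ext_tree_simps ext_sub_def)
  qed
  hence "mop_iso X.M (P_ob (Z_ob C)) (cell_map (extend_map (Z_ext C) (ext_op (Z_ob C)) id_map))"
    unfolding P_ob_op_mop by (rule op_mop_iso[OF X.extended_axioms ext_op_extended[OF Z_ob_opetope]])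
  hence "mop_iso C (P_ob (Z_ob C)) (\<lambda>x. cell_map (extend_map (Z_ext C) (ext_op (Z_ob C)) id_map) (tag x))"
    by (rule mop_iso_comp[OF tag_iso])
  thus ?thesis unfolding unit_map_def by (rule mop_iso_is_iso[OF dfc P_ob_dfc[OF Z_ob_opetope]])
qed

lemma unit_map_eq:
  assumes x: "x \<in> cells C"
  shows "unit_map x = Cell (dim C x) (if nat (dim C x + 2) \<le> n \<or> nat (dim C x + 2) = Suc n \<and> x \<in> nodes (Z_tree C n)
    then x else fresh (Z_ob C))" by (auto simp: x ext_tree_def Z_ob_def unit_map_def tag_def extend_map_def id_map_def Z_ext_simps)

end

text \<open>Degrees up to n, n + 1 and n + 2 are checked separately on the formula
  \<open>unit_map_eq\<close>; a renamed root stays a root because \<open>fresh\<close> is not a node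
  in degree n.\<close>

lemma unit_natural:
  assumes d: "is_dfc C" "is_dfc D" and f: "is_iso DFC C D f" and x: "x \<in> cells C"
  shows "P_mor (Z_ob C) (Z_ob D) (Z_mor C D f) (dendritic_elem.unit_map C x) = dendritic_elem.unit_map D (f x)"
proof -
  interpret C: dendritic_elem C using d by (simp add: dendritic_elem_def dendritic_def)
  interpret D: dendritic_elem D using d by (simp add: dendritic_elem_def dendritic_def)
  interpret dendritic_iso C D f using is_iso_mop_iso(1)[OF d f] by unfold_locales
  have dm: "odim (Z_ob C) = mop_dim C" "odim (Z_ob D) = mop_dim C" "otree (Z_ob C) = Z_tree C" "mop_dim D = mop_dim C"
    using f_top by (simp_all add: Z_ob_def)
  have fx: "f x \<in> cells D" "dim D (f x) = dim C x" using f_mem f_dim x by blast+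
  have ns: "nodes (Z_tree C (mop_dim C)) \<subseteq> cells C"
    using C.Z_ob_cells(1)[of "mop_dim C"] by (simp add: onodes_def dm)
  have nb: "f x \<in> nodes (Z_tree D (mop_dim C)) \<longleftrightarrow> x \<in> nodes (Z_tree C (mop_dim C))"
  proof -
    have "f ` nodes (Z_tree C (mop_dim C)) = nodes (Z_tree D (mop_dim C))"
      using Z_level_iso by (simp add: level_iso_def tree_iso_def bij_betw_def Z_ob_def)
    thus ?thesis using ns f_inj x by blast
  qed
  have im: "C.unit_map x \<in> P_cells (Z_ob C)"
    using C.unit_iso x unfolding is_iso_def DFC_simps mop_hom_def P_ob_def P_faces_def by auto
  let ?j = "nat (dim C x + 2)"
  have j: "?j \<le> mop_dim C \<or> ?j = Suc (mop_dim C) \<or> ?j = Suc (Suc (mop_dim C))"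
    using C.cell_edge(1)[OF x] by arith
  have e: "x \<in> edges (Z_tree C ?j)" by (rule C.cell_edge(2)[OF x])
  have fr: "fresh (Z_ob C) \<notin> nodes (Z_tree C (mop_dim C))" using fresh_notin[OF C.Z_ob_opetope] by (simp add: dm)
  have "P_act (Z_ob C) (Z_ob D) (Z_mor C D f) (C.unit_map x) = D.unit_map (f x)"
    using j by (elim disjE)
      (use e nb fr in \<open>auto simp: C.unit_map_eq[OF x] D.unit_map_eq[OF fx(1)] fx(2) ext_edge_map_def dm Z_mor_def oedges_def onodes_def\<close>)
  thus ?thesis using im by (simp add: P_mor_def)
qed

lemma groupoid_isos: "is_groupoid C \<Longrightarrow> X \<in> Ob C \<Longrightarrow> Y \<in> Ob C \<Longrightarrow> f \<in> Hom C X Y \<Longrightarrow> is_iso C X Y f"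
  by (auto simp: is_groupoid_def)

lemma unit_natural_iso:
  "natural_iso (DFC_core :: ('a elem mop, 'a elem \<Rightarrow> 'a elem) category) DFC_core id_functor
     (comp_functor P_functor Z_functor) dendritic_elem.unit_map"
  unfolding natural_iso_def id_functor_def comp_functor_def P_functor_def Z_functor_def cfunctor.select_convs
    DFC_core_simps mem_Collect_eq
proof (intro conjI ballI)
  fix C :: "'a elem mop" assume "C \<in> {C. is_dfc C}"
  then interpret dendritic_elem C by unfold_locales simp
  show "is_iso DFC_core C (P_ob (Z_ob C)) unit_map"
    by (rule groupoid_isos[OF DFC_core_groupoid]) (use dfc P_ob_dfc[OF Z_ob_opetope] unit_iso in \<open>simp_all add: DFC_core_simps\<close>)
next
  fix C D :: "'a elem mop" and f assume "C \<in> {C. is_dfc C}" "D \<in> {C. is_dfc C}" "f \<in> {f. is_iso DFC C D f}"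
  hence d: "is_dfc C" "is_dfc D" and f: "is_iso DFC C D f" by simp_all
  show "compose (cells C) (dendritic_elem.unit_map D) f =
      compose (cells C) (P_mor (Z_ob C) (Z_ob D) (Z_mor C D f)) (dendritic_elem.unit_map C)"
    using unit_natural[OF d f] by (simp add: compose_def fun_eq_iff)
qed

section \<open>The counit\<close>

lemma (in tree) root_unique: "b \<in> edges T \<Longrightarrow> (\<And>a. (b, a) \<notin> tsource T) \<Longrightarrow> b = root T"
proof (rule ccontr)
  assume b: "b \<in> edges T" "\<And>a. (b, a) \<notin> tsource T" "b \<noteq> root T"
  hence "desc T (Inr b) (Inr (root T))" using desc_root by simp
  then obtain z where "(Inr b, z) \<in> desc_step T" using desc_firstE b by (metis sum.inject(2))
  thus False using b(2) by (cases z) auto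
qed

locale extended_cells = extended
begin

sublocale D: dendritic "M"
  by unfold_locales (rule op_mop_dfc)

definition uncell :: "'a elem \<Rightarrow> 'a elem" where
  "uncell P = (case P of Cell k x \<Rightarrow> x | Atom x \<Rightarrow> Atom x)"

lemma uncell_simps [simp]: "uncell (Cell k x) = x"
  by (simp add: uncell_def)

lemma top_eq: "top_cell M = top_elem" "odim X = Suc (Suc D.n)"
proof -
  have t: "top_elem \<in> cells M" "(top_cell M, top_elem) \<in> le_rel M"
    using greatest_top D.top_cells by (simp_all only: greatest_cell_def)
  thus eq: "top_cell M = top_elem"
    using D.le_top[OF t(1)] D.le_rel_dim[OF t(2)] D.top_dim by auto
  have "int D.n = int (odim X - 2)" using D.top_dim by (simp add: eq top_elem_def)
  thus "odim X = Suc (Suc D.n)" using two by simp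
qed

lemma cells_dim_op: "P \<in> cells_dim M (int e) \<longleftrightarrow> (\<exists>x. P = Cell (int e) x \<and> e + 2 \<le> odim X \<and> x \<in> edges (tr (e + 2)))"
  unfolding D.cells_dim_iff op_mop_simps
proof
  assume "P \<in> op_cells X \<and> P_dim P = int e"
  hence "P \<in> op_cells X" "P_dim P = int e" by auto
  thus "\<exists>x. P = Cell (int e) x \<and> e + 2 \<le> odim X \<and> x \<in> edges (tr (e + 2))"
    by (cases rule: cellE) auto
qed (auto simp: cell_iff)

lemma bottom_op: "cells_dim M (-1) = {Cell (-1) (root (tr 1))}" by (auto simp: D.cells_dim_iff op_cells_def)

lemma Lm_op: "P \<in> D.Lm (int e) \<longleftrightarrow> (\<exists>x. P = Cell (int e) x \<and> e + 2 \<le> odim X \<and> x \<in> leaves (tr (e + 2)))"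
  using D.Lm_iff Lam_cell Lam_iff leaves_def by fastforce

text \<open>In degree \<open>e + 2\<close> of the tree built from the complex, edges are tagged with
  dimension \<open>e\<close> and nodes, which are leaves one degree up, with \<open>e + 1\<close>;
  dropping the tags gives the isomorphism. The roots correspond because each is the only edge with
  no lower node.\<close>

lemma tree_counit:
  assumes e: "e + 3 \<le> odim X"
  shows "tree_iso (D.TT e) (tr (e + 2)) uncell uncell"
proof -
  have e': "e + 2 \<le> odim X" "e \<le> D.n" "e + 2 < odim X" using e top_eq(2) by auto
  interpret A: tree "tr (e + 2)" using tree_level e' by blast
  interpret B: tree "D.TT e" using D.TT_tree e' by blast
  have nl: "nodes (tr (e + 2)) = leaves (tr (e + 3))"
    using constellation.nodes_eq[OF level[OF e'(3)]] by (simp add: numeral_3_eq_3)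
  have N: "P \<in> nodes (D.TT e) \<longleftrightarrow> (\<exists>x. P = Cell (int (Suc e)) x \<and> x \<in> nodes (tr (e + 2)))" for P
  proof -
    have "nodes (D.TT e) = D.Lm (int (Suc e))" by (simp add: D.TT_simps add.commute)
    thus ?thesis using Lm_op[of P "Suc e"] e nl by (simp add: numeral_3_eq_3 del: of_nat_Suc)
  qed
  have E: "P \<in> edges (D.TT e) \<longleftrightarrow> (\<exists>x. P = Cell (int e) x \<and> x \<in> edges (tr (e + 2)))" for P
    using cells_dim_op[of P e] e' by (simp add: D.TT_simps)
  have inc: "(Cell (int e) y, Cell (int (Suc e)) x) \<in> tsource (D.TT e) \<longleftrightarrow> (y, x) \<in> tsource (tr (e + 2))"
    "(Cell (int e) y, Cell (int (Suc e)) x) \<in> ttarget (D.TT e) \<longleftrightarrow> (y, x) \<in> ttarget (tr (e + 2))"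
    if x: "x \<in> nodes (tr (e + 2))" for x y
  proof -
    have xl: "Suc e + 2 \<le> odim X" "x \<in> leaves (tr (Suc e + 2))" using x nl e by (simp_all add: numeral_3_eq_3)
    have L: "Cell (int (Suc e)) x \<in> D.Lm (int e + 1)" using Lm_op[of _ "Suc e"] xl by (simp add: add.commute)
    show "(Cell (int e) y, Cell (int (Suc e)) x) \<in> tsource (D.TT e) \<longleftrightarrow> (y, x) \<in> tsource (tr (e + 2))"
      "(Cell (int e) y, Cell (int (Suc e)) x) \<in> ttarget (D.TT e) \<longleftrightarrow> (y, x) \<in> ttarget (tr (e + 2))"
      using L face_leaf[OF xl, of _ "Cell (int e) y"] by (simp_all add: D.TT_simps)
  qed
  have r: "root (D.TT e) = Cell (int e) (root (tr (e + 2)))" by (metis B.root_unique E A.root_mem B.source_mem N inc A.root_not_source)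
  show ?thesis unfolding tree_iso_def
  proof (intro conjI ballI)
    show "bij_betw uncell (nodes (D.TT e)) (nodes (tr (e + 2)))"
      by (rule bij_betw_byWitness[where f' = "Cell (int (Suc e))"]) (auto simp: N simp del: of_nat_Suc)
    show "bij_betw uncell (edges (D.TT e)) (edges (tr (e + 2)))"
      by (rule bij_betw_byWitness[where f' = "Cell (int e)"]) (auto simp: E)
    show "uncell (root (D.TT e)) = root (tr (e + 2))" by (simp add: r)
    fix P Q assume "P \<in> nodes (D.TT e)" "Q \<in> edges (D.TT e)"
    then obtain x y where "P = Cell (int (Suc e)) x" "x \<in> nodes (tr (e + 2))" "Q = Cell (int e) y" using N E by blast
    thus "((uncell Q, uncell P) \<in> tsource (tr (e + 2))) = ((Q, P) \<in> tsource (D.TT e))"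
      "((uncell Q, uncell P) \<in> ttarget (tr (e + 2))) = ((Q, P) \<in> ttarget (D.TT e))"
      using inc by (simp_all del: of_nat_Suc)
  qed
qed

text \<open>The white dots of an edge are compared at their meet. If a sign of the edge in a branch
  decides there, convexity of the dots above this branch forces the same order in the subdivision;
  between loops, the local order of P is by definition that of the white dots above them.\<close>

lemma whites_counit:
  assumes e: "e + 4 \<le> odim X"
  shows "subdiv_iso (D.TT e) (Z_sub M (e + 2)) (sb (e + 2)) uncell uncell"
proof -
  obtain m where m: "m = e + 2" by simp
  have ms: "Suc (Suc e) = m" "Suc e + 2 = Suc m" by (simp_all add: m)
  have e': "Suc e \<le> D.n" "m < odim X" "Suc m < odim X" "Suc e + 2 \<le> odim X" "m + 2 \<le> odim X"
    using e top_eq(2) by (auto simp: m)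
  interpret L: dendritic_level "M" e using e' by unfold_locales
  note LU = L.U_source[folded m] and Ln = L.null_dots_U[folded m] and Ls = L.Lm_Suc(2)[folded m] and Lw = L.WW_def[folded m]
    and cE = cells_dim_op[of _ e, folded m] and cS = cells_dim_op[of _ "Suc e", unfolded ms]
  interpret K: constellation "tr m" "sb m" "tr (Suc m)" using level[OF e'(2)] .
  have l4: "leaves (tr (Suc (Suc m))) = nodes (tr (Suc m))"
    using constellation.nodes_eq[OF level[OF e'(3)]] by simp
  have ti: "tree_iso L.TS (tr (Suc m)) uncell uncell" using tree_counit[of "Suc e"] e ms by simp
  have N: "P \<in> D.Lm (int m) \<longleftrightarrow> (\<exists>x. P = Cell (int m) x \<and> x \<in> nodes (tr (Suc m)))" for P
    using Lm_op[of P m] e' l4 by simp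
  have F: "face M s (Cell (int (Suc e)) y) (Cell (int m) x) \<longleftrightarrow>
      s = 1 \<and> (y, x) \<in> ttarget (tr (Suc m)) \<or> s = -1 \<and> (y, x) \<in> tsource (tr (Suc m))" if "x \<in> nodes (tr (Suc m))" for s y x
  proof -
    have c: "int (Suc e) = int m - 1" by (simp add: m)
    show ?thesis using face_leaf[OF e'(5), of x s] that l4 by (auto simp: m)
  qed
  have G: "face M s (Cell (int e) z) (Cell (int (Suc e)) y) \<longleftrightarrow> K.inc s z y" if "y \<in> edges (tr (Suc m))" for s z y
  proof -
    have c: "int e = int (Suc e) - 1" by simp
    show ?thesis using face_iff[OF e'(4), of y s, unfolded ms] that by auto
  qed
  have null: "Cell (int m) w \<in> null_dots L.TS \<longleftrightarrow> w \<in> white_dots (tr m) (sb m)" for w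
  proof -
    have "(\<exists>Q. (Q, Cell (int m) w) \<in> tsource L.TS) \<longleftrightarrow> (\<exists>y. (y, w) \<in> tsource (tr (Suc m)))" if "w \<in> nodes (tr (Suc m))"
    proof
      assume "\<exists>Q. (Q, Cell (int m) w) \<in> tsource L.TS"
      then obtain Q where Q: "(Q, Cell (int m) w) \<in> tsource L.TS" by blast
      have "Q \<in> cells_dim M (int (Suc e))" using conjunct1[OF L.U.source_mem[OF Q]] unfolding D.TT_simps .
      then obtain y where "Q = Cell (int (Suc e)) y" using cS[of Q] by blast
      thus "\<exists>y. (y, w) \<in> tsource (tr (Suc m))" using Q F[OF that, of "-1" y] unfolding LU by auto
    next
      assume "\<exists>y. (y, w) \<in> tsource (tr (Suc m))"
      thus "\<exists>Q. (Q, Cell (int m) w) \<in> tsource L.TS" using F[OF that] N that unfolding LU by blast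
    qed
    moreover have "Cell (int m) w \<in> nodes L.TS \<longleftrightarrow> w \<in> nodes (tr (Suc m))"
      unfolding D.TT_simps Ls N by simp
    ultimately show ?thesis unfolding K.whites_eq null_dots_def by blast
  qed
  have fw: "w \<in> wset (sb m) z" if P: "Cell (int m) w \<in> L.whites (Cell (int e) z)" for w z
  proof -
    let ?P = "Cell (int m) w"
    have nd: "?P \<in> null_dots L.TS" "gam M (gam M ?P) = Cell (int e) z" using P L.whites_iff by blast+
    note fc = L.null_loop(1,2)[OF nd(1)]
    have wd: "w \<in> white_dots (tr m) (sb m)" using null nd by blast
    hence wn: "w \<in> nodes (tr (Suc m))" unfolding K.whites_eq null_dots_def by blast
    have "gam M ?P \<in> cells_dim M (int (Suc e))"
      using D.face_mem(2,4)[OF fc(1)] by (simp add: D.cells_dim_iff m)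
    then obtain y where y: "gam M ?P = Cell (int (Suc e)) y" using cS by blast
    have t: "(y, w) \<in> ttarget (tr (Suc m))" using fc(1) F[OF wn] unfolding y by simp
    hence yE: "y \<in> edges (tr (Suc m))" using K.U.target_mem by blast
    have "K.inc 0 z y" using iffD1[OF G[OF yE] fc(2)[unfolded nd(2), unfolded y]] .
    moreover have "Inr w \<in> K.above y" using wd K.U.desc_target[OF t] by (simp add: K.above_iff)
    ultimately show ?thesis unfolding K.inc_def by auto
  qed
  have bw: "Cell (int m) w \<in> L.whites (Cell (int e) z)" if w: "w \<in> wset (sb m) z" and z: "z \<in> edges (tr m)" for w z
  proof -
    let ?P = "Cell (int m) w"
    have nd: "?P \<in> null_dots L.TS" using null w z by (auto simp: white_dots_def)
    note fc = L.null_loop(1,2)[OF nd]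
    have "P_dim (gam M ?P) = int (Suc e)" using D.face_mem(4)[OF fc(1)] by (simp add: m)
    hence "gam M (gam M ?P) \<in> cells_dim M (int e)"
      using D.face_mem(2,4)[OF fc(2)] by (simp add: D.cells_dim_iff)
    then obtain z' where z': "gam M (gam M ?P) = Cell (int e) z'" "z' \<in> edges (tr m)"
      unfolding cE by blast
    have P: "?P \<in> L.whites (Cell (int e) z')" using nd z' L.whites_iff by blast
    hence "z' = z" using K.wset_disjoint[OF z'(2) z fw[OF P] w] by simp
    thus ?thesis using P by simp
  qed
  have lx: "(w, w') \<in> wless (sb m) z" if z: "z \<in> edges (tr m)" and w: "w \<in> wset (sb m) z" "w' \<in> wset (sb m) z"
    and l: "L.lx (Cell (int e) z) (Inl (Cell (int m) w)) (Inl (Cell (int m) w'))" for z w w'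
  proof -
    obtain A Q Q' where a: "(Q, A) \<in> tsource L.TS" "(Q', A) \<in> tsource L.TS" "Q \<noteq> Q'"
      "desc L.TS (Inl (Cell (int m) w)) (Inr Q)" "desc L.TS (Inl (Cell (int m) w')) (Inr Q')"
      "L.before (Cell (int e) z) A Q Q'" using l unfolding L.U.lex_def by blast
    have "A \<in> D.Lm (int m)" using a(1) LU by blast
    then obtain x where x: "A = Cell (int m) x" "x \<in> nodes (tr (Suc m))" using N by blast
    have "Q \<in> cells_dim M (int (Suc e))" "Q' \<in> cells_dim M (int (Suc e))"
      using L.U.source_mem[OF a(1)] L.U.source_mem[OF a(2)] by (simp_all add: D.TT_simps)
    then obtain y y' where y: "Q = Cell (int (Suc e)) y" "Q' = Cell (int (Suc e)) y'" unfolding cS by blast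
    have f: "face M (-1) Q A" "face M (-1) Q' A" using a(1,2) LU by blast+
    hence s: "(y, x) \<in> tsource (tr (Suc m))" "(y', x) \<in> tsource (tr (Suc m))" using F[OF x(2)] unfolding x(1) y by simp_all
    have yE: "y \<in> edges (tr (Suc m))" "y' \<in> edges (tr (Suc m))" using s K.U.source_mem by blast+
    have ds: "desc (tr (Suc m)) (Inl w) (Inr y)" "desc (tr (Suc m)) (Inl w') (Inr y')"
      using tree_iso_desc[OF L.U.rooted ti a(4)] tree_iso_desc[OF L.U.rooted ti a(5)] by (simp_all add: y)
    have wd: "w \<in> white_dots (tr m) (sb m)" "w' \<in> white_dots (tr m) (sb m)"
      using w z by (auto simp: white_dots_def)
    have ab: "Inr w \<in> K.above y" "Inr w' \<in> K.above y'" using wd ds by (simp_all add: K.above_iff)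
    have yy: "y \<noteq> y'" using a(3) y by simp
    have na: "Inr w' \<notin> K.above y" "Inr w \<notin> K.above y'"
      using K.U.sources_disjoint[OF s] ds yy by (simp_all add: K.above_iff) blast+
    have ne: "w \<noteq> w'" using ab na by blast
    \<comment> \<open>The branch that contains the lower node and \<open>w\<close> would, by
      convexity, contain a white dot \<open>w'\<close> between them; likewise at the upper end with
      the roles exchanged.\<close>
    have no: "(w', w) \<notin> wless (sb m) z" if "face M (-1) (Cell (int e) z) Q \<or> face M 1 (Cell (int e) z) Q'"
    proof
      assume o: "(w', w) \<in> wless (sb m) z"
      from that show False
      proof
        assume "face M (-1) (Cell (int e) z) Q"
        hence "K.inc (-1) z y" unfolding y G[OF yE(1)] .
        then obtain l where "(z, l) \<in> tsource (tr m)" "Inl l \<in> K.above y" by (auto simp: K.inc_def enters_def lower_in_def)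
        thus False using K.connected_convex[OF K.above_connected[OF yE(1)] _ ab(1) z, of "Inl l" "Inr w'"] w o na(1) by simp
      next
        assume "face M 1 (Cell (int e) z) Q'"
        hence "K.inc 1 z y'" unfolding y G[OF yE(2)] .
        then obtain u where "(z, u) \<in> ttarget (tr m)" "Inl u \<in> K.above y'" by (auto simp: K.inc_def leaves_at_def upper_in_def)
        thus False using K.connected_convex[OF K.above_connected[OF yE(2)] ab(2) _ z, of "Inl u" "Inr w"] w o na(2) by simp
      qed
    qed
    show ?thesis
    proof (cases "face M (-1) (Cell (int e) z) Q \<or> face M 1 (Cell (int e) z) Q'")
      case True
      thus ?thesis using no K.wless_total[OF z w ne] by blast
    next
      case False
      hence lo: "(Q, Q') \<in> op_lord X A (Cell (int e) z)" using a(6) by (simp add: L.before_def)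
      have xl: "x \<in> leaves (tr (m + 2))" using x(2) l4 by simp
      have c: "int e = int m - 2" "int (Suc e) = int m - 1" by (simp_all add: m)
      have ab': "op_dots X m (Inr v) = K.above v" for v using op_dots_above[OF e'(2)] .
      obtain v v' u where "Q = Cell (int m - 1) v" "Q' = Cell (int m - 1) v'" "Cell (int e) z = Cell (int m - 2) u"
        "\<forall>w w'. Inr w \<in> K.above v \<and> Inr w' \<in> K.above v' \<longrightarrow> (w, w') \<in> wless (sb m) u"
        using iffD1[OF lord_iff[OF e'(5) xl] lo[unfolded x(1)], unfolded ab'] by (elim exE conjE) (rule that)
      thus ?thesis using ab unfolding y by blast
    qed
  qed
  have form: "\<exists>w. P = Cell (int m) w \<and> w \<in> wset (sb m) z" if "P \<in> L.whites (Cell (int e) z)" for P z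
  proof -
    have "P \<in> D.Lm (int m)" using that by (simp add: L.whites_iff Ln)
    then obtain w where w: "P = Cell (int m) w" unfolding N by blast
    thus ?thesis using fw[of w z] that by simp
  qed
  show ?thesis unfolding subdiv_iso_def m[symmetric]
  proof (intro ballI conjI)
    fix c assume "c \<in> edges (D.TT e)"
    then obtain z where c: "c = Cell (int e) z" and z: "z \<in> edges (tr m)" using cE[of c] unfolding D.TT_simps by blast
    have "bij_betw uncell (L.whites c) (wset (sb m) z)"
    proof (rule bij_betw_byWitness[where f' = "Cell (int m)"])
      show "\<forall>P\<in>L.whites c. Cell (int m) (uncell P) = P" "uncell ` L.whites c \<subseteq> wset (sb m) z"
        using form[of _ z] unfolding c by force+
      show "Cell (int m) ` wset (sb m) z \<subseteq> L.whites c" using bw z unfolding c by blast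
    qed simp
    thus "bij_betw uncell (wset (Z_sub M m) c) (wset (sb m) (uncell c))"
      using L.WW_simps(1) by (simp add: Lw c)
    fix P P' assume "P \<in> wset (Z_sub M m) c" "P' \<in> wset (Z_sub M m) c"
    hence P: "P \<in> L.whites c" "P' \<in> L.whites c" using L.WW_simps(1) by (simp_all add: Lw)
    then obtain w w' where w: "P = Cell (int m) w" "P' = Cell (int m) w'" "w \<in> wset (sb m) z" "w' \<in> wset (sb m) z"
      using form c by blast
    have "(w, w') \<in> wless (sb m) z \<longleftrightarrow> L.lx c (Inl P) (Inl P')"
    proof
      assume m: "(w, w') \<in> wless (sb m) z"
      hence ne: "w \<noteq> w'" "(w', w) \<notin> wless (sb m) z"
        using K.wless_irrefl[OF z] transD[OF K.wless_trans[OF z]] by blast+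
      hence "\<not> L.lx c (Inl P') (Inl P)" using lx[OF z w(4,3)] unfolding c w by blast
      moreover have "P \<noteq> P'" using ne w by simp
      ultimately show "L.lx c (Inl P) (Inl P')" using L.lx_total[of "Inl P" c "Inl P'"] P by (auto simp: L.strand_def)
    next
      assume "L.lx c (Inl P) (Inl P')"
      thus "(w, w') \<in> wless (sb m) z" using lx[OF z w(3,4)] unfolding c w by blast
    qed
    thus "((uncell P, uncell P') \<in> wless (sb m) (uncell c)) = ((P, P') \<in> wless (Z_sub M m) c)"
      using L.WW_simps(2) P by (simp add: Lw w c)
  qed
qed

lemma low_leaf: "the_elem (leaves (tr 1)) = the_elem (nodes (tr 0))"
  using constellation.nodes_eq[OF level[of 0]] two by simp

lemma first_leaf_op: "first_leaf M = Cell 0 (the_elem (nodes (tr 1)))"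
proof -
  have "first_leaf M \<in> D.Lm (int 0)" using D.first_leaf_eq(1) by simp
  then obtain x where x: "first_leaf M = Cell (int 0) x" "x \<in> leaves (tr (0 + 2))" unfolding Lm_op by blast
  moreover have "nodes (tr 1) = leaves (tr 2)" using constellation.nodes_eq[OF level[of 1]] two by (simp add: numeral_2_eq_2)
  ultimately show ?thesis using low_shape[of 1] by (auto simp: numeral_2_eq_2)
qed

text \<open>In degrees 0 and 1 the trees of Z use the same two names, \<open>first_leaf\<close> and
  the bottom cell, so their parts are matched by shape. From degree 2 on, and for the node in degree
  1, dropping the tag is correct.\<close>

definition counit_map :: "'a elem opetope_map" where
  "counit_map =
     \<lparr>mnode = \<lambda>k P. if k = 0 then the_elem (nodes (tr 0)) else uncell P,
      medge = \<lambda>k P. if 2 \<le> k then uncell P else if P = Cell (-1) (root (tr 1)) then root (tr k) else the_elem (leaves (tr k)),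
      mwhite = \<lambda>k. uncell\<rparr>"

lemma counit_iso: "level_iso (Z_ob M) (truncate X) counit_map"
proof -
  have t: "tree_iso (Z_tree M k) (tr k) (mnode counit_map k) (medge counit_map k)" if k: "k \<le> D.n" for k
  proof (cases "k < 2")
    case True
    obtain p l where s: "edges (tr k) = {root (tr k), l}" "l \<noteq> root (tr k)" "nodes (tr k) = {p}" "leaves (tr k) = {l}"
      "ttarget (tr k) = {(root (tr k), p)}" "tsource (tr k) = {(l, p)}"
      using low_shape[OF True] by blast
    have b: "the_elem (cells_dim M (-1)) = Cell (-1) (root (tr 1))" by (simp add: bottom_op)
    have "mnode counit_map k (first_leaf M) = p"
      using s(3) True by (cases "k = 0") (auto simp: counit_map_def first_leaf_op less_2_cases_iff)
    moreover have "medge counit_map k (first_leaf M) = l" "medge counit_map k (Cell (-1) (root (tr 1))) = root (tr k)"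
      using s(4) True by (simp_all add: counit_map_def first_leaf_op)
    ultimately show ?thesis unfolding D.low_tree(1)[OF True] b tree_iso_def s using s(2) by (auto simp: bij_betw_def)
  next
    case False
    then obtain e where e: "k = e + 2" by (metis le_add_diff_inverse2 not_less)
    hence "mnode counit_map k = uncell" "medge counit_map k = uncell" by (simp_all add: counit_map_def)
    moreover have "e + 3 \<le> odim X" using k e top_eq(2) by simp
    ultimately show ?thesis using tree_counit[of e] e by (simp add: D.TT_def)
  qed
  have s: "subdiv_iso (Z_tree M k) (Z_sub M k) (sb k) (medge counit_map k) (mwhite counit_map k)" if k: "k < D.n" for k
  proof (cases "k < 2")
    case True
    have lv: "k < odim X" using k top_eq(2) by simp
    interpret K: constellation "tr k" "sb k" "tr (Suc k)" by (rule level[OF lv])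
    have "null_dots (tr (Suc k)) = {}"
    proof (cases "k = 0")
      case True
      thus ?thesis using low_shape[of 1] by (auto simp: null_dots_def)
    next
      case False
      hence "k = 1" using \<open>k < 2\<close> by simp
      thus ?thesis using opetope two by (auto simp: is_opetope_def linear_tree_def null_dots_def numeral_2_eq_2)
    qed
    hence w: "wset (sb k) c = {}" if "c \<in> edges (tr k)" for c
      using that K.whites_eq by (auto simp: white_dots_def)
    have "medge counit_map k c \<in> edges (tr k)" if "c \<in> edges (Z_tree M k)" for c
      using t[of k] k that by (auto simp: tree_iso_def bij_betw_def)
    thus ?thesis unfolding subdiv_iso_def D.low_tree(2)[OF True] using w by (auto simp: empty_subdiv_def bij_betw_def)
  next
    case False
    then obtain e where e: "k = e + 2" by (metis le_add_diff_inverse2 not_less)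
    hence "mwhite counit_map k = uncell" "medge counit_map k = uncell" by (simp_all add: counit_map_def)
    moreover have "e + 4 \<le> odim X" using k e top_eq(2) by simp
    ultimately show ?thesis using whites_counit[of e] e by (simp add: D.TT_def)
  qed
  have c: "medge counit_map (Suc k) a = mnode counit_map k a" if k: "k < D.n" "a \<in> nodes (Z_tree M k)" for k a
  proof (cases "k = 0")
    case True
    hence "a = Cell 0 (the_elem (nodes (tr 1)))" using that D.low_tree(5)[of 0] first_leaf_op by simp
    thus ?thesis using low_leaf by (simp add: counit_map_def)
  qed (simp add: counit_map_def)
  have w: "mnode counit_map (Suc k) a = mwhite counit_map k a" for k a by (simp add: counit_map_def)
  show ?thesis unfolding level_iso_def Z_ob_def using t s c w top_eq(2) by (simp add: onodes_def)
qed

text \<open>\<open>cell_map\<close> acts according to the dimension in the tag, so naturality needs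
  to know the tags that occur in each degree. The node in degree 0 is left out: its tag is 0 instead
  of -1.\<close>

lemma counit_forms:
  shows "0 < k \<Longrightarrow> a \<in> onodes (Z_ob M) k \<Longrightarrow> \<exists>x. a = Cell (int k - 1) x \<and> x \<in> nodes (tr k)"
    and "2 \<le> k \<Longrightarrow> a \<in> oedges (Z_ob M) k \<Longrightarrow> \<exists>x. a = Cell (int k - 2) x \<and> x \<in> edges (tr k)"
    and "a \<in> owhites (Z_ob M) k \<Longrightarrow> \<exists>x. a = Cell (int k) x \<and> x \<in> white_dots (tr k) (sb k) \<and> k + 2 < odim X"
proof -
  note m = level_iso_onto[OF D.Z_ob_opetope _ counit_iso]
  have "is_opetope (truncate X)" using opetope by (auto simp: is_opetope_def)
  note m = m[OF this, THEN bij_betwE, rule_format]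
  show "\<exists>x. a = Cell (int k - 1) x \<and> x \<in> nodes (tr k)" if k: "0 < k" and a: "a \<in> onodes (Z_ob M) k"
  proof -
    have "uncell a \<in> nodes (tr k)" using m(1)[OF a] k by (auto simp: counit_map_def onodes_def split: if_splits)
    moreover have "\<exists>x. a = Cell (int k - 1) x"
    proof (cases "k = 1")
      case True
      thus ?thesis using a D.low_tree(5)[of 1] first_leaf_op by (auto simp: onodes_def Z_ob_def split: if_splits)
    next
      case False
      then obtain e where e: "k = e + 2" using k by (metis Suc_leI le_add_diff_inverse2 le_neq_implies_less Suc_1 One_nat_def)
      have "a \<in> nodes (D.TT e)" using a by (auto simp: onodes_def Z_ob_def e D.TT_def split: if_splits)
      hence "a \<in> D.Lm (int (Suc e))" by (simp add: D.TT_simps add.commute)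
      then obtain x where "a = Cell (int (Suc e)) x" unfolding Lm_op by blast
      thus ?thesis by (simp add: e)
    qed
    ultimately show ?thesis by auto
  qed
  show "\<exists>x. a = Cell (int k - 2) x \<and> x \<in> edges (tr k)" if k: "2 \<le> k" and a: "a \<in> oedges (Z_ob M) k"
  proof -
    obtain e where e: "k = e + 2" using k by (metis le_add_diff_inverse2)
    have "a \<in> edges (D.TT e)" using a by (auto simp: oedges_def Z_ob_def e D.TT_def split: if_splits)
    then obtain x where "a = Cell (int e) x" "x \<in> edges (tr (e + 2))" using cells_dim_op unfolding D.TT_simps by blast
    thus ?thesis by (simp add: e)
  qed
  show "\<exists>x. a = Cell (int k) x \<and> x \<in> white_dots (tr k) (sb k) \<and> k + 2 < odim X" if a: "a \<in> owhites (Z_ob M) k"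
  proof -
    have k: "k < D.n" using a by (auto simp: owhites_def Z_ob_def split: if_splits)
    have "uncell a \<in> white_dots (tr k) (sb k)" using m(3)[OF a] by (auto simp: counit_map_def owhites_def split: if_splits)
    moreover have "a \<in> D.Lm (int k)"
      using a by (auto simp: owhites_def Z_ob_def Z_sub_def white_dots_def empty_subdiv_def Z_white_def D.Lm_def split: if_splits)
    then obtain x where "a = Cell (int k) x" unfolding Lm_op by blast
    ultimately show ?thesis using k top_eq(2) by simp
  qed
qed

end

lemma counit_natural:
  assumes X: "extended X" "extended X'" and g: "level_iso X X' g"
  shows "a \<in> onodes (Z_ob (op_mop X)) k \<Longrightarrow>
      mnode (extended_cells.counit_map X') k (cell_map g a) = mnode g k (mnode (extended_cells.counit_map X) k a)"
    and "b \<in> oedges (Z_ob (op_mop X)) k \<Longrightarrow>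
      medge (extended_cells.counit_map X') k (cell_map g b) = medge g k (medge (extended_cells.counit_map X) k b)"
    and "w \<in> owhites (Z_ob (op_mop X)) k \<Longrightarrow>
      mwhite (extended_cells.counit_map X') k (cell_map g w) = mwhite g k (mwhite (extended_cells.counit_map X) k w)"
proof -
  interpret A: extended_cells X using X by (simp add: extended_cells_def)
  interpret B: extended_cells X' using X by (simp add: extended_cells_def)
  have ti: "tree_iso (A.tr k) (B.tr k) (mnode g k) (medge g k)" if "k \<le> odim X" for k using g that by (simp add: level_iso_def)
  have cm: "medge g (Suc k) x = mnode g k x" if "k < odim X" "x \<in> nodes (A.tr k)" for k x
    using g that by (simp add: level_iso_def onodes_def)
  have cw: "mnode g (Suc k) x = mwhite g k x" if "k < odim X" "x \<in> white_dots (A.tr k) (A.sb k)" for k x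
    using g that by (simp add: level_iso_def owhites_def)
  have nk: "k + 2 \<le> odim X" if "k \<le> odim (Z_ob (op_mop X))" for k using that A.top_eq(2) by (simp add: Z_ob_def)
  show "mnode B.counit_map k (cell_map g a) = mnode g k (mnode A.counit_map k a)" if a: "a \<in> onodes (Z_ob (op_mop X)) k"
  proof (cases "k = 0")
    case True
    obtain p p' where p: "nodes (A.tr 0) = {p}" "nodes (B.tr 0) = {p'}" using A.low_shape[of 0] B.low_shape[of 0] by auto
    hence "mnode g 0 p = p'" using ti[of 0] by (simp add: tree_iso_def)
    thus ?thesis using True p by (simp add: A.counit_map_def B.counit_map_def)
  next
    case False
    have k: "k < odim X" using nk[of k] a by (auto simp: onodes_def split: if_splits)
    obtain x where x: "a = Cell (int k - 1) x" "x \<in> nodes (A.tr k)" using A.counit_forms(1)[OF _ a] False by blast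
    have "nat (int k - 1 + 2) = Suc k" by simp
    thus ?thesis using False x cm[OF k x(2)] by (simp add: A.counit_map_def B.counit_map_def)
  qed
  show "medge B.counit_map k (cell_map g b) = medge g k (medge A.counit_map k b)" if b: "b \<in> oedges (Z_ob (op_mop X)) k"
  proof (cases "k < 2")
    case False
    then obtain x where "b = Cell (int k - 2) x" using A.counit_forms(2)[OF _ b] by auto
    thus ?thesis using False by (simp add: A.counit_map_def B.counit_map_def)
  next
    case True
    have k: "k \<le> odim X" using True A.two by simp
    have r: "medge g k (root (A.tr k)) = root (B.tr k)" "medge g 1 (root (A.tr 1)) = root (B.tr 1)"
      using ti[OF k] ti[of 1] A.two by (simp_all add: tree_iso_def)
    obtain l l' where l: "leaves (A.tr k) = {l}" "leaves (B.tr k) = {l'}" using A.low_shape[OF True] B.low_shape[OF True] by auto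
    have "medge g k l \<in> leaves (B.tr k)"
      using tree_iso_leaves[OF _ ti[OF k]] A.tree_level[OF k] B.tree_level[of k] l(1) True B.two
      by (auto simp: tree_def leaves_def)
    hence gl: "medge g k l = l'" using l by simp
    have "b = Cell (-1) (root (A.tr 1)) \<or> b = Cell 0 (the_elem (nodes (A.tr 1)))"
      using b True A.D.low_tree(1)[OF True] by (auto simp: oedges_def Z_ob_def A.bottom_op A.first_leaf_op split: if_splits)
    thus ?thesis using True r l gl by (auto simp: A.counit_map_def B.counit_map_def)
  qed
  show "mwhite B.counit_map k (cell_map g w) = mwhite g k (mwhite A.counit_map k w)" if w: "w \<in> owhites (Z_ob (op_mop X)) k"
  proof -
    obtain x where x: "w = Cell (int k) x" "x \<in> white_dots (A.tr k) (A.sb k)" "k + 2 < odim X" using A.counit_forms(3)[OF w] by blast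
    have "x \<in> nodes (A.tr (Suc k))" using constellation.whites_eq[OF A.level[of k]] x by (auto simp: null_dots_def)
    hence "medge g (Suc (Suc k)) x = mwhite g k x" using cm[of "Suc k" x] cw[of k x] x by simp
    moreover have "nat (int k + 2) = Suc (Suc k)" by simp
    ultimately show ?thesis using x by (simp add: A.counit_map_def B.counit_map_def)
  qed
qed

definition counit :: "'a elem opetope \<Rightarrow> 'a elem opetope_map" where
  "counit Y = restrict_map (Z_ob (P_ob Y)) (extended_cells.counit_map (ext_op Y))"

lemma counit_natural_iso:
  "natural_iso (KJBM :: ('a elem opetope, 'a elem opetope_map) category) KJBM
     (comp_functor Z_functor P_functor) id_functor counit"
  unfolding natural_iso_def id_functor_def comp_functor_def P_functor_def Z_functor_def cfunctor.select_convs
    KJBM_simps mem_Collect_eq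
proof (intro conjI ballI)
  fix Y :: "'a elem opetope" assume "Y \<in> {Y. is_opetope Y}"
  hence Y: "is_opetope Y" by simp
  interpret extended_cells "ext_op Y" using ext_op_extended[OF Y] by (simp add: extended_cells_def)
  have "level_iso (Z_ob (P_ob Y)) Y counit_map"
    by (rule level_iso_levels[OF counit_iso]) (simp_all add: P_ob_op_mop ext_tree_simps ext_sub_def)
  hence "counit Y \<in> opetope_isos (Z_ob (P_ob Y)) Y"
    unfolding counit_def P_ob_op_mop by (rule restrict_map_iso[OF D.Z_ob_opetope])
  thus "is_iso KJBM (Z_ob (P_ob Y)) Y (counit Y)"
    using KJBM_inverse D.Z_ob_opetope Y by (simp add: P_ob_op_mop)
next
  fix Y Y' :: "'a elem opetope" and f
  assume "Y \<in> {Y. is_opetope Y}" "Y' \<in> {Y. is_opetope Y}" and f: "f \<in> opetope_isos Y Y'"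
  hence o: "is_opetope Y" "is_opetope Y'" by simp_all
  interpret A: extended_cells "ext_op Y" using ext_op_extended[OF o(1)] by (simp add: extended_cells_def)
  interpret B: extended_cells "ext_op Y'" using ext_op_extended[OF o(2)] by (simp add: extended_cells_def)
  let ?g = "extend_map (ext_op Y) (ext_op Y') f" and ?Z = "Z_ob (op_mop (ext_op Y))"
  have l: "level_iso Y Y' f" using f opetope_isos_iff by blast
  hence d: "odim Y = odim Y'" by (simp add: level_iso_def)
  have "Z_mor (P_ob Y) (P_ob Y') (P_mor Y Y' f) \<in> opetope_isos ?Z (Z_ob (op_mop (ext_op Y')))"
    using Z_mor_iso[OF P_ob_dfc[OF o(1)] P_ob_dfc[OF o(2)] P_mor_iso(1)[OF o f]] by (simp add: P_ob_op_mop)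
  note m = opetope_isos_mem[OF A.D.Z_ob_opetope B.D.Z_ob_opetope this]
  have pm: "P_mor Y Y' f a = cell_map ?g a" if "a \<in> op_cells (ext_op Y)" for a
    using that by (simp add: P_mor_cell_map[OF d] P_ob_op_mop)
  note c = subsetD[OF A.D.Z_ob_cells(1), unfolded op_mop_simps] subsetD[OF A.D.Z_ob_cells(2), unfolded op_mop_simps]
    subsetD[OF A.D.Z_ob_cells(3), unfolded op_mop_simps]
  have n: "odim ?Z = odim Y" using A.top_eq(2) by (simp add: Z_ob_def)
  have gf: "a \<in> onodes ?Z k \<Longrightarrow> mnode ?g k = mnode f k" "a \<in> oedges ?Z k \<Longrightarrow> medge ?g k = medge f k"
    "a \<in> owhites ?Z k \<Longrightarrow> mwhite ?g k = mwhite f k" for a k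
    using n by (auto simp: onodes_def oedges_def owhites_def extend_map_def fun_eq_iff split: if_splits)
  note nat = counit_natural[OF A.extended_axioms B.extended_axioms ext_op_iso[OF o l]]
  show "restrict_map (Z_ob (P_ob Y)) (comp_map (counit Y') (Z_mor (P_ob Y) (P_ob Y') (P_mor Y Y' f))) =
      restrict_map (Z_ob (P_ob Y)) (comp_map f (counit Y))"
    unfolding P_ob_op_mop
  proof (rule restrict_map_cong)
    fix k a
    show "mnode (comp_map (counit Y') (Z_mor (op_mop (ext_op Y)) (op_mop (ext_op Y')) (P_mor Y Y' f))) k a = mnode (comp_map f (counit Y)) k a"
      if a: "a \<in> onodes ?Z k"
      using m(1)[OF a] nat(1)[OF a] gf(1)[OF a] pm[OF c(1)[OF a]] a
      by (simp add: comp_map_def counit_def restrict_map_def Z_mor_def P_ob_op_mop)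
    show "medge (comp_map (counit Y') (Z_mor (op_mop (ext_op Y)) (op_mop (ext_op Y')) (P_mor Y Y' f))) k a = medge (comp_map f (counit Y)) k a"
      if a: "a \<in> oedges ?Z k"
      using m(2)[OF a] nat(2)[OF a] gf(2)[OF a] pm[OF c(2)[OF a]] a
      by (simp add: comp_map_def counit_def restrict_map_def Z_mor_def P_ob_op_mop)
    show "mwhite (comp_map (counit Y') (Z_mor (op_mop (ext_op Y)) (op_mop (ext_op Y')) (P_mor Y Y' f))) k a = mwhite (comp_map f (counit Y)) k a"
      if a: "a \<in> owhites ?Z k"
      using m(3)[OF a] nat(3)[OF a] gf(3)[OF a] pm[OF c(3)[OF a]] a
      by (simp add: comp_map_def counit_def restrict_map_def Z_mor_def P_ob_op_mop)
  qed
qed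

theorem theorem6p5:
  shows "is_groupoid (DFC_core :: ('a elem mop, 'a elem \<Rightarrow> 'a elem) category) \<and>
         is_groupoid (KJBM :: ('a elem opetope, 'a elem opetope_map) category) \<and>
         forms_equivalence (DFC_core :: ('a elem mop, 'a elem \<Rightarrow> 'a elem) category) KJBM
           Z_functor P_functor"
  unfolding forms_equivalence_def
  using DFC_core_groupoid KJBM_groupoid Z_is_functor P_is_functor unit_natural_iso counit_natural_iso
  by (metis is_groupoid_def)

end
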